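(* Let $\Omega\subset\mathbb{R}^3$ be a simply connected bounded domain whose smooth boundary $\partial\Omega$ has a finite number of 2-dimensional connected components. Let $q\in(3,6)$, $M_1,M_2>0$, $s\in(\frac12,1]$ and $\hat\rho\ge\bar\rho+1$ be given, and suppose that $(\rho_0,u_0,H_0)$ satisfy $u_0\cdot n=0$, $\mathrm{curl}\,u_0\times n=0$, $H_0\cdot n=0$, $\mathrm{curl}\,H_0\times n=0$ on $\partial\Omega$, and $$0\le\rho_0\le\hat\rho,\quad(\rho_0,P(\rho_0))\in H^2\cap W^{2,q},\quad u_0,H_0\in H^2,\quad\mathrm{div}\,H_0=0,\quad\|u_0\|_{H^s}\le M_1,\quad\|H_0\|_{H^s}\le M_2,$$ $$-\mu\Delta u_0-(\mu+\lambda)\nabla\,\mathrm{div}\,u_0+\nabla P(\rho_0)-(\nabla\times H_0)\times H_0=\rho_0^{1/2}g\quad\text{for some }g\in L^2.$$ Let $\varepsilon>0$, depending only on $\mu,\lambda,\nu,\gamma,a,\bar\rho,\hat\rho,s,\Omega,M_1,M_2$, be the smallness constant described in the context, and suppose $C_0\le\varepsilon$, so that problem (MHD) has the unique global classical solution $(\rho,u,H)$ described in the context. Assume further that there exists some point $x_0\in\Omega$ such that $\rho_0(x_0)=0$. Then for any $r_1>3$ there exist positive constants $\tilde C_1$ and $\tilde C_2$ depending only on $\mu,\lambda,\nu,\gamma,a,s,\bar\rho,\hat\rho,\Omega,M_1,M_2$ and $r_1$ such that for any $t>0$, $$\|\nabla\rho(\cdot,t)\|_{L^{r_1}}\ge\tilde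 C_1e^{\tilde C_2t}.$$
   Context: Constants: $\mu>0$, $2\mu+3\lambda\ge0$, $\nu>0$, $a>0$, $\gamma>1$; $P=P(\rho)=a\rho^\gamma$; $n$ is the unit outward normal to $\partial\Omega$. Problem (MHD): find $\rho$ (scalar), $u$ and $H$ ($\mathbb{R}^3$-valued) with $$\begin{cases}\rho_t+\mathrm{div}(\rho u)=0,\\ (\rho u)_t+\mathrm{div}(\rho u\otimes u)+\nabla P=\mu\Delta u+(\mu+\lambda)\nabla\,\mathrm{div}\,u+(\nabla\times H)\times H,\\ H_t-\nabla\times(u\times H)=-\nu\nabla\times(\nabla\times H),\\ \mathrm{div}\,H=0,\end{cases}$$ initial data $\rho(x,0)=\rho_0(x)$, $\rho u(x,0)=\rho_0u_0(x)$, $H(x,0)=H_0(x)$ for $x\in\Omega$, and boundary conditions $u\cdot n=0$, $\mathrm{curl}\,u\times n=0$, $H\cdot n=0$, $\mathrm{curl}\,H\times n=0$ on $\partial\Omega$. Notation: $\bar\rho=\frac1{|\Omega|}\int_\Omega\rho_0\,dx$, $\bar P=P(\bar\rho)$, $\dot v=v_t+u\cdot\nabla v$, $G(\rho)=\rho\int_{\bar\rho}^\rho\frac{P(\tau)-\bar P}{\tau^2}\,d\tau$ (extended by continuity to $\rho=0$), $C_0=\int_\Omega\left(\frac12\rho_0|u_0|^2+G(\rho_0)+\frac12|H_0|^2\right)dx$. For $s\in(0,1)$, $\|v\|_{H^s}=\|v\|_{L^2}+\left(\int_{\Omega\times\Omega}\frac{|v(x)-v(y)|^2}{|x-y|^{3+2s}}\,dxdy\right)^{1/2}$.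 The global solution. Under the stated conditions on the data there is $\varepsilon>0$ depending only on $\mu,\lambda,\nu,\gamma,a,\bar\rho,\hat\rho,s,\Omega,M_1,M_2$ such that if $C_0\le\varepsilon$ then (MHD) has a unique global classical solution $(\rho,u,H)$ in $\Omega\times(0,\infty)$ with $0\le\rho\le2\hat\rho$; $(\rho-\bar\rho,P-\bar P)\in C([0,\infty);H^2\cap W^{2,q})$; $\nabla u\in C([0,\infty);H^1)\cap L^\infty_{\rm loc}(0,\infty;H^2\cap W^{2,q})$; $u_t\in L^\infty_{\rm loc}(0,\infty;H^2)\cap H^1_{\rm loc}(0,\infty;H^1)$; $H\in C([0,\infty);H^2)\cap L^\infty_{\rm loc}(0,\infty;H^4)$; $H_t\in C([0,\infty);L^2)\cap H^1_{\rm loc}(0,\infty;H^1)\cap L^\infty_{\rm loc}(0,\infty;H^2)$; and such that for any $r\in[1,\infty)$, $p\in[1,6]$ there are $C,\eta_0>0$ depending only on $\mu,\lambda,\nu,\gamma,a,s,\bar\rho,\hat\rho,\Omega,M_1,M_2,r,p$ with $$\|\rho(\cdot,t)-\bar\rho\|_{L^r}+\|u(\cdot,t)\|_{W^{1,p}}+\|(\sqrt\rho\,\dot u)(\cdot,t)\|_{L^2}^2+\|H(\cdot,t)\|_{H^2}\le Ce^{-\eta_0t}\quad(t>0).$$ *)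

theory Defs
  imports "HOL-Analysis.Analysis"
begin

section \<open>Classical differential operators on three-dimensional space\<close>

definition pd :: "3 \<Rightarrow> (real^3 \<Rightarrow> 'b::real_normed_vector) \<Rightarrow> real^3 \<Rightarrow> 'b" where
  "pd i f x = frechet_derivative f (at x) (axis i 1)"

definition dt :: "(real \<Rightarrow> real^3 \<Rightarrow> 'b::real_normed_vector) \<Rightarrow> real \<Rightarrow> real^3 \<Rightarrow> 'b" where
  "dt f t x = vector_derivative (\<lambda>\<tau>. f \<tau> x) (at t)"

text \<open>The next three operators take the family \<open>D i\<close> of first partial derivatives of a field, so that
  they serve both for classical (\<open>D i = pd i v\<close>) and for weak derivatives.\<close>

definition grad_of :: "(3 \<Rightarrow> real^3 \<Rightarrow> real) \<Rightarrow> real^3 \<Rightarrow> real^3" where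
  "grad_of D x = (\<chi> i. D i x)"

definition div_of :: "(3 \<Rightarrow> real^3 \<Rightarrow> real^3) \<Rightarrow> real^3 \<Rightarrow> real" where
  "div_of D x = (\<Sum>i\<in>UNIV. D i x $ i)"

definition curl_of :: "(3 \<Rightarrow> real^3 \<Rightarrow> real^3) \<Rightarrow> real^3 \<Rightarrow> real^3" where
  "curl_of D x = vector [D 2 x $ 3 - D 3 x $ 2, D 3 x $ 1 - D 1 x $ 3, D 1 x $ 2 - D 2 x $ 1]"

definition grad :: "(real^3 \<Rightarrow> real) \<Rightarrow> real^3 \<Rightarrow> real^3" where
  "grad f = grad_of (\<lambda>i. pd i f)"

definition divergence :: "(real^3 \<Rightarrow> real^3) \<Rightarrow> real^3 \<Rightarrow> real" where
  "divergence v = div_of (\<lambda>i. pd i v)"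

definition curl :: "(real^3 \<Rightarrow> real^3) \<Rightarrow> real^3 \<Rightarrow> real^3" where
  "curl v = curl_of (\<lambda>i. pd i v)"

definition laplacian :: "(real^3 \<Rightarrow> real^3) \<Rightarrow> real^3 \<Rightarrow> real^3" where
  "laplacian v x = (\<Sum>i\<in>UNIV. pd i (pd i v) x)"

text \<open>Continuous differentiability of order \<open>k\<close>; only meaningful on open sets \<open>S\<close>.\<close>

primrec Ck_on :: "nat \<Rightarrow> (real^3) set \<Rightarrow> (real^3 \<Rightarrow> 'b::real_normed_vector) \<Rightarrow> bool" where
  "Ck_on 0 S f \<longleftrightarrow> continuous_on S f"
| "Ck_on (Suc k) S f \<longleftrightarrow> (\<forall>x\<in>S. f differentiable (at x)) \<and> (\<forall>i. Ck_on k S (pd i f))"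

definition smooth_on :: "(real^3) set \<Rightarrow> (real^3 \<Rightarrow> 'b::real_normed_vector) \<Rightarrow> bool" where
  "smooth_on S f \<longleftrightarrow> (\<forall>k. Ck_on k S f)"


section \<open>Smooth domains, outward normal, surface measure\<close>

definition local_defining_function ::
    "(real^3) set \<Rightarrow> real^3 \<Rightarrow> (real^3) set \<Rightarrow> (real^3 \<Rightarrow> real) \<Rightarrow> bool" where
  "local_defining_function \<Omega> x U \<phi> \<longleftrightarrow>
     open U \<and> x \<in> U \<and> smooth_on U \<phi> \<and> (\<forall>y\<in>U. grad \<phi> y \<noteq> 0) \<and>
     \<Omega> \<inter> U = {y\<in>U. \<phi> y < 0} \<and> frontier \<Omega> \<inter> U = {y\<in>U. \<phi> y = 0}"

definition smooth_boundary :: "(real^3) set \<Rightarrow> bool" where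
  "smooth_boundary \<Omega> \<longleftrightarrow> (\<forall>x\<in>frontier \<Omega>. \<exists>U \<phi>. local_defining_function \<Omega> x U \<phi>)"

text \<open>For \<open>x\<close> on the boundary of a smooth domain there is exactly one such \<open>n\<close>.\<close>

definition outward_unit_normal :: "(real^3) set \<Rightarrow> real^3 \<Rightarrow> real^3 \<Rightarrow> bool" where
  "outward_unit_normal \<Omega> x n \<longleftrightarrow> x \<in> frontier \<Omega> \<and>
     (\<exists>U \<phi>. local_defining_function \<Omega> x U \<phi> \<and> n = grad \<phi> x /\<^sub>R norm (grad \<phi> x))"

definition admissible_domain :: "(real^3) set \<Rightarrow> bool" where
  "admissible_domain \<Omega> \<longleftrightarrow> open \<Omega> \<and> connected \<Omega> \<and> \<Omega> \<noteq> {} \<and> bounded \<Omega> \<and> simply_connected \<Omega> \<and>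
     smooth_boundary \<Omega> \<and> finite (components (frontier \<Omega>))"

text \<open>Two-dimensional Hausdorff measure on the Borel sets, normalised (factor \<open>pi / 4\<close>) so that it is
  surface area on smooth surfaces. The set function \<open>hausdorff2_outer\<close> is a metric outer measure,
  hence countably additive on the Borel sets, so \<open>measure_of\<close> does not collapse to the zero measure.\<close>

definition hausdorff2_pre :: "real \<Rightarrow> (real^3) set \<Rightarrow> ennreal" where
  "hausdorff2_pre \<delta> A =
     (INF C \<in> {C :: nat \<Rightarrow> (real^3) set. A \<subseteq> (\<Union>i. C i) \<and> (\<forall>i. bounded (C i) \<and> diameter (C i) \<le> \<delta>)}.
        (\<Sum>i. ennreal (pi / 4 * (diameter (C i))\<^sup>2)))"

definition hausdorff2_outer :: "(real^3) set \<Rightarrow> ennreal" where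
  "hausdorff2_outer A = (SUP \<delta>\<in>{0<..}. hausdorff2_pre \<delta> A)"

definition surface_measure :: "(real^3) measure" where
  "surface_measure = measure_of UNIV (sets borel) hausdorff2_outer"


section \<open>Lebesgue and Sobolev spaces\<close>

definition Lp :: "real \<Rightarrow> (real^3) set \<Rightarrow> (real^3 \<Rightarrow> 'b::euclidean_space) \<Rightarrow> bool" where
  "Lp p \<Omega> f \<longleftrightarrow> f \<in> borel_measurable (lebesgue_on \<Omega>) \<and>
     integrable (lebesgue_on \<Omega>) (\<lambda>x. norm (f x) powr p)"

definition Lp_norm :: "real \<Rightarrow> (real^3) set \<Rightarrow> (real^3 \<Rightarrow> 'b::euclidean_space) \<Rightarrow> real" where
  "Lp_norm p \<Omega> f = (\<integral>x. norm (f x) powr p \<partial>lebesgue_on \<Omega>) powr (1 / p)"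

definition test_function :: "(real^3) set \<Rightarrow> (real^3 \<Rightarrow> real) \<Rightarrow> bool" where
  "test_function \<Omega> \<phi> \<longleftrightarrow> smooth_on UNIV \<phi> \<and>
     (\<exists>K. compact K \<and> K \<subseteq> \<Omega> \<and> (\<forall>x. x \<notin> K \<longrightarrow> \<phi> x = 0))"

definition locally_integrable :: "(real^3) set \<Rightarrow> (real^3 \<Rightarrow> 'b::euclidean_space) \<Rightarrow> bool" where
  "locally_integrable \<Omega> f \<longleftrightarrow> (\<forall>K. compact K \<and> K \<subseteq> \<Omega> \<longrightarrow> integrable (lebesgue_on K) f)"

definition weak_pd ::
    "(real^3) set \<Rightarrow> 3 \<Rightarrow> (real^3 \<Rightarrow> 'b::euclidean_space) \<Rightarrow> (real^3 \<Rightarrow> 'b) \<Rightarrow> bool" where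
  "weak_pd \<Omega> i f g \<longleftrightarrow> locally_integrable \<Omega> f \<and> locally_integrable \<Omega> g \<and>
     (\<forall>\<phi>. test_function \<Omega> \<phi> \<longrightarrow>
        (\<integral>x. pd i \<phi> x *\<^sub>R f x \<partial>lebesgue_on \<Omega>) = - (\<integral>x. \<phi> x *\<^sub>R g x \<partial>lebesgue_on \<Omega>))"

text \<open>A representative of the weak derivative; it is determined up to null sets whenever it exists.\<close>

definition wpd :: "(real^3) set \<Rightarrow> 3 \<Rightarrow> (real^3 \<Rightarrow> 'b::euclidean_space) \<Rightarrow> real^3 \<Rightarrow> 'b" where
  "wpd \<Omega> i f = (SOME g. weak_pd \<Omega> i f g)"

primrec Wkp :: "nat \<Rightarrow> real \<Rightarrow> (real^3) set \<Rightarrow> (real^3 \<Rightarrow> 'b::euclidean_space) \<Rightarrow> bool" where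
  "Wkp 0 p \<Omega> f \<longleftrightarrow> Lp p \<Omega> f"
| "Wkp (Suc k) p \<Omega> f \<longleftrightarrow> Lp p \<Omega> f \<and> (\<forall>i. \<exists>g. weak_pd \<Omega> i f g \<and> Wkp k p \<Omega> g)"

text \<open>The sum of the \<open>Lp\<close> norms of all iterated weak derivatives up to order \<open>k\<close>; mixed derivatives
  are counted once for each order of differentiation, which gives an equivalent norm.\<close>

primrec Wkp_norm :: "nat \<Rightarrow> real \<Rightarrow> (real^3) set \<Rightarrow> (real^3 \<Rightarrow> 'b::euclidean_space) \<Rightarrow> real" where
  "Wkp_norm 0 p \<Omega> f = Lp_norm p \<Omega> f"
| "Wkp_norm (Suc k) p \<Omega> f = Lp_norm p \<Omega> f + (\<Sum>i\<in>UNIV. Wkp_norm k p \<Omega> (wpd \<Omega> i f))"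

definition Hs_norm :: "real \<Rightarrow> (real^3) set \<Rightarrow> (real^3 \<Rightarrow> 'b::euclidean_space) \<Rightarrow> real" where
  "Hs_norm s \<Omega> v =
     (if s = 1 then Wkp_norm 1 2 \<Omega> v
      else Lp_norm 2 \<Omega> v +
        sqrt (\<integral>z. (norm (v (fst z) - v (snd z)))\<^sup>2 / norm (fst z - snd z) powr (3 + 2 * s)
              \<partial>lebesgue_on (\<Omega> \<times> \<Omega>)))"

text \<open>Traces on the boundary of a function in \<open>H\<^sup>1\<close>: limits in \<open>L\<^sup>2\<close> of the boundary values of
  smooth approximations.\<close>

definition has_trace ::
    "(real^3) set \<Rightarrow> (real^3 \<Rightarrow> 'b::euclidean_space) \<Rightarrow> (real^3 \<Rightarrow> 'b) \<Rightarrow> bool" where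
  "has_trace \<Omega> v g \<longleftrightarrow> Wkp 1 2 \<Omega> v \<and> g \<in> borel_measurable borel \<and>
     (\<exists>w. (\<forall>k::nat. smooth_on UNIV (w k)) \<and>
        (\<lambda>k. Wkp_norm 1 2 \<Omega> (\<lambda>x. w k x - v x)) \<longlonglongrightarrow> 0 \<and>
        (\<lambda>k. \<integral>\<^sup>+x\<in>frontier \<Omega>. ennreal ((norm (w k x - g x))\<^sup>2) \<partial>surface_measure) \<longlonglongrightarrow> 0)"

definition wcurl :: "(real^3) set \<Rightarrow> (real^3 \<Rightarrow> real^3) \<Rightarrow> real^3 \<Rightarrow> real^3" where
  "wcurl \<Omega> v = curl_of (\<lambda>i. wpd \<Omega> i v)"

definition wdiv :: "(real^3) set \<Rightarrow> (real^3 \<Rightarrow> real^3) \<Rightarrow> real^3 \<Rightarrow> real" where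
  "wdiv \<Omega> v = div_of (\<lambda>i. wpd \<Omega> i v)"

definition wgrad :: "(real^3) set \<Rightarrow> (real^3 \<Rightarrow> real) \<Rightarrow> real^3 \<Rightarrow> real^3" where
  "wgrad \<Omega> f = grad_of (\<lambda>i. wpd \<Omega> i f)"

definition wlaplacian :: "(real^3) set \<Rightarrow> (real^3 \<Rightarrow> real^3) \<Rightarrow> real^3 \<Rightarrow> real^3" where
  "wlaplacian \<Omega> v x = (\<Sum>i\<in>UNIV. wpd \<Omega> i (wpd \<Omega> i v) x)"

text \<open>The boundary conditions \<open>v \<bullet> n = 0\<close> (pointwise, for \<open>v\<close> continuous up to the boundary) and
  \<open>curl v \<times> n = 0\<close> (in the sense of traces).\<close>

definition slip_boundary :: "(real^3) set \<Rightarrow> (real^3 \<Rightarrow> real^3) \<Rightarrow> bool" where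
  "slip_boundary \<Omega> v \<longleftrightarrow>
     (\<forall>x n. outward_unit_normal \<Omega> x n \<longrightarrow> v x \<bullet> n = 0) \<and>
     (\<exists>g. has_trace \<Omega> (wcurl \<Omega> v) g \<and>
        (AE x in surface_measure. \<forall>n. outward_unit_normal \<Omega> x n \<longrightarrow> cross3 (g x) n = 0))"


section \<open>Spaces of functions of time with values in Sobolev spaces\<close>

definition C_time :: "nat \<Rightarrow> real \<Rightarrow> (real^3) set \<Rightarrow> (real \<Rightarrow> real^3 \<Rightarrow> 'b::euclidean_space) \<Rightarrow> bool" where
  "C_time k p \<Omega> f \<longleftrightarrow> (\<forall>t\<ge>0. Wkp k p \<Omega> (f t)) \<and>
     (\<forall>t0\<ge>0. ((\<lambda>t. Wkp_norm k p \<Omega> (\<lambda>x. f t x - f t0 x)) \<longlongrightarrow> 0) (at t0 within {0..}))"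

text \<open>Bochner measurability: almost everywhere limit, in the norm of the space, of simple functions.\<close>

definition strongly_measurable ::
    "nat \<Rightarrow> real \<Rightarrow> (real^3) set \<Rightarrow> (real \<Rightarrow> real^3 \<Rightarrow> 'b::euclidean_space) \<Rightarrow> bool" where
  "strongly_measurable k p \<Omega> f \<longleftrightarrow>
     (\<exists>S :: nat \<Rightarrow> real \<Rightarrow> real^3 \<Rightarrow> 'b.
        (\<forall>n. finite (range (S n)) \<and> (\<forall>v. {t. S n t = v} \<in> sets lebesgue) \<and> (\<forall>t. Wkp k p \<Omega> (S n t))) \<and>
        (AE t in lebesgue_on {0<..}. Wkp k p \<Omega> (f t) \<and>
           (\<lambda>n. Wkp_norm k p \<Omega> (\<lambda>x. f t x - S n t x)) \<longlonglongrightarrow> 0))"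

definition Linf_loc :: "nat \<Rightarrow> real \<Rightarrow> (real^3) set \<Rightarrow> (real \<Rightarrow> real^3 \<Rightarrow> 'b::euclidean_space) \<Rightarrow> bool" where
  "Linf_loc k p \<Omega> f \<longleftrightarrow> strongly_measurable k p \<Omega> f \<and>
     (\<forall>t1 t2. 0 < t1 \<and> t1 < t2 \<longrightarrow>
        (\<exists>B. AE t in lebesgue_on {t1..t2}. Wkp_norm k p \<Omega> (f t) \<le> B))"

definition L2_loc :: "nat \<Rightarrow> real \<Rightarrow> (real^3) set \<Rightarrow> (real \<Rightarrow> real^3 \<Rightarrow> 'b::euclidean_space) \<Rightarrow> bool" where
  "L2_loc k p \<Omega> f \<longleftrightarrow> strongly_measurable k p \<Omega> f \<and>
     (\<forall>t1 t2. 0 < t1 \<and> t1 < t2 \<longrightarrow>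
        integrable (lebesgue_on {t1..t2}) (\<lambda>t. (Wkp_norm k p \<Omega> (f t))\<^sup>2))"

definition time_test_function :: "(real \<Rightarrow> real) \<Rightarrow> bool" where
  "time_test_function \<phi> \<longleftrightarrow> (\<forall>k t. ((deriv ^^ k) \<phi>) differentiable (at t)) \<and>
     (\<exists>t1 t2. 0 < t1 \<and> (\<forall>t. t \<notin> {t1..t2} \<longrightarrow> \<phi> t = 0))"

text \<open>\<open>g\<close> is the weak time derivative of \<open>f\<close> on \<open>(0, \<infinity>)\<close>; the identity between elements of
  \<open>L\<^sup>2(\<Omega>)\<close> is tested against functions of \<open>x\<close>.\<close>

definition weak_dt ::
    "(real^3) set \<Rightarrow> (real \<Rightarrow> real^3 \<Rightarrow> 'b::euclidean_space) \<Rightarrow> (real \<Rightarrow> real^3 \<Rightarrow> 'b) \<Rightarrow> bool" where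
  "weak_dt \<Omega> f g \<longleftrightarrow> (\<forall>\<phi> \<psi>. time_test_function \<phi> \<and> test_function \<Omega> \<psi> \<longrightarrow>
     (\<integral>t. deriv \<phi> t *\<^sub>R (\<integral>x. \<psi> x *\<^sub>R f t x \<partial>lebesgue_on \<Omega>) \<partial>lebesgue_on {0<..}) =
     - (\<integral>t. \<phi> t *\<^sub>R (\<integral>x. \<psi> x *\<^sub>R g t x \<partial>lebesgue_on \<Omega>) \<partial>lebesgue_on {0<..}))"

text \<open>\<open>H\<^sup>1\<close> locally in time with values in \<open>H\<^sup>k\<close>.\<close>

definition H1_loc :: "nat \<Rightarrow> (real^3) set \<Rightarrow> (real \<Rightarrow> real^3 \<Rightarrow> 'b::euclidean_space) \<Rightarrow> bool" where
  "H1_loc k \<Omega> f \<longleftrightarrow> L2_loc k 2 \<Omega> f \<and> (\<exists>g. weak_dt \<Omega> f g \<and> L2_loc k 2 \<Omega> g)"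

text \<open>Classical regularity on \<open>\<Omega> \<times> (0, \<infinity>)\<close>: once continuously differentiable in time,
  \<open>k\<close> times continuously differentiable in space.\<close>

primrec Ck_space :: "nat \<Rightarrow> (real^3) set \<Rightarrow> (real \<Rightarrow> real^3 \<Rightarrow> 'b::real_normed_vector) \<Rightarrow> bool" where
  "Ck_space 0 \<Omega> f \<longleftrightarrow> continuous_on ({0<..} \<times> \<Omega>) (\<lambda>(t, x). f t x)"
| "Ck_space (Suc k) \<Omega> f \<longleftrightarrow> continuous_on ({0<..} \<times> \<Omega>) (\<lambda>(t, x). f t x) \<and>
     (\<forall>t>0. \<forall>x\<in>\<Omega>. f t differentiable (at x)) \<and> (\<forall>i. Ck_space k \<Omega> (\<lambda>t. pd i (f t)))"

definition C1_time :: "(real^3) set \<Rightarrow> (real \<Rightarrow> real^3 \<Rightarrow> 'b::real_normed_vector) \<Rightarrow> bool" where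
  "C1_time \<Omega> f \<longleftrightarrow> (\<forall>t>0. \<forall>x\<in>\<Omega>. (\<lambda>\<tau>. f \<tau> x) differentiable (at t)) \<and>
     continuous_on ({0<..} \<times> \<Omega>) (\<lambda>(t, x). dt f t x)"


section \<open>The compressible MHD system\<close>

definition pressure :: "real \<Rightarrow> real \<Rightarrow> real \<Rightarrow> real" where
  "pressure a \<gamma> r = a * r powr \<gamma>"

definition G_pos :: "real \<Rightarrow> real \<Rightarrow> real \<Rightarrow> real \<Rightarrow> real" where
  "G_pos a \<gamma> \<rho>bar r = r * (LBINT \<tau>=\<rho>bar..r. (pressure a \<gamma> \<tau> - pressure a \<gamma> \<rho>bar) / \<tau>\<^sup>2)"

definition G_pot :: "real \<Rightarrow> real \<Rightarrow> real \<Rightarrow> real \<Rightarrow> real" where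
  "G_pot a \<gamma> \<rho>bar r = (if r = 0 then Lim (at_right 0) (G_pos a \<gamma> \<rho>bar) else G_pos a \<gamma> \<rho>bar r)"

definition initial_energy ::
    "real \<Rightarrow> real \<Rightarrow> real \<Rightarrow> (real^3) set \<Rightarrow> (real^3 \<Rightarrow> real) \<Rightarrow> (real^3 \<Rightarrow> real^3) \<Rightarrow> (real^3 \<Rightarrow> real^3) \<Rightarrow> real" where
  "initial_energy a \<gamma> \<rho>bar \<Omega> \<rho>0 u0 H0 =
     (\<integral>x. 1/2 * \<rho>0 x * (norm (u0 x))\<^sup>2 + G_pot a \<gamma> \<rho>bar (\<rho>0 x) + 1/2 * (norm (H0 x))\<^sup>2 \<partial>lebesgue_on \<Omega>)"

definition mean_value :: "(real^3) set \<Rightarrow> (real^3 \<Rightarrow> real) \<Rightarrow> real" where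
  "mean_value \<Omega> f = (\<integral>x. f x \<partial>lebesgue_on \<Omega>) / measure lebesgue \<Omega>"

text \<open>The data are given by their continuous representatives on the closed domain
  (functions in \<open>H\<^sup>2\<close> have one), so that pointwise values of \<open>\<rho>0\<close> make sense.\<close>

definition admissible_data ::
    "real \<Rightarrow> real \<Rightarrow> real \<Rightarrow> real \<Rightarrow> real \<Rightarrow> real \<Rightarrow> real \<Rightarrow> (real^3) set \<Rightarrow> real \<Rightarrow> real \<Rightarrow> real \<Rightarrow>
     (real^3 \<Rightarrow> real) \<Rightarrow> (real^3 \<Rightarrow> real^3) \<Rightarrow> (real^3 \<Rightarrow> real^3) \<Rightarrow> bool" where
  "admissible_data \<mu> lam \<gamma> a \<rho>bar \<rho>hat s \<Omega> M1 M2 q \<rho>0 u0 H0 \<longleftrightarrow>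
     continuous_on (closure \<Omega>) \<rho>0 \<and> continuous_on (closure \<Omega>) u0 \<and> continuous_on (closure \<Omega>) H0 \<and>
     mean_value \<Omega> \<rho>0 = \<rho>bar \<and>
     slip_boundary \<Omega> u0 \<and> slip_boundary \<Omega> H0 \<and>
     (\<forall>x\<in>\<Omega>. 0 \<le> \<rho>0 x \<and> \<rho>0 x \<le> \<rho>hat) \<and>
     Wkp 2 2 \<Omega> \<rho>0 \<and> Wkp 2 q \<Omega> \<rho>0 \<and>
     Wkp 2 2 \<Omega> (\<lambda>x. pressure a \<gamma> (\<rho>0 x)) \<and> Wkp 2 q \<Omega> (\<lambda>x. pressure a \<gamma> (\<rho>0 x)) \<and>
     Wkp 2 2 \<Omega> u0 \<and> Wkp 2 2 \<Omega> H0 \<and>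
     (AE x in lebesgue_on \<Omega>. wdiv \<Omega> H0 x = 0) \<and>
     Hs_norm s \<Omega> u0 \<le> M1 \<and> Hs_norm s \<Omega> H0 \<le> M2 \<and>
     (\<exists>g. Lp 2 \<Omega> g \<and>
        (AE x in lebesgue_on \<Omega>.
           - \<mu> *\<^sub>R wlaplacian \<Omega> u0 x - (\<mu> + lam) *\<^sub>R wgrad \<Omega> (wdiv \<Omega> u0) x
             + wgrad \<Omega> (\<lambda>y. pressure a \<gamma> (\<rho>0 y)) x - cross3 (wcurl \<Omega> H0 x) (H0 x)
           = sqrt (\<rho>0 x) *\<^sub>R g x))"

text \<open>In the momentum equation, \<open>(div (\<rho> u \<otimes> u)) $ j = (\<Sum>i. \<partial>\<^sub>i (\<rho> u\<^sub>i u\<^sub>j))\<close>.\<close>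

definition MHD_equations ::
    "real \<Rightarrow> real \<Rightarrow> real \<Rightarrow> real \<Rightarrow> real \<Rightarrow> (real^3) set \<Rightarrow>
     (real \<Rightarrow> real^3 \<Rightarrow> real) \<Rightarrow> (real \<Rightarrow> real^3 \<Rightarrow> real^3) \<Rightarrow> (real \<Rightarrow> real^3 \<Rightarrow> real^3) \<Rightarrow> bool" where
  "MHD_equations \<mu> lam \<nu> \<gamma> a \<Omega> \<rho> u H \<longleftrightarrow>
     (\<forall>t>0. \<forall>x\<in>\<Omega>.
        dt \<rho> t x + divergence (\<lambda>y. \<rho> t y *\<^sub>R u t y) x = 0 \<and>
        dt (\<lambda>\<tau> y. \<rho> \<tau> y *\<^sub>R u \<tau> y) t x
          + (\<Sum>i\<in>UNIV. pd i (\<lambda>y. (\<rho> t y * u t y $ i) *\<^sub>R u t y) x)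
          + grad (\<lambda>y. pressure a \<gamma> (\<rho> t y)) x
        = \<mu> *\<^sub>R laplacian (u t) x + (\<mu> + lam) *\<^sub>R grad (divergence (u t)) x
          + cross3 (curl (H t) x) (H t x) \<and>
        dt H t x - curl (\<lambda>y. cross3 (u t y) (H t y)) x = - \<nu> *\<^sub>R curl (curl (H t)) x \<and>
        divergence (H t) x = 0)"

definition classical_MHD_solution ::
    "real \<Rightarrow> real \<Rightarrow> real \<Rightarrow> real \<Rightarrow> real \<Rightarrow> (real^3) set \<Rightarrow>
     (real^3 \<Rightarrow> real) \<Rightarrow> (real^3 \<Rightarrow> real^3) \<Rightarrow> (real^3 \<Rightarrow> real^3) \<Rightarrow>
     (real \<Rightarrow> real^3 \<Rightarrow> real) \<Rightarrow> (real \<Rightarrow> real^3 \<Rightarrow> real^3) \<Rightarrow> (real \<Rightarrow> real^3 \<Rightarrow> real^3) \<Rightarrow> bool" where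
  "classical_MHD_solution \<mu> lam \<nu> \<gamma> a \<Omega> \<rho>0 u0 H0 \<rho> u H \<longleftrightarrow>
     continuous_on ({0..} \<times> closure \<Omega>) (\<lambda>(t, x). \<rho> t x) \<and>
     continuous_on ({0..} \<times> closure \<Omega>) (\<lambda>(t, x). u t x) \<and>
     continuous_on ({0..} \<times> closure \<Omega>) (\<lambda>(t, x). H t x) \<and>
     C1_time \<Omega> \<rho> \<and> Ck_space 1 \<Omega> \<rho> \<and>
     C1_time \<Omega> u \<and> Ck_space 2 \<Omega> u \<and>
     C1_time \<Omega> H \<and> Ck_space 2 \<Omega> H \<and>
     MHD_equations \<mu> lam \<nu> \<gamma> a \<Omega> \<rho> u H \<and>
     (\<forall>x\<in>\<Omega>. \<rho> 0 x = \<rho>0 x \<and> \<rho> 0 x *\<^sub>R u 0 x = \<rho>0 x *\<^sub>R u0 x \<and> H 0 x = H0 x) \<and>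
     (\<forall>t>0. slip_boundary \<Omega> (u t) \<and> slip_boundary \<Omega> (H t))"

text \<open>The regularity class. \<open>Du i\<close> is the \<open>i\<close>-th weak derivative of \<open>u\<close>, and \<open>Ht\<close> is the
  continuous extension of the time derivative of \<open>H\<close> to \<open>t = 0\<close>.\<close>

definition solution_regularity ::
    "real \<Rightarrow> real \<Rightarrow> real \<Rightarrow> (real^3) set \<Rightarrow> real \<Rightarrow>
     (real \<Rightarrow> real^3 \<Rightarrow> real) \<Rightarrow> (real \<Rightarrow> real^3 \<Rightarrow> real^3) \<Rightarrow> (real \<Rightarrow> real^3 \<Rightarrow> real^3) \<Rightarrow> bool" where
  "solution_regularity \<gamma> a \<rho>bar \<Omega> q \<rho> u H \<longleftrightarrow>
     C_time 2 2 \<Omega> (\<lambda>t x. \<rho> t x - \<rho>bar) \<and> C_time 2 q \<Omega> (\<lambda>t x. \<rho> t x - \<rho>bar) \<and>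
     C_time 2 2 \<Omega> (\<lambda>t x. pressure a \<gamma> (\<rho> t x) - pressure a \<gamma> \<rho>bar) \<and>
     C_time 2 q \<Omega> (\<lambda>t x. pressure a \<gamma> (\<rho> t x) - pressure a \<gamma> \<rho>bar) \<and>
     (\<exists>Du. \<forall>i. (\<forall>t\<ge>0. weak_pd \<Omega> i (u t) (Du i t)) \<and>
        C_time 1 2 \<Omega> (Du i) \<and> Linf_loc 2 2 \<Omega> (Du i) \<and> Linf_loc 2 q \<Omega> (Du i)) \<and>
     Linf_loc 2 2 \<Omega> (dt u) \<and> H1_loc 1 \<Omega> (dt u) \<and>
     C_time 2 2 \<Omega> H \<and> Linf_loc 4 2 \<Omega> H \<and>
     (\<exists>Ht. (\<forall>t>0. \<forall>x\<in>\<Omega>. Ht t x = dt H t x) \<and> C_time 0 2 \<Omega> Ht) \<and>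
     H1_loc 1 \<Omega> (dt H) \<and> Linf_loc 2 2 \<Omega> (dt H)"

definition global_solution ::
    "real \<Rightarrow> real \<Rightarrow> real \<Rightarrow> real \<Rightarrow> real \<Rightarrow> real \<Rightarrow> real \<Rightarrow> (real^3) set \<Rightarrow> real \<Rightarrow>
     (real^3 \<Rightarrow> real) \<Rightarrow> (real^3 \<Rightarrow> real^3) \<Rightarrow> (real^3 \<Rightarrow> real^3) \<Rightarrow>
     (real \<Rightarrow> real^3 \<Rightarrow> real) \<Rightarrow> (real \<Rightarrow> real^3 \<Rightarrow> real^3) \<Rightarrow> (real \<Rightarrow> real^3 \<Rightarrow> real^3) \<Rightarrow> bool" where
  "global_solution \<mu> lam \<nu> \<gamma> a \<rho>bar \<rho>hat \<Omega> q \<rho>0 u0 H0 \<rho> u H \<longleftrightarrow>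
     classical_MHD_solution \<mu> lam \<nu> \<gamma> a \<Omega> \<rho>0 u0 H0 \<rho> u H \<and>
     (\<forall>t\<ge>0. \<forall>x\<in>\<Omega>. 0 \<le> \<rho> t x \<and> \<rho> t x \<le> 2 * \<rho>hat) \<and>
     solution_regularity \<gamma> a \<rho>bar \<Omega> q \<rho> u H"

definition material_derivative :: "(real \<Rightarrow> real^3 \<Rightarrow> real^3) \<Rightarrow> real \<Rightarrow> real^3 \<Rightarrow> real^3" where
  "material_derivative u t x = dt u t x + (\<Sum>i\<in>UNIV. (u t x $ i) *\<^sub>R pd i (u t) x)"

definition decay_quantity ::
    "real \<Rightarrow> (real^3) set \<Rightarrow> real \<Rightarrow> real \<Rightarrow>
     (real \<Rightarrow> real^3 \<Rightarrow> real) \<Rightarrow> (real \<Rightarrow> real^3 \<Rightarrow> real^3) \<Rightarrow> (real \<Rightarrow> real^3 \<Rightarrow> real^3) \<Rightarrow> real \<Rightarrow> real" where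
  "decay_quantity \<rho>bar \<Omega> r p \<rho> u H t =
     Lp_norm r \<Omega> (\<lambda>x. \<rho> t x - \<rho>bar) + Wkp_norm 1 p \<Omega> (u t)
     + (Lp_norm 2 \<Omega> (\<lambda>x. sqrt (\<rho> t x) *\<^sub>R material_derivative u t x))\<^sup>2 + Wkp_norm 2 2 \<Omega> (H t)"

text \<open>\<open>smallness_constant \<dots> \<epsilon>\<close>: small energy \<open>C\<^sub>0 \<le> \<epsilon>\<close> guarantees the unique global classical solution
  and its exponential decay. Neither \<open>\<epsilon>\<close> nor the decay constants \<open>C\<close>, \<open>\<eta>0\<close> depend on \<open>q\<close> or on the data
  beyond the listed parameters. The bound on the full quantity is required for \<open>t \<ge> 1\<close> only and the
  density bound for all \<open>t > 0\<close>: as \<open>t \<rightarrow> 0\<close>, the norms of \<open>u\<close>, \<open>H\<close> and of the material derivative tend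
  to those of the data, which the parameters do not control (only the \<open>H\<^sup>s\<close> norms are bounded by
  \<open>M1\<close>, \<open>M2\<close>), so that no \<open>\<epsilon>\<close> could satisfy a uniform bound of them on \<open>(0, \<infinity>)\<close>.\<close>

definition smallness_constant ::
    "real \<Rightarrow> real \<Rightarrow> real \<Rightarrow> real \<Rightarrow> real \<Rightarrow> real \<Rightarrow> real \<Rightarrow> real \<Rightarrow> (real^3) set \<Rightarrow> real \<Rightarrow> real \<Rightarrow> real \<Rightarrow> bool" where
  "smallness_constant \<mu> lam \<nu> \<gamma> a \<rho>bar \<rho>hat s \<Omega> M1 M2 \<epsilon> \<longleftrightarrow> \<epsilon> > 0 \<and>
     (\<forall>q \<rho>0 u0 H0. 3 < q \<and> q < 6 \<and>
        admissible_data \<mu> lam \<gamma> a \<rho>bar \<rho>hat s \<Omega> M1 M2 q \<rho>0 u0 H0 \<and>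
        initial_energy a \<gamma> \<rho>bar \<Omega> \<rho>0 u0 H0 \<le> \<epsilon> \<longrightarrow>
        (\<exists>\<rho> u H. global_solution \<mu> lam \<nu> \<gamma> a \<rho>bar \<rho>hat \<Omega> q \<rho>0 u0 H0 \<rho> u H \<and>
           (\<forall>\<rho>' u' H'. global_solution \<mu> lam \<nu> \<gamma> a \<rho>bar \<rho>hat \<Omega> q \<rho>0 u0 H0 \<rho>' u' H' \<longrightarrow>
              (\<forall>t\<ge>0. \<forall>x\<in>\<Omega>. \<rho>' t x = \<rho> t x \<and> u' t x = u t x \<and> H' t x = H t x)))) \<and>
     (\<forall>r p. 1 \<le> r \<and> 1 \<le> p \<and> p \<le> 6 \<longrightarrow>
        (\<exists>C>0. \<exists>\<eta>0>0. \<forall>q \<rho>0 u0 H0 \<rho> u H. 3 < q \<and> q < 6 \<and>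
           admissible_data \<mu> lam \<gamma> a \<rho>bar \<rho>hat s \<Omega> M1 M2 q \<rho>0 u0 H0 \<and>
           initial_energy a \<gamma> \<rho>bar \<Omega> \<rho>0 u0 H0 \<le> \<epsilon> \<and>
           global_solution \<mu> lam \<nu> \<gamma> a \<rho>bar \<rho>hat \<Omega> q \<rho>0 u0 H0 \<rho> u H \<longrightarrow>
           (\<forall>t>0. Lp_norm r \<Omega> (\<lambda>x. \<rho> t x - \<rho>bar) \<le> C * exp (- \<eta>0 * t)) \<and>
           (\<forall>t\<ge>1. decay_quantity \<rho>bar \<Omega> r p \<rho> u H t \<le> C * exp (- \<eta>0 * t))))"

end

theory Submission
 imports Defs "HOL-Computational_Algebra.Polynomial"
begin

text \<open>The lower bound has two sources: the vacuum present initially never disappears, and the density converges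
  exponentially to its mean in \<open>L\<^sup>1\<close>. At every time the density thus deviates from its mean \<open>\<rho>bar\<close> by a fixed amount
  at some point, although the deviation is small in \<open>L\<^sup>1\<close>. A function that is small on average but not in the
  supremum norm has a large gradient. Quantitatively, \<open>sup_interpolation\<close> bounds the supremum by
  \<open>(1 / h) ^ 3\<close> times the \<open>L\<^sup>1\<close> norm plus \<open>h powr (1 - 3 / r1)\<close> times the norm of the gradient, for all small
  scales \<open>h\<close>; a scale that decreases exponentially in time gives exponential growth of the gradient. For bounded times
  the conservation of mass (\<open>mass_conserved\<close>) yields a second point with a density close to \<open>\<rho>bar\<close>, and
  \<open>oscillation_bound\<close> applies (\<open>density_spread\<close>).

  The persistence of vacuum is to be understood in the form that no positive constant bounds \<open>\<rho> T\<close> from below, for any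
  positive time \<open>T\<close>. Otherwise \<open>\<rho>\<close> would be positive everywhere at time zero (\<open>initial_density_positive\<close>). Between two
  positive times the velocity gradient is bounded, and a minimum principle for the transport equation carries the lower
  bound backwards (\<open>density_lower_bound_backwards\<close>); it is applied to a function that tends to infinity at the
  boundary, whose growth is controlled because the flow is tangential there (\<open>normal_flux_bound\<close>).

  Near the initial time only \<open>L\<^sup>2\<close> bounds of second derivatives of the velocity hold uniformly, so \<open>div u\<close> may be
  unbounded. It is eliminated by the momentum equation: the derivative along the flow of the potential
  \<open>div (laplacian)^{-1} (\<rho> u)\<close> equals a multiple of \<open>div u\<close> up to the pressure, which has a favourable sign, and
  commutators. The latter are integrals of differences of velocities and of magnetic fields against a kernel of degree
  \<open>-3\<close>; they are bounded (\<open>flux_estimate\<close>) because functions in \<open>H\<^sup>2\<close> are Hoelder continuous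
  (\<open>hoelder_half\<close>). The exponential of the potential is thus an integrating factor for the transport equation, and
  a minimum principle on cones (\<open>density_cone_minimum\<close>) bounds the density from below up to the initial time.
  The kernel is regularised and the potential localised, so that all differentiations are classical.\<close>

section \<open>Partial derivatives\<close>

lemma has_derivative_pd:
 fixes f :: "real^3 \<Rightarrow> 'b::real_normed_vector"
 assumes "f differentiable (at x)"
 shows "(f has_derivative (\<lambda>h. \<Sum>i\<in>UNIV. (h $ i) *\<^sub>R pd i f x)) (at x)"
proof -
 have D: "(f has_derivative frechet_derivative f (at x)) (at x)"
  using assms frechet_derivative_works by blast
 have lin: "linear (frechet_derivative f (at x))"
  using D has_derivative_linear by blast
 have "frechet_derivative f (at x) h = (\<Sum>i\<in>UNIV. (h $ i) *\<^sub>R pd i f x)" for h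
 proof -
  have "h = (\<Sum>i\<in>UNIV. (h $ i) *\<^sub>R axis i 1)"
   using basis_expansion[of h] by (simp add: scalar_mult_eq_scaleR)
  then have "frechet_derivative f (at x) h = frechet_derivative f (at x) (\<Sum>i\<in>UNIV. (h $ i) *\<^sub>R axis i 1)"
   by simp
  also have "\<dots> = (\<Sum>i\<in>UNIV. (h $ i) *\<^sub>R pd i f x)"
   using lin by (simp add: linear_sum linear_scale pd_def)
  finally show ?thesis .
 qed
 then have "frechet_derivative f (at x) = (\<lambda>h. \<Sum>i\<in>UNIV. (h $ i) *\<^sub>R pd i f x)" by blast
 then show ?thesis using D by simp
qed

lemma pd_eqI:
 assumes "(f has_derivative f') (at x)"
 shows "pd i f x = f' (axis i 1)"
 using frechet_derivative_at[OF assms] by (simp add: pd_def)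

lemma pd_cong:
 assumes "open S" "x \<in> S" "!!y. y \<in> S ==> f y = g y"
 shows "pd i f x = pd i g x"
proof -
 have "(f has_derivative D) (at x) \<longleftrightarrow> (g has_derivative D) (at x)" for D
  using has_derivative_transform_within_open[OF _ assms(1,2), of f D UNIV g]
   has_derivative_transform_within_open[OF _ assms(1,2), of g D UNIV f] assms(3) by auto
 then show ?thesis by (simp add: pd_def frechet_derivative_def)
qed

lemma differentiable_cong_open:
 assumes "open S" "x \<in> S" "!!y. y \<in> S ==> f y = g y"
 shows "f differentiable (at x) \<longleftrightarrow> g differentiable (at x)"
 using has_derivative_transform_within_open[OF _ assms(1,2), of f _ UNIV g]
  has_derivative_transform_within_open[OF _ assms(1,2), of g _ UNIV f] assms(3)
 unfolding differentiable_def by metis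

lemma pd_const [simp]: "pd i (\<lambda>x. c) x = 0"
 by (rule pd_eqI[OF has_derivative_const])

lemma pd_add:
 assumes "f differentiable (at x)" "g differentiable (at x)"
 shows "pd i (\<lambda>y. f y + g y) x = pd i f x + pd i g x"
 using pd_eqI[OF has_derivative_add[OF has_derivative_pd[OF assms(1)] has_derivative_pd[OF assms(2)]], of i]
 by (simp add: axis_def if_distrib[of "\<lambda>c. c *\<^sub>R _"] cong: if_cong)

lemma pd_diff:
 assumes "f differentiable (at x)" "g differentiable (at x)"
 shows "pd i (\<lambda>y. f y - g y) x = pd i f x - pd i g x"
 using pd_eqI[OF has_derivative_diff[OF has_derivative_pd[OF assms(1)] has_derivative_pd[OF assms(2)]], of i]
 by (simp add: axis_def if_distrib[of "\<lambda>c. c *\<^sub>R _"] cong: if_cong)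

lemma pd_scaleR:
 fixes f :: "real^3 \<Rightarrow> real"
 assumes "f differentiable (at x)" "g differentiable (at x)"
 shows "pd i (\<lambda>y. f y *\<^sub>R g y) x = pd i f x *\<^sub>R g x + f x *\<^sub>R pd i g x"
 using pd_eqI[OF has_derivative_scaleR[OF has_derivative_pd[OF assms(1)] has_derivative_pd[OF assms(2)]], of i]
 by (simp add: axis_def if_distrib[of "\<lambda>c. c *\<^sub>R _"] if_distrib[of "\<lambda>c. c * _"] cong: if_cong)

lemma pd_mult:
 fixes f :: "real^3 \<Rightarrow> real"
 assumes "f differentiable (at x)" "g differentiable (at x)"
 shows "pd i (\<lambda>y. f y * g y) x = pd i f x * g x + f x * pd i g x"
 using pd_scaleR[OF assms, of i] by simp

lemma pd_linear:
 assumes "bounded_linear L" "f differentiable (at x)"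
 shows "pd i (\<lambda>y. L (f y)) x = L (pd i f x)"
 using pd_eqI[OF bounded_linear.has_derivative[OF assms(1) has_derivative_pd[OF assms(2)]], of i]
 by (simp add: axis_def if_distrib[of "\<lambda>c. c *\<^sub>R _"] cong: if_cong)

lemma pd_cmul:
 fixes f :: "real^3 \<Rightarrow> real"
 assumes "f differentiable (at x)"
 shows "pd i (\<lambda>y. c * f y) x = c * pd i f x"
 using pd_linear[OF bounded_linear_mult_right assms] .

lemma pd_uminus:
 assumes "f differentiable (at x)"
 shows "pd i (\<lambda>y. - f y) x = - pd i f x"
 using pd_linear[OF bounded_linear_minus[OF bounded_linear_ident] assms] .

lemma pd_nth:
 fixes f :: "real^3 \<Rightarrow> real^'n"
 assumes "f differentiable (at x)"
 shows "pd i (\<lambda>y. f y $ j) x = pd i f x $ j"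
 using pd_linear[OF bounded_linear_vec_nth assms] .

lemma pd_sum:
 assumes "!!j. j \<in> J ==> f j differentiable (at x)"
 shows "pd i (\<lambda>y. \<Sum>j\<in>J. f j y) x = (\<Sum>j\<in>J. pd i (f j) x)"
 using assms
proof (induction J rule: infinite_finite_induct)
 case (insert a F)
 then show ?case by (simp add: pd_add differentiable_sum)
qed simp_all

lemma pd_compose:
 fixes h :: "real \<Rightarrow> real"
 assumes "(h has_real_derivative h') (at (f x))" "f differentiable (at x)"
 shows "pd i (\<lambda>y. h (f y)) x = h' * pd i f x"
  and "(\<lambda>y. h (f y)) differentiable (at x)"
proof -
 have D: "((\<lambda>y. h (f y)) has_derivative (\<lambda>v. h' * (\<Sum>i\<in>UNIV. (v $ i) *\<^sub>R pd i f x))) (at x)"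
  using has_derivative_compose[OF has_derivative_pd[OF assms(2)], of h "(*) h'"] assms(1)
  by (simp add: has_field_derivative_def)
 show "(\<lambda>y. h (f y)) differentiable (at x)" using D differentiableI by blast
 show "pd i (\<lambda>y. h (f y)) x = h' * pd i f x"
  using pd_eqI[OF D, of i] by (simp add: axis_def if_distrib[of "\<lambda>c. c * _"] cong: if_cong)
qed

lemma pd_coord: "pd i (\<lambda>y. y $ j) x = (if i = j then 1 else 0)"
proof -
 have "((\<lambda>y::real^3. y $ j) has_derivative (\<lambda>h. h $ j)) (at x)"
  by (simp add: bounded_linear_imp_has_derivative bounded_linear_vec_nth)
 from pd_eqI[OF this, of i] show ?thesis by (auto simp: axis_def)
qed

lemma has_vector_derivative_along_line:
 fixes f :: "real^3 \<Rightarrow> 'b::real_normed_vector"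
 assumes "f differentiable (at (x + s *\<^sub>R v))"
 shows "((\<lambda>s. f (x + s *\<^sub>R v)) has_vector_derivative (\<Sum>i\<in>UNIV. (v $ i) *\<^sub>R pd i f (x + s *\<^sub>R v))) (at s)"
proof -
 have L: "((\<lambda>s. x + s *\<^sub>R v) has_derivative (\<lambda>r. r *\<^sub>R v)) (at s)"
  by (auto intro!: derivative_eq_intros)
 have "((\<lambda>s. f (x + s *\<^sub>R v)) has_derivative (\<lambda>r. \<Sum>i\<in>UNIV. ((r *\<^sub>R v) $ i) *\<^sub>R pd i f (x + s *\<^sub>R v))) (at s)"
  using has_derivative_compose[OF L has_derivative_pd[OF assms]] .
 then show ?thesis
  by (simp add: has_vector_derivative_def scaleR_sum_right)
qed

lemma has_vector_derivative_axis:
 fixes f :: "real^3 \<Rightarrow> 'b::real_normed_vector"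
 assumes "f differentiable (at (x + s *\<^sub>R axis i 1))"
 shows "((\<lambda>s. f (x + s *\<^sub>R axis i 1)) has_vector_derivative pd i f (x + s *\<^sub>R axis i 1)) (at s)"
proof -
 have "(\<Sum>k\<in>UNIV. (axis i (1::real) $ k) *\<^sub>R pd k f (x + s *\<^sub>R axis i 1)) = pd i f (x + s *\<^sub>R axis i 1)"
  by (subst axis_def) (simp add: if_distrib[of "\<lambda>c. c *\<^sub>R _"] cong: if_cong)
 then show ?thesis using has_vector_derivative_along_line[OF assms] by simp
qed

section \<open>Functions of class \<open>C\<^sup>k\<close>\<close>

lemma Ck_on_SucI:
 assumes "!!x. x \<in> S ==> f differentiable (at x)" "!!i. Ck_on k S (pd i f)"
 shows "Ck_on (Suc k) S f"
 using assms by simp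

lemma Ck_on_differentiable: "Ck_on (Suc k) S f ==> x \<in> S ==> f differentiable (at x)"
 by simp

lemma Ck_on_pd: "Ck_on (Suc k) S f ==> Ck_on k S (pd i f)"
 by simp

declare Ck_on.simps(2) [simp del]

lemma Ck_on_cong:
 assumes "open S" "!!x. x \<in> S ==> f x = g x" "Ck_on k S f"
 shows "Ck_on k S g"
 using assms(2,3)
proof (induction k arbitrary: f g)
 case 0 then show ?case using continuous_on_cong[of S S f g] by simp
next
 case (Suc k)
 show ?case
 proof (rule Ck_on_SucI)
  show "g differentiable (at x)" if "x \<in> S" for x
   using differentiable_cong_open[OF assms(1) that Suc.prems(1)] Ck_on_differentiable[OF Suc.prems(2) that]
   by simp
  show "Ck_on k S (pd i g)" for i
   by (rule Suc.IH[OF _ Ck_on_pd[OF Suc.prems(2)]]) (rule pd_cong[OF assms(1) _ Suc.prems(1)])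
 qed
qed

lemma Ck_on_continuous: "Ck_on k S f ==> continuous_on S f"
proof (cases k)
 case (Suc m)
 assume f: "Ck_on k S f"
 have "isCont f x" if "x \<in> S" for x
  by (rule differentiable_imp_continuous_within[OF Ck_on_differentiable[OF f[unfolded Suc] that]])
 then show ?thesis by (simp add: continuous_at_imp_continuous_on)
qed simp

lemma Ck_on_Suc_D: "Ck_on (Suc k) S f ==> Ck_on k S f"
proof (induction k arbitrary: f)
 case 0 then show ?case using Ck_on_continuous[OF 0] by simp
next
 case (Suc k)
 show ?case
  by (rule Ck_on_SucI) (rule Ck_on_differentiable[OF Suc.prems], assumption, rule Suc.IH[OF Ck_on_pd[OF Suc.prems]])
qed

lemma Ck_on_le: "Ck_on k S f ==> m \<le> k ==> Ck_on m S f"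
proof (induction k)
 case (Suc k)
 then show ?case using Ck_on_Suc_D[of k S f] by (cases "m = Suc k") auto
qed simp

lemma Ck_on_subset:
 assumes "T \<subseteq> S" shows "Ck_on k S f ==> Ck_on k T f"
proof (induction k arbitrary: f)
 case 0 then show ?case using assms continuous_on_subset by auto
next
 case (Suc k)
 show ?case
  by (rule Ck_on_SucI) (use Ck_on_differentiable[OF Suc.prems] assms in blast, rule Suc.IH[OF Ck_on_pd[OF Suc.prems]])
qed

lemma Ck_on_const [simp]: "Ck_on k S (\<lambda>x. c)"
proof (induction k arbitrary: c)
 case (Suc k)
 have "pd i (\<lambda>x. c) = (\<lambda>x. 0)" for i by (rule ext) simp
 then show ?case using Suc.IH[of 0] by (intro Ck_on_SucI) simp_all
qed simp

lemma Ck_on_linear: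
 assumes "bounded_linear L" "open S" "Ck_on k S f"
 shows "Ck_on k S (\<lambda>x. L (f x))"
 using assms(3)
proof (induction k arbitrary: f)
 case 0 then show ?case using assms(1) by (simp add: bounded_linear.continuous_on)
next
 case (Suc k)
 note d = Ck_on_differentiable[OF Suc.prems]
 show ?case
 proof (rule Ck_on_SucI)
  show "(\<lambda>x. L (f x)) differentiable (at x)" if "x \<in> S" for x
   using bounded_linear.has_derivative[OF assms(1) has_derivative_pd[OF d[OF that]]]
   by (rule differentiableI)
  show "Ck_on k S (pd i (\<lambda>x. L (f x)))" for i
   by (rule Ck_on_cong[OF assms(2) _ Suc.IH[OF Ck_on_pd[OF Suc.prems, of i]]])
    (simp add: pd_linear[OF assms(1)] d)
 qed
qed

lemma Ck_on_add:
 assumes "open S" "Ck_on k S f" "Ck_on k S g"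
 shows "Ck_on k S (\<lambda>x. f x + g x)"
 using assms(2,3)
proof (induction k arbitrary: f g)
 case 0 then show ?case by (simp add: continuous_on_add)
next
 case (Suc k)
 note d = Ck_on_differentiable[OF Suc.prems(1)] Ck_on_differentiable[OF Suc.prems(2)]
 show ?case
 proof (rule Ck_on_SucI)
  show "Ck_on k S (pd i (\<lambda>x. f x + g x))" for i
   by (rule Ck_on_cong[OF assms(1) _ Suc.IH[OF Suc.prems[THEN Ck_on_pd], of i i]]) (simp add: pd_add d)
 qed (simp add: d)
qed

lemma Ck_on_uminus: "open S ==> Ck_on k S f ==> Ck_on k S (\<lambda>x. - f x)"
 by (rule Ck_on_linear[OF bounded_linear_minus[OF bounded_linear_ident]])

lemma Ck_on_diff: "open S ==> Ck_on k S f ==> Ck_on k S g ==> Ck_on k S (\<lambda>x. f x - g x)"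
 using Ck_on_add[of S k f "\<lambda>x. - g x"] Ck_on_uminus[of S k g] by simp

lemma Ck_on_nth: "open S ==> Ck_on k S f ==> Ck_on k S (\<lambda>x. f x $ j)"
 by (rule Ck_on_linear[OF bounded_linear_vec_nth])

lemma Ck_on_sum:
 assumes "open S" "!!j. j \<in> J ==> Ck_on k S (f j)"
 shows "Ck_on k S (\<lambda>x. \<Sum>j\<in>J. f j x)"
 using assms(2)
proof (induction J rule: infinite_finite_induct)
 case (insert a F)
 then show ?case using Ck_on_add[OF assms(1), of k "f a" "\<lambda>x. \<Sum>j\<in>F. f j x"] by simp
qed simp_all

lemma Ck_on_scaleR:
 fixes f :: "real^3 \<Rightarrow> real"
 assumes "open S" "Ck_on k S f" "Ck_on k S g"
 shows "Ck_on k S (\<lambda>x. f x *\<^sub>R g x)"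
 using assms(2,3)
proof (induction k arbitrary: f g)
 case 0 then show ?case by (simp add: continuous_on_scaleR)
next
 case (Suc k)
 note d = Ck_on_differentiable[OF Suc.prems(1)] Ck_on_differentiable[OF Suc.prems(2)]
 show ?case
 proof (rule Ck_on_SucI)
  have p: "Ck_on k S (\<lambda>x. pd i f x *\<^sub>R g x + f x *\<^sub>R pd i g x)" for i
   by (intro Ck_on_add assms(1) Suc.IH Ck_on_pd Suc.prems Suc.prems[THEN Ck_on_Suc_D])
  show "Ck_on k S (pd i (\<lambda>x. f x *\<^sub>R g x))" for i
   by (rule Ck_on_cong[OF assms(1) _ p[of i]]) (simp add: pd_scaleR d)
 qed (simp add: d)
qed

lemma Ck_on_mult:
 fixes f g :: "real^3 \<Rightarrow> real"
 shows "open S ==> Ck_on k S f ==> Ck_on k S g ==> Ck_on k S (\<lambda>x. f x * g x)"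
 using Ck_on_scaleR[of S k f g] by simp

lemma Ck_on_prod:
 fixes f :: "'j \<Rightarrow> real^3 \<Rightarrow> real"
 assumes "open S" "!!j. j \<in> J ==> Ck_on k S (f j)"
 shows "Ck_on k S (\<lambda>x. \<Prod>j\<in>J. f j x)"
 using assms(2)
proof (induction J rule: infinite_finite_induct)
 case (insert a F)
 then show ?case using Ck_on_mult[OF assms(1), of k "f a" "\<lambda>x. \<Prod>j\<in>F. f j x"] by simp
qed simp_all

lemma Ck_on_coord: "Ck_on k S (\<lambda>x. x $ j)"
proof (cases k)
 case 0 then show ?thesis by (simp add: continuous_on_component)
next
 case (Suc m)
 have "pd i (\<lambda>x. x $ j) = (\<lambda>x. if i = j then 1 else 0)" for i by (rule ext) (rule pd_coord)
 moreover have "(\<lambda>y::real^3. y $ j) differentiable (at x)" for x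
  by (rule differentiableI[OF bounded_linear_imp_has_derivative[OF bounded_linear_vec_nth]])
 ultimately show ?thesis using Suc by (auto intro: Ck_on_SucI)
qed

lemma Ck_on_compose_chain:
 fixes d :: "nat \<Rightarrow> real \<Rightarrow> real"
 assumes "open S" "!!n s. s \<in> T ==> (d n has_real_derivative d (Suc n) s) (at s)"
  and "Ck_on k S f" "f ` S \<subseteq> T"
 shows "Ck_on k S (\<lambda>x. d n (f x))"
 using assms(3)
proof (induction k arbitrary: n)
 case 0
 have "continuous_on T (d n)"
  using assms(2) by (meson DERIV_continuous_on has_field_derivative_at_within)
 then show ?case using 0 assms(4) by (auto intro: continuous_on_compose2)
next
 case (Suc k)
 have *: "f differentiable (at x)" "(d n has_real_derivative d (Suc n) (f x)) (at (f x))" if "x \<in> S" for x n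
  using Ck_on_differentiable[OF Suc.prems] that assms(2,4) by auto
 show ?case
 proof (rule Ck_on_SucI)
  have p: "Ck_on k S (\<lambda>x. d (Suc n) (f x) * pd i f x)" for i
   by (rule Ck_on_mult[OF assms(1) Suc.IH[OF Ck_on_Suc_D[OF Suc.prems]] Ck_on_pd[OF Suc.prems]])
  show "Ck_on k S (pd i (\<lambda>x. d n (f x)))" for i
   by (rule Ck_on_cong[OF assms(1) _ p[of i]]) (simp add: pd_compose(1)[OF *(2) *(1)])
  show "(\<lambda>x. d n (f x)) differentiable (at x)" if "x \<in> S" for x
   by (rule pd_compose(2)[OF *(2)[OF that] *(1)[OF that]])
 qed
qed

lemma Ck_on_local:
 assumes "!!x. x \<in> S ==> \<exists>U. open U \<and> x \<in> U \<and> Ck_on k U f"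
 shows "Ck_on k S f"
 using assms
proof (induction k arbitrary: f)
 case 0
 then have "isCont f x" if "x \<in> S" for x
  using that by (metis Ck_on.simps(1) continuous_on_eq_continuous_at)
 then show ?case by (simp add: continuous_at_imp_continuous_on)
next
 case (Suc k)
 show ?case
 proof (rule Ck_on_SucI)
  show "f differentiable (at x)" if "x \<in> S" for x
   using Suc.prems[OF that] Ck_on_differentiable by blast
  show "Ck_on k S (pd i f)" for i
  proof (rule Suc.IH)
   fix x assume "x \<in> S"
   then obtain U where "open U" "x \<in> U" "Ck_on (Suc k) U f" using Suc.prems by blast
   then show "\<exists>U. open U \<and> x \<in> U \<and> Ck_on k U (pd i f)" using Ck_on_pd by blast
  qed
 qed
qed

lemma Ck_on_zero_extend:
 assumes "open S" "closed K" "K \<subseteq> S" "Ck_on k S f" "!!x. x \<in> S - K ==> f x = 0"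
 shows "Ck_on k UNIV (\<lambda>x. if x \<in> S then f x else 0)"
proof (rule Ck_on_local)
 fix x
 show "\<exists>U. open U \<and> x \<in> U \<and> Ck_on k U (\<lambda>x. if x \<in> S then f x else 0)"
 proof (cases "x \<in> S")
  case True
  have "Ck_on k S (\<lambda>x. if x \<in> S then f x else 0)"
   by (rule Ck_on_cong[OF assms(1) _ assms(4)]) simp
  then show ?thesis using True assms(1) by blast
 next
  case False
  have "Ck_on k (- K) (\<lambda>x. if x \<in> S then f x else 0)"
   by (rule Ck_on_cong[of _ "\<lambda>x. 0"]) (use assms in \<open>auto simp: open_Compl\<close>)
  then show ?thesis using False assms(2,3) by (meson ComplI open_Compl subsetD)
 qed
qed

text \<open>Schwarz's theorem: write the increment of \<open>f\<close> along one axis as an integral of its derivative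
  and differentiate under the integral sign along the other axis.\<close>

lemma pd_commute:
 fixes f :: "real^3 \<Rightarrow> 'b::banach"
 assumes "open S" "x \<in> S" "Ck_on 2 S f"
 shows "pd i (pd j f) x = pd j (pd i f) x"
proof -
 let ?p = "\<lambda>s t. x + s *\<^sub>R axis i 1 + t *\<^sub>R axis j (1::real)"
 have C: "!!x. x \<in> S ==> f differentiable (at x)" "!!x i. x \<in> S ==> pd i f differentiable (at x)"
  "!!i. continuous_on S (pd i f)" "!!i j. continuous_on S (pd i (pd j f))"
 proof -
  have 2: "Ck_on (Suc (Suc 0)) S f" using assms(3) by (simp add: numeral_2_eq_2)
  show "f differentiable (at x)" if "x \<in> S" for x by (rule Ck_on_differentiable[OF 2 that])
  show "pd i f differentiable (at x)" if "x \<in> S" for x i by (rule Ck_on_differentiable[OF Ck_on_pd[OF 2] that])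
  show "continuous_on S (pd i f)" for i by (rule Ck_on_continuous[OF Ck_on_pd[OF 2]])
  show "continuous_on S (pd i (pd j f))" for i j by (rule Ck_on_continuous[OF Ck_on_pd[OF Ck_on_pd[OF 2]]])
 qed
 obtain e where e: "e > 0" "ball x e \<subseteq> S" using assms openE by blast
 define r where "r = e / 3"
 have r: "r > 0" using e by (simp add: r_def)
 have pS: "?p s t \<in> S" if "s \<in> {-r..r}" "t \<in> {-r..r}" for s t
 proof -
  have "dist x (?p s t) \<le> \<bar>s\<bar> + \<bar>t\<bar>"
   using norm_triangle_ineq[of "s *\<^sub>R axis i 1" "t *\<^sub>R axis j (1::real)"]
   by (simp add: dist_norm norm_minus_commute algebra_simps)
  also have "\<dots> < e" using that r by (auto simp: r_def)
  finally show ?thesis using e by auto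
 qed
 have eq1: "f (?p s t) = f (?p 0 t) + integral {0..s} (\<lambda>a. pd i f (?p a t))"
  if "s \<in> {0..r}" "t \<in> {-r..r}" for s t
 proof -
  have "((\<lambda>a. pd i f (?p a t)) has_integral f (?p s t) - f (?p 0 t)) {0..s}"
  proof (rule fundamental_theorem_of_calculus)
   fix a assume "a \<in> {0..s}"
   then have "?p a t \<in> S" using pS that r by auto
   then have "f differentiable (at (x + t *\<^sub>R axis j 1 + a *\<^sub>R axis i 1))"
    using C by (auto simp: algebra_simps)
   from has_vector_derivative_axis[OF this]
   show "((\<lambda>a. f (?p a t)) has_vector_derivative pd i f (?p a t)) (at a within {0..s})"
    by (auto simp: algebra_simps intro: has_vector_derivative_at_within)
  qed (use that in auto)
  then show ?thesis by (simp add: integral_unique)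
 qed
 have eq2: "pd j f (?p s 0) = pd j f x + integral {0..s} (\<lambda>a. pd j (pd i f) (?p a 0))"
  if s: "s \<in> {0..r}" for s
 proof -
  have U: "convex {-r..r}" "0 \<in> {-r..r}" using r by auto
  have L: "((\<lambda>t. integral (cbox 0 s) (\<lambda>a. pd i f (?p a t))) has_vector_derivative
    integral (cbox 0 s) (\<lambda>a. pd j (pd i f) (?p a 0))) (at 0 within {-r..r})"
  proof (rule leibniz_rule_vector_derivative[where U = "{-r..r}" and fx = "\<lambda>t a. pd j (pd i f) (?p a t)"])
   fix t a assume ta: "t \<in> {-r..r}" "a \<in> cbox 0 s"
   then have "?p a t \<in> S" using pS s by auto
   from has_vector_derivative_at_within[OF has_vector_derivative_axis[OF C(2)[OF this]]]
   show "((\<lambda>t. pd i f (?p a t)) has_vector_derivative pd j (pd i f) (?p a t)) (at t within {-r..r})" .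
  next
   fix t assume "t \<in> {-r..r}"
   then show "(\<lambda>a. pd i f (?p a t)) integrable_on cbox 0 s"
    using pS s by (intro integrable_continuous continuous_on_compose2[OF C(3)])
     (auto intro!: continuous_intros)
  next
   show "continuous_on ({-r..r} \<times> cbox 0 s) (\<lambda>(t, a). pd j (pd i f) (?p a t))"
    using pS s by (auto simp: split_beta intro!: continuous_on_compose2[OF C(4)] continuous_intros)
  qed (use U in auto)
  have "((\<lambda>t. f (?p 0 t)) has_vector_derivative pd j f (?p 0 0)) (at 0 within {-r..r})"
   using C(1) assms(2) has_vector_derivative_axis[of f "x" 0 j]
   by (auto intro: has_vector_derivative_at_within)
  from has_vector_derivative_add[OF this L]
  have A: "((\<lambda>t. f (?p s t)) has_vector_derivative
    pd j f (?p 0 0) + integral (cbox 0 s) (\<lambda>a. pd j (pd i f) (?p a 0))) (at 0 within {-r..r})"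
   by (rule has_vector_derivative_transform[rotated 2]) (use eq1 s U in auto)
  have B: "((\<lambda>t. f (?p s t)) has_vector_derivative pd j f (?p s 0)) (at 0 within {-r..r})"
   using C(1) pS[of s 0] s r has_vector_derivative_axis[of f "x + s *\<^sub>R axis i 1" 0 j]
   by (auto intro: has_vector_derivative_at_within)
  have nt: "at 0 within {-r..r} \<noteq> bot"
   using r by (simp add: trivial_limit_within islimpt_Icc)
  show ?thesis using vector_derivative_unique_within[OF nt B A] by simp
 qed
 have D1: "((\<lambda>s. integral {0..s} (\<lambda>a. pd j (pd i f) (?p a 0))) has_vector_derivative pd j (pd i f) (?p 0 0)) (at 0 within {0..r})"
 proof (rule integral_has_vector_derivative)
  have "(\<lambda>a. ?p a 0) ` {0..r} \<subseteq> S" using pS[of _ 0] r by auto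
  then show "continuous_on {0..r} (\<lambda>a. pd j (pd i f) (?p a 0))"
   by (intro continuous_on_compose2[OF C(4)[of j i], of "{0..r}" "\<lambda>a. ?p a 0"])
    (auto intro!: continuous_intros)
 qed (use r in auto)
 have "((\<lambda>s. pd j f (?p s 0)) has_vector_derivative pd j (pd i f) x) (at 0 within {0..r})"
  by (rule has_vector_derivative_transform[OF _ eq2]) (use D1 r in \<open>auto intro!: derivative_eq_intros\<close>)
 moreover have "((\<lambda>s. pd j f (?p s 0)) has_vector_derivative pd i (pd j f) x) (at 0 within {0..r})"
  using C(2) assms(2) has_vector_derivative_axis[of "pd j f" "x" 0 i]
  by (auto intro: has_vector_derivative_at_within)
 moreover have "at 0 within {0..r} \<noteq> bot"
  using r by (simp add: trivial_limit_within islimpt_Icc)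
 ultimately show ?thesis using vector_derivative_unique_within by metis
qed

section \<open>Smooth cut-off functions\<close>

lemma poly_mult_exp_tendsto_0: "((\<lambda>x::real. x ^ m * poly p x * exp (- x)) \<longlongrightarrow> 0) at_top"
proof (induction p arbitrary: m)
 case (pCons a p)
 have "((\<lambda>x::real. a * (x ^ m / exp x) + x ^ Suc m * poly p x * exp (- x)) \<longlongrightarrow> a * 0 + 0) at_top"
  by (intro tendsto_add tendsto_mult tendsto_const tendsto_power_div_exp_0 pCons.IH)
 then show ?case by (simp add: algebra_simps exp_minus divide_inverse)
qed simp

primrec flat_poly :: "nat \<Rightarrow> real poly" where
 "flat_poly 0 = 1"
| "flat_poly (Suc n) = [:0, 0, 1:] * (flat_poly n - pderiv (flat_poly n))"

text \<open>The \<open>n\<close>-th derivative of the function that is \<open>exp (- 1 / s)\<close> for positive \<open>s\<close> and zero elsewhere.\<close>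

definition flat :: "nat \<Rightarrow> real \<Rightarrow> real" where
 "flat n s = (if s > 0 then poly (flat_poly n) (1 / s) * exp (- (1 / s)) else 0)"

lemma flat_deriv: "(flat n has_real_derivative flat (Suc n) s) (at s)"
proof (cases s "0::real" rule: linorder_cases)
 case less
 have "((\<lambda>s. 0) has_real_derivative 0) (at s)" by simp
 then have "(flat n has_real_derivative 0) (at s)"
  by (rule has_field_derivative_transform_within_open[where S = "{..<0}"]) (use less in \<open>auto simp: flat_def\<close>)
 then show ?thesis using less by (simp add: flat_def)
next
 case greater
 have "((\<lambda>s. poly (flat_poly n) (1 / s) * exp (- (1 / s))) has_real_derivative
   poly (pderiv (flat_poly n)) (1 / s) * (- 1 / s\<^sup>2) * exp (- (1 / s))
   + exp (- (1 / s)) * (1 / s\<^sup>2) * poly (flat_poly n) (1 / s)) (at s)"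
  using greater by (auto intro!: derivative_eq_intros DERIV_chain'[OF _ poly_DERIV] simp: power2_eq_square divide_simps)
 then have "((\<lambda>s. poly (flat_poly n) (1 / s) * exp (- (1 / s))) has_real_derivative flat (Suc n) s) (at s)"
  by (rule has_field_derivative_cong_eventually[THEN iffD1, rotated 2, OF DERIV_cong])
   (use greater in \<open>auto simp: flat_def algebra_simps power2_eq_square divide_simps\<close>)
 then show ?thesis
  by (rule has_field_derivative_transform_within_open[where S = "{0<..}"]) (use greater in \<open>auto simp: flat_def\<close>)
next
 case equal
 have "((\<lambda>x::real. x ^ 1 * poly (flat_poly n) x * exp (- x)) \<longlongrightarrow> 0) at_top"
  by (rule poly_mult_exp_tendsto_0)
 then have "((\<lambda>h. inverse h ^ 1 * poly (flat_poly n) (inverse h) * exp (- inverse h)) \<longlongrightarrow> 0) (at_right 0)"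
  by (rule filterlim_compose) (rule filterlim_inverse_at_top_right)
 then have R: "((\<lambda>h. (flat n h - flat n 0) / (h - 0)) \<longlongrightarrow> 0) (at_right 0)"
  by (rule tendsto_cong[THEN iffD1, rotated])
   (auto simp: flat_def eventually_at_filter divide_simps inverse_eq_divide)
 have L: "((\<lambda>h. (flat n h - flat n 0) / (h - 0)) \<longlongrightarrow> 0) (at_left 0)"
  by (rule tendsto_cong[THEN iffD1, rotated, OF tendsto_const]) (auto simp: flat_def eventually_at_filter)
 have "((\<lambda>h. (flat n h - flat n 0) / (h - 0)) \<longlongrightarrow> 0) (at 0)"
  using L R by (rule filterlim_split_at)
 then show ?thesis using equal by (simp add: has_field_derivative_iff flat_def)
qed

lemma flat_0: "flat 0 s = (if s > 0 then exp (- (1 / s)) else 0)"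
 by (simp add: flat_def)

lemma flat_1: "flat (Suc 0) s = (if s > 0 then exp (- (1 / s)) / s\<^sup>2 else 0)"
 by (simp add: flat_def pderiv_1 power2_eq_square)

lemma flat_0_bounds: "0 \<le> flat 0 s" "flat 0 s \<le> 1" "flat 0 s = 0 \<longleftrightarrow> s \<le> 0" "0 < flat 0 s \<longleftrightarrow> 0 < s"
 by (auto simp: flat_0)

lemma Ck_on_flat: "open S ==> Ck_on k S f ==> Ck_on k S (\<lambda>x. flat n (f x))"
 by (rule Ck_on_compose_chain[where T = UNIV]) (auto intro: flat_deriv)

lemma Ck_on_inverse:
 assumes "open S" "Ck_on k S f" "!!x. x \<in> S ==> f x \<noteq> 0"
 shows "Ck_on k S (\<lambda>x. inverse (f x) :: real)"
proof -
 let ?d = "\<lambda>n s::real. (-1) ^ n * fact n * inverse s ^ Suc n"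
 have "(?d n has_real_derivative ?d (Suc n) s) (at s)" if "s \<in> {s. s \<noteq> 0}" for n s
 proof -
  have "(?d n has_real_derivative (-1) ^ n * fact n * ((1 + real n) * (- (inverse s ^ Suc (Suc 0)) * inverse s ^ n))) (at s)"
   by (rule DERIV_cmult[OF DERIV_power_Suc[OF DERIV_inverse]]) (use that in auto)
  then show ?thesis by (rule DERIV_cong) (simp add: algebra_simps)
 qed
 from Ck_on_compose_chain[of S "{s. s \<noteq> 0}" ?d k f 0, OF assms(1) this assms(2)] assms(3)
 show ?thesis by (auto simp: image_subset_iff)
qed

definition step :: "real \<Rightarrow> real" where
 "step s = flat 0 s / (flat 0 s + flat 0 (1 - s))"

lemma step_denominator: "flat 0 s + flat 0 (1 - s) > 0"
proof (cases "s > 0")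
 case True then show ?thesis using flat_0_bounds(1)[of "1 - s"] flat_0_bounds(4)[of s] by linarith
next
 case False then show ?thesis using flat_0_bounds(1)[of s] flat_0_bounds(4)[of "1 - s"] by linarith
qed

lemma step_eq: "s \<le> 0 ==> step s = 0" "s \<ge> 1 ==> step s = 1"
 by (auto simp: step_def flat_0)

lemma step_bounds: "0 \<le> step s" "step s \<le> 1"
 using step_denominator[of s] flat_0_bounds(1)[of s] flat_0_bounds(1)[of "1 - s"]
 by (auto simp: step_def divide_simps)

lemma Ck_on_step:
 assumes "open S" "Ck_on k S f" shows "Ck_on k S (\<lambda>x. step (f x))"
 unfolding step_def divide_inverse using step_denominator
 by (intro Ck_on_mult Ck_on_inverse Ck_on_add Ck_on_flat Ck_on_diff assms Ck_on_const) (metis less_irrefl)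

text \<open>A smooth function equal to one on the cube of radius \<open>r\<close> around \<open>x0\<close> and vanishing outside the
  cube of radius \<open>2 * r\<close>.\<close>

definition plateau :: "real^3 \<Rightarrow> real \<Rightarrow> real^3 \<Rightarrow> real" where
 "plateau x0 r x = (\<Prod>i\<in>UNIV. step (2 - (x $ i - x0 $ i) / r) * step (2 + (x $ i - x0 $ i) / r))"

lemma Ck_on_plateau: "Ck_on k UNIV (plateau x0 r)"
 unfolding plateau_def [abs_def] divide_inverse
 by (intro Ck_on_prod Ck_on_mult Ck_on_step Ck_on_diff Ck_on_add Ck_on_const Ck_on_coord) auto

lemma plateau_bounds: "0 \<le> plateau x0 r x" "plateau x0 r x \<le> 1"
 unfolding plateau_def by (auto intro!: prod_nonneg prod_le_1 mult_le_one simp: step_bounds)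

lemma plateau_eq_1:
 assumes "r > 0" "x \<in> cbox (x0 - vec r) (x0 + vec r)" shows "plateau x0 r x = 1"
proof -
 have "step (2 - (x $ i - x0 $ i) / r) = 1 \<and> step (2 + (x $ i - x0 $ i) / r) = 1" for i
  using assms by (auto simp: mem_box_cart divide_simps intro!: step_eq dest!: spec[of _ i])
 then show ?thesis by (simp add: plateau_def)
qed

lemma plateau_eq_0:
 assumes "r > 0" "x \<notin> cbox (x0 - vec (2 * r)) (x0 + vec (2 * r))" shows "plateau x0 r x = 0"
proof -
 obtain i where "x $ i < x0 $ i - 2 * r \<or> x0 $ i + 2 * r < x $ i"
  using assms(2) by (auto simp: mem_box_cart not_le)
 then have "step (2 - (x $ i - x0 $ i) / r) = 0 \<or> step (2 + (x $ i - x0 $ i) / r) = 0"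
  using assms(1) by (auto simp: divide_simps intro!: step_eq)
 then show ?thesis unfolding plateau_def by (subst prod_zero_iff) auto
qed

section \<open>Integration by parts\<close>

lemma integrable_cpt_support:
 fixes f :: "real^3 \<Rightarrow> 'b::euclidean_space"
 assumes "continuous_on K f" "compact K" "K \<subseteq> S" "!!x. x \<in> S - K ==> f x = 0"
 shows "f absolutely_integrable_on S" "f integrable_on S"
proof -
 have "integrable lborel (\<lambda>x. indicator K x *\<^sub>R f x)" by (rule borel_integrable_compact[OF assms(2,1)])
 then have "set_integrable lborel K f" by (simp add: set_integrable_def)
 then have "f absolutely_integrable_on K"
  using absolutely_integrable_on_def set_borel_integral_eq_integral(1)
  by (metis (no_types, lifting) integrable_completion set_integrable_def borel_measurable_integrable measurable_lborel1)
 then have "(\<lambda>x. if x \<in> K then f x else 0) absolutely_integrable_on UNIV"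
  using absolutely_integrable_restrict_UNIV by blast
 moreover have "(\<lambda>x. if x \<in> K then f x else 0) = (\<lambda>x. if x \<in> S then f x else 0)"
  using assms(3,4) by (intro ext) auto
 ultimately show "f absolutely_integrable_on S"
  using absolutely_integrable_restrict_UNIV[of S f] by simp
 then show "f integrable_on S" using absolutely_integrable_on_def by blast
qed

lemma integral_cpt_support:
 fixes f :: "real^3 \<Rightarrow> 'b::banach"
 assumes "K \<subseteq> S" "K \<subseteq> T" "!!x. x \<in> S \<union> T ==> x \<notin> K ==> f x = 0"
 shows "integral S f = integral T f"
proof -
 have "(\<lambda>x. if x \<in> S then f x else 0) = (\<lambda>x. if x \<in> T then f x else 0)"
  using assms by (intro ext) auto
 then show ?thesis
  using Henstock_Kurzweil_Integration.integral_restrict_UNIV[of S f]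
   Henstock_Kurzweil_Integration.integral_restrict_UNIV[of T f] by simp
qed

text \<open>The integral of a compactly supported function does not change under translation; differentiate
  this in the direction of an axis.\<close>

lemma integral_pd_UNIV:
 fixes f :: "real^3 \<Rightarrow> real"
 assumes C: "Ck_on 1 UNIV f" and z: "!!x. x \<notin> cbox a b ==> f x = 0"
 shows "integral UNIV (pd i f) = 0"
proof -
 have C': "Ck_on (Suc 0) UNIV f" using C by simp
 have cf: "continuous_on UNIV f" by (rule Ck_on_continuous[OF C])
 have cp: "continuous_on UNIV (pd i f)" by (rule Ck_on_continuous[OF Ck_on_pd[OF C']])
 define A B where "A = a - vec 1" and "B = b + vec 1"
 have out: "f (y + s *\<^sub>R axis i 1) = 0" if "y \<notin> cbox A B" "s \<in> {-1..1}" for y s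
 proof (rule z)
  have "\<not> (\<forall>j. A $ j \<le> y $ j \<and> y $ j \<le> B $ j)" using that(1) by (simp add: mem_box_cart)
  then obtain j where "y $ j < a $ j - 1 \<or> b $ j + 1 < y $ j"
   by (auto simp: A_def B_def not_le)
  then show "y + s *\<^sub>R axis i 1 \<notin> cbox a b"
   using that(2) by (auto simp: mem_box_cart axis_def not_le intro!: exI[of _ j])
 qed
 have const: "integral (cbox A B) (\<lambda>y. f (y + s *\<^sub>R axis i 1)) = integral (cbox a b) f" if s: "s \<in> {-1..1}" for s
 proof -
  have I: "(f has_integral integral (cbox a b) f) (cbox a b)"
   using integrable_continuous[OF continuous_on_subset[OF cf]] by (simp add: has_integral_integral)
  define c where "c = s *\<^sub>R axis i (1::real)"
  have "((f \<circ> (+) c) has_integral integral (cbox a b) f) (cbox (a - c) (b - c))"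
   using I by (subst has_integral_shift_cbox_iff) simp
  then have "((\<lambda>y. f (y + c)) has_integral integral (cbox a b) f) (cbox (a - c) (b - c))"
   by (simp add: o_def add.commute)
  then have "((\<lambda>y. f (y + c)) has_integral integral (cbox a b) f) (cbox A B)"
  proof (rule has_integral_on_superset)
   fix y assume y: "y \<notin> cbox (a - c) (b - c)"
   have "y + c \<notin> cbox a b" using y by (auto simp: mem_box_cart algebra_simps)
   then show "f (y + c) = 0" by (rule z)
  next
   have ca: "\<bar>c $ j\<bar> \<le> 1" for j using s by (auto simp: c_def axis_def)
   have "y \<in> cbox A B" if "y \<in> cbox (a - c) (b - c)" for y
   proof -
    have "A $ j \<le> y $ j \<and> y $ j \<le> B $ j" for j
     using that ca[of j] by (auto simp: mem_box_cart A_def B_def dest!: spec[of _ j])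
    then show ?thesis by (simp add: mem_box_cart)
   qed
   then show "cbox (a - c) (b - c) \<subseteq> cbox A B" by blast
  qed
  then show ?thesis by (simp add: c_def integral_unique)
 qed
 have "((\<lambda>s. integral (cbox A B) (\<lambda>y. f (y + s *\<^sub>R axis i 1))) has_vector_derivative
   integral (cbox A B) (\<lambda>y. pd i f (y + 0 *\<^sub>R axis i 1))) (at 0 within {-1..1})"
 proof (rule leibniz_rule_vector_derivative[where fx = "\<lambda>s y. pd i f (y + s *\<^sub>R axis i 1)"])
  show "((\<lambda>s. f (y + s *\<^sub>R axis i 1)) has_vector_derivative pd i f (y + s *\<^sub>R axis i 1)) (at s within {-1..1})" for s y
   by (rule has_vector_derivative_at_within[OF has_vector_derivative_axis[OF Ck_on_differentiable[OF C' UNIV_I]]])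
  show "(\<lambda>y. f (y + s *\<^sub>R axis i 1)) integrable_on cbox A B" for s
   by (intro integrable_continuous continuous_on_compose2[OF cf] continuous_intros) auto
  show "continuous_on ({- 1..1} \<times> cbox A B) (\<lambda>(s, y). pd i f (y + s *\<^sub>R axis i 1))"
   unfolding split_beta by (intro continuous_on_compose2[OF cp] continuous_intros) auto
 qed auto
 moreover have "((\<lambda>s. integral (cbox A B) (\<lambda>y. f (y + s *\<^sub>R axis i 1))) has_vector_derivative 0) (at 0 within {-1..1})"
  by (rule has_vector_derivative_transform[of 0 "{-1..1}" _ "\<lambda>s. integral (cbox a b) f"])
   (use const in auto)
 moreover have "at (0::real) within {-1..1} \<noteq> bot" by (simp add: trivial_limit_within islimpt_Icc)
 ultimately have 0: "integral (cbox A B) (pd i f) = 0"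
  using vector_derivative_unique_within[of 0 "{-1..1}"] by fastforce
 have "pd i f x = 0" if "x \<notin> cbox a b" for x
  using pd_cong[of "- cbox a b" x f "\<lambda>x. 0" i] that z by (auto simp: open_Compl)
 moreover have "cbox a b \<subseteq> cbox A B"
  unfolding A_def B_def by (intro subset_box_imp) (auto simp: Basis_vec_def inner_axis)
 ultimately have "integral UNIV (pd i f) = integral (cbox A B) (pd i f)"
  by (intro integral_cpt_support[of "cbox a b"]) auto
 then show ?thesis using 0 by simp
qed

lemma integral_pd_eq_0:
 fixes f :: "real^3 \<Rightarrow> real"
 assumes "open \<Omega>" "compact K" "K \<subseteq> S" "S \<subseteq> \<Omega>" "Ck_on 1 \<Omega> f" and z: "!!x. x \<in> \<Omega> - K ==> f x = 0"
 shows "integral S (pd i f) = 0"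
proof -
 define F where "F = (\<lambda>x. if x \<in> \<Omega> then f x else 0)"
 have C: "Ck_on 1 UNIV F" unfolding F_def
  by (rule Ck_on_zero_extend[OF assms(1) compact_imp_closed[OF assms(2)]]) (use assms in auto)
 obtain a b where ab: "K \<subseteq> cbox a b"
  using bounded_subset_cbox_symmetric[OF compact_imp_bounded[OF assms(2)]] by blast
 have "F x = 0" if "x \<notin> K" for x using that z by (auto simp: F_def)
 then have zF: "pd i F x = 0" if "x \<notin> K" for x
  using pd_cong[of "- K" x F "\<lambda>x. 0" i] that compact_imp_closed[OF assms(2)] by (auto simp: open_Compl)
 have e: "pd i f x = pd i F x" if "x \<in> \<Omega>" for x
  by (rule pd_cong[OF assms(1) that]) (simp add: F_def)
 have "integral S (pd i f) = integral S (pd i F)"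
  by (rule Henstock_Kurzweil_Integration.integral_cong) (use e assms in auto)
 also have "\<dots> = integral UNIV (pd i F)"
  by (rule integral_cpt_support[of K]) (use assms zF in auto)
 also have "\<dots> = 0"
  by (rule integral_pd_UNIV[OF C]) (use ab z in \<open>auto simp: F_def\<close>)
 finally show ?thesis .
qed

lemma integral_by_parts:
 fixes f h :: "real^3 \<Rightarrow> real"
 assumes "open \<Omega>" "compact K" "K \<subseteq> S" "S \<subseteq> \<Omega>" "Ck_on 1 \<Omega> f" "Ck_on 1 \<Omega> h"
  and z: "!!x. x \<in> \<Omega> - K ==> h x = 0"
 shows "integral S (\<lambda>x. pd i f x * h x) = - integral S (\<lambda>x. f x * pd i h x)"
  and "(\<lambda>x. pd i f x * h x) integrable_on S" "(\<lambda>x. f x * pd i h x) integrable_on S"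
proof -
 have C: "Ck_on (Suc 0) \<Omega> f" "Ck_on (Suc 0) \<Omega> h" using assms by auto
 have cont: "continuous_on \<Omega> f" "continuous_on \<Omega> h" "continuous_on \<Omega> (pd i f)" "continuous_on \<Omega> (pd i h)"
  using Ck_on_continuous[OF C(1)] Ck_on_continuous[OF C(2)]
   Ck_on_continuous[OF Ck_on_pd[OF C(1)]] Ck_on_continuous[OF Ck_on_pd[OF C(2)]] by auto
 have zp: "pd i h x = 0" if "x \<in> \<Omega> - K" for x
  using pd_cong[of "\<Omega> - K" x h "\<lambda>x. 0" i] that z assms(1) compact_imp_closed[OF assms(2)]
  by (auto simp: open_Diff)
 have KO: "K \<subseteq> \<Omega>" using assms by blast
 show I1: "(\<lambda>x. pd i f x * h x) integrable_on S"
  by (rule integrable_cpt_support(2)[OF _ assms(2,3)])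
   (use z assms(4) KO cont in \<open>auto intro!: continuous_intros intro: continuous_on_subset\<close>)
 show I2: "(\<lambda>x. f x * pd i h x) integrable_on S"
  by (rule integrable_cpt_support(2)[OF _ assms(2,3)])
   (use zp assms(4) KO cont in \<open>auto intro!: continuous_intros intro: continuous_on_subset\<close>)
 have "integral S (pd i (\<lambda>x. f x * h x)) = 0"
  by (rule integral_pd_eq_0[OF assms(1-4) Ck_on_mult[OF assms(1,5,6)]]) (use z in auto)
 also have "integral S (pd i (\<lambda>x. f x * h x)) = integral S (\<lambda>x. pd i f x * h x + f x * pd i h x)"
  by (rule Henstock_Kurzweil_Integration.integral_cong)
   (use assms(4) in \<open>auto simp: pd_mult[OF Ck_on_differentiable[OF C(1)] Ck_on_differentiable[OF C(2)]]\<close>)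
 also have "\<dots> = integral S (\<lambda>x. pd i f x * h x) + integral S (\<lambda>x. f x * pd i h x)"
  by (rule Henstock_Kurzweil_Integration.integral_add[OF I1 I2])
 finally show "integral S (\<lambda>x. pd i f x * h x) = - integral S (\<lambda>x. f x * pd i h x)" by simp
qed

section \<open>Differentiation along space-time lines\<close>

lemma Ck_space_continuous: "Ck_space k \<Omega> f ==> continuous_on ({0<..} \<times> \<Omega>) (\<lambda>(t, x). f t x)"
 by (cases k) auto

lemma Ck_space_Suc_D:
 assumes "Ck_space (Suc k) \<Omega> f"
 shows "t > 0 ==> x \<in> \<Omega> ==> f t differentiable (at x)" "Ck_space k \<Omega> (\<lambda>t. pd i (f t))"
 using assms by auto

lemma continuous_on_time_slice:
 assumes "continuous_on ({0<..} \<times> \<Omega>) (\<lambda>(t, x). f t x)" "t > 0"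
 shows "continuous_on \<Omega> (f t)"
proof -
 have "continuous_on \<Omega> (\<lambda>x. (\<lambda>(t, x). f t x) (t, x))"
  by (rule continuous_on_compose2[OF assms(1)]) (use assms(2) in \<open>auto intro!: continuous_intros\<close>)
 then show ?thesis by simp
qed

lemma Ck_space_imp_Ck_on: "Ck_space k \<Omega> f ==> t > 0 ==> Ck_on k \<Omega> (f t)"
proof (induction k arbitrary: f)
 case 0 then show ?case using continuous_on_time_slice by simp
next
 case (Suc k)
 show ?case
  by (intro Ck_on_SucI Ck_space_Suc_D(1)[OF Suc.prems] Suc.IH[OF Ck_space_Suc_D(2)[OF Suc.prems(1)] Suc.prems(2)])
qed

lemma has_vector_derivative_space_time:
 fixes f :: "real \<Rightarrow> real^3 \<Rightarrow> 'b::banach"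
 assumes O: "open \<Omega>" and C1: "C1_time \<Omega> f" and d: "f t differentiable (at x)"
  and t: "t > 0" and x: "x \<in> \<Omega>"
 shows "((\<lambda>s. f (t + s) (x + s *\<^sub>R v)) has_vector_derivative
  dt f t x + (\<Sum>i\<in>UNIV. (v $ i) *\<^sub>R pd i (f t) x)) (at 0)"
proof -
 have F: "((\<lambda>(y, \<tau>). f \<tau> y) has_derivative
   (\<lambda>(h, r). (\<Sum>i\<in>UNIV. (h $ i) *\<^sub>R pd i (f t) x) + blinfun_scaleR_left (dt f t x) r))
   (at (x, t) within \<Omega> \<times> {0<..})"
 proof (rule has_derivative_partialsI)
  show "((\<lambda>y. f t y) has_derivative (\<lambda>h. \<Sum>i\<in>UNIV. (h $ i) *\<^sub>R pd i (f t) x)) (at x within \<Omega>)"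
   by (rule has_derivative_at_withinI[OF has_derivative_pd[OF d]])
 next
  fix y \<tau> assume "y \<in> \<Omega>" "\<tau> \<in> {0::real<..}"
  then have "(\<lambda>\<tau>. f \<tau> y) differentiable (at \<tau>)" using C1 by (simp add: C1_time_def)
  then have "((\<lambda>\<tau>. f \<tau> y) has_vector_derivative dt f \<tau> y) (at \<tau>)"
   unfolding dt_def using vector_derivative_works by blast
  then show "((\<lambda>\<tau>. f \<tau> y) has_derivative blinfun_apply (blinfun_scaleR_left (dt f \<tau> y))) (at \<tau> within {0<..})"
   by (simp add: has_vector_derivative_def has_derivative_at_withinI)
 next
  have "continuous_on (\<Omega> \<times> {0<..}) (\<lambda>z. (\<lambda>(t, x). dt f t x) (snd z, fst z))"
   by (rule continuous_on_compose2[of "{0<..} \<times> \<Omega>"]) (use C1 in \<open>auto simp: C1_time_def intro!: continuous_intros\<close>)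
  then have "continuous_on (\<Omega> \<times> {0<..}) (\<lambda>z. blinfun_scaleR_left (dt f (snd z) (fst z)))"
   by (intro bounded_linear.continuous_on[OF bounded_linear_blinfun_scaleR_left]) (simp add: split_beta)
  then have "continuous (at (x, t) within \<Omega> \<times> {0<..}) (\<lambda>z. blinfun_scaleR_left (dt f (snd z) (fst z)))"
   unfolding continuous_on_eq_continuous_within using x t by blast
  then show "continuous (at (x, t) within \<Omega> \<times> {0<..}) (\<lambda>(y, \<tau>). blinfun_scaleR_left (dt f \<tau> y))"
   by (simp only: case_prod_beta')
 qed (use t in auto)
 have "open (\<Omega> \<times> {0::real<..})" using O by (intro open_Times) auto
 then have F': "((\<lambda>(y, \<tau>). f \<tau> y) has_derivative
   (\<lambda>(h, r). (\<Sum>i\<in>UNIV. (h $ i) *\<^sub>R pd i (f t) x) + blinfun_scaleR_left (dt f t x) r)) (at (x + 0 *\<^sub>R v, t + 0))"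
  using F unfolding at_within_open[OF SigmaI[OF x greaterThan_iff[THEN iffD2, OF t]] \<open>open (\<Omega> \<times> {0<..})\<close>]
  by simp
 have L: "((\<lambda>s. (x + s *\<^sub>R v, t + s)) has_derivative (\<lambda>s. (s *\<^sub>R v, s))) (at 0)"
  by (auto intro!: derivative_eq_intros)
 have "((\<lambda>s. f (t + s) (x + s *\<^sub>R v)) has_derivative
   (\<lambda>s. (\<Sum>i\<in>UNIV. ((s *\<^sub>R v) $ i) *\<^sub>R pd i (f t) x) + blinfun_scaleR_left (dt f t x) s)) (at 0)"
  using has_derivative_compose[OF L F'] by simp
 then show ?thesis
  by (simp add: has_vector_derivative_def scaleR_sum_right scaleR_add_right add.commute)
qed

section \<open>Weak derivatives\<close>

lemma absolutely_integrable_iff_integrable: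
 "S \<in> sets lebesgue ==> f absolutely_integrable_on S \<longleftrightarrow> integrable (lebesgue_on S) f"
 by (simp add: set_integrable_def integrable_restrict_space)

lemma AE_lebesgue_on: "S \<in> sets lebesgue ==> (AE x in lebesgue_on S. P x) \<longleftrightarrow> (AE x in lebesgue. x \<in> S \<longrightarrow> P x)"
 by (subst AE_restrict_space_iff) auto

lemma AE_lebesgue_negligible: "(AE x in lebesgue. P x) \<longleftrightarrow> negligible {x. \<not> P x}"
 unfolding negligible_iff_null_sets
proof
 assume "AE x in lebesgue. P x"
 then obtain N where N: "N \<in> null_sets lebesgue" "{x. \<not> P x} \<subseteq> N"
  unfolding eventually_ae_filter by auto
 then show "{x. \<not> P x} \<in> null_sets lebesgue"
  by (meson negligible_iff_null_sets negligible_subset)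
next
 assume "{x. \<not> P x} \<in> null_sets lebesgue"
 then show "AE x in lebesgue. P x" unfolding eventually_ae_filter by auto
qed

lemma integrable_lebesgue_on_cong_AE:
 fixes f g :: "'a::euclidean_space \<Rightarrow> 'b::euclidean_space"
 assumes S: "S \<in> sets lebesgue" and "integrable (lebesgue_on S) f" and ae: "AE x in lebesgue_on S. f x = g x"
 shows "integrable (lebesgue_on S) g" "integral\<^sup>L (lebesgue_on S) f = integral\<^sup>L (lebesgue_on S) g"
proof -
 have N: "negligible {x. \<not> (x \<in> S \<longrightarrow> f x = g x)}"
  using ae AE_lebesgue_on[OF S] AE_lebesgue_negligible[of "\<lambda>x. x \<in> S \<longrightarrow> f x = g x"] by simp
 have "f absolutely_integrable_on S" using assms absolutely_integrable_iff_integrable[OF S, of f] by simp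
 then have "g absolutely_integrable_on S" by (rule absolutely_integrable_spike[OF _ N]) auto
 then show g: "integrable (lebesgue_on S) g" by (rule absolutely_integrable_imp_integrable[OF _ S])
 show "integral\<^sup>L (lebesgue_on S) f = integral\<^sup>L (lebesgue_on S) g"
  by (rule integral_cong_AE) (use g assms in auto)
qed

lemma integrable_cutoff_mult:
 fixes f :: "real^3 \<Rightarrow> 'b::euclidean_space" and \<psi> :: "real^3 \<Rightarrow> real"
 assumes O: "open \<Omega>" and f: "locally_integrable \<Omega> f" and K: "compact K" "K \<subseteq> \<Omega>"
  and c: "continuous_on K \<psi>" and z: "!!x. x \<in> \<Omega> - K ==> \<psi> x = 0"
 shows "integrable (lebesgue_on \<Omega>) (\<lambda>x. \<psi> x *\<^sub>R f x)"
proof -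
 have KL: "K \<in> sets lebesgue" using K(1) by (simp add: compact_imp_closed borel_closed)
 have OL: "\<Omega> \<in> sets lebesgue" using O by simp
 have fK: "f absolutely_integrable_on K"
  using f K absolutely_integrable_iff_integrable[OF KL] by (auto simp: locally_integrable_def)
 have m: "\<psi> \<in> borel_measurable (lebesgue_on K)"
  by (rule continuous_imp_measurable_on_sets_lebesgue[OF c KL])
 have b: "bounded (\<psi> ` K)" using compact_continuous_image[OF c K(1)] compact_imp_bounded by blast
 have "bilinear (\<lambda>(r::real) (x::'b). r *\<^sub>R x)"
  using bounded_bilinear_scaleR by (simp add: bilinear_conv_bounded_bilinear)
 from absolutely_integrable_bounded_measurable_product[OF this m KL b fK]
 have "(\<lambda>x. \<psi> x *\<^sub>R f x) absolutely_integrable_on K" .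
 then have "(\<lambda>x. if x \<in> K then \<psi> x *\<^sub>R f x else 0) absolutely_integrable_on UNIV"
  using absolutely_integrable_restrict_UNIV[of K "\<lambda>x. \<psi> x *\<^sub>R f x"] by simp
 moreover have "(\<lambda>x. if x \<in> K then \<psi> x *\<^sub>R f x else 0) = (\<lambda>x. if x \<in> \<Omega> then \<psi> x *\<^sub>R f x else 0)"
  using K(2) z by (intro ext) auto
 ultimately have "(\<lambda>x. \<psi> x *\<^sub>R f x) absolutely_integrable_on \<Omega>"
  using absolutely_integrable_restrict_UNIV[of \<Omega> "\<lambda>x. \<psi> x *\<^sub>R f x"] by simp
 then show ?thesis by (rule absolutely_integrable_imp_integrable[OF _ OL])
qed

lemma test_functionE:
 assumes "test_function \<Omega> \<phi>"
 obtains K where "compact K" "K \<subseteq> \<Omega>" "!!k. Ck_on k UNIV \<phi>" "!!x. x \<notin> K ==> \<phi> x = 0"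
  "!!i x. x \<notin> K ==> pd i \<phi> x = 0" "continuous_on K \<phi>" "!!i. continuous_on K (pd i \<phi>)"
proof -
 obtain K where K: "compact K" "K \<subseteq> \<Omega>" "!!x. x \<notin> K ==> \<phi> x = 0"
  and s: "!!k. Ck_on k UNIV \<phi>"
  using assms by (auto simp: test_function_def smooth_on_def)
 have "pd i \<phi> x = 0" if "x \<notin> K" for i x
  using pd_cong[of "- K" x \<phi> "\<lambda>x. 0" i] that K compact_imp_closed[OF K(1)] by (auto simp: open_Compl)
 moreover have "continuous_on K \<phi>" "continuous_on K (pd i \<phi>)" for i
  using Ck_on_continuous[OF s] Ck_on_continuous[OF Ck_on_pd[OF s]] continuous_on_subset by blast+
 ultimately show ?thesis using that[OF K(1,2) s K(3)] by blast
qed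

lemma weak_pd_integrable:
 assumes "open \<Omega>" "locally_integrable \<Omega> f" "test_function \<Omega> \<phi>"
 shows "integrable (lebesgue_on \<Omega>) (\<lambda>x. \<phi> x *\<^sub>R f x)"
  and "integrable (lebesgue_on \<Omega>) (\<lambda>x. pd i \<phi> x *\<^sub>R f x)"
proof -
 obtain K where K: "compact K" "K \<subseteq> \<Omega>" "!!x. x \<notin> K ==> \<phi> x = 0"
  "!!i x. x \<notin> K ==> pd i \<phi> x = 0" "continuous_on K \<phi>" "!!i. continuous_on K (pd i \<phi>)"
  using test_functionE[OF assms(3)] by metis
 show "integrable (lebesgue_on \<Omega>) (\<lambda>x. \<phi> x *\<^sub>R f x)"
  by (rule integrable_cutoff_mult[OF assms(1,2) K(1,2,5)]) (use K(3) in auto)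
 show "integrable (lebesgue_on \<Omega>) (\<lambda>x. pd i \<phi> x *\<^sub>R f x)"
  by (rule integrable_cutoff_mult[OF assms(1,2) K(1,2,6)]) (use K(4) in auto)
qed

lemma continuous_locally_integrable:
 fixes f :: "real^3 \<Rightarrow> 'b::euclidean_space"
 assumes "continuous_on \<Omega> f" shows "locally_integrable \<Omega> f"
 unfolding locally_integrable_def
proof (intro allI impI, elim conjE)
 fix K assume K: "compact K" "K \<subseteq> \<Omega>"
 have "f absolutely_integrable_on K"
  by (rule integrable_cpt_support(1)[OF _ K(1) order_refl]) (use continuous_on_subset[OF assms K(2)] in auto)
 then show "integrable (lebesgue_on K) f"
  using K(1) by (simp add: absolutely_integrable_iff_integrable compact_imp_closed borel_closed)
qed

lemma weak_pd_classical:
 fixes f :: "real^3 \<Rightarrow> 'b::euclidean_space"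
 assumes O: "open \<Omega>" and C: "Ck_on 1 \<Omega> f"
 shows "weak_pd \<Omega> i f (pd i f)"
proof -
 have C': "Ck_on (Suc 0) \<Omega> f" using C by simp
 have li: "locally_integrable \<Omega> f" "locally_integrable \<Omega> (pd i f)"
  using continuous_locally_integrable Ck_on_continuous[OF C] Ck_on_continuous[OF Ck_on_pd[OF C']] by blast+
 have OL: "\<Omega> \<in> sets lebesgue" using O by simp
 have "(\<integral>x. pd i \<phi> x *\<^sub>R f x \<partial>lebesgue_on \<Omega>) = - (\<integral>x. \<phi> x *\<^sub>R pd i f x \<partial>lebesgue_on \<Omega>)"
  if t: "test_function \<Omega> \<phi>" for \<phi>
 proof (rule euclidean_eqI)
  fix b :: 'b assume "b \<in> Basis"
  obtain K where K: "compact K" "K \<subseteq> \<Omega>" "!!k. Ck_on k UNIV \<phi>" "!!x. x \<notin> K ==> \<phi> x = 0"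
   using test_functionE[OF t] by metis
  note I = weak_pd_integrable[OF O li(1) t] weak_pd_integrable[OF O li(2) t]
  have Cb: "Ck_on 1 \<Omega> (\<lambda>x. f x \<bullet> b)" by (rule Ck_on_linear[OF bounded_linear_inner_left O C])
  have "(\<integral>x. pd i \<phi> x *\<^sub>R f x \<partial>lebesgue_on \<Omega>) \<bullet> b = integral \<Omega> (\<lambda>x. pd i \<phi> x * (f x \<bullet> b))"
   using lebesgue_integral_eq_integral[OF integrable_inner_left[OF I(2)[of i]] OL, of b] integral_inner_left[OF I(2)[of i], of b]
   by simp
  also have "\<dots> = integral \<Omega> (\<lambda>x. (f x \<bullet> b) * pd i \<phi> x)" by (simp add: mult.commute)
  also have "\<dots> = - integral \<Omega> (\<lambda>x. pd i (\<lambda>x. f x \<bullet> b) x * \<phi> x)"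
   using integral_by_parts(1)[OF O K(1,2) order_refl Cb Ck_on_subset[OF subset_UNIV K(3)], of i] K(4) by simp
  also have "integral \<Omega> (\<lambda>x. pd i (\<lambda>x. f x \<bullet> b) x * \<phi> x) = integral \<Omega> (\<lambda>x. \<phi> x * (pd i f x \<bullet> b))"
   by (rule Henstock_Kurzweil_Integration.integral_cong)
    (simp add: pd_linear[OF bounded_linear_inner_left Ck_on_differentiable[OF C']])
  also have "- \<dots> = - (\<integral>x. \<phi> x *\<^sub>R pd i f x \<partial>lebesgue_on \<Omega>) \<bullet> b"
   using lebesgue_integral_eq_integral[OF integrable_inner_left[OF I(3)] OL, of b] integral_inner_left[OF I(3), of b]
   by simp
  finally show "(\<integral>x. pd i \<phi> x *\<^sub>R f x \<partial>lebesgue_on \<Omega>) \<bullet> b = - (\<integral>x. \<phi> x *\<^sub>R pd i f x \<partial>lebesgue_on \<Omega>) \<bullet> b" .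
 qed
 then show ?thesis using li by (simp add: weak_pd_def)
qed

text \<open>A test function with support in a given box; as \<open>n\<close> grows it increases to the indicator function
  of the interior of the box.\<close>

definition box_bump :: "nat \<Rightarrow> real^3 \<Rightarrow> real^3 \<Rightarrow> real^3 \<Rightarrow> real" where
 "box_bump n a b x = (\<Prod>i\<in>UNIV. flat 0 (real n * (x $ i - a $ i)) * flat 0 (real n * (b $ i - x $ i)))"

lemma Ck_on_box_bump: "Ck_on k UNIV (box_bump n a b)"
 unfolding box_bump_def [abs_def]
 by (intro Ck_on_prod Ck_on_mult Ck_on_flat Ck_on_diff Ck_on_const Ck_on_coord) auto

lemma box_bump_bounds: "0 \<le> box_bump n a b x" "box_bump n a b x \<le> 1"
 unfolding box_bump_def by (auto intro!: prod_nonneg prod_le_1 mult_le_one simp: flat_0_bounds)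

lemma box_bump_outside: "x \<notin> box a b ==> box_bump n a b x = 0"
proof -
 assume "x \<notin> box a b"
 then obtain i where "x $ i \<le> a $ i \<or> b $ i \<le> x $ i" by (auto simp: mem_box_cart not_less)
 then have "real n * (x $ i - a $ i) \<le> 0 \<or> real n * (b $ i - x $ i) \<le> 0"
  by (auto simp: mult_nonneg_nonpos)
 then have "flat 0 (real n * (x $ i - a $ i)) * flat 0 (real n * (b $ i - x $ i)) = 0"
  using flat_0_bounds(3) by auto
 then show ?thesis unfolding box_bump_def by (subst prod_zero_iff) auto
qed

lemma box_bump_pos: "n > 0 ==> x \<in> box a b ==> box_bump n a b x > 0"
 unfolding box_bump_def by (auto intro!: prod_pos mult_pos_pos simp: flat_0_bounds mem_box_cart)

lemma box_bump_tendsto: "(\<lambda>n. box_bump n a b x) \<longlonglongrightarrow> indicator (box a b) x"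
proof (cases "x \<in> box a b")
 case False then show ?thesis by (simp add: box_bump_outside)
next
 case True
 have *: "(\<lambda>n. flat 0 (real n * c)) \<longlonglongrightarrow> 1" if "c > 0" for c
 proof -
  have "(\<lambda>n. exp (- (1 / (real n * c)))) \<longlonglongrightarrow> exp (- 0)"
  proof (intro tendsto_exp tendsto_minus)
   have "(\<lambda>n. (1 / c) * (1 / real n)) \<longlonglongrightarrow> (1 / c) * 0" by (intro tendsto_mult tendsto_const lim_1_over_n)
   then show "(\<lambda>n. 1 / (real n * c)) \<longlonglongrightarrow> 0" by (simp add: mult.commute)
  qed
  then have "(\<lambda>n. exp (- (1 / (real n * c)))) \<longlonglongrightarrow> 1" by simp
  then show ?thesis
   by (rule Lim_transform_eventually)
    (use that in \<open>auto simp: flat_0 eventually_sequentially intro!: exI[of _ 1]\<close>)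
 qed
 have "(\<lambda>n. box_bump n a b x) \<longlonglongrightarrow> (\<Prod>i\<in>(UNIV::3 set). 1 * 1)"
  unfolding box_bump_def by (intro tendsto_prod tendsto_mult *) (use True in \<open>auto simp: mem_box_cart\<close>)
 then show ?thesis using True by simp
qed

lemma test_function_box_bump: "cbox a b \<subseteq> \<Omega> ==> test_function \<Omega> (box_bump n a b)"
 unfolding test_function_def smooth_on_def
proof (intro conjI allI exI[of _ "cbox a b"] impI)
 show "box_bump n a b x = 0" if "x \<notin> cbox a b" for x
  by (rule box_bump_outside) (use that box_subset_cbox in blast)
qed (auto intro: Ck_on_box_bump)

text \<open>The fundamental lemma of the calculus of variations. The bumps above give vanishing integrals over
  all small boxes; these boxes generate the Borel sets.\<close>

lemma fundamental_lemma_real: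
 fixes h :: "real^3 \<Rightarrow> real"
 assumes O: "open \<Omega>" and h: "locally_integrable \<Omega> h"
  and 0: "!!\<phi>. test_function \<Omega> \<phi> ==> (\<integral>x. \<phi> x * h x \<partial>lebesgue_on \<Omega>) = 0"
 shows "AE x in lebesgue_on \<Omega>. h x = 0"
proof -
 have OL: "\<Omega> \<in> sets lebesgue" using O by simp
 have int_box: "integrable lebesgue (\<lambda>x. indicator (box c d) x * h x)" if "cbox c d \<subseteq> \<Omega>" for c d
 proof -
  have "integrable (lebesgue_on (cbox c d)) h" using h that by (auto simp: locally_integrable_def)
  then have "h absolutely_integrable_on cbox c d" by (simp add: absolutely_integrable_iff_integrable)
  then have "h absolutely_integrable_on box c d"
   by (rule set_integrable_subset) (auto simp: box_subset_cbox)
  then show ?thesis by (simp add: set_integrable_def)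
 qed
 have box0: "(\<integral>x. indicator (box c d) x * h x \<partial>lebesgue) = 0" if cd: "cbox c d \<subseteq> \<Omega>" for c d
 proof -
  have eq: "box_bump n c d x * (indicator (box c d) x * h x) = indicator \<Omega> x * (box_bump n c d x * h x)" for n x
   using cd box_bump_outside[of x c d n] box_subset_cbox[of c d] by (cases "x \<in> box c d") (auto simp: indicator_def)
  have "(\<integral>x. box_bump n c d x * (indicator (box c d) x * h x) \<partial>lebesgue) = 0" for n
   unfolding eq using 0[OF test_function_box_bump[OF cd, of n]] OL by (simp add: integral_restrict_space)
  moreover have "(\<lambda>n. \<integral>x. box_bump n c d x * (indicator (box c d) x * h x) \<partial>lebesgue) \<longlonglongrightarrow>
    (\<integral>x. indicator (box c d) x * h x \<partial>lebesgue)"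
  proof (rule integral_dominated_convergence[where w = "\<lambda>x. \<bar>indicator (box c d) x * h x\<bar>"])
   show "(\<lambda>x. indicator (box c d) x * h x) \<in> borel_measurable lebesgue" using int_box[OF cd] by auto
   show "(\<lambda>x. box_bump n c d x * (indicator (box c d) x * h x)) \<in> borel_measurable lebesgue" for n
   proof (rule borel_measurable_times)
    have "continuous_on UNIV (box_bump n c d)" by (rule Ck_on_continuous[OF Ck_on_box_bump])
    then show "box_bump n c d \<in> borel_measurable lebesgue"
     by (intro measurable_completion) (simp add: borel_measurable_continuous_onI)
   qed (use int_box[OF cd] in auto)
   show "integrable lebesgue (\<lambda>x. \<bar>indicator (box c d) x * h x\<bar>)" using int_box[OF cd] by simp
   show "AE x in lebesgue. (\<lambda>n. box_bump n c d x * (indicator (box c d) x * h x)) \<longlonglongrightarrow> indicator (box c d) x * h x"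
   proof (rule AE_I2)
    fix x
    have "(\<lambda>n. box_bump n c d x * (indicator (box c d) x * h x)) \<longlonglongrightarrow>
     indicator (box c d) x * (indicator (box c d) x * h x)"
     by (intro tendsto_mult box_bump_tendsto tendsto_const)
    then show "(\<lambda>n. box_bump n c d x * (indicator (box c d) x * h x)) \<longlonglongrightarrow> indicator (box c d) x * h x"
     by (cases "x \<in> box c d") auto
   qed
   show "AE x in lebesgue. norm (box_bump n c d x * (indicator (box c d) x * h x)) \<le> \<bar>indicator (box c d) x * h x\<bar>" for n
    using box_bump_bounds by (auto simp: abs_mult intro!: mult_left_le_one_le)
  qed
  ultimately show ?thesis by (simp add: LIMSEQ_const_iff)
 qed
 have ae_box: "AE x in lebesgue. x \<in> box c d \<longrightarrow> h x = 0" if cd: "cbox c d \<subseteq> \<Omega>" for c d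
 proof -
  define k where "k = (\<lambda>x. indicator (box c d) x * h x)"
  have k: "integrable lebesgue k" unfolding k_def by (rule int_box[OF cd])
  have kA: "set_integrable lebesgue A k" if "A \<in> sets borel" for A
   unfolding set_integrable_def using integrable_mult_indicator[OF _ k, of A] that by simp
  have borel0: "(LINT x:A|lebesgue. k x) = 0" if "A \<in> sets borel" for A
  proof -
   have G: "A \<in> sigma_sets UNIV (range (\<lambda>(a, b). box a b))" (is "_ \<in> sigma_sets _ ?G")
    using that by (simp add: borel_eq_box)
   have IS: "Int_stable ?G"
   proof (rule Int_stableI)
    fix X Y assume "X \<in> ?G" "Y \<in> ?G"
    then obtain a b a' b' where "X = box a b" "Y = box a' b'" by auto
    then show "X \<inter> Y \<in> ?G" using box_Int_box[of a b a' b'] by auto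
   qed
   have P: "?G \<subseteq> Pow UNIV" by simp
   from IS P G show ?thesis
   proof (induction rule: sigma_sets_induct_disjoint)
    case (basic A)
    then obtain a b where A: "A = box a b" by auto
    obtain a' b' where ab: "box a b \<inter> box c d = box a' b'" by (simp add: box_Int_box)
    have "indicator A x * k x = indicator (box a' b') x * h x" for x
     unfolding k_def A ab[symmetric] by (simp add: indicator_def)
    moreover have "(\<integral>x. indicator (box a' b') x * h x \<partial>lebesgue) = 0"
    proof (cases "box a' b' = {}")
     case False
     have "cbox a' b' \<subseteq> cbox c d"
      using closure_mono[of "box a' b'" "box c d"] ab False
      by (metis Int_lower2 closure_box inf.absorb_iff2 inf_bot_right)
     then show ?thesis using box0 cd by blast
    qed simp
    ultimately show ?case by (simp add: set_lebesgue_integral_def)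
   next
    case empty show ?case by (simp add: set_lebesgue_integral_def)
   next
    case (compl A)
    have A: "A \<in> sets borel" using compl(1) by (simp add: borel_eq_box)
    have "(LINT x:UNIV - A|lebesgue. k x) + (LINT x:A|lebesgue. k x) = (LINT x:UNIV|lebesgue. k x)"
     using set_integral_Un[of "UNIV - A" A lebesgue k] kA[of "UNIV - A"] kA[of A] A
     by (simp add: Diff_disjoint Int_commute)
    also have "\<dots> = 0" using box0[OF cd] by (simp add: set_lebesgue_integral_def k_def)
    finally show ?case using compl by simp
   next
    case (union A)
    have A: "A i \<in> sets borel" for i using union(2) by (auto simp: borel_eq_box)
    have "(LINT x:(\<Union>i. A i)|lebesgue. k x) = (\<Sum>i. LINT x:A i|lebesgue. k x)"
     by (rule lebesgue_integral_countable_add)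
      (use A union(1) kA in \<open>auto simp: disjoint_family_on_def\<close>)
    then show ?case using union(3) by simp
   qed
  qed
  have "AE x in lebesgue. k x = 0"
  proof (rule density_unique_real[OF k integrable_zero])
   fix A :: "(real^3) set" assume "A \<in> sets lebesgue"
   then obtain S N N' where A: "A = S \<union> N" "N \<subseteq> N'" "N' \<in> null_sets lborel" "S \<in> sets borel"
    using sets_completionE[of A lborel] by auto
   have "AE x in lebesgue. indicator A x *\<^sub>R k x = indicator S x *\<^sub>R k x"
    using AE_completion[OF AE_not_in[OF A(3)]] by eventually_elim (use A in \<open>auto simp: indicator_def\<close>)
   then have "(LINT x:A|lebesgue. k x) = (LINT x:S|lebesgue. k x)"
    unfolding set_lebesgue_integral_def
    by (intro integral_cong_AE borel_measurable_scaleR borel_measurable_indicator)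
     (use k A \<open>A \<in> sets lebesgue\<close> in auto)
   then show "(LINT x:A|lebesgue. k x) = (LINT x:A|lebesgue. 0)"
    using borel0[OF A(4)] by (simp add: set_lebesgue_integral_def)
  qed
  then show ?thesis by eventually_elim (auto simp: k_def indicator_def split: if_splits)
 qed
 obtain \<D> where D: "countable \<D>" "\<D> \<subseteq> Pow \<Omega>" "!!X. X \<in> \<D> ==> \<exists>a b. X = cbox a b" "\<Union>\<D> = \<Omega>"
  by (rule open_countable_Union_open_cbox[OF O], rule that)
 have "AE x in lebesgue. \<forall>X\<in>\<D>. x \<in> X \<longrightarrow> h x = 0"
 proof (rule AE_ball_countable[THEN iffD2, OF D(1)], intro ballI)
  fix X assume "X \<in> \<D>"
  then obtain a b where X: "X = cbox a b" "cbox a b \<subseteq> \<Omega>" using D(2) D(3)[of X] by auto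
  have "AE x in lebesgue. x \<notin> cbox a b - box a b"
   using negligible_frontier_interval[of a b] by (simp add: AE_lebesgue_negligible set_diff_eq)
  then show "AE x in lebesgue. x \<in> X \<longrightarrow> h x = 0"
   using ae_box[OF X(2)] by eventually_elim (auto simp: X)
 qed
 then show ?thesis unfolding AE_lebesgue_on[OF OL] by eventually_elim (use D(4) in blast)
qed

lemma fundamental_lemma:
 fixes h :: "real^3 \<Rightarrow> 'b::euclidean_space"
 assumes O: "open \<Omega>" and h: "locally_integrable \<Omega> h"
  and 0: "!!\<phi>. test_function \<Omega> \<phi> ==> (\<integral>x. \<phi> x *\<^sub>R h x \<partial>lebesgue_on \<Omega>) = 0"
 shows "AE x in lebesgue_on \<Omega>. h x = 0"
proof -
 have "AE x in lebesgue_on \<Omega>. h x \<bullet> b = 0" for b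
 proof (rule fundamental_lemma_real[OF O])
  show "locally_integrable \<Omega> (\<lambda>x. h x \<bullet> b)" using h by (auto simp: locally_integrable_def)
  show "(\<integral>x. \<phi> x * (h x \<bullet> b) \<partial>lebesgue_on \<Omega>) = 0" if "test_function \<Omega> \<phi>" for \<phi>
   using integral_inner_left[OF weak_pd_integrable(1)[OF O h that], of b] 0[OF that] by simp
 qed
 then have "AE x in lebesgue_on \<Omega>. \<forall>b\<in>Basis. h x \<bullet> b = 0"
  by (simp add: AE_finite_all)
 then show ?thesis by eventually_elim (simp add: euclidean_all_zero_iff)
qed

lemma weak_pd_unique:
 fixes f f' :: "real^3 \<Rightarrow> 'b::euclidean_space"
 assumes O: "open \<Omega>" and w: "weak_pd \<Omega> i f g" "weak_pd \<Omega> i f' g'"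
  and ae: "AE x in lebesgue_on \<Omega>. f x = f' x"
 shows "AE x in lebesgue_on \<Omega>. g x = g' x"
proof -
 have OL: "\<Omega> \<in> sets lebesgue" using O by simp
 have li: "locally_integrable \<Omega> f" "locally_integrable \<Omega> f'" "locally_integrable \<Omega> g" "locally_integrable \<Omega> g'"
  using w by (auto simp: weak_pd_def)
 have "AE x in lebesgue_on \<Omega>. g x - g' x = 0"
 proof (rule fundamental_lemma[OF O])
  show "locally_integrable \<Omega> (\<lambda>x. g x - g' x)" using li by (auto simp: locally_integrable_def)
  fix \<phi> assume t: "test_function \<Omega> \<phi>"
  have "(\<integral>x. \<phi> x *\<^sub>R (g x - g' x) \<partial>lebesgue_on \<Omega>) =
    (\<integral>x. \<phi> x *\<^sub>R g x \<partial>lebesgue_on \<Omega>) - (\<integral>x. \<phi> x *\<^sub>R g' x \<partial>lebesgue_on \<Omega>)"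
   using weak_pd_integrable(1)[OF O li(3) t] weak_pd_integrable(1)[OF O li(4) t] by (simp add: scaleR_diff_right)
  also have "\<dots> = (\<integral>x. pd i \<phi> x *\<^sub>R f' x \<partial>lebesgue_on \<Omega>) - (\<integral>x. pd i \<phi> x *\<^sub>R f x \<partial>lebesgue_on \<Omega>)"
   using w t by (simp add: weak_pd_def)
  also have "\<dots> = 0"
  proof -
   have "AE x in lebesgue_on \<Omega>. pd i \<phi> x *\<^sub>R f x = pd i \<phi> x *\<^sub>R f' x"
    using ae by eventually_elim simp
   from integrable_lebesgue_on_cong_AE(2)[OF OL weak_pd_integrable(2)[OF O li(1) t, of i] this]
   show ?thesis by simp
  qed
  finally show "(\<integral>x. \<phi> x *\<^sub>R (g x - g' x) \<partial>lebesgue_on \<Omega>) = 0" .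
 qed
 then show ?thesis by simp
qed

section \<open>Norms of weak derivatives\<close>

lemma wpd_weak_pd: "weak_pd \<Omega> i f g ==> weak_pd \<Omega> i f (wpd \<Omega> i f)"
 using someI[of "weak_pd \<Omega> i f" g] by (simp add: wpd_def)

lemma locally_integrable_cong_AE:
 fixes f f' :: "real^3 \<Rightarrow> 'b::euclidean_space"
 assumes "open \<Omega>" "locally_integrable \<Omega> f" "AE x in lebesgue_on \<Omega>. f x = f' x"
 shows "locally_integrable \<Omega> f'"
 unfolding locally_integrable_def
proof (intro allI impI, elim conjE)
 fix K assume K: "compact K" "K \<subseteq> \<Omega>"
 have KL: "K \<in> sets lebesgue" using K(1) by (simp add: compact_imp_closed borel_closed)
 have OL: "\<Omega> \<in> sets lebesgue" using assms(1) by simp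
 have "AE x in lebesgue_on K. f x = f' x"
  using assms(3) unfolding AE_lebesgue_on[OF KL] AE_lebesgue_on[OF OL] by eventually_elim (use K in blast)
 moreover have "integrable (lebesgue_on K) f" using assms(2) K by (auto simp: locally_integrable_def)
 ultimately show "integrable (lebesgue_on K) f'" using integrable_lebesgue_on_cong_AE(1)[OF KL] by blast
qed

lemma weak_pd_cong_AE:
 fixes f f' :: "real^3 \<Rightarrow> 'b::euclidean_space"
 assumes O: "open \<Omega>" and w: "weak_pd \<Omega> i f g" and ae: "AE x in lebesgue_on \<Omega>. f x = f' x"
 shows "weak_pd \<Omega> i f' g"
proof -
 have OL: "\<Omega> \<in> sets lebesgue" using O by simp
 have f: "locally_integrable \<Omega> f" using w by (simp add: weak_pd_def)
 have "(\<integral>x. pd i \<phi> x *\<^sub>R f x \<partial>lebesgue_on \<Omega>) = (\<integral>x. pd i \<phi> x *\<^sub>R f' x \<partial>lebesgue_on \<Omega>)"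
  if t: "test_function \<Omega> \<phi>" for \<phi>
 proof (rule integrable_lebesgue_on_cong_AE(2)[OF OL weak_pd_integrable(2)[OF O f t]])
  show "AE x in lebesgue_on \<Omega>. pd i \<phi> x *\<^sub>R f x = pd i \<phi> x *\<^sub>R f' x"
   using ae by eventually_elim simp
 qed
 then show ?thesis using w locally_integrable_cong_AE[OF O f ae] by (simp add: weak_pd_def)
qed

lemma weak_pd_diff:
 fixes f f' :: "real^3 \<Rightarrow> 'b::euclidean_space"
 assumes O: "open \<Omega>" and w: "weak_pd \<Omega> i f g" "weak_pd \<Omega> i f' g'"
 shows "weak_pd \<Omega> i (\<lambda>x. f x - f' x) (\<lambda>x. g x - g' x)"
proof -
 have li: "locally_integrable \<Omega> f" "locally_integrable \<Omega> f'" "locally_integrable \<Omega> g" "locally_integrable \<Omega> g'"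
  using w by (auto simp: weak_pd_def)
 have "(\<integral>x. pd i \<phi> x *\<^sub>R (f x - f' x) \<partial>lebesgue_on \<Omega>) = - (\<integral>x. \<phi> x *\<^sub>R (g x - g' x) \<partial>lebesgue_on \<Omega>)"
  if t: "test_function \<Omega> \<phi>" for \<phi>
 proof -
  have "(\<integral>x. pd i \<phi> x *\<^sub>R (f x - f' x) \<partial>lebesgue_on \<Omega>) =
    (\<integral>x. pd i \<phi> x *\<^sub>R f x \<partial>lebesgue_on \<Omega>) - (\<integral>x. pd i \<phi> x *\<^sub>R f' x \<partial>lebesgue_on \<Omega>)"
   using weak_pd_integrable(2)[OF O li(1) t, of i] weak_pd_integrable(2)[OF O li(2) t, of i] by (simp add: scaleR_diff_right)
  moreover have "(\<integral>x. \<phi> x *\<^sub>R (g x - g' x) \<partial>lebesgue_on \<Omega>) =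
    (\<integral>x. \<phi> x *\<^sub>R g x \<partial>lebesgue_on \<Omega>) - (\<integral>x. \<phi> x *\<^sub>R g' x \<partial>lebesgue_on \<Omega>)"
   using weak_pd_integrable(1)[OF O li(3) t] weak_pd_integrable(1)[OF O li(4) t] by (simp add: scaleR_diff_right)
  ultimately show ?thesis using w t by (simp add: weak_pd_def)
 qed
 moreover have "locally_integrable \<Omega> (\<lambda>x. f x - f' x)" "locally_integrable \<Omega> (\<lambda>x. g x - g' x)"
  using li by (auto simp: locally_integrable_def)
 ultimately show ?thesis by (simp add: weak_pd_def)
qed

lemma wpd_cong_AE:
 fixes f f' :: "real^3 \<Rightarrow> 'b::euclidean_space"
 assumes O: "open \<Omega>" and ae: "AE x in lebesgue_on \<Omega>. f x = f' x"
 shows "wpd \<Omega> i f = wpd \<Omega> i f'"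
proof -
 have ae': "AE x in lebesgue_on \<Omega>. f' x = f x" using ae by eventually_elim simp
 have "weak_pd \<Omega> i f g \<longleftrightarrow> weak_pd \<Omega> i f' g" for g
  using weak_pd_cong_AE[OF O _ ae] weak_pd_cong_AE[OF O _ ae'] by blast
 then show ?thesis by (simp add: wpd_def)
qed

lemma Lp_cong_AE:
 fixes f f' :: "real^3 \<Rightarrow> 'b::euclidean_space"
 assumes O: "open \<Omega>" and f: "Lp p \<Omega> f" and ae: "AE x in lebesgue_on \<Omega>. f x = f' x"
 shows "Lp p \<Omega> f'" "Lp_norm p \<Omega> f = Lp_norm p \<Omega> f'"
proof -
 have OL: "\<Omega> \<in> sets lebesgue" using O by simp
 have "(\<lambda>x. if x \<in> \<Omega> then f x else 0) \<in> borel_measurable lebesgue"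
  using f borel_measurable_if[OF OL, of f] by (simp add: Lp_def)
 moreover have "AE x in lebesgue. (if x \<in> \<Omega> then f x else 0) = (if x \<in> \<Omega> then f' x else 0)"
  using ae unfolding AE_lebesgue_on[OF OL] by eventually_elim simp
 ultimately have "(\<lambda>x. if x \<in> \<Omega> then f' x else 0) \<in> borel_measurable lebesgue"
  by (rule borel_measurable_AE)
 then have m: "f' \<in> borel_measurable (lebesgue_on \<Omega>)" using borel_measurable_if[OF OL, of f'] by simp
 have ae': "AE x in lebesgue_on \<Omega>. norm (f x) powr p = norm (f' x) powr p" using ae by eventually_elim simp
 note I = integrable_lebesgue_on_cong_AE[OF OL _ ae']
 show "Lp p \<Omega> f'" using f m I(1) by (simp add: Lp_def)
 show "Lp_norm p \<Omega> f = Lp_norm p \<Omega> f'" using f I(2) by (simp add: Lp_def Lp_norm_def)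
qed

lemma Lp_norm_nonneg: "0 \<le> Lp_norm p \<Omega> f"
 by (simp add: Lp_norm_def)

lemma Wkp_norm_nonneg: "0 \<le> Wkp_norm k p \<Omega> f"
 by (induction k arbitrary: f) (auto simp: Lp_norm_nonneg intro!: add_nonneg_nonneg sum_nonneg)

lemma Wkp_imp_Lp: "Wkp k p \<Omega> f ==> Lp p \<Omega> f"
 by (cases k) auto

lemma Wkp_norm_ge: "Lp_norm p \<Omega> f \<le> Wkp_norm k p \<Omega> f"
 by (cases k) (auto intro!: sum_nonneg Wkp_norm_nonneg)

lemma Wkp_norm_Suc_ge: "Wkp_norm k p \<Omega> (wpd \<Omega> i f) \<le> Wkp_norm (Suc k) p \<Omega> f"
proof -
 have "Wkp_norm k p \<Omega> (wpd \<Omega> i f) \<le> (\<Sum>i\<in>UNIV. Wkp_norm k p \<Omega> (wpd \<Omega> i f))"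
  by (rule member_le_sum) (auto simp: Wkp_norm_nonneg)
 then show ?thesis using Lp_norm_nonneg[of p \<Omega> f] by simp
qed

lemma Wkp_norm_cong_AE:
 fixes f f' :: "real^3 \<Rightarrow> 'b::euclidean_space"
 assumes O: "open \<Omega>" and f: "Lp p \<Omega> f" and ae: "AE x in lebesgue_on \<Omega>. f x = f' x"
 shows "Wkp_norm k p \<Omega> f = Wkp_norm k p \<Omega> f'"
 using Lp_cong_AE(2)[OF assms] wpd_cong_AE[OF O ae] by (cases k) simp_all

lemma Lp_norm_powr: "p > 0 ==> (\<integral>x. norm (f x) powr p \<partial>lebesgue_on \<Omega>) = Lp_norm p \<Omega> f powr p"
 by (simp add: Lp_norm_def powr_powr)

lemma norm_add_powr_le:
 fixes a b :: "'b::real_normed_vector"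
 assumes "p > 0" shows "norm (a + b) powr p \<le> 2 powr p * (norm a powr p + norm b powr p)"
proof -
 let ?m = "max (norm a) (norm b)"
 have "norm (a + b) powr p \<le> (2 * ?m) powr p"
  using norm_triangle_ineq[of a b] assms by (intro powr_mono2) auto
 also have "\<dots> = 2 powr p * ?m powr p" by (simp add: powr_mult)
 also have "?m powr p \<le> norm a powr p + norm b powr p" by (auto simp: max_def)
 finally show ?thesis by simp
qed

text \<open>The factor comes from \<open>norm (a + b) \<le> 2 * max (norm a) (norm b)\<close>.\<close>

lemma Lp_add:
 fixes f g :: "real^3 \<Rightarrow> 'b::euclidean_space"
 assumes p: "p \<ge> 1" and f: "Lp p \<Omega> f" and g: "Lp p \<Omega> g"
 shows "Lp p \<Omega> (\<lambda>x. f x + g x)" "Lp_norm p \<Omega> (\<lambda>x. f x + g x) \<le> 2 * (Lp_norm p \<Omega> f + Lp_norm p \<Omega> g)"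
proof -
 have m: "(\<lambda>x. f x + g x) \<in> borel_measurable (lebesgue_on \<Omega>)"
  using f g by (intro borel_measurable_add) (simp_all add: Lp_def)
 have B: "integrable (lebesgue_on \<Omega>) (\<lambda>x. 2 powr p * (norm (f x) powr p + norm (g x) powr p))"
  using f g by (simp add: Lp_def)
 have I: "integrable (lebesgue_on \<Omega>) (\<lambda>x. norm (f x + g x) powr p)"
  by (rule Bochner_Integration.integrable_bound[OF B])
   (use m p in \<open>auto intro!: AE_I2 norm_add_powr_le simp: abs_mult\<close>)
 then show "Lp p \<Omega> (\<lambda>x. f x + g x)" using m by (simp add: Lp_def)
 let ?F = "Lp_norm p \<Omega> f" and ?G = "Lp_norm p \<Omega> g"
 have "(\<integral>x. norm (f x + g x) powr p \<partial>lebesgue_on \<Omega>) \<le> (\<integral>x. 2 powr p * (norm (f x) powr p + norm (g x) powr p) \<partial>lebesgue_on \<Omega>)"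
  by (rule integral_mono[OF I B]) (use p in \<open>auto intro!: norm_add_powr_le\<close>)
 also have "\<dots> = 2 powr p * (?F powr p + ?G powr p)"
  using f g p by (simp add: Lp_def Lp_norm_powr)
 also have "?F powr p + ?G powr p \<le> (?F + ?G) powr p"
 proof -
  have F: "?F \<ge> 0" "?G \<ge> 0" by (simp_all add: Lp_norm_nonneg)
  show ?thesis
  proof (cases "?F + ?G = 0")
   case True then have "?F = 0" "?G = 0" using F by linarith+
   then show ?thesis by simp
  next
   case False
   let ?S = "?F + ?G"
   have S: "?S > 0" using False F by linarith
   have le: "x powr p \<le> x * ?S powr (p - 1)" if "0 \<le> x" "x \<le> ?S" for x
   proof (cases "x = 0")
    case False
    then have "x powr p = x * x powr (p - 1)" using that by (simp add: powr_diff powr_mult_base[symmetric] powr_one)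
    also have "\<dots> \<le> x * ?S powr (p - 1)" using that p by (intro mult_left_mono powr_mono2) auto
    finally show ?thesis .
   qed simp
   have "?F powr p + ?G powr p \<le> ?F * ?S powr (p - 1) + ?G * ?S powr (p - 1)"
    using F by (intro add_mono le) auto
   also have "\<dots> = ?S * ?S powr (p - 1)" by (simp only: distrib_right)
   also have "\<dots> = ?S powr p" using S by (simp add: powr_diff)
   finally show ?thesis .
  qed
 qed
 also have "2 powr p * (?F + ?G) powr p = (2 * (?F + ?G)) powr p"
  by (simp only: powr_mult)
 finally have "(\<integral>x. norm (f x + g x) powr p \<partial>lebesgue_on \<Omega>) \<le> (2 * (?F + ?G)) powr p"
  by simp
 then have "Lp_norm p \<Omega> (\<lambda>x. f x + g x) \<le> ((2 * (?F + ?G)) powr p) powr (1 / p)"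
  unfolding Lp_norm_def using p by (intro powr_mono2) auto
 also have "\<dots> = 2 * (?F + ?G)" using p Lp_norm_nonneg[of p \<Omega> f] Lp_norm_nonneg[of p \<Omega> g] by (simp add: powr_powr)
 finally show "Lp_norm p \<Omega> (\<lambda>x. f x + g x) \<le> 2 * (?F + ?G)" .
qed

lemma Lp_uminus: "Lp p \<Omega> f ==> Lp p \<Omega> (\<lambda>x. - f x)" "Lp_norm p \<Omega> (\<lambda>x. - f x) = Lp_norm p \<Omega> f"
 by (auto simp: Lp_def Lp_norm_def)

lemma Lp_diff:
 fixes f g :: "real^3 \<Rightarrow> 'b::euclidean_space"
 assumes "p \<ge> 1" "Lp p \<Omega> f" "Lp p \<Omega> g"
 shows "Lp p \<Omega> (\<lambda>x. f x - g x)"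
 using Lp_add(1)[OF assms(1,2) Lp_uminus(1)[OF assms(3)]] by simp

lemma C_time_wpd:
 fixes f :: "real \<Rightarrow> real^3 \<Rightarrow> 'b::euclidean_space"
 assumes O: "open \<Omega>" and p: "p \<ge> 1" and C: "C_time (Suc k) p \<Omega> f"
 shows "\<exists>g. (\<forall>t\<ge>0. weak_pd \<Omega> i (f t) (g t)) \<and> C_time k p \<Omega> g"
proof -
 have "\<forall>t. \<exists>g. t \<ge> 0 \<longrightarrow> weak_pd \<Omega> i (f t) g \<and> Wkp k p \<Omega> g"
  using C by (auto simp: C_time_def)
 then obtain g where g: "!!t. t \<ge> 0 ==> weak_pd \<Omega> i (f t) (g t) \<and> Wkp k p \<Omega> (g t)"
  by metis
 have le: "Wkp_norm k p \<Omega> (\<lambda>x. g t x - g t0 x) \<le> Wkp_norm (Suc k) p \<Omega> (\<lambda>x. f t x - f t0 x)" if "t \<ge> 0" "t0 \<ge> 0" for t t0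
 proof -
  have w: "weak_pd \<Omega> i (\<lambda>x. f t x - f t0 x) (\<lambda>x. g t x - g t0 x)"
   using weak_pd_diff[OF O] g that by blast
  have L: "Lp p \<Omega> (\<lambda>x. g t x - g t0 x)" using Lp_diff[OF p] g that Wkp_imp_Lp by blast
  have "AE x in lebesgue_on \<Omega>. g t x - g t0 x = wpd \<Omega> i (\<lambda>x. f t x - f t0 x) x"
   by (rule weak_pd_unique[OF O w wpd_weak_pd[OF w]]) simp
  from Wkp_norm_cong_AE[OF O L this] show ?thesis using Wkp_norm_Suc_ge by metis
 qed
 have "C_time k p \<Omega> g"
  unfolding C_time_def
 proof (intro conjI allI impI)
  fix t0 :: real assume t0: "t0 \<ge> 0"
  have "((\<lambda>t. Wkp_norm (Suc k) p \<Omega> (\<lambda>x. f t x - f t0 x)) \<longlongrightarrow> 0) (at t0 within {0..})"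
   using C t0 by (simp add: C_time_def)
  then show "((\<lambda>t. Wkp_norm k p \<Omega> (\<lambda>x. g t x - g t0 x)) \<longlongrightarrow> 0) (at t0 within {0..})"
   by (rule Lim_null_comparison[rotated])
    (use le t0 in \<open>auto simp: eventually_at_filter Wkp_norm_nonneg\<close>)
 qed (use g in auto)
 then show ?thesis using g by blast
qed

lemma C_time_bounded_near_0:
 fixes f :: "real \<Rightarrow> real^3 \<Rightarrow> 'b::euclidean_space"
 assumes O: "open \<Omega>" and p: "p \<ge> 1" and C: "C_time k p \<Omega> f"
 shows "\<exists>M \<delta>. \<delta> > 0 \<and> (\<forall>t. 0 \<le> t \<and> t \<le> \<delta> \<longrightarrow> Lp p \<Omega> (f t) \<and> Lp_norm p \<Omega> (f t) \<le> M)"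
proof -
 have L: "Lp p \<Omega> (f t)" if "t \<ge> 0" for t
  using C that Wkp_imp_Lp[of k p \<Omega> "f t"] by (simp add: C_time_def)
 have "((\<lambda>t. Wkp_norm k p \<Omega> (\<lambda>x. f t x - f 0 x)) \<longlongrightarrow> 0) (at 0 within {0..})"
  using C by (simp add: C_time_def)
 then have "eventually (\<lambda>t. Wkp_norm k p \<Omega> (\<lambda>x. f t x - f 0 x) < 1) (at 0 within {0..})"
  by (rule order_tendstoD) simp
 then obtain d where d: "d > 0" "!!t. 0 \<le> t ==> t \<noteq> 0 ==> dist t 0 < d ==> Wkp_norm k p \<Omega> (\<lambda>x. f t x - f 0 x) < 1"
  unfolding eventually_at by (auto simp: less_imp_le)
 have "Lp_norm p \<Omega> (f t) \<le> 2 * (1 + Lp_norm p \<Omega> (f 0))" if t: "0 \<le> t" "t \<le> d / 2" for t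
 proof (cases "t = 0")
  case True then show ?thesis using Lp_norm_nonneg[of p \<Omega> "f 0"] by simp
 next
  case False
  have "Lp_norm p \<Omega> (\<lambda>x. f t x - f 0 x) \<le> 1"
   using d(2)[of t] Wkp_norm_ge[of p \<Omega> "\<lambda>x. f t x - f 0 x" k] t False d(1) by (auto simp: dist_real_def)
  moreover have "Lp_norm p \<Omega> (\<lambda>x. (f t x - f 0 x) + f 0 x) \<le> 2 * (Lp_norm p \<Omega> (\<lambda>x. f t x - f 0 x) + Lp_norm p \<Omega> (f 0))"
   by (rule Lp_add(2)[OF p Lp_diff[OF p L[OF t(1)] L] L]) auto
  ultimately show ?thesis by simp
 qed
 then show ?thesis using L d(1) by (intro exI[of _ "2 * (1 + Lp_norm p \<Omega> (f 0))"] exI[of _ "d / 2"]) auto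
qed

text \<open>If a continuous family in \<open>W\<^sup>1\<^sup>,\<^sup>p\<close> has a classical representative for positive times, the classical
  first derivatives are bounded in \<open>L\<^sup>p\<close> near the initial time.\<close>

lemma C_time_classical_bound:
 fixes f c :: "real \<Rightarrow> real^3 \<Rightarrow> 'b::euclidean_space"
 assumes O: "open \<Omega>" and p: "p \<ge> 1" and C: "C_time (Suc k) p \<Omega> f"
  and cl: "!!t. t > 0 ==> Ck_on 1 \<Omega> (c t)" "!!t. t > 0 ==> AE x in lebesgue_on \<Omega>. f t x = c t x"
 shows "\<exists>M \<delta>. \<delta> > 0 \<and> (\<forall>t. 0 < t \<and> t \<le> \<delta> \<longrightarrow> Lp p \<Omega> (pd i (c t)) \<and> Lp_norm p \<Omega> (pd i (c t)) \<le> M)"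
  and "\<exists>g. C_time k p \<Omega> g \<and> (\<forall>t>0. AE x in lebesgue_on \<Omega>. g t x = pd i (c t) x)"
proof -
 obtain g where g: "!!t. t \<ge> 0 ==> weak_pd \<Omega> i (f t) (g t)" "C_time k p \<Omega> g"
  using C_time_wpd[OF O p C, of i] by auto
 have ae: "AE x in lebesgue_on \<Omega>. g t x = pd i (c t) x" if "t > 0" for t
  by (rule weak_pd_unique[OF O g(1) weak_pd_classical[OF O cl(1)] cl(2)]) (use that in auto)
 then show "\<exists>g. C_time k p \<Omega> g \<and> (\<forall>t>0. AE x in lebesgue_on \<Omega>. g t x = pd i (c t) x)" using g(2) by blast
 obtain M \<delta> where M: "\<delta> > 0" "!!t. 0 \<le> t ==> t \<le> \<delta> ==> Lp p \<Omega> (g t) \<and> Lp_norm p \<Omega> (g t) \<le> M"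
  using C_time_bounded_near_0[OF O p g(2)] by auto
 show "\<exists>M \<delta>. \<delta> > 0 \<and> (\<forall>t. 0 < t \<and> t \<le> \<delta> \<longrightarrow> Lp p \<Omega> (pd i (c t)) \<and> Lp_norm p \<Omega> (pd i (c t)) \<le> M)"
 proof (intro exI conjI allI impI, rule M(1))
  fix t assume t: "0 < t \<and> t \<le> \<delta>"
  show "Lp p \<Omega> (pd i (c t))" by (rule Lp_cong_AE(1)[OF O _ ae]) (use M t in auto)
  show "Lp_norm p \<Omega> (pd i (c t)) \<le> M" using Lp_cong_AE(2)[OF O _ ae, of p t] M(2)[of t] t by auto
 qed
qed

section \<open>Domains with smooth boundary\<close>

lemma inner_grad: "v \<bullet> grad f x = (\<Sum>i\<in>UNIV. v $ i * pd i f x)"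
 by (simp add: inner_vec_def grad_def grad_of_def)

lemma grad_nth: "grad f x $ i = pd i f x"
 by (simp add: grad_def grad_of_def)

lemma DERIV_along_line:
 fixes f :: "real^3 \<Rightarrow> real"
 assumes "f differentiable (at (x + s *\<^sub>R v))"
 shows "((\<lambda>s. f (x + s *\<^sub>R v)) has_real_derivative (v \<bullet> grad f (x + s *\<^sub>R v))) (at s)"
 using has_vector_derivative_along_line[OF assms]
 by (simp add: inner_grad has_real_derivative_iff_has_vector_derivative)

text \<open>Both functions are negative exactly inside the domain, so a direction that leaves the domain
  according to one of them cannot enter it according to the other.\<close>

lemma local_defining_function_grad_inner_pos:
 assumes x: "x \<in> frontier \<Omega>" and 1: "local_defining_function \<Omega> x U \<phi>" and 2: "local_defining_function \<Omega> x V \<psi>"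
 shows "grad \<phi> x \<bullet> grad \<psi> x > 0"
proof -
 have U: "open U" "x \<in> U" "open V" "x \<in> V" using 1 2 by (auto simp: local_defining_function_def)
 have s: "Ck_on (Suc 0) U \<phi>" "Ck_on (Suc 0) V \<psi>"
  using 1 2 by (auto simp: local_defining_function_def smooth_on_def simp del: Ck_on.simps)
 have d: "\<phi> differentiable (at x)" "\<psi> differentiable (at x)"
  using Ck_on_differentiable[OF s(1) U(2)] Ck_on_differentiable[OF s(2) U(4)] by auto
 have z: "\<phi> x = 0" "\<psi> x = 0" using 1 2 x by (auto simp: local_defining_function_def)
 have key: "v \<bullet> grad \<psi> x \<ge> 0" if v: "v \<bullet> grad \<phi> x > 0" for v
 proof (rule ccontr)
  assume "\<not> v \<bullet> grad \<psi> x \<ge> 0"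
  then have v2: "v \<bullet> grad \<psi> x < 0" by simp
  have "((\<lambda>s. \<phi> (x + s *\<^sub>R v)) has_real_derivative (v \<bullet> grad \<phi> x)) (at 0)"
   using DERIV_along_line[of \<phi> x 0 v] d by simp
  from DERIV_pos_inc_right[OF this v] obtain d1 where d1: "d1 > 0"
   "!!h. h > 0 ==> h < d1 ==> \<phi> (x + h *\<^sub>R v) > 0" using z by auto
  have "((\<lambda>s. \<psi> (x + s *\<^sub>R v)) has_real_derivative (v \<bullet> grad \<psi> x)) (at 0)"
   using DERIV_along_line[of \<psi> x 0 v] d by simp
  from DERIV_neg_dec_right[OF this v2] obtain d2 where d2: "d2 > 0"
   "!!h. h > 0 ==> h < d2 ==> \<psi> (x + h *\<^sub>R v) < 0" using z by auto
  have "((\<lambda>h. x + h *\<^sub>R v) \<longlongrightarrow> x + 0 *\<^sub>R v) (at_right 0)" by (intro tendsto_intros)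
  then have "eventually (\<lambda>h. x + h *\<^sub>R v \<in> U \<inter> V) (at_right 0)"
   using U by (intro topological_tendstoD) auto
  moreover have "eventually (\<lambda>h. 0 < h \<and> h < min d1 d2) (at_right 0)"
   unfolding eventually_at_right_field using d1(1) d2(1) by (intro exI[of _ "min d1 d2"]) auto
  ultimately have "eventually (\<lambda>h. False) (at_right (0::real))"
  proof eventually_elim
   case (elim h)
   then have "\<phi> (x + h *\<^sub>R v) > 0" "\<psi> (x + h *\<^sub>R v) < 0" using d1 d2 by auto
   moreover have "\<Omega> \<inter> U = {y \<in> U. \<phi> y < 0}" "\<Omega> \<inter> V = {y \<in> V. \<psi> y < 0}"
    using 1 2 by (auto simp: local_defining_function_def)
   ultimately show False using elim by (auto simp: set_eq_iff dest!: spec[of _ "x + h *\<^sub>R v"])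
  qed
  then show False by (simp add: eventually_const)
 qed
 let ?a = "grad \<phi> x" and ?b = "grad \<psi> x"
 have a: "?a \<bullet> ?a > 0" "?b \<bullet> ?b > 0" using 1 2 U by (auto simp: local_defining_function_def)
 have "?a \<bullet> ?b \<ge> 0" using key[OF a(1)] .
 moreover have "?a \<bullet> ?b \<noteq> 0"
 proof
  assume 0: "?a \<bullet> ?b = 0"
  have "(?a - ?b) \<bullet> ?a > 0" using a 0 by (simp only: inner_diff_left inner_commute[of ?b ?a] diff_0_right)
  from key[OF this] show False using a 0 by (simp add: inner_diff_left)
 qed
 ultimately show ?thesis by linarith
qed

text \<open>Gluing local defining functions with bumps gives one on the whole space: on the boundary the
  gradients of the local functions have positive inner products, so they cannot cancel.\<close>

lemma global_defining_function:
 assumes adm: "admissible_domain \<Omega>"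
 obtains g where "Ck_on 2 UNIV g" "!!x. x \<in> \<Omega> ==> g x > 0" "!!x. x \<in> frontier \<Omega> ==> g x = 0"
  "!!x. x \<in> frontier \<Omega> ==> grad g x \<noteq> 0"
  "!!x w. x \<in> frontier \<Omega> ==> (!!n. outward_unit_normal \<Omega> x n ==> w \<bullet> n = 0) ==> w \<bullet> grad g x = 0"
proof -
 have O: "open \<Omega>" and bd: "bounded \<Omega>" using adm by (auto simp: admissible_domain_def)
 define good where "good = (\<lambda>a b U \<phi>. open U \<and> cbox a b \<subseteq> U \<and> Ck_on 2 U \<phi> \<and> (\<forall>y\<in>\<Omega> \<inter> U. \<phi> y < 0) \<and>
  (\<forall>y\<in>frontier \<Omega> \<inter> U. \<phi> y = 0 \<and> local_defining_function \<Omega> y U \<phi>))"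
 have "\<exists>a b U \<phi>. x \<in> box a b \<and> good a b U \<phi>" if x: "x \<in> closure \<Omega>" for x
 proof -
  have box: "\<exists>a b. x \<in> box a b \<and> cbox a b \<subseteq> U" if "open U" "x \<in> U" for U :: "(real^3) set"
   using open_contains_cbox that by (meson open_contains_cbox)
  show ?thesis
  proof (cases "x \<in> \<Omega>")
   case True
   obtain a b where ab: "x \<in> box a b" "cbox a b \<subseteq> \<Omega>" using box[OF O True] by auto
   have "good a b \<Omega> (\<lambda>x. -1)"
    using ab O frontier_disjoint_eq[of \<Omega>] by (auto simp: good_def)
   then show ?thesis using ab by blast
  next
   case False
   then have "x \<in> frontier \<Omega>" using x O by (simp add: frontier_def interior_open)
   then obtain U \<phi> where U: "local_defining_function \<Omega> x U \<phi>"
    using adm unfolding admissible_domain_def smooth_boundary_def by blast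
   then have "open U" "x \<in> U" by (auto simp: local_defining_function_def)
   then obtain a b where ab: "x \<in> box a b" "cbox a b \<subseteq> U" using box by metis
   have "good a b U \<phi>"
    using ab U unfolding good_def local_defining_function_def smooth_on_def by auto
   then show ?thesis using ab by blast
  qed
 qed
 then obtain A B U \<Phi> where G: "!!x. x \<in> closure \<Omega> ==> x \<in> box (A x) (B x) \<and> good (A x) (B x) (U x) (\<Phi> x)"
  by metis
 have "compact (closure \<Omega>)" using bd by (simp add: compact_closure)
 then obtain C where C: "C \<subseteq> closure \<Omega>" "finite C" "closure \<Omega> \<subseteq> (\<Union>c\<in>C. box (A c) (B c))"
  by (rule compactE_image[of "closure \<Omega>" "closure \<Omega>" "\<lambda>c. box (A c) (B c)"]) (use G in auto)
 define h where "h = (\<lambda>c y. if y \<in> U c then box_bump 1 (A c) (B c) y * (- \<Phi> c y) else 0)"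
 define g where "g = (\<lambda>y. \<Sum>c\<in>C. h c y)"
 have good: "open (U c)" "cbox (A c) (B c) \<subseteq> U c" "Ck_on 2 (U c) (\<Phi> c)"
  "!!y. y \<in> \<Omega> ==> y \<in> U c ==> \<Phi> c y < 0"
  "!!y. y \<in> frontier \<Omega> ==> y \<in> U c ==> \<Phi> c y = 0"
  "!!y. y \<in> frontier \<Omega> ==> y \<in> U c ==> local_defining_function \<Omega> y (U c) (\<Phi> c)" if "c \<in> C" for c
  using G[of c] C(1) that unfolding good_def by blast+
 have hC: "Ck_on 2 UNIV (h c)" if "c \<in> C" for c
  unfolding h_def
 proof (rule Ck_on_zero_extend[OF good(1)[OF that] closed_cbox good(2)[OF that]])
  show "Ck_on 2 (U c) (\<lambda>y. box_bump 1 (A c) (B c) y * - \<Phi> c y)"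
   by (intro Ck_on_mult Ck_on_uminus good that Ck_on_subset[OF subset_UNIV Ck_on_box_bump])
  show "box_bump 1 (A c) (B c) x * - \<Phi> c x = 0" if "x \<in> U c - cbox (A c) (B c)" for x
   using that box_bump_outside[of x "A c" "B c" 1] box_subset_cbox[of "A c" "B c"] by auto
 qed
 have gC: "Ck_on 2 UNIV g" unfolding g_def by (intro Ck_on_sum hC) auto
 have h_nonneg: "h c y \<ge> 0" if "y \<in> \<Omega>" "c \<in> C" for c y
  unfolding h_def using good(4)[OF that(2,1)] box_bump_bounds(1)[of 1 "A c" "B c" y]
  by (auto intro!: mult_nonneg_nonpos simp: less_imp_le)
 have gpos: "g x > 0" if x: "x \<in> \<Omega>" for x
 proof -
  obtain c where c: "c \<in> C" "x \<in> box (A c) (B c)" using C(3) x closure_subset by blast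
  then have xU: "x \<in> U c" using good(2)[OF c(1)] box_subset_cbox by blast
  have "h c x > 0"
   using xU box_bump_pos[OF _ c(2), of 1] good(4)[OF c(1) x xU] by (simp add: h_def mult_pos_neg)
  then show ?thesis unfolding g_def
   using C(2) c(1) h_nonneg[OF x] by (intro sum_pos2[of C c]) auto
 qed
 have hfr: "h c x = 0" if "x \<in> frontier \<Omega>" "c \<in> C" for x c
  using good(5)[OF that(2,1)] by (simp add: h_def)
 have gfr: "g x = 0" if "x \<in> frontier \<Omega>" for x
  unfolding g_def using hfr[OF that] by simp
 have hd: "h c differentiable (at x)" if "c \<in> C" for c x
  using Ck_on_differentiable[of 1 UNIV "h c" x] hC[OF that] by (simp add: numeral_2_eq_2)
 have grad_h: "pd i (h c) x = - box_bump 1 (A c) (B c) x * (if x \<in> U c then pd i (\<Phi> c) x else 0)"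
  if x: "x \<in> frontier \<Omega>" and c: "c \<in> C" for x c i
 proof (cases "x \<in> U c")
  case True
  have "pd i (h c) x = pd i (\<lambda>y. box_bump 1 (A c) (B c) y * (- \<Phi> c y)) x"
   by (rule pd_cong[OF good(1)[OF c] True]) (simp add: h_def)
  also have "\<dots> = pd i (box_bump 1 (A c) (B c)) x * (- \<Phi> c x) + box_bump 1 (A c) (B c) x * pd i (\<lambda>y. - \<Phi> c y) x"
  proof (rule pd_mult)
   show "box_bump 1 (A c) (B c) differentiable (at x)"
    by (rule Ck_on_differentiable[OF Ck_on_box_bump UNIV_I])
   show "(\<lambda>y. - \<Phi> c y) differentiable (at x)"
    using Ck_on_differentiable[of 1 "U c" "\<Phi> c" x] good(3)[OF c] True by (simp add: numeral_2_eq_2)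
  qed
  also have "pd i (\<lambda>y. - \<Phi> c y) x = - pd i (\<Phi> c) x"
   using Ck_on_differentiable[of 1 "U c" "\<Phi> c" x] good(3)[OF c] True
   by (intro pd_uminus) (simp add: numeral_2_eq_2)
  finally show ?thesis using good(5)[OF c x True] True by simp
 next
  case False
  then have "x \<in> - cbox (A c) (B c)" using good(2)[OF c] by blast
  then have "pd i (h c) x = pd i (\<lambda>y. 0) x"
  proof (rule pd_cong[rotated])
   show "h c y = 0" if "y \<in> - cbox (A c) (B c)" for y
    using that box_bump_outside[of y "A c" "B c" 1] box_subset_cbox[of "A c" "B c"] by (auto simp: h_def)
  qed (rule open_Compl[OF closed_cbox])
  then show ?thesis using False by simp
 qed
 have grad_g: "grad g x = (\<Sum>c\<in>C. - box_bump 1 (A c) (B c) x *\<^sub>R (if x \<in> U c then grad (\<Phi> c) x else 0))"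
  if x: "x \<in> frontier \<Omega>" for x
 proof -
  have "grad g x $ i = (\<Sum>c\<in>C. pd i (h c) x)" for i
   unfolding g_def grad_nth by (rule pd_sum) (rule hd)
  then show ?thesis
   by (auto simp: vec_eq_iff grad_h[OF x] grad_nth if_distrib[of "\<lambda>v. v $ _"] intro!: sum.cong)
 qed
 show ?thesis
 proof (rule that[OF gC gpos gfr])
  fix x assume x: "x \<in> frontier \<Omega>"
  obtain c0 where c0: "c0 \<in> C" "x \<in> box (A c0) (B c0)" using C(3) x by (auto simp: frontier_def)
  then have xU: "x \<in> U c0" using good(2)[OF c0(1)] box_subset_cbox by blast
  note L0 = good(6)[OF c0(1) x xU]
  define w where "w = (\<lambda>c. box_bump 1 (A c) (B c) x *\<^sub>R (if x \<in> U c then grad (\<Phi> c) x else 0) \<bullet> grad (\<Phi> c0) x)"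
  have "grad g x \<bullet> grad (\<Phi> c0) x = - (\<Sum>c\<in>C. w c)"
   by (simp add: grad_g[OF x] inner_sum_left sum_negf w_def)
  moreover have "w c \<ge> 0" if "c \<in> C" for c
   unfolding w_def using local_defining_function_grad_inner_pos[OF x good(6)[OF that x] L0]
   by (auto simp: box_bump_bounds less_imp_le)
  moreover have "w c0 > 0"
   unfolding w_def using local_defining_function_grad_inner_pos[OF x L0 L0] xU box_bump_pos[OF _ c0(2), of 1] by simp
  ultimately have "grad g x \<bullet> grad (\<Phi> c0) x < 0"
   using sum_pos2[OF C(2) c0(1), of w] by simp
  then show "grad g x \<noteq> 0" by auto
 next
  fix x w assume x: "x \<in> frontier \<Omega>" and n: "!!n. outward_unit_normal \<Omega> x n ==> w \<bullet> n = 0"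
  have "w \<bullet> grad (\<Phi> c) x = 0" if "c \<in> C" "x \<in> U c" for c
  proof -
   have L: "local_defining_function \<Omega> x (U c) (\<Phi> c)" by (rule good(6)[OF that(1) x that(2)])
   then have "outward_unit_normal \<Omega> x (grad (\<Phi> c) x /\<^sub>R norm (grad (\<Phi> c) x))"
    using x by (auto simp: outward_unit_normal_def)
   from n[OF this] show ?thesis using L that(2) by (auto simp: local_defining_function_def)
  qed
  then show "w \<bullet> grad g x = 0"
   by (auto simp: grad_g[OF x] inner_sum_right intro!: sum.neutral)
 qed
qed

lemma ball_infdist_frontier_subset:
 fixes \<Omega> :: "(real^3) set"
 assumes "x \<in> \<Omega>" shows "ball x (infdist x (frontier \<Omega>)) \<subseteq> \<Omega>"
proof (rule ccontr)
 assume n: "\<not> ball x (infdist x (frontier \<Omega>)) \<subseteq> \<Omega>"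
 then obtain z where z: "z \<in> ball x (infdist x (frontier \<Omega>))" "z \<notin> \<Omega>" by blast
 then have "infdist x (frontier \<Omega>) > 0" by (metis ball_eq_empty empty_iff not_le)
 then have "ball x (infdist x (frontier \<Omega>)) \<inter> frontier \<Omega> \<noteq> {}"
  using z assms centre_in_ball[of x "infdist x (frontier \<Omega>)"]
  by (intro connected_Int_frontier[OF connected_ball]) blast+
 then obtain y where "y \<in> frontier \<Omega>" "dist x y < infdist x (frontier \<Omega>)" by auto
 then show False using infdist_le[of y "frontier \<Omega>" x] by simp
qed

locale defining_function =
 fixes \<Omega> :: "(real^3) set" and g :: "real^3 \<Rightarrow> real"
 assumes O: "open \<Omega>" and bd: "bounded \<Omega>" and ne: "\<Omega> \<noteq> {}"
  and gC: "Ck_on 2 UNIV g" and gpos: "!!x. x \<in> \<Omega> ==> g x > 0"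
  and gfr: "!!x. x \<in> frontier \<Omega> ==> g x = 0" and ggr: "!!x. x \<in> frontier \<Omega> ==> grad g x \<noteq> 0"
begin

lemma gd: "g differentiable (at x)" "pd i g differentiable (at x)"
 and gcont: "continuous_on S g" "continuous_on S (pd i g)" "continuous_on S (pd i (pd j g))"
 and grad_cont: "continuous_on S (grad g)"
proof -
 have 2: "Ck_on (Suc (Suc 0)) UNIV g" using gC by (simp add: numeral_2_eq_2)
 show "g differentiable (at x)" by (rule Ck_on_differentiable[OF 2 UNIV_I])
 show "pd i g differentiable (at x)" by (rule Ck_on_differentiable[OF Ck_on_pd[OF 2] UNIV_I])
 show "continuous_on S g" using Ck_on_continuous[OF 2] continuous_on_subset by blast
 show *: "continuous_on S (pd i g)" for i using Ck_on_continuous[OF Ck_on_pd[OF 2]] continuous_on_subset by blast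
 show "continuous_on S (pd i (pd j g))" using Ck_on_continuous[OF Ck_on_pd[OF Ck_on_pd[OF 2]]] continuous_on_subset by blast
 show "continuous_on S (grad g)" unfolding grad_def grad_of_def [abs_def]
  by (intro continuous_on_vec_lambda *)
qed

lemma frontier_ne: "frontier \<Omega> \<noteq> {}"
proof
 assume "frontier \<Omega> = {}"
 then have "\<Omega> = UNIV" using ne frontier_eq_empty by blast
 then show False using bd not_bounded_UNIV by blast
qed

lemma compacts: "compact (closure \<Omega>)" "compact (frontier \<Omega>)"
 using bd by (auto simp: compact_closure compact_frontier_bounded)

lemma grad_near_boundary:
 obtains r c where "r > 0" "c > 0"
  "!!x y. x \<in> \<Omega> ==> infdist x (frontier \<Omega>) < r ==> dist x y < r ==> norm (grad g x) \<ge> c \<and> norm (grad g y - grad g x) \<le> c / 4"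
proof -
 obtain z where z: "z \<in> frontier \<Omega>" "!!y. y \<in> frontier \<Omega> ==> norm (grad g z) \<le> norm (grad g y)"
  using continuous_attains_inf[OF compacts(2) frontier_ne continuous_on_norm[OF grad_cont]] by blast
 define c where "c = norm (grad g z) / 2"
 have c: "c > 0" using ggr[OF z(1)] by (simp add: c_def)
 obtain R where R: "!!x. x \<in> closure \<Omega> ==> norm x \<le> R"
  using compact_imp_bounded[OF compacts(1)] by (auto simp: bounded_iff)
 have "uniformly_continuous_on (cball 0 (R + 1)) (grad g)"
  by (rule compact_uniformly_continuous[OF grad_cont compact_cball])
 then obtain d where d: "d > 0" "!!x y. norm x \<le> R + 1 ==> norm y \<le> R + 1 ==> dist y x < d ==> dist (grad g y) (grad g x) < c / 4"
  unfolding uniformly_continuous_on_def using c by (metis (no_types, lifting) divide_pos_pos mem_cball_0 zero_less_numeral)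
 define r where "r = min d 1"
 show ?thesis
 proof (rule that[of r c])
  show "r > 0" using d by (simp add: r_def)
  show "c > 0" by (rule c)
  fix x y assume x: "x \<in> \<Omega>" "infdist x (frontier \<Omega>) < r" and y: "dist x y < r"
  have nx: "norm x \<le> R" using R x closure_subset by blast
  obtain w where w: "w \<in> frontier \<Omega>" "infdist x (frontier \<Omega>) = dist x w"
   using infdist_attains_inf[OF frontier_closed frontier_ne] by blast
  have nw: "norm w \<le> R" using R w by (simp add: frontier_def)
  have "dist (grad g x) (grad g w) < c / 4"
   using d(2)[of w x] nx nw x(2) w(2) by (simp add: r_def)
  then have "norm (grad g x) > norm (grad g w) - c / 4"
   by (smt (verit) dist_norm norm_triangle_ineq2 norm_minus_commute)
  then have "norm (grad g x) \<ge> c" using z(2)[OF w(1)] c unfolding c_def by linarith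
  moreover have "norm y \<le> R + 1"
   using nx y norm_triangle_sub[of y x] by (simp add: r_def dist_norm norm_minus_commute)
  then have "norm (grad g y - grad g x) \<le> c / 4"
   using d(2)[of x y] nx y by (simp add: r_def dist_commute dist_norm norm_minus_commute)
  ultimately show "norm (grad g x) \<ge> c \<and> norm (grad g y - grad g x) \<le> c / 4" by blast
 qed
qed

lemma increasing_along:
 assumes "s \<ge> 0" "!!\<sigma>. 0 \<le> \<sigma> ==> \<sigma> \<le> s ==> w \<bullet> grad g (x + \<sigma> *\<^sub>R w) \<ge> m"
 shows "g (x + s *\<^sub>R w) \<ge> g x + m * s"
proof -
 have "(\<lambda>\<sigma>. g (x + \<sigma> *\<^sub>R w) - m * \<sigma>) 0 \<le> (\<lambda>\<sigma>. g (x + \<sigma> *\<^sub>R w) - m * \<sigma>) s"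
 proof (rule DERIV_nonneg_imp_nondecreasing[OF assms(1)])
  fix \<sigma> assume "0 \<le> \<sigma>" "\<sigma> \<le> s"
  then show "\<exists>y. ((\<lambda>\<sigma>. g (x + \<sigma> *\<^sub>R w) - m * \<sigma>) has_real_derivative y) (at \<sigma>) \<and> 0 \<le> y"
   using assms(2)[of \<sigma>] by (intro exI[of _ "w \<bullet> grad g (x + \<sigma> *\<^sub>R w) - m"] conjI)
    (auto intro!: derivative_eq_intros DERIV_along_line gd)
 qed
 then show ?thesis by simp
qed

text \<open>Near the boundary the gradient of \<open>g\<close> is bounded away from zero, so \<open>g\<close> grows at least linearly with the
  distance; on the rest of the domain it has a positive minimum.\<close>

lemma ge_infdist: obtains c where "c > 0" "!!x. x \<in> \<Omega> ==> c * infdist x (frontier \<Omega>) \<le> g x"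
proof -
 obtain r c where r: "r > 0" "c > 0" and
  rc: "!!x y. x \<in> \<Omega> ==> infdist x (frontier \<Omega>) < r ==> dist x y < r ==> norm (grad g x) \<ge> c \<and> norm (grad g y - grad g x) \<le> c / 4"
  by (rule grad_near_boundary, rule that)
 have near: "c / 4 * infdist x (frontier \<Omega>) \<le> g x" if x: "x \<in> \<Omega>" "infdist x (frontier \<Omega>) < r" for x
 proof -
  let ?d = "infdist x (frontier \<Omega>)"
  define e where "e = grad g x /\<^sub>R norm (grad g x)"
  define s where "s = ?d / 2"
  have n: "norm (grad g x) \<ge> c" using rc[OF x, of x] r by simp
  then have e: "norm e = 1" "e \<bullet> grad g x = norm (grad g x)"
  proof -
   have "grad g x \<noteq> 0" using n r by auto
   then show "norm e = 1" "e \<bullet> grad g x = norm (grad g x)"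
    by (simp_all add: e_def power2_norm_eq_inner[symmetric] power2_eq_square)
  qed
  have s: "0 \<le> s" "s \<le> ?d" using infdist_nonneg by (auto simp: s_def)
  have "g ((x - s *\<^sub>R e) + s *\<^sub>R e) \<ge> g (x - s *\<^sub>R e) + c / 2 * s"
  proof (rule increasing_along[OF s(1)])
   fix \<sigma> assume \<sigma>: "0 \<le> \<sigma>" "\<sigma> \<le> s"
   let ?y = "x - s *\<^sub>R e + \<sigma> *\<^sub>R e"
   have "dist x ?y = \<bar>s - \<sigma>\<bar> * norm e" by (simp add: dist_norm scaleR_left_diff_distrib[symmetric])
   also have "\<dots> < r" using \<sigma> s x e by simp
   finally have y: "norm (grad g ?y - grad g x) \<le> c / 4" using rc[OF x] by blast
   have "\<bar>e \<bullet> (grad g ?y - grad g x)\<bar> \<le> c / 4"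
    using Cauchy_Schwarz_ineq2[of e "grad g ?y - grad g x"] y e by simp
   then show "e \<bullet> grad g ?y \<ge> c / 2" using e n r unfolding inner_diff_right by linarith
  qed
  moreover have "g (x - s *\<^sub>R e) \<ge> 0"
  proof (cases "?d = 0")
   case True then show ?thesis using gpos[OF x(1)] by (simp add: s_def)
  next
   case False
   then have "s < ?d" using infdist_nonneg[of x "frontier \<Omega>"] by (simp add: s_def)
   then have "x - s *\<^sub>R e \<in> ball x ?d" using e s by (simp add: dist_norm)
   then have "x - s *\<^sub>R e \<in> \<Omega>" using ball_infdist_frontier_subset[OF x(1)] by blast
   then show ?thesis using gpos by (simp add: less_imp_le)
  qed
  ultimately show ?thesis by (simp add: s_def)
 qed
 define K where "K = closure \<Omega> \<inter> {x. r \<le> infdist x (frontier \<Omega>)}"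
 have K: "compact K" unfolding K_def
  by (intro compact_Int_closed compacts closed_Collect_le continuous_intros) 
 have KO: "x \<in> \<Omega>" if "x \<in> K" for x
 proof (rule ccontr)
  assume "x \<notin> \<Omega>"
  then have "x \<in> frontier \<Omega>" using that O by (auto simp: K_def frontier_def interior_open)
  then show False using that r by (auto simp: K_def)
 qed
 obtain D where D: "!!x. x \<in> \<Omega> ==> infdist x (frontier \<Omega>) \<le> D" "D > 0"
 proof -
  obtain w where w: "w \<in> frontier \<Omega>" using frontier_ne by auto
  have "infdist x (frontier \<Omega>) \<le> diameter (closure \<Omega>) + 1" if "x \<in> \<Omega>" for x
  proof -
   have "dist x w \<le> diameter (closure \<Omega>)"
    using that w closure_subset compact_imp_bounded[OF compacts(1)]
    by (intro diameter_bounded_bound) (auto simp: frontier_def)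
   then show ?thesis using infdist_le[OF w, of x] by simp
  qed
  moreover have "diameter (closure \<Omega>) + 1 > 0" using diameter_ge_0[OF compact_imp_bounded[OF compacts(1)]] by simp
  ultimately show ?thesis using that by blast
 qed
 obtain m where m: "m > 0" "!!x. x \<in> K ==> m \<le> g x"
 proof (cases "K = {}")
  case True then show ?thesis using that[of 1] by simp
 next
  case False
  then obtain z where "z \<in> K" "!!y. y \<in> K ==> g z \<le> g y"
   using continuous_attains_inf[OF K False gcont(1)] by blast
  then show ?thesis using that[of "g z"] gpos KO by blast
 qed
 show ?thesis
 proof (rule that[of "min (c / 4) (m / D)"])
  show "min (c / 4) (m / D) > 0" using r m D by simp
  fix x assume x: "x \<in> \<Omega>"
  let ?d = "infdist x (frontier \<Omega>)"
  show "min (c / 4) (m / D) * ?d \<le> g x"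
  proof (cases "?d < r")
   case True
   have "min (c / 4) (m / D) * ?d \<le> c / 4 * ?d"
    by (rule mult_right_mono[OF min.cobounded1 infdist_nonneg])
   then show ?thesis using near[OF x True] by simp
  next
   case False
   then have "m \<le> g x" using x closure_subset by (intro m(2)) (auto simp: K_def)
   moreover have "min (c / 4) (m / D) * ?d \<le> (m / D) * D"
    using D m infdist_nonneg[of x "frontier \<Omega>"] by (intro mult_mono D(1) x) (auto intro!: divide_nonneg_nonneg)
   ultimately show ?thesis using D(2) by simp
  qed
 qed
qed

text \<open>Near the boundary the cone opens in the direction of \<open>grad g\<close>, along which \<open>g\<close> increases; elsewhere a ball
  of fixed radius fits into the domain.\<close>

lemma uniform_cone:
 obtains \<kappa> h0 where "\<kappa> > 0" "h0 > 0"
  "!!x. x \<in> \<Omega> ==> \<exists>e. norm e \<le> 1 \<and> (\<forall>w\<in>cbox (e - vec \<kappa>) (e + vec \<kappa>). \<forall>s. 0 < s \<and> s \<le> h0 \<longrightarrow> x + s *\<^sub>R w \<in> \<Omega>)"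
proof -
 obtain r c where r: "r > 0" "c > 0" and
  rc: "!!x y. x \<in> \<Omega> ==> infdist x (frontier \<Omega>) < r ==> dist x y < r ==> norm (grad g x) \<ge> c \<and> norm (grad g y - grad g x) \<le> c / 4"
  by (rule grad_near_boundary, rule that)
 define \<kappa> where "\<kappa> = (1/24 :: real)"
 define h0 where "h0 = r / 4"
 have wb: "norm (w - e) \<le> 1 / 8" if "w \<in> cbox (e - vec \<kappa>) (e + vec \<kappa>)" for w e :: "real^3"
 proof -
  have "norm (w - e) \<le> (\<Sum>i\<in>UNIV. \<bar>(w - e) $ i\<bar>)" by (rule norm_le_l1_cart)
  also have "\<dots> \<le> (\<Sum>i\<in>(UNIV::3 set). \<kappa>)"
   using that by (intro sum_mono) (auto simp: mem_box_cart abs_le_iff algebra_simps)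
  finally show ?thesis by (simp add: \<kappa>_def)
 qed
 have "\<exists>e. norm e \<le> 1 \<and> (\<forall>w\<in>cbox (e - vec \<kappa>) (e + vec \<kappa>). \<forall>s. 0 < s \<and> s \<le> h0 \<longrightarrow> x + s *\<^sub>R w \<in> \<Omega>)"
  if x: "x \<in> \<Omega>" for x
 proof (cases "infdist x (frontier \<Omega>) < r")
  case False
  have "x + s *\<^sub>R w \<in> \<Omega>" if w: "w \<in> cbox (0 - vec \<kappa>) (0 + vec \<kappa>)" and s: "0 < s" "s \<le> h0" for w s
  proof -
   have "norm (s *\<^sub>R w) \<le> h0 * (1 / 8)" using wb[OF w] s unfolding norm_scaleR by (intro mult_mono) auto
   also have "\<dots> < infdist x (frontier \<Omega>)" using False r by (simp add: h0_def)
   finally have "x + s *\<^sub>R w \<in> ball x (infdist x (frontier \<Omega>))" by (simp add: dist_norm)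
   then show ?thesis using ball_infdist_frontier_subset[OF x] by blast
  qed
  then show ?thesis by (intro exI[of _ 0]) auto
 next
  case True
  define e where "e = grad g x /\<^sub>R norm (grad g x)"
  have n: "norm (grad g x) \<ge> c" using rc[OF x True, of x] r by simp
  then have e: "norm e = 1" "e \<bullet> grad g x = norm (grad g x)"
  proof -
   have "grad g x \<noteq> 0" using n r by auto
   then show "norm e = 1" "e \<bullet> grad g x = norm (grad g x)"
    by (simp_all add: e_def power2_norm_eq_inner[symmetric] power2_eq_square)
  qed
  have "x + s *\<^sub>R w \<in> \<Omega>" if w: "w \<in> cbox (e - vec \<kappa>) (e + vec \<kappa>)" and s: "0 < s" "s \<le> h0" for w s
  proof -
   have nw: "norm w \<le> 2" using wb[OF w] e norm_triangle_sub[of w e] by simp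
   have pos: "g (x + \<sigma> *\<^sub>R w) > 0" if \<sigma>: "0 \<le> \<sigma>" "\<sigma> \<le> s" for \<sigma>
   proof -
    have "g (x + \<sigma> *\<^sub>R w) \<ge> g x + 0 * \<sigma>"
    proof (rule increasing_along[OF \<sigma>(1)])
     fix \<tau> assume \<tau>: "0 \<le> \<tau>" "\<tau> \<le> \<sigma>"
     let ?y = "x + \<tau> *\<^sub>R w"
     have "dist x ?y \<le> h0 * 2" using \<tau> \<sigma> s nw by (auto simp: dist_norm intro!: mult_mono)
     also have "\<dots> < r" using r by (simp add: h0_def)
     finally have y: "norm (grad g ?y - grad g x) \<le> c / 4" using rc[OF x True] by blast
     have 1: "\<bar>e \<bullet> (grad g ?y - grad g x)\<bar> \<le> c / 4"
      using Cauchy_Schwarz_ineq2[of e "grad g ?y - grad g x"] y e by simp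
     have "norm (grad g ?y) \<le> norm (grad g x) + c / 4"
      using norm_triangle_sub[of "grad g ?y" "grad g x"] y by simp
     then have "norm (w - e) * norm (grad g ?y) \<le> 1 / 8 * (norm (grad g x) + c / 4)"
      using wb[OF w] by (intro mult_mono) auto
     then have 2: "\<bar>(w - e) \<bullet> grad g ?y\<bar> \<le> 1 / 8 * (norm (grad g x) + c / 4)"
      using Cauchy_Schwarz_ineq2[of "w - e" "grad g ?y"] by simp
     have "w \<bullet> grad g ?y = e \<bullet> grad g x + e \<bullet> (grad g ?y - grad g x) + (w - e) \<bullet> grad g ?y"
      by (simp add: inner_diff_left inner_diff_right)
     then show "0 \<le> w \<bullet> grad g ?y" using 1 2 n e r by (simp add: abs_le_iff)
    qed
    then show ?thesis using gpos[OF x] by simp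
   qed
   show ?thesis
   proof (rule ccontr)
    assume "x + s *\<^sub>R w \<notin> \<Omega>"
    then have "closed_segment x (x + s *\<^sub>R w) \<inter> frontier \<Omega> \<noteq> {}"
     using x by (intro connected_Int_frontier) auto
    then obtain z where z: "z \<in> closed_segment x (x + s *\<^sub>R w)" "z \<in> frontier \<Omega>" by auto
    then obtain v where v: "0 \<le> v" "v \<le> 1" "z = (1 - v) *\<^sub>R x + v *\<^sub>R (x + s *\<^sub>R w)"
     by (auto simp: closed_segment_def)
    then have "z = x + (v * s) *\<^sub>R w" by (simp add: algebra_simps)
    moreover have "v * s \<le> s" "0 \<le> v * s" using v s mult_right_le_one_le[of s v] by (auto simp: mult.commute)
    ultimately show False using pos[of "v * s"] gfr[OF z(2)] by simp
   qed
  qed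
  then show ?thesis using e by (intro exI[of _ e]) auto
 qed
 moreover have "\<kappa> > 0" "h0 > 0" using r by (auto simp: \<kappa>_def h0_def)
 ultimately show ?thesis using that by blast
qed

text \<open>The function \<open>v \<bullet> grad g\<close> is Lipschitz continuous and vanishes on the boundary. It is therefore bounded by a
  multiple of the distance to the boundary, hence of \<open>g\<close>.\<close>

lemma normal_flux_bound:
 obtains C where "C \<ge> 0"
  "!!v x. continuous_on (closure \<Omega>) v ==> (!!y. y \<in> \<Omega> ==> norm (v y) \<le> V) ==>
   (!!y. y \<in> \<Omega> ==> v differentiable (at y)) ==> (!!y i. y \<in> \<Omega> ==> norm (pd i v y) \<le> L) ==>
   (!!y. y \<in> frontier \<Omega> ==> v y \<bullet> grad g y = 0) ==> x \<in> \<Omega> ==> \<bar>v x \<bullet> grad g x\<bar> \<le> C * g x"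
proof -
 have bnd: "\<exists>B. \<forall>x\<in>closure \<Omega>. \<bar>f x\<bar> \<le> B" if "continuous_on (closure \<Omega>) f" for f :: "real^3 \<Rightarrow> real"
  using compact_imp_bounded[OF compact_continuous_image[OF that compacts(1)]] by (auto simp: bounded_iff)
 obtain B1 where B1: "!!x i. x \<in> closure \<Omega> ==> \<bar>pd i g x\<bar> \<le> B1"
 proof -
  have "\<forall>i. \<exists>B. \<forall>x\<in>closure \<Omega>. \<bar>pd i g x\<bar> \<le> B" using bnd gcont(2) by blast
  then obtain B where B: "!!i x. x \<in> closure \<Omega> ==> \<bar>pd i g x\<bar> \<le> B i" by metis
  have "\<bar>pd i g x\<bar> \<le> (\<Sum>i\<in>UNIV. \<bar>B i\<bar>)" if "x \<in> closure \<Omega>" for i x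
   using B[OF that, of i] member_le_sum[of i UNIV "\<lambda>i. \<bar>B i\<bar>"] by simp
  then show ?thesis using that by blast
 qed
 obtain B2 where B2: "!!x i j. x \<in> closure \<Omega> ==> \<bar>pd i (pd j g) x\<bar> \<le> B2"
 proof -
  have "\<forall>p. \<exists>B. \<forall>x\<in>closure \<Omega>. \<bar>pd (fst p) (pd (snd p) g) x\<bar> \<le> B" using bnd gcont(3) by blast
  then obtain B where B: "!!p x. x \<in> closure \<Omega> ==> \<bar>pd (fst p) (pd (snd p) g) x\<bar> \<le> B p" by metis
  have "\<bar>pd i (pd j g) x\<bar> \<le> (\<Sum>p\<in>UNIV. \<bar>B p\<bar>)" if "x \<in> closure \<Omega>" for i j x
   using B[OF that, of "(i, j)"] member_le_sum[of "(i, j)" UNIV "\<lambda>p. \<bar>B p\<bar>"] by simp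
  then show ?thesis using that by blast
 qed
 obtain c where c: "c > 0" "!!x. x \<in> \<Omega> ==> c * infdist x (frontier \<Omega>) \<le> g x" by (rule ge_infdist, rule that)
 define D where "D = 9 * (\<bar>L\<bar> * \<bar>B1\<bar> + \<bar>V\<bar> * \<bar>B2\<bar>)"
 have D: "D \<ge> 0" by (simp add: D_def)
 show ?thesis
 proof (rule that[of "D / c"])
  show "D / c \<ge> 0" using D c by simp
  fix v x
  assume vc: "continuous_on (closure \<Omega>) v" and vV: "!!y. y \<in> \<Omega> ==> norm (v y) \<le> V"
   and vd: "!!y. y \<in> \<Omega> ==> v differentiable (at y)" and vL: "!!y i. y \<in> \<Omega> ==> norm (pd i v y) \<le> L"
   and v0: "!!y. y \<in> frontier \<Omega> ==> v y \<bullet> grad g y = 0" and x: "x \<in> \<Omega>"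
  define f where "f = (\<lambda>y. \<Sum>j\<in>UNIV. v y $ j * pd j g y)"
  have f: "f y = v y \<bullet> grad g y" for y by (simp add: f_def inner_grad)
  have fc: "continuous_on (closure \<Omega>) f" unfolding f_def by (intro continuous_intros vc gcont)
  have vj: "(\<lambda>y. v y $ j) differentiable (at y)" if "y \<in> \<Omega>" for y j
   using bounded_linear.has_derivative[OF bounded_linear_vec_nth has_derivative_pd[OF vd[OF that]]]
   by (rule differentiableI)
  have fd: "f differentiable (at y)" if "y \<in> \<Omega>" for y
   unfolding f_def by (intro differentiable_sum ballI differentiable_mult vj that gd finite)
  have fpd: "\<bar>pd i f y\<bar> \<le> D / 3" if y: "y \<in> \<Omega>" for y i
  proof -
   have yc: "y \<in> closure \<Omega>" using y closure_subset by blast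
   have "pd i f y = (\<Sum>j\<in>UNIV. pd i v y $ j * pd j g y + v y $ j * pd i (pd j g) y)"
    unfolding f_def using vj[OF y] gd vd[OF y] by (simp add: pd_sum pd_mult pd_nth)
   also have "\<bar>\<dots>\<bar> \<le> (\<Sum>j\<in>(UNIV::3 set). \<bar>L\<bar> * \<bar>B1\<bar> + \<bar>V\<bar> * \<bar>B2\<bar>)"
   proof (rule order_trans[OF sum_abs sum_mono])
    fix j :: 3
    have 1: "\<bar>pd i v y $ j\<bar> \<le> \<bar>L\<bar>" using component_le_norm_cart[of "pd i v y" j] vL[OF y, of i] by linarith
    have 2: "\<bar>v y $ j\<bar> \<le> \<bar>V\<bar>" using component_le_norm_cart[of "v y" j] vV[OF y] by linarith
    have "\<bar>pd i v y $ j * pd j g y + v y $ j * pd i (pd j g) y\<bar>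
     \<le> \<bar>pd i v y $ j\<bar> * \<bar>pd j g y\<bar> + \<bar>v y $ j\<bar> * \<bar>pd i (pd j g) y\<bar>"
     by (metis abs_mult abs_triangle_ineq)
    also have "\<dots> \<le> \<bar>L\<bar> * \<bar>B1\<bar> + \<bar>V\<bar> * \<bar>B2\<bar>"
     using 1 2 B1[OF yc, of j] B2[OF yc, of i j] by (intro add_mono mult_mono) auto
    finally show "\<bar>pd i v y $ j * pd j g y + v y $ j * pd i (pd j g) y\<bar> \<le> \<bar>L\<bar> * \<bar>B1\<bar> + \<bar>V\<bar> * \<bar>B2\<bar>" .
   qed
   finally show ?thesis by (simp add: D_def)
  qed
  obtain z where z: "z \<in> frontier \<Omega>" "infdist x (frontier \<Omega>) = dist x z"
   using infdist_attains_inf[OF frontier_closed frontier_ne] by blast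
  have seg: "x + s *\<^sub>R (z - x) \<in> \<Omega>" if "0 \<le> s" "s < 1" for s
  proof (cases "x = z")
   case False
   then have "s * dist x z < dist x z" using that by simp
   then have "x + s *\<^sub>R (z - x) \<in> ball x (dist x z)" using that by (simp add: dist_norm norm_minus_commute)
   then show ?thesis using ball_infdist_frontier_subset[OF x] z by auto
  qed (use x in simp)
  have segc: "x + s *\<^sub>R (z - x) \<in> closure \<Omega>" if "0 \<le> s" "s \<le> 1" for s
   using seg[of s] that z(1) closure_subset by (cases "s = 1") (auto simp: frontier_def)
  have "\<exists>s\<in>{0<..<1}. norm (f (x + 1 *\<^sub>R (z - x)) - f (x + 0 *\<^sub>R (z - x)))
   \<le> norm ((\<lambda>r. r * ((z - x) \<bullet> grad f (x + s *\<^sub>R (z - x)))) (1 - 0))"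
  proof (rule mvt_general[of 0 1 "\<lambda>s. f (x + s *\<^sub>R (z - x))" "\<lambda>s r. r * ((z - x) \<bullet> grad f (x + s *\<^sub>R (z - x)))"])
   show "continuous_on {0..1} (\<lambda>s. f (x + s *\<^sub>R (z - x)))"
    by (intro continuous_on_compose2[OF fc] continuous_intros) (use segc in auto)
   fix s :: real assume "0 < s" "s < 1"
   then have "f differentiable (at (x + s *\<^sub>R (z - x)))" using fd seg by auto
   from DERIV_along_line[OF this]
   show "((\<lambda>s. f (x + s *\<^sub>R (z - x))) has_derivative (\<lambda>r. r * ((z - x) \<bullet> grad f (x + s *\<^sub>R (z - x))))) (at s)"
    by (simp add: has_field_derivative_def mult_commute_abs)
  qed simp
  then obtain s where s: "0 < s" "s < 1" "\<bar>f x\<bar> \<le> \<bar>(z - x) \<bullet> grad f (x + s *\<^sub>R (z - x))\<bar>"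
   using v0[OF z(1)] by (auto simp: f)
  let ?y = "x + s *\<^sub>R (z - x)"
  have "norm (grad f ?y) \<le> (\<Sum>i\<in>UNIV. \<bar>grad f ?y $ i\<bar>)" by (rule norm_le_l1_cart)
  also have "\<dots> \<le> (\<Sum>i\<in>(UNIV::3 set). D / 3)"
   using fpd[of ?y] seg s by (intro sum_mono) (auto simp: grad_nth)
  finally have n: "norm (grad f ?y) \<le> D" by simp
  have "\<bar>f x\<bar> \<le> norm (z - x) * norm (grad f ?y)" using s(3) Cauchy_Schwarz_ineq2[of "z - x" "grad f ?y"] by simp
  also have "\<dots> \<le> infdist x (frontier \<Omega>) * D" using n z(2) by (intro mult_mono) (auto simp: dist_norm norm_minus_commute)
  also have "\<dots> \<le> (g x / c) * D" using c(2)[OF x] c(1) D by (intro mult_right_mono) (auto simp: field_simps)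
  finally show "\<bar>v x \<bullet> grad g x\<bar> \<le> D / c * g x" by (simp add: f field_simps)
 qed
qed

end

section \<open>Morrey's inequality\<close>

lemma le_powr_split:
 fixes g A p :: real
 assumes "g \<ge> 0" "A > 0" "p \<ge> 1"
 shows "g \<le> A + g powr p * A powr (1 - p)"
proof (cases "g \<le> A")
 case False
 then have g: "g > 0" using assms by simp
 have "g = g powr p * g powr (1 - p)" using g by (simp add: powr_add[symmetric])
 also have "\<dots> \<le> g powr p * A powr (1 - p)"
  using False assms by (intro mult_left_mono powr_mono2') auto
 finally show ?thesis using assms by linarith
qed (use assms in \<open>simp add: add_increasing2\<close>)

lemma Lp_integral_bound:
 fixes G :: "real^3 \<Rightarrow> 'b::euclidean_space" and \<psi> :: "real^3 \<Rightarrow> real"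
 assumes OL: "\<Omega> \<in> sets lebesgue" and p: "p > 1" and G: "Lp p \<Omega> G" "Lp_norm p \<Omega> G \<le> N"
  and S: "S \<in> lmeasurable" "S \<subseteq> \<Omega>" "measure lebesgue S > 0"
  and \<psi>: "\<psi> \<in> borel_measurable (lebesgue_on \<Omega>)" "!!x. \<bar>\<psi> x\<bar> \<le> M" "!!x. x \<notin> S ==> \<psi> x = 0"
 shows "norm (\<integral>x. \<psi> x *\<^sub>R G x \<partial>lebesgue_on \<Omega>) \<le> 2 * M * N * measure lebesgue S powr (1 - 1 / p)"
proof -
 let ?m = "measure lebesgue S"
 have M: "M \<ge> 0" using \<psi>(2)[of undefined] by linarith
 have pos: "norm (\<integral>x. \<psi> x *\<^sub>R G x \<partial>lebesgue_on \<Omega>) \<le> 2 * M * ?m powr (1 - 1 / p) * N'" if N': "N' > 0" "Lp_norm p \<Omega> G \<le> N'" for N'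
 proof -
  define A where "A = N' * ?m powr (- (1 / p))"
  have A: "A > 0" using N' S by (simp add: A_def)
  let ?b = "\<lambda>x. M * (A * indicator S x + norm (G x) powr p * A powr (1 - p))"
  have iS: "integrable (lebesgue_on \<Omega>) (indicator S :: _ \<Rightarrow> real)"
  proof -
   have "integrable lebesgue (indicator S :: _ \<Rightarrow> real)"
    using S(1) by (simp add: lmeasurable_iff_integrable)
   moreover have "(\<lambda>x. indicator \<Omega> x *\<^sub>R (indicator S x :: real)) = indicator S"
    using S(2) by (auto simp: indicator_def fun_eq_iff)
   ultimately show ?thesis using OL by (simp add: integrable_restrict_space)
  qed
  have mS: "(\<integral>x. indicator S x \<partial>lebesgue_on \<Omega>) = ?m"
   using S(2) OL by (simp add: measure_restrict_space inf_absorb1)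
  have iG: "integrable (lebesgue_on \<Omega>) (\<lambda>x. norm (G x) powr p)" using G by (simp add: Lp_def)
  have ib: "integrable (lebesgue_on \<Omega>) ?b" using iS iG by simp
  have le: "norm (\<psi> x *\<^sub>R G x) \<le> ?b x" for x
  proof (cases "x \<in> S")
   case True
   have "norm (\<psi> x *\<^sub>R G x) \<le> M * norm (G x)" using \<psi>(2)[of x] by (simp add: mult_right_mono)
   also have "\<dots> \<le> M * (A + norm (G x) powr p * A powr (1 - p))"
    using le_powr_split[of "norm (G x)" A p] A p M by (intro mult_left_mono) auto
   finally show ?thesis using True by simp
  next
   case False then show ?thesis using \<psi>(3) M A by simp
  qed
  have i: "integrable (lebesgue_on \<Omega>) (\<lambda>x. \<psi> x *\<^sub>R G x)"
   by (rule Bochner_Integration.integrable_bound[OF ib])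
    (use \<psi>(1) G(1) le in \<open>auto simp: Lp_def intro!: AE_I2 order_trans[OF le abs_ge_self, simplified] borel_measurable_scaleR\<close>)
  have "norm (\<integral>x. \<psi> x *\<^sub>R G x \<partial>lebesgue_on \<Omega>) \<le> (\<integral>x. ?b x \<partial>lebesgue_on \<Omega>)"
   by (rule order_trans[OF integral_norm_bound integral_mono[OF integrable_norm[OF i] ib le]])
  also have "\<dots> = M * (A * ?m + Lp_norm p \<Omega> G powr p * A powr (1 - p))"
   using iS iG mS p by (simp add: Lp_norm_powr)
  also have "\<dots> \<le> M * (A * ?m + N' powr p * A powr (1 - p))"
   using N' p M Lp_norm_nonneg[of p \<Omega> G] by (intro mult_left_mono add_left_mono mult_right_mono powr_mono2) auto
  also have "A * ?m = N' * ?m powr (1 - 1 / p)"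
  proof -
   have "?m powr (- (1 / p)) * ?m = ?m powr (1 - 1 / p)"
    using S(3) powr_add[of ?m "- (1 / p)" 1] by simp
   then show ?thesis by (simp add: A_def mult.assoc)
  qed
  also have "N' powr p * A powr (1 - p) = N' * ?m powr (1 - 1 / p)"
  proof -
   have "A powr (1 - p) = N' powr (1 - p) * ?m powr (- (1 / p) * (1 - p))"
    using N' S(3) by (simp add: A_def powr_mult powr_powr)
   also have "- (1 / p) * (1 - p) = 1 - 1 / p" using p by (simp add: field_simps)
   finally have "N' powr p * A powr (1 - p) = (N' powr p * N' powr (1 - p)) * ?m powr (1 - 1 / p)" by simp
   also have "N' powr p * N' powr (1 - p) = N'" using N' by (simp add: powr_add[symmetric])
   finally show ?thesis .
  qed
  finally show ?thesis by (simp add: algebra_simps)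
 qed
 have N: "N \<ge> 0" using Lp_norm_nonneg[of p \<Omega> G] G(2) by linarith
 have "(\<lambda>n. 2 * M * ?m powr (1 - 1 / p) * (N + 1 / real (Suc n))) \<longlonglongrightarrow> 2 * M * ?m powr (1 - 1 / p) * (N + 0)"
  by (intro tendsto_intros LIMSEQ_Suc[OF lim_1_over_n])
 then have "norm (\<integral>x. \<psi> x *\<^sub>R G x \<partial>lebesgue_on \<Omega>) \<le> 2 * M * ?m powr (1 - 1 / p) * (N + 0)"
 proof (rule LIMSEQ_le_const, intro exI allI impI)
  fix n
  have "N + 1 / real (Suc n) > 0" using N by (simp add: add_nonneg_pos)
  moreover have "Lp_norm p \<Omega> G \<le> N + 1 / real (Suc n)" using G(2) by (simp add: add_increasing2)
  ultimately show "norm (\<integral>x. \<psi> x *\<^sub>R G x \<partial>lebesgue_on \<Omega>) \<le> 2 * M * ?m powr (1 - 1 / p) * (N + 1 / real (Suc n))"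
   using pos by blast
 qed
 then show ?thesis by (simp add: mult.assoc mult.left_commute mult.commute)
qed

definition bump :: "real^3 \<Rightarrow> real^3 \<Rightarrow> real^3 \<Rightarrow> real" where
 "bump = box_bump 1"

lemma Ck_on_bump: "Ck_on k UNIV (bump a b)"
 unfolding bump_def by (rule Ck_on_box_bump)

lemma bump_bounds: "0 \<le> bump a b w" "bump a b w \<le> 1"
 unfolding bump_def by (rule box_bump_bounds)+

lemma bump_zero: "w \<notin> cbox a b ==> bump a b w = 0"
 using box_bump_outside[of w a b 1] box_subset_cbox[of a b] unfolding bump_def by blast

lemma bump_pd_zero: "w \<notin> cbox a b ==> pd j (bump a b) w = 0"
 using pd_cong[of "- cbox a b" w "bump a b" "\<lambda>x. 0" j] bump_zero[of _ a b] open_Compl[OF closed_cbox, of a b] by simp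

lemma bump_differentiable: "bump a b differentiable (at w)"
 by (rule Ck_on_differentiable[OF Ck_on_bump UNIV_I])

lemma bump_continuous: "continuous_on S (bump a b)" "continuous_on S (pd j (bump a b))"
 by (rule continuous_on_subset[OF Ck_on_continuous[OF Ck_on_bump] subset_UNIV])
  (rule continuous_on_subset[OF Ck_on_continuous[OF Ck_on_pd[OF Ck_on_bump]] subset_UNIV])

lemma bump_scaled_time_derivative:
 assumes "s > 0"
 shows "((\<lambda>s. (1 / s) ^ 3 * bump a b ((1 / s) *\<^sub>R v)) has_real_derivative
  - (3 * (1 / s) ^ 4 * bump a b ((1 / s) *\<^sub>R v) + (\<Sum>j\<in>UNIV. v $ j * (1 / s) ^ 5 * pd j (bump a b) ((1 / s) *\<^sub>R v)))) (at s)"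
proof -
 have L: "((\<lambda>s. (1 / s) *\<^sub>R v) has_derivative (\<lambda>r. (r * (- ((1 / s) ^ 2))) *\<^sub>R v)) (at s)"
  using assms by (auto intro!: derivative_eq_intros simp: power2_eq_square divide_simps)
 have B: "((\<lambda>s. bump a b ((1 / s) *\<^sub>R v)) has_real_derivative
   (- ((1 / s) ^ 2) * (\<Sum>j\<in>UNIV. v $ j * pd j (bump a b) ((1 / s) *\<^sub>R v)))) (at s)"
  unfolding has_field_derivative_def
  by (rule has_derivative_eq_rhs[OF has_derivative_compose[OF L has_derivative_pd[OF bump_differentiable]]])
   (simp add: fun_eq_iff sum_distrib_left mult_ac)
 have P: "((\<lambda>s. (1 / s) ^ 3) has_real_derivative (- (3 * (1 / s) ^ 4))) (at s)"
  using assms by (auto intro!: derivative_eq_intros simp: power2_eq_square divide_simps eval_nat_numeral)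
 show ?thesis
  by (rule DERIV_cong[OF DERIV_mult[OF P B]])
   (simp add: sum_distrib_left sum_distrib_right algebra_simps eval_nat_numeral sum_negf)
qed

text \<open>Its divergence is, up to sign, the derivative in \<open>s\<close> of the weight \<open>(1 / s) ^ 3 * bump a b ((1 / s) *\<^sub>R (y - x))\<close>.\<close>

definition bump_flux :: "real^3 \<Rightarrow> real^3 \<Rightarrow> real^3 \<Rightarrow> real \<Rightarrow> 3 \<Rightarrow> real^3 \<Rightarrow> real" where
 "bump_flux a b x s i y = (y $ i - x $ i) * (1 / s) ^ 4 * bump a b ((1 / s) *\<^sub>R (y - x))"

lemma Ck_on_bump_scaled: "Ck_on k UNIV (\<lambda>y. bump a b (r *\<^sub>R (y - x)))"
 unfolding bump_def box_bump_def vector_scaleR_component vector_minus_component real_scaleR_def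
 by (intro Ck_on_prod Ck_on_mult Ck_on_flat Ck_on_diff Ck_on_const Ck_on_coord) auto

lemma Ck_on_bump_flux: "Ck_on k UNIV (bump_flux a b x s i)"
 unfolding bump_flux_def [abs_def]
 by (intro Ck_on_mult Ck_on_diff Ck_on_const Ck_on_coord Ck_on_bump_scaled) auto

lemma pd_bump_scaled: "pd i (\<lambda>y. bump a b (r *\<^sub>R (y - x))) y = r * pd i (bump a b) (r *\<^sub>R (y - x))"
proof -
 have L: "((\<lambda>y. r *\<^sub>R (y - x)) has_derivative (\<lambda>h. r *\<^sub>R h)) (at y)"
  by (auto intro!: derivative_eq_intros)
 show ?thesis
  using pd_eqI[OF has_derivative_compose[OF L has_derivative_pd[OF bump_differentiable]], of i]
  by (simp add: axis_def if_distrib[of "\<lambda>c. c * _"] if_distrib[of "\<lambda>c. _ * c"] cong: if_cong)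
qed

lemma sum_pd_bump_flux:
 "(\<Sum>i\<in>UNIV. pd i (bump_flux a b x s i) y) =
  3 * (1 / s) ^ 4 * bump a b ((1 / s) *\<^sub>R (y - x)) + (\<Sum>i\<in>UNIV. (y - x) $ i * (1 / s) ^ 5 * pd i (bump a b) ((1 / s) *\<^sub>R (y - x)))"
proof -
 have "pd i (bump_flux a b x s i) y =
  (1 / s) ^ 4 * bump a b ((1 / s) *\<^sub>R (y - x)) + (y - x) $ i * (1 / s) ^ 5 * pd i (bump a b) ((1 / s) *\<^sub>R (y - x))" for i
 proof -
  have d: "(\<lambda>y. (y $ i - x $ i) * (1 / s) ^ 4) differentiable (at y)"
   by (rule Ck_on_differentiable[of 0 UNIV]) (auto intro!: Ck_on_mult Ck_on_diff Ck_on_coord)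
  have d': "(\<lambda>y. y $ i - x $ i) differentiable (at y)" "(\<lambda>y::real^3. y $ i) differentiable (at y)"
   by (rule Ck_on_differentiable[of 0 UNIV], auto intro!: Ck_on_diff Ck_on_coord)+
  have p: "pd i (\<lambda>y. (y $ i - x $ i) * (1 / s) ^ 4) y = (1 / s) ^ 4"
   using d' by (subst pd_mult) (auto simp: pd_diff pd_coord)
  show ?thesis
   unfolding bump_flux_def [abs_def] pd_mult[OF d Ck_on_differentiable[OF Ck_on_bump_scaled UNIV_I]] p pd_bump_scaled
   by (simp add: eval_nat_numeral)
 qed
 then show ?thesis by (simp add: sum.distrib)
qed

lemma has_integral_scaled_weight:
 fixes f :: "real^3 \<Rightarrow> 'b::euclidean_space"
 assumes \<beta>: "continuous_on UNIV \<beta>" "!!w. w \<notin> cbox a b ==> \<beta> w = (0::real)" and s: "s > 0" and f: "continuous_on ((\<lambda>w. x + s *\<^sub>R w) ` cbox a b) f"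
  and T: "(\<lambda>w. x + s *\<^sub>R w) ` cbox a b \<subseteq> T"
 shows "((\<lambda>y. ((1 / s) ^ 3 * \<beta> ((1 / s) *\<^sub>R (y - x))) *\<^sub>R f y) has_integral
  integral (cbox a b) (\<lambda>w. \<beta> w *\<^sub>R f (x + s *\<^sub>R w))) T"
proof -
 let ?h = "\<lambda>w. \<beta> w *\<^sub>R f (x + s *\<^sub>R w)"
 let ?c = "- (1 / s) *\<^sub>R x"
 have "?h integrable_on cbox a b"
  by (intro integrable_continuous continuous_intros continuous_on_subset[OF \<beta>(1)] continuous_on_compose2[OF f]) auto
 then have I: "(?h has_integral integral (cbox a b) ?h) (cbox a b)" by (rule integrable_integral)
 have A: "((\<lambda>y. ?h ((1 / s) *\<^sub>R y + ?c)) has_integral (1 / \<bar>1 / s\<bar> ^ DIM(real^3)) *\<^sub>R integral (cbox a b) ?h)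
   ((\<lambda>y. (1 / (1 / s)) *\<^sub>R y + - ((1 / (1 / s)) *\<^sub>R ?c)) ` cbox a b)"
  by (rule has_integral_affinity[OF I]) (use s in simp)
 have e: "(1 / s) *\<^sub>R y + ?c = (1 / s) *\<^sub>R (y - x)" for y by (simp add: algebra_simps)
 have e2: "x + s *\<^sub>R ((1 / s) *\<^sub>R (y - x)) = y" for y using s by simp
 have im: "(\<lambda>y. (1 / (1 / s)) *\<^sub>R y + - ((1 / (1 / s)) *\<^sub>R ?c)) ` cbox a b = (\<lambda>w. x + s *\<^sub>R w) ` cbox a b"
  using s by (intro image_cong) (auto simp: add.commute)
 have "((\<lambda>y. (1 / s) ^ 3 *\<^sub>R (\<beta> ((1 / s) *\<^sub>R (y - x)) *\<^sub>R f y)) has_integral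
   (1 / s) ^ 3 *\<^sub>R ((1 / \<bar>1 / s\<bar> ^ 3) *\<^sub>R integral (cbox a b) ?h)) ((\<lambda>w. x + s *\<^sub>R w) ` cbox a b)"
  using A unfolding e e2 im by (intro has_integral_cmul) simp
 then have "((\<lambda>y. ((1 / s) ^ 3 * \<beta> ((1 / s) *\<^sub>R (y - x))) *\<^sub>R f y) has_integral
   integral (cbox a b) ?h) ((\<lambda>w. x + s *\<^sub>R w) ` cbox a b)"
  using s by (simp add: power_divide)
 then show ?thesis
 proof (rule has_integral_on_superset[OF _ _ T])
  fix y assume y: "y \<notin> (\<lambda>w. x + s *\<^sub>R w) ` cbox a b"
  have "(1 / s) *\<^sub>R (y - x) \<notin> cbox a b"
  proof
   assume "(1 / s) *\<^sub>R (y - x) \<in> cbox a b"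
   then have "x + s *\<^sub>R ((1 / s) *\<^sub>R (y - x)) \<in> (\<lambda>w. x + s *\<^sub>R w) ` cbox a b" by blast
   then show False using y e2 by simp
  qed
  then show "((1 / s) ^ 3 * \<beta> ((1 / s) *\<^sub>R (y - x))) *\<^sub>R f y = 0" by (simp add: \<beta>(2))
 qed
qed

lemma has_integral_bump_scaled:
 fixes f :: "real^3 \<Rightarrow> 'b::euclidean_space"
 assumes "s > 0" "continuous_on ((\<lambda>w. x + s *\<^sub>R w) ` cbox a b) f" "(\<lambda>w. x + s *\<^sub>R w) ` cbox a b \<subseteq> T"
 shows "((\<lambda>y. ((1 / s) ^ 3 * bump a b ((1 / s) *\<^sub>R (y - x))) *\<^sub>R f y) has_integral
  integral (cbox a b) (\<lambda>w. bump a b w *\<^sub>R f (x + s *\<^sub>R w))) T"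
 by (rule has_integral_scaled_weight[OF bump_continuous(1) _ assms]) (rule bump_zero)

text \<open>The mean of \<open>f\<close> over the shrinking cubes \<open>x + s Q\<close> has a derivative in \<open>s\<close> that only involves the
  weak gradient: the derivative of the rescaled weight is a divergence.\<close>

lemma scaled_mean_derivative:
 fixes f :: "real^3 \<Rightarrow> 'b::euclidean_space"
 assumes O: "open \<Omega>" and f: "continuous_on \<Omega> f" and w: "!!i. weak_pd \<Omega> i f (G i)"
  and cone: "!!w s. w \<in> cbox a b ==> 0 < s ==> s \<le> h ==> x + s *\<^sub>R w \<in> \<Omega>"
  and s0: "0 < s0" "s0 < h"
 shows "((\<lambda>s. integral (cbox a b) (\<lambda>w. bump a b w *\<^sub>R f (x + s *\<^sub>R w))) has_vector_derivative
  (\<Sum>i\<in>UNIV. \<integral>y. bump_flux a b x s0 i y *\<^sub>R G i y \<partial>lebesgue_on \<Omega>)) (at s0)"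
proof -
 define U where "U = {s0 / 2..h}"
 define K0 where "K0 = (\<lambda>z. x + fst z *\<^sub>R snd z) ` (U \<times> cbox a b)"
 have OL: "\<Omega> \<in> sets lebesgue" using O by simp
 have K0: "compact K0" unfolding K0_def U_def
  by (intro compact_continuous_image continuous_intros compact_Times) auto
 have K0O: "K0 \<subseteq> \<Omega>" using cone s0 by (auto simp: K0_def U_def)
 obtain ft where ft: "continuous_on UNIV ft" "!!y. y \<in> K0 ==> ft y = f y"
 proof (rule Tietze_unbounded[of K0 f UNIV])
  show "continuous_on K0 f" by (rule continuous_on_subset[OF f K0O])
  show "closedin (top_of_set UNIV) K0" using compact_imp_closed[OF K0] by (simp flip: closed_closedin)
 qed (rule that)
 obtain c where c: "K0 \<subseteq> cbox (-c) c" using bounded_subset_cbox_symmetric[OF compact_imp_bounded[OF K0]] by blast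
 let ?R = "cbox (-c) c"
 let ?K = "\<lambda>s y. (1 / s) ^ 3 * bump a b ((1 / s) *\<^sub>R (y - x))"
 let ?K' = "\<lambda>s y. - (\<Sum>i\<in>UNIV. pd i (bump_flux a b x s i) y)"
 have sub: "(\<lambda>w. x + s *\<^sub>R w) ` cbox a b \<subseteq> K0" if "s \<in> U" for s
  using that by (force simp: K0_def)
 have Upos: "s > 0" if "s \<in> U" for s using that s0 by (auto simp: U_def)
 have F: "integral (cbox a b) (\<lambda>w. bump a b w *\<^sub>R f (x + s *\<^sub>R w)) = integral ?R (\<lambda>y. ?K s y *\<^sub>R ft y)" if s: "s \<in> U" for s
 proof -
  have "integral (cbox a b) (\<lambda>w. bump a b w *\<^sub>R f (x + s *\<^sub>R w)) = integral (cbox a b) (\<lambda>w. bump a b w *\<^sub>R ft (x + s *\<^sub>R w))"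
   using sub[OF s] ft(2) by (intro Henstock_Kurzweil_Integration.integral_cong) auto
  moreover have "((\<lambda>y. ?K s y *\<^sub>R ft y) has_integral integral (cbox a b) (\<lambda>w. bump a b w *\<^sub>R ft (x + s *\<^sub>R w))) ?R"
   using sub[OF s] c by (intro has_integral_bump_scaled Upos[OF s] continuous_on_subset[OF ft(1)]) auto
  ultimately show ?thesis by (simp add: integral_unique)
 qed
 have "((\<lambda>s. integral ?R (\<lambda>y. ?K s y *\<^sub>R ft y)) has_vector_derivative integral ?R (\<lambda>y. ?K' s0 y *\<^sub>R ft y)) (at s0 within U)"
 proof (rule leibniz_rule_vector_derivative[where U = U])
  fix s y assume s: "s \<in> U"
  have "((\<lambda>s. ?K s y) has_real_derivative ?K' s y) (at s)"
   using bump_scaled_time_derivative[OF Upos[OF s], of a b "y - x"] by (simp add: sum_pd_bump_flux)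
  then have "((\<lambda>s. ?K s y) has_vector_derivative ?K' s y) (at s within U)"
   by (simp add: has_real_derivative_iff_has_vector_derivative has_vector_derivative_at_within)
  then show "((\<lambda>s. ?K s y *\<^sub>R ft y) has_vector_derivative ?K' s y *\<^sub>R ft y) (at s within U)"
   by (rule bounded_linear.has_vector_derivative[OF bounded_linear_scaleR_left])
 next
  fix s assume s: "s \<in> U"
  show "(\<lambda>y. ?K s y *\<^sub>R ft y) integrable_on ?R"
   by (intro integrable_continuous continuous_intros continuous_on_compose2[OF bump_continuous(1)[of UNIV]]
     continuous_on_subset[OF ft(1)]) auto
 next
  show "continuous_on (U \<times> ?R) (\<lambda>(s, y). ?K' s y *\<^sub>R ft y)"
   unfolding sum_pd_bump_flux split_beta
   by (intro continuous_intros continuous_on_compose2[OF bump_continuous(1)[of UNIV]]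
     continuous_on_compose2[OF bump_continuous(2)[of UNIV]] continuous_on_compose2[OF ft(1)]) (auto dest: Upos)
 qed (use s0 in \<open>auto simp: U_def\<close>)
 moreover have "integral ?R (\<lambda>y. ?K' s0 y *\<^sub>R ft y) = (\<Sum>i\<in>UNIV. \<integral>y. bump_flux a b x s0 i y *\<^sub>R G i y \<partial>lebesgue_on \<Omega>)"
 proof -
  let ?S = "(\<lambda>w. x + s0 *\<^sub>R w) ` cbox a b"
  have s0U: "s0 \<in> U" using s0 by (auto simp: U_def)
  have S: "compact ?S" by (intro compact_continuous_image continuous_intros) auto
  have out: "(1 / s0) *\<^sub>R (y - x) \<notin> cbox a b" if "y \<notin> ?S" for y
  proof
   assume "(1 / s0) *\<^sub>R (y - x) \<in> cbox a b"
   then have "x + s0 *\<^sub>R ((1 / s0) *\<^sub>R (y - x)) \<in> ?S" by blast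
   then show False using that s0 by simp
  qed
  have t: "test_function \<Omega> (bump_flux a b x s0 i)" for i
   unfolding test_function_def smooth_on_def
  proof (intro conjI allI exI[of _ ?S] impI)
   show "bump_flux a b x s0 i y = 0" if "y \<notin> ?S" for y using out[OF that] by (simp add: bump_flux_def bump_zero)
   show "?S \<subseteq> \<Omega>" using sub[OF s0U] K0O by blast
  qed (use S Ck_on_bump_flux in auto)
  have zK: "?K' s0 y = 0" if "y \<notin> ?S" for y
   using out[OF that] by (simp add: sum_pd_bump_flux bump_zero bump_pd_zero)
  have lf: "locally_integrable \<Omega> f" by (rule continuous_locally_integrable[OF f])
  have I: "integrable (lebesgue_on \<Omega>) (\<lambda>y. pd i (bump_flux a b x s0 i) y *\<^sub>R f y)" for i
   by (rule weak_pd_integrable(2)[OF O lf t])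
  have "integral ?R (\<lambda>y. ?K' s0 y *\<^sub>R ft y) = integral ?S (\<lambda>y. ?K' s0 y *\<^sub>R ft y)"
   using zK sub[OF s0U] c by (intro integral_cpt_support[of ?S]) auto
  also have "\<dots> = integral ?S (\<lambda>y. ?K' s0 y *\<^sub>R f y)"
   using ft(2) sub[OF s0U] by (intro Henstock_Kurzweil_Integration.integral_cong) auto
  also have "\<dots> = integral \<Omega> (\<lambda>y. ?K' s0 y *\<^sub>R f y)"
   using zK sub[OF s0U] K0O by (intro integral_cpt_support[of ?S]) auto
  also have "\<dots> = integral \<Omega> (\<lambda>y. \<Sum>i\<in>UNIV. - (pd i (bump_flux a b x s0 i) y *\<^sub>R f y))"
   by (simp add: sum_negf scaleR_sum_left)
  also have "\<dots> = (\<integral>y. (\<Sum>i\<in>UNIV. - (pd i (bump_flux a b x s0 i) y *\<^sub>R f y)) \<partial>lebesgue_on \<Omega>)"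
   by (rule lebesgue_integral_eq_integral[symmetric, OF _ OL]) (intro Bochner_Integration.integrable_sum integrable_minus I)
  also have "\<dots> = (\<Sum>i\<in>UNIV. \<integral>y. bump_flux a b x s0 i y *\<^sub>R G i y \<partial>lebesgue_on \<Omega>)"
   using w t by (subst Bochner_Integration.integral_sum) (auto simp: I weak_pd_def)
  finally show ?thesis .
 qed
 ultimately have "((\<lambda>s. integral ?R (\<lambda>y. ?K s y *\<^sub>R ft y)) has_vector_derivative
   (\<Sum>i\<in>UNIV. \<integral>y. bump_flux a b x s0 i y *\<^sub>R G i y \<partial>lebesgue_on \<Omega>)) (at s0 within U)" by simp
 then have "((\<lambda>s. integral (cbox a b) (\<lambda>w. bump a b w *\<^sub>R f (x + s *\<^sub>R w))) has_vector_derivative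
   (\<Sum>i\<in>UNIV. \<integral>y. bump_flux a b x s0 i y *\<^sub>R G i y \<partial>lebesgue_on \<Omega>)) (at s0 within U)"
  by (rule has_vector_derivative_transform[rotated 2]) (use F s0 in \<open>auto simp: U_def\<close>)
 moreover have "at s0 within U = at s0"
  by (rule at_within_interior) (use s0 in \<open>auto simp: U_def\<close>)
 ultimately show ?thesis by simp
qed

text \<open>The derivative of the mean over the cube of scale \<open>s\<close> is bounded by a power of \<open>s\<close> that is integrable at
  zero exactly for \<open>p > 3\<close>.\<close>

lemma morrey_cone:
 fixes f :: "real^3 \<Rightarrow> 'b::euclidean_space"
 assumes O: "open \<Omega>" and f: "continuous_on \<Omega> f" and w: "!!i. weak_pd \<Omega> i f (G i)"
  and p: "p > 3" and G: "!!i. Lp p \<Omega> (G i)" "!!i. Lp_norm p \<Omega> (G i) \<le> N"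
  and x: "x \<in> \<Omega>" and h: "h > 0"
  and cone: "!!w s. w \<in> cbox a b ==> 0 < s ==> s \<le> h ==> x + s *\<^sub>R w \<in> \<Omega>"
  and W: "!!w. w \<in> cbox a b ==> norm w \<le> W" and ab: "measure lborel (cbox a b) > 0"
 shows "norm (integral (cbox a b) (\<lambda>w. bump a b w *\<^sub>R f (x + h *\<^sub>R w)) - integral (cbox a b) (bump a b) *\<^sub>R f x)
  \<le> 6 * W * N * measure lborel (cbox a b) powr (1 - 1 / p) / (1 - 3 / p) * h powr (1 - 3 / p)"
proof -
 define F where "F = (\<lambda>s. integral (cbox a b) (\<lambda>w. bump a b w *\<^sub>R f (x + s *\<^sub>R w)))"
 define D where "D = 6 * W * N * measure lborel (cbox a b) powr (1 - 1 / p)"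
 have q: "1 - 3 / p > 0" using p by simp
 have cone0: "x + s *\<^sub>R w \<in> \<Omega>" if "w \<in> cbox a b" "0 \<le> s" "s \<le> h" for w s
  using cone[OF that(1)] that x by (cases "s = 0") auto
 have OL: "\<Omega> \<in> sets lebesgue" using O by simp
 have bound: "norm (\<Sum>i\<in>UNIV. \<integral>y. bump_flux a b x s i y *\<^sub>R G i y \<partial>lebesgue_on \<Omega>) \<le> D * s powr (- 3 / p)"
  if s: "0 < s" "s < h" for s
 proof -
  let ?S = "(\<lambda>w. x + s *\<^sub>R w) ` cbox a b"
  have S: "?S \<in> lmeasurable" "?S \<subseteq> \<Omega>"
   using cone s by (auto intro!: lmeasurable_compact compact_continuous_image continuous_intros)
  have mS: "measure lebesgue ?S = s ^ 3 * measure lborel (cbox a b)"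
  proof -
   have "?S \<in> sets borel"
    by (intro borel_compact compact_continuous_image continuous_intros) auto
   then show ?thesis using content_image_affinity_cbox[of s x a b] s
    by (simp add: add.commute power3_eq_cube)
  qed
  have "norm (\<integral>y. bump_flux a b x s i y *\<^sub>R G i y \<partial>lebesgue_on \<Omega>)
   \<le> 2 * (W * (1 / s) ^ 3) * N * measure lebesgue ?S powr (1 - 1 / p)" for i
  proof (rule Lp_integral_bound[OF OL _ G S])
   show "measure lebesgue ?S > 0" using mS ab s by simp
   show "bump_flux a b x s i \<in> borel_measurable (lebesgue_on \<Omega>)"
    by (rule continuous_imp_measurable_on_sets_lebesgue[OF continuous_on_subset[OF Ck_on_continuous[OF Ck_on_bump_flux]] OL]) simp
   show zero: "bump_flux a b x s i y = 0" if "y \<notin> ?S" for y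
   proof -
    have "(1 / s) *\<^sub>R (y - x) \<notin> cbox a b"
    proof
     assume "(1 / s) *\<^sub>R (y - x) \<in> cbox a b"
     then have "x + s *\<^sub>R ((1 / s) *\<^sub>R (y - x)) \<in> ?S" by blast
     then show False using that s by simp
    qed
    then show ?thesis by (simp add: bump_flux_def bump_zero)
   qed
   show "\<bar>bump_flux a b x s i y\<bar> \<le> W * (1 / s) ^ 3" for y
   proof (cases "y \<in> ?S")
    case True
    then obtain w where w: "w \<in> cbox a b" "y = x + s *\<^sub>R w" by auto
    have "bump_flux a b x s i y = w $ i * (1 / s) ^ 3 * bump a b w"
     using s by (simp add: bump_flux_def w eval_nat_numeral)
    also have "\<bar>\<dots>\<bar> \<le> W * (1 / s) ^ 3 * 1"
     unfolding abs_mult using component_le_norm_cart[of w i] W[OF w(1)] s bump_bounds[of a b w]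
     by (intro mult_mono) auto
    finally show ?thesis by simp
   next
    case False
    have "cbox a b \<noteq> {}" using ab by auto
    then obtain w where "w \<in> cbox a b" by blast
    then have "W \<ge> 0" using W[of w] norm_ge_zero[of w] by linarith
    then show ?thesis using zero[OF False] s by simp
   qed
  qed (use p in simp)
  then have "norm (\<Sum>i\<in>UNIV. \<integral>y. bump_flux a b x s i y *\<^sub>R G i y \<partial>lebesgue_on \<Omega>)
   \<le> (\<Sum>i\<in>(UNIV::3 set). 2 * (W * (1 / s) ^ 3) * N * measure lebesgue ?S powr (1 - 1 / p))"
   by (intro order_trans[OF norm_sum sum_mono])
  also have "\<dots> = 6 * W * N * ((1 / s) ^ 3 * (s ^ 3 * measure lborel (cbox a b)) powr (1 - 1 / p))"
   by (simp add: mS)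
  also have "(1 / s) ^ 3 * (s ^ 3 * measure lborel (cbox a b)) powr (1 - 1 / p)
   = measure lborel (cbox a b) powr (1 - 1 / p) * s powr (- 3 / p)"
  proof -
   have s3: "s ^ 3 = s powr 3" using s by simp
   have "(1 / s) ^ 3 = s powr (-3)" using s by (simp add: powr_minus power_one_over inverse_eq_divide)
   moreover have "(s ^ 3) powr (1 - 1 / p) = s powr (3 * (1 - 1 / p))" unfolding s3 powr_powr ..
   moreover have "s powr (-3) * s powr (3 * (1 - 1 / p)) = s powr (- 3 / p)"
   proof -
    have "-3 + 3 * (1 - 1 / p) = - 3 / p" by simp
    then show ?thesis by (simp only: powr_add[symmetric])
   qed
   ultimately show ?thesis using s by (simp add: powr_mult mult_ac)
  qed
  finally show ?thesis by (simp add: D_def mult_ac)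
 qed
 have "norm (F h - F 0) \<le> D / (1 - 3 / p) * h powr (1 - 3 / p) - D / (1 - 3 / p) * 0 powr (1 - 3 / p)"
 proof (rule differentiable_bound_general[OF h])
  show "continuous_on {0..h} F" unfolding F_def
  proof (rule integral_continuous_on_param)
   show "continuous_on ({0..h} \<times> cbox a b) (\<lambda>(s, w). bump a b w *\<^sub>R f (x + s *\<^sub>R w))"
    unfolding split_beta
    by (intro continuous_intros continuous_on_compose2[OF bump_continuous(1)[of UNIV]] continuous_on_compose2[OF f])
     (use cone0 in auto)
  qed
  show "continuous_on {0..h} (\<lambda>s. D / (1 - 3 / p) * s powr (1 - 3 / p))"
   using q by (intro continuous_intros continuous_on_powr') auto
  fix s assume s: "0 < s" "s < h"
  show "(F has_vector_derivative (\<Sum>i\<in>UNIV. \<integral>y. bump_flux a b x s i y *\<^sub>R G i y \<partial>lebesgue_on \<Omega>)) (at s)"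
   unfolding F_def by (rule scaled_mean_derivative[OF O f w cone s])
  show "((\<lambda>s. D / (1 - 3 / p) * s powr (1 - 3 / p)) has_vector_derivative D * s powr (- 3 / p)) (at s)"
   unfolding has_real_derivative_iff_has_vector_derivative[symmetric]
   by (rule DERIV_cong[OF DERIV_cmult[OF has_real_derivative_powr[OF s(1)]]]) (use p in simp)
  show "norm (\<Sum>i\<in>UNIV. \<integral>y. bump_flux a b x s i y *\<^sub>R G i y \<partial>lebesgue_on \<Omega>) \<le> D * s powr (- 3 / p)"
   by (rule bound[OF s])
 qed
 moreover have "F 0 = integral (cbox a b) (bump a b) *\<^sub>R f x"
 proof -
  have "(bump a b has_integral integral (cbox a b) (bump a b)) (cbox a b)"
   by (intro integrable_integral integrable_continuous bump_continuous)
  from has_integral_scaleR_left[OF this, of "f x"] show ?thesis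
   by (simp add: F_def integral_unique)
 qed
 ultimately show ?thesis using q by (simp add: F_def D_def)
qed

section \<open>Sobolev bounds on smooth domains\<close>

lemma bump_translate: "bump (a + v) (b + v) (w + v) = bump a b w"
 by (simp add: bump_def box_bump_def)

lemma integral_bump_translate:
 fixes \<phi> :: "real^3 \<Rightarrow> 'b::euclidean_space"
 assumes "continuous_on (cbox (a + v) (b + v)) \<phi>"
 shows "integral (cbox a b) (\<lambda>w. bump a b w *\<^sub>R \<phi> (w + v)) = integral (cbox (a + v) (b + v)) (\<lambda>w. bump (a + v) (b + v) w *\<^sub>R \<phi> w)"
proof -
 let ?f = "\<lambda>w. bump (a + v) (b + v) w *\<^sub>R \<phi> w"
 have "(?f has_integral integral (cbox (a + v) (b + v)) ?f) (cbox (a + v) (b + v))"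
  by (intro integrable_integral integrable_continuous continuous_intros bump_continuous assms)
 then have "((?f \<circ> (+) v) has_integral integral (cbox (a + v) (b + v)) ?f) (cbox a b)"
  by (simp add: has_integral_shift_cbox_iff)
 moreover have "?f \<circ> (+) v = (\<lambda>w. bump a b w *\<^sub>R \<phi> (w + v))"
  using bump_translate[of a v b] by (simp add: fun_eq_iff add.commute)
 ultimately show ?thesis by (simp add: integral_unique)
qed

lemma integral_bump_center:
 "integral (cbox (e - vec k) (e + vec k)) (bump (e - vec k) (e + vec k)) = integral (cbox (- vec k) (vec k)) (bump (- vec k) (vec k))"
 using integral_bump_translate[of "- vec k" e "vec k" "\<lambda>w. 1 :: real"] by (simp add: add.commute)

lemma integral_bump_pos:
 assumes "k > 0" shows "integral (cbox (- vec k) (vec k)) (bump (- vec k) (vec k)) > 0"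
proof -
 have 0: "(0::real^3) \<in> box (- vec k) (vec k)" using assms by (simp add: mem_box_cart)
 then have p: "bump (- vec k) (vec k) 0 > 0" unfolding bump_def by (intro box_bump_pos) auto
 have "integral (cbox (- vec k) (vec k)) (bump (- vec k) (vec k)) \<noteq> 0"
  using integral_cbox_eq_0_iff[OF bump_continuous(1), of "- vec k" "vec k" "- vec k" "vec k"] 0 p
   bump_bounds(1) box_subset_cbox[of "- vec k :: real^3" "vec k"] by force
 moreover have "integral (cbox (- vec k) (vec k)) (bump (- vec k) (vec k)) \<ge> 0"
  by (rule Henstock_Kurzweil_Integration.integral_nonneg) (auto intro!: integrable_continuous bump_continuous bump_bounds)
 ultimately show ?thesis by linarith
qed

lemma content_cube: "k > 0 ==> measure lborel (cbox (e - vec k) (e + vec k) :: (real^3) set) = (2 * k) ^ 3"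
proof -
 assume k: "k > 0"
 then have "e \<in> cbox (e - vec k) (e + vec k)" by (simp add: mem_box_cart)
 then have "cbox (e - vec k) (e + vec k) \<noteq> {}" by blast
 from content_cbox_cart[OF this] show ?thesis by simp
qed

lemma norm_cube_le: "w \<in> cbox (e - vec k) (e + vec k) ==> norm (w - e :: real^3) \<le> 3 * k"
proof -
 assume w: "w \<in> cbox (e - vec k) (e + vec k)"
 have "norm (w - e) \<le> (\<Sum>i\<in>UNIV. \<bar>(w - e) $ i\<bar>)" by (rule norm_le_l1_cart)
 also have "\<dots> \<le> (\<Sum>i\<in>(UNIV::3 set). k)"
  using w by (intro sum_mono) (auto simp: mem_box_cart abs_le_iff algebra_simps)
 finally show ?thesis by simp
qed

context defining_function
begin

text \<open>The two terms scale differently in \<open>h\<close>; optimising in \<open>h\<close> gives the interpolation inequality of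
  Gagliardo and Nirenberg.\<close>

lemma sup_interpolation:
 assumes p: "p > 3"
 obtains C h0 where "C > 0" "h0 > 0"
  "!!(f :: real^3 \<Rightarrow> 'b::euclidean_space) G N h x. continuous_on \<Omega> f ==> (!!i. weak_pd \<Omega> i f (G i)) ==>
   (!!i. Lp p \<Omega> (G i)) ==> (!!i. Lp_norm p \<Omega> (G i) \<le> N) ==> integrable (lebesgue_on \<Omega>) (\<lambda>x. norm (f x)) ==>
   0 < h ==> h \<le> h0 ==> x \<in> \<Omega> ==>
   norm (f x) \<le> C * ((1 / h) ^ 3 * (\<integral>x. norm (f x) \<partial>lebesgue_on \<Omega>) + h powr (1 - 3 / p) * N)"
proof -
 obtain \<kappa> h0 where \<kappa>: "\<kappa> > 0" and h0: "h0 > 0" and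
  cone: "!!x. x \<in> \<Omega> ==> \<exists>e. norm e \<le> 1 \<and> (\<forall>w\<in>cbox (e - vec \<kappa>) (e + vec \<kappa>). \<forall>s. 0 < s \<and> s \<le> h0 \<longrightarrow> x + s *\<^sub>R w \<in> \<Omega>)"
  by (rule uniform_cone, rule that)
 define B where "B = integral (cbox (- vec \<kappa>) (vec \<kappa>)) (bump (- vec \<kappa>) (vec \<kappa>))"
 have B: "B > 0" unfolding B_def by (rule integral_bump_pos[OF \<kappa>])
 define D where "D = 6 * (1 + 3 * \<kappa>) * ((2 * \<kappa>) ^ 3) powr (1 - 1 / p) / (1 - 3 / p)"
 have D: "D \<ge> 0" using \<kappa> p by (simp add: D_def)
 have OL: "\<Omega> \<in> sets lebesgue" using O by simp
 show ?thesis
 proof (rule that[of "(1 + D) / B" h0])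
  show "(1 + D) / B > 0" using B D by simp
  show "h0 > 0" by (rule h0)
  fix f :: "real^3 \<Rightarrow> 'b" and G N h x
  assume f: "continuous_on \<Omega> f" and w: "!!i. weak_pd \<Omega> i f (G i)"
   and G: "!!i. Lp p \<Omega> (G i)" "!!i. Lp_norm p \<Omega> (G i) \<le> N" and i: "integrable (lebesgue_on \<Omega>) (\<lambda>x. norm (f x))"
   and h: "0 < h" "h \<le> h0" and x: "x \<in> \<Omega>"
  obtain e where e: "norm e \<le> 1" "!!w s. w \<in> cbox (e - vec \<kappa>) (e + vec \<kappa>) ==> 0 < s ==> s \<le> h0 ==> x + s *\<^sub>R w \<in> \<Omega>"
   using cone[OF x] by blast
  define a b where "a = e - vec \<kappa>" and "b = e + vec \<kappa>"
  have N: "N \<ge> 0" using G(2) Lp_norm_nonneg[of p \<Omega> "G undefined"] by (meson order_trans)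
  define A where "A = integral (cbox a b) (\<lambda>w. bump a b w *\<^sub>R f (x + h *\<^sub>R w))"
  have 1: "norm (A - integral (cbox a b) (bump a b) *\<^sub>R f x)
   \<le> 6 * (1 + 3 * \<kappa>) * N * measure lborel (cbox a b) powr (1 - 1 / p) / (1 - 3 / p) * h powr (1 - 3 / p)"
   unfolding A_def
  proof (rule morrey_cone[OF O f w p G x h(1)])
   show "x + s *\<^sub>R w \<in> \<Omega>" if "w \<in> cbox a b" "0 < s" "s \<le> h" for w s
    using e(2) that h by (auto simp: a_def b_def)
   show "norm w \<le> 1 + 3 * \<kappa>" if "w \<in> cbox a b" for w
    using norm_cube_le[of w e \<kappa>] that e(1) norm_triangle_sub[of w e] by (auto simp: a_def b_def)
   show "0 < measure lborel (cbox a b)" using content_cube[OF \<kappa>, of e] \<kappa> by (simp add: a_def b_def)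
  qed
  have BB: "integral (cbox a b) (bump a b) = B" unfolding a_def b_def B_def by (rule integral_bump_center)
  have eqD: "6 * (1 + 3 * \<kappa>) * N * measure lborel (cbox a b) powr (1 - 1 / p) / (1 - 3 / p) * h powr (1 - 3 / p)
    = D * (h powr (1 - 3 / p) * N)"
   using content_cube[OF \<kappa>, of e] by (simp add: a_def b_def D_def)
  have im: "(\<lambda>w. x + h *\<^sub>R w) ` cbox a b \<subseteq> \<Omega>" using e(2) h by (auto simp: a_def b_def)
  have hi: "((\<lambda>y. ((1 / h) ^ 3 * bump a b ((1 / h) *\<^sub>R (y - x))) *\<^sub>R f y) has_integral A) \<Omega>"
   unfolding A_def by (rule has_integral_bump_scaled[OF h(1) continuous_on_subset[OF f im] im])
  have "norm A \<le> integral \<Omega> (\<lambda>y. (1 / h) ^ 3 * norm (f y))"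
  proof -
   have "norm (integral \<Omega> (\<lambda>y. ((1 / h) ^ 3 * bump a b ((1 / h) *\<^sub>R (y - x))) *\<^sub>R f y)) \<le> integral \<Omega> (\<lambda>y. (1 / h) ^ 3 * norm (f y))"
   proof (rule Henstock_Kurzweil_Integration.integral_norm_bound_integral)
    show "(\<lambda>y. ((1 / h) ^ 3 * bump a b ((1 / h) *\<^sub>R (y - x))) *\<^sub>R f y) integrable_on \<Omega>" using hi by blast
    have "integrable (lebesgue_on \<Omega>) (\<lambda>y. (1 / h) ^ 3 * norm (f y))" using i by simp
    then show "(\<lambda>y. (1 / h) ^ 3 * norm (f y)) integrable_on \<Omega>"
     using has_integral_integral_lebesgue_on[OF _ OL] by blast
    fix y
    show "norm (((1 / h) ^ 3 * bump a b ((1 / h) *\<^sub>R (y - x))) *\<^sub>R f y) \<le> (1 / h) ^ 3 * norm (f y)"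
     using h bump_bounds[of a b "(1 / h) *\<^sub>R (y - x)"]
     by (auto simp: abs_mult intro!: mult_left_le_one_le divide_right_mono)
   qed
   then show ?thesis using hi by (simp add: integral_unique)
  qed
  also have "\<dots> = (1 / h) ^ 3 * (\<integral>x. norm (f x) \<partial>lebesgue_on \<Omega>)"
   using lebesgue_integral_eq_integral[OF i OL] by simp
  finally have 2: "norm A \<le> (1 / h) ^ 3 * (\<integral>x. norm (f x) \<partial>lebesgue_on \<Omega>)" .
  have "B * norm (f x) = norm (B *\<^sub>R f x)" using B by simp
  also have "\<dots> \<le> norm A + norm (A - B *\<^sub>R f x)" by (metis add.commute norm_minus_commute norm_triangle_sub)
  also have "\<dots> \<le> (1 / h) ^ 3 * (\<integral>x. norm (f x) \<partial>lebesgue_on \<Omega>) + D * (h powr (1 - 3 / p) * N)"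
   using 1 2 unfolding BB eqD by linarith
  also have "\<dots> \<le> (1 + D) * ((1 / h) ^ 3 * (\<integral>x. norm (f x) \<partial>lebesgue_on \<Omega>) + h powr (1 - 3 / p) * N)"
  proof -
   have "0 \<le> (1 / h) ^ 3 * (\<integral>x. norm (f x) \<partial>lebesgue_on \<Omega>)" using h by simp
   moreover have "0 \<le> h powr (1 - 3 / p) * N" using N by simp
   ultimately show ?thesis using D by (simp add: algebra_simps)
  qed
  finally show "norm (f x) \<le> (1 + D) / B * ((1 / h) ^ 3 * (\<integral>x. norm (f x) \<partial>lebesgue_on \<Omega>) + h powr (1 - 3 / p) * N)"
   using B by (simp add: field_simps)
 qed
qed

lemma star_compare:
 fixes f :: "real^3 \<Rightarrow> real"
 assumes p: "p > 3" and f: "continuous_on \<Omega> f" and w: "!!i. weak_pd \<Omega> i f (G i)"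
  and G: "!!i. Lp p \<Omega> (G i)" "!!i. Lp_norm p \<Omega> (G i) \<le> N" and k: "k > 0"
  and star: "!!x w s. x \<in> {x1, x2} ==> w \<in> cbox (z - x - vec k) (z - x + vec k) ==> 0 < s ==> s \<le> 1 ==> x + s *\<^sub>R w \<in> \<Omega>"
  and x: "x1 \<in> \<Omega>" "x2 \<in> \<Omega>" and D: "norm (z - x1) \<le> D" "norm (z - x2) \<le> D"
 shows "\<bar>f x1 - f x2\<bar> \<le> 12 * (D + 3 * k) * ((2 * k) ^ 3) powr (1 - 1 / p) / (1 - 3 / p)
   / integral (cbox (- vec k) (vec k)) (bump (- vec k) (vec k)) * N"
proof -
 define B where "B = integral (cbox (- vec k) (vec k)) (bump (- vec k) (vec k))"
 have B: "B > 0" unfolding B_def by (rule integral_bump_pos[OF k])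
 define A where "A = integral (cbox (z - vec k) (z + vec k)) (\<lambda>w. bump (z - vec k) (z + vec k) w *\<^sub>R f w)"
 let ?E = "6 * (D + 3 * k) * N * ((2 * k) ^ 3) powr (1 - 1 / p) / (1 - 3 / p)"
 have one: "\<bar>A - B * f x\<bar> \<le> ?E" if xx: "x \<in> {x1, x2}" for x
 proof -
  let ?a = "z - x - vec k" and ?b = "z - x + vec k"
  have xO: "x \<in> \<Omega>" "norm (z - x) \<le> D" using xx x D by auto
  have "norm (integral (cbox ?a ?b) (\<lambda>w. bump ?a ?b w *\<^sub>R f (x + 1 *\<^sub>R w)) - integral (cbox ?a ?b) (bump ?a ?b) *\<^sub>R f x)
   \<le> 6 * (D + 3 * k) * N * measure lborel (cbox ?a ?b) powr (1 - 1 / p) / (1 - 3 / p) * 1 powr (1 - 3 / p)"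
  proof (rule morrey_cone[OF O f w p G xO(1)])
   show "x + s *\<^sub>R w \<in> \<Omega>" if "w \<in> cbox ?a ?b" "0 < s" "s \<le> 1" for w s by (rule star[OF xx that])
   show "norm w \<le> D + 3 * k" if "w \<in> cbox ?a ?b" for w
    using norm_cube_le[OF that] xO(2) norm_triangle_sub[of w "z - x"] by linarith
   show "0 < measure lborel (cbox ?a ?b)" using content_cube[OF k, of "z - x"] k by simp
  qed simp
  moreover have "integral (cbox ?a ?b) (bump ?a ?b) = B" unfolding B_def by (rule integral_bump_center)
  moreover have "integral (cbox ?a ?b) (\<lambda>w. bump ?a ?b w *\<^sub>R f (x + 1 *\<^sub>R w)) = A"
  proof -
   have e: "?a + x = z - vec k" "?b + x = z + vec k" by simp_all
   have "cbox (?a + x) (?b + x) \<subseteq> \<Omega>"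
   proof
    fix y assume "y \<in> cbox (?a + x) (?b + x)"
    then have "y - x \<in> cbox ?a ?b" by (auto simp: mem_box_cart algebra_simps)
    from star[OF xx this, of 1] show "y \<in> \<Omega>" by simp
   qed
   from integral_bump_translate[OF continuous_on_subset[OF f this]]
   show ?thesis unfolding e A_def by (simp add: add.commute)
  qed
  ultimately show ?thesis using content_cube[OF k, of "z - x"] by simp
 qed
 have "B * \<bar>f x1 - f x2\<bar> = \<bar>B * f x1 - B * f x2\<bar>" using B by (simp add: abs_mult flip: right_diff_distrib)
 also have "\<dots> \<le> 2 * ?E"
 proof -
  have "\<bar>A - B * f x1\<bar> \<le> ?E" "\<bar>A - B * f x2\<bar> \<le> ?E" by (rule one, simp)+
  then show ?thesis by linarith
 qed
 finally have "\<bar>f x1 - f x2\<bar> \<le> 2 * ?E / B" by (simp only: pos_le_divide_eq[OF B] mult.commute[of _ B])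
 also have "2 * ?E / B = 12 * (D + 3 * k) * ((2 * k) ^ 3) powr (1 - 1 / p) / (1 - 3 / p) / B * N"
  by (simp only: times_divide_eq_left times_divide_eq_right) (simp add: algebra_simps)
 finally show ?thesis by (simp only: B_def)
qed

text \<open>Poincare's inequality in the supremum norm: near a point of \<open>\<Omega>\<close>, and along the cones, values are
  compared through common means; connectedness and compactness do the rest.\<close>

lemma oscillation_bound:
 assumes p: "p > 3" and con: "connected \<Omega>"
 obtains C where "C > 0"
  "!!(f :: real^3 \<Rightarrow> real) G N x y. continuous_on \<Omega> f ==> (!!i. weak_pd \<Omega> i f (G i)) ==>
   (!!i. Lp p \<Omega> (G i)) ==> (!!i. Lp_norm p \<Omega> (G i) \<le> N) ==> x \<in> \<Omega> ==> y \<in> \<Omega> ==> \<bar>f x - f y\<bar> \<le> C * N"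
proof -
 define adm where "adm = (\<lambda>(f :: real^3 \<Rightarrow> real) N. N \<ge> 0 \<and> continuous_on \<Omega> f \<and>
  (\<exists>G. (\<forall>i. weak_pd \<Omega> i f (G i)) \<and> (\<forall>i. Lp p \<Omega> (G i)) \<and> (\<forall>i. Lp_norm p \<Omega> (G i) \<le> N)))"
 define E where "E = (\<lambda>k D. 12 * (D + 3 * k) * ((2 * k) ^ 3) powr (1 - 1 / p) / (1 - 3 / p)
   / integral (cbox (- vec k) (vec k)) (bump (- vec k) (vec k)))"
 have cmp: "\<bar>f x1 - f x2\<bar> \<le> E k D * N"
  if "adm f N" "k > 0" "!!x w s. x \<in> {x1, x2} ==> w \<in> cbox (z - x - vec k) (z - x + vec k) ==> 0 < s ==> s \<le> 1 ==> x + s *\<^sub>R w \<in> \<Omega>"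
   "x1 \<in> \<Omega>" "x2 \<in> \<Omega>" "norm (z - x1) \<le> D" "norm (z - x2) \<le> D" for f N k D x1 x2 z
 proof -
  have cf: "continuous_on \<Omega> f" using that(1) by (simp add: adm_def)
  have "\<exists>G. (\<forall>i. weak_pd \<Omega> i f (G i)) \<and> (\<forall>i. Lp p \<Omega> (G i)) \<and> (\<forall>i. Lp_norm p \<Omega> (G i) \<le> N)"
   using that(1) by (simp add: adm_def)
  then obtain G where G: "\<forall>i. weak_pd \<Omega> i f (G i)" "\<forall>i. Lp p \<Omega> (G i)" "\<forall>i. Lp_norm p \<Omega> (G i) \<le> N"
   by (elim exE conjE)
  from star_compare[OF p cf spec[OF G(1)] spec[OF G(2)] spec[OF G(3)] that(2-7)] show ?thesis by (simp add: E_def)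
 qed
 have loc: "\<exists>\<rho> C. \<rho> > 0 \<and> ball z \<rho> \<subseteq> \<Omega> \<and> (\<forall>y\<in>ball z \<rho>. \<forall>f N. adm f N \<longrightarrow> \<bar>f z - f y\<bar> \<le> C * N)" if z: "z \<in> \<Omega>" for z
 proof -
  obtain \<rho> where \<rho>: "\<rho> > 0" "ball z \<rho> \<subseteq> \<Omega>" using O z openE by blast
  define k where "k = \<rho> / 12"
  have k: "k > 0" using \<rho> by (simp add: k_def)
  have "\<bar>f z - f y\<bar> \<le> E k \<rho> * N" if y: "y \<in> ball z \<rho>" and f: "adm f N" for y f N
  proof (rule cmp[OF f k])
   fix x w and s :: real assume x: "x \<in> {z, y}" and w: "w \<in> cbox (z - x - vec k) (z - x + vec k)" and s: "0 < s" "s \<le> 1"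
   have xb: "x \<in> ball z \<rho>" using x y \<rho> by auto
   have "norm (w - (z - x)) \<le> 3 * k" by (rule norm_cube_le[OF w])
   also have "\<dots> < \<rho>" using \<rho> by (simp add: k_def)
   finally have "x + w \<in> ball z \<rho>" by (simp add: dist_norm norm_minus_commute algebra_simps)
   then have "(1 - s) *\<^sub>R x + s *\<^sub>R (x + w) \<in> ball z \<rho>"
    using xb s by (intro convexD[OF convex_ball]) auto
   then show "x + s *\<^sub>R w \<in> \<Omega>" using \<rho>(2) by (auto simp: algebra_simps)
  qed (use y \<rho> z in \<open>auto simp: dist_norm\<close>)
  then show ?thesis using \<rho> by blast
 qed
 then obtain \<rho> C where rC: "!!z. z \<in> \<Omega> ==> \<rho> z > 0" "!!z. z \<in> \<Omega> ==> ball z (\<rho> z) \<subseteq> \<Omega>"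
  "!!z y f N. z \<in> \<Omega> ==> y \<in> ball z (\<rho> z) ==> adm f N ==> \<bar>f z - f y\<bar> \<le> C z * N"
  by metis
 obtain x0 where x0: "x0 \<in> \<Omega>" using ne by blast
 have conn: "\<exists>C'. \<forall>f N. adm f N \<longrightarrow> \<bar>f x0 - f z\<bar> \<le> C' * N" if z: "z \<in> \<Omega>" for z
 proof (rule connected_equivalence_relation[OF con x0 z])
  show "\<exists>C'. \<forall>f N. adm f N \<longrightarrow> \<bar>f y - f x\<bar> \<le> C' * N" if "\<exists>C'. \<forall>f N. adm f N \<longrightarrow> \<bar>f x - f y\<bar> \<le> C' * N" for x y
   using that by (simp add: abs_minus_commute)
  show "\<exists>C'. \<forall>f N. adm f N \<longrightarrow> \<bar>f x - f u\<bar> \<le> C' * N"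
   if xy: "\<exists>C'. \<forall>f N. adm f N \<longrightarrow> \<bar>f x - f y\<bar> \<le> C' * N" and yu: "\<exists>C'. \<forall>f N. adm f N \<longrightarrow> \<bar>f y - f u\<bar> \<le> C' * N" for x y u
  proof -
   obtain C1 C2 where c: "!!f N. adm f N ==> \<bar>f x - f y\<bar> \<le> C1 * N" "!!f N. adm f N ==> \<bar>f y - f u\<bar> \<le> C2 * N"
    using xy yu by blast
   have "\<bar>f x - f u\<bar> \<le> (C1 + C2) * N" if "adm f N" for f N
    using c(1)[OF that] c(2)[OF that] by (simp add: distrib_right)
   then show ?thesis by blast
  qed
  show "\<exists>T. openin (top_of_set \<Omega>) T \<and> a \<in> T \<and> (\<forall>x\<in>T. \<exists>C'. \<forall>f N. adm f N \<longrightarrow> \<bar>f a - f x\<bar> \<le> C' * N)" if a: "a \<in> \<Omega>" for a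
  proof (intro exI[of _ "ball a (\<rho> a)"] conjI ballI)
   show "openin (top_of_set \<Omega>) (ball a (\<rho> a))" using rC(2)[OF a] O by (simp add: openin_open_eq)
   show "a \<in> ball a (\<rho> a)" using rC(1)[OF a] by simp
   show "\<exists>C'. \<forall>f N. adm f N \<longrightarrow> \<bar>f a - f x\<bar> \<le> C' * N" if "x \<in> ball a (\<rho> a)" for x
    using rC(3)[OF a that] by blast
  qed
 qed
 then obtain C' where C': "!!z f N. z \<in> \<Omega> ==> adm f N ==> \<bar>f x0 - f z\<bar> \<le> C' z * N" by metis
 obtain \<kappa> h0 where \<kappa>: "\<kappa> > 0" and h0: "h0 > 0" and
  cone: "!!x. x \<in> \<Omega> ==> \<exists>e. norm e \<le> 1 \<and> (\<forall>w\<in>cbox (e - vec \<kappa>) (e + vec \<kappa>). \<forall>s. 0 < s \<and> s \<le> h0 \<longrightarrow> x + s *\<^sub>R w \<in> \<Omega>)"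
  by (rule uniform_cone, rule that)
 define k where "k = h0 * \<kappa>"
 have k: "k > 0" using h0 \<kappa> by (simp add: k_def)
 define K where "K = closure \<Omega> \<inter> {x. k \<le> infdist x (frontier \<Omega>)}"
 have K: "compact K" unfolding K_def
  by (intro compact_Int_closed compacts closed_Collect_le continuous_intros) 
 have KO: "K \<subseteq> \<Omega>"
 proof
  fix x assume x: "x \<in> K"
  show "x \<in> \<Omega>"
  proof (rule ccontr)
   assume "x \<notin> \<Omega>"
   then have "x \<in> frontier \<Omega>" using x O by (auto simp: K_def frontier_def interior_open)
   then show False using x k by (auto simp: K_def)
  qed
 qed
 obtain Z where Z: "Z \<subseteq> K" "finite Z" "K \<subseteq> (\<Union>z\<in>Z. ball z (\<rho> z))"
  by (rule compactE_image[OF K, of K "\<lambda>z. ball z (\<rho> z)"]) (use rC(1) KO in force)+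
 define CK where "CK = (\<Sum>z\<in>Z. \<bar>C' z\<bar> + \<bar>C z\<bar>)"
 have onK: "\<bar>f x0 - f y\<bar> \<le> CK * N" if y: "y \<in> K" and f: "adm f N" for y f N
 proof -
  have N: "N \<ge> 0" using f by (simp add: adm_def)
  obtain z where z: "z \<in> Z" "y \<in> ball z (\<rho> z)" using Z(3) y by blast
  have zO: "z \<in> \<Omega>" using z(1) Z(1) KO by blast
  have "\<bar>f x0 - f y\<bar> \<le> C' z * N + C z * N" using C'[OF zO f] rC(3)[OF zO z(2) f] by linarith
  also have "\<dots> \<le> (\<bar>C' z\<bar> + \<bar>C z\<bar>) * N"
   unfolding distrib_right using N by (intro add_mono mult_right_mono) auto
  also have "\<dots> \<le> CK * N" unfolding CK_def using N z(1) Z(2)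
   by (intro mult_right_mono member_le_sum[of z Z "\<lambda>z. \<bar>C' z\<bar> + \<bar>C z\<bar>"]) auto
  finally show ?thesis .
 qed
 have all: "\<bar>f x0 - f x\<bar> \<le> (CK + E k h0) * N" if x: "x \<in> \<Omega>" and f: "adm f N" for x f N
 proof -
  obtain e where e: "norm e \<le> 1" "!!w s. w \<in> cbox (e - vec \<kappa>) (e + vec \<kappa>) ==> 0 < s ==> s \<le> h0 ==> x + s *\<^sub>R w \<in> \<Omega>"
   using cone[OF x] by blast
  define z where "z = x + h0 *\<^sub>R e"
  have inb: "(1 / h0) *\<^sub>R (y - x) \<in> cbox (e - vec \<kappa>) (e + vec \<kappa>)" if "y \<in> cbox (z - vec k) (z + vec k)" for y
   using that h0 by (auto simp: mem_box_cart z_def k_def field_simps)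
  have cubeO: "y \<in> \<Omega>" if "y \<in> cbox (z - vec k) (z + vec k)" for y
   using e(2)[OF inb[OF that], of h0] h0 by simp
  have zz: "z \<in> cbox (z - vec k) (z + vec k)" using k by (simp add: mem_box_cart)
  then have zO: "z \<in> \<Omega>" by (rule cubeO)
  have zK: "z \<in> K"
  proof -
   have "k \<le> dist z y" if y: "y \<in> frontier \<Omega>" for y
   proof (rule ccontr)
    assume "\<not> k \<le> dist z y"
    then have "\<bar>(y - z) $ i\<bar> \<le> k" for i
     using component_le_norm_cart[of "y - z" i] by (simp add: dist_norm norm_minus_commute)
    then have "y \<in> cbox (z - vec k) (z + vec k)" by (auto simp: mem_box_cart abs_le_iff algebra_simps)
    then have "y \<in> \<Omega>" by (rule cubeO)
    then show False using y O frontier_disjoint_eq[of \<Omega>] by blast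
   qed
   then have "k \<le> infdist z (frontier \<Omega>)" using infdist_attains_inf[OF frontier_closed frontier_ne, of z] by metis
   then show ?thesis using zO closure_subset by (auto simp: K_def)
  qed
  have "\<bar>f z - f x\<bar> \<le> E k h0 * N"
  proof (rule cmp[OF f k])
   fix u w and s :: real assume u: "u \<in> {z, x}" and w: "w \<in> cbox (z - u - vec k) (z - u + vec k)" and s: "0 < s" "s \<le> 1"
   show "u + s *\<^sub>R w \<in> \<Omega>"
   proof (cases "u = x")
    case True
    have "x + w \<in> cbox (z - vec k) (z + vec k)" using w True by (auto simp: mem_box_cart algebra_simps)
    from inb[OF this] have "(1 / h0) *\<^sub>R w \<in> cbox (e - vec \<kappa>) (e + vec \<kappa>)" by simp
    from e(2)[OF this, of "s * h0"] show ?thesis using s h0 True by (simp add: mult_le_cancel_right1)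
   next
    case False
    then have u: "u = z" using u by simp
    have "- k \<le> w $ i \<and> w $ i \<le> k" for i using w u by (simp add: mem_box_cart)
    then have "(z - vec k) $ i \<le> (z + w) $ i \<and> (z + w) $ i \<le> (z + vec k) $ i" for i
     by (simp add: add.commute minus_le_iff)
    then have "z + w \<in> cbox (z - vec k) (z + vec k)" by (simp add: mem_box_cart)
    then have "(1 - s) *\<^sub>R z + s *\<^sub>R (z + w) \<in> cbox (z - vec k) (z + vec k)"
     using zz s by (intro convexD[OF convex_box(1)]) auto
    then have "z + s *\<^sub>R w \<in> cbox (z - vec k) (z + vec k)" by (simp add: algebra_simps)
    then show ?thesis using cubeO u by simp
   qed
  next
   show "norm (z - x) \<le> h0" using e(1) h0 by (simp add: z_def mult_left_le)
  qed (use zO x h0 in auto)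
  then show ?thesis using onK[OF zK f] by (simp add: distrib_right)
 qed
 show ?thesis
 proof (rule that[of "2 * \<bar>CK + E k h0\<bar> + 1"])
  fix f :: "real^3 \<Rightarrow> real" and G N x y
  assume f: "continuous_on \<Omega> f" "!!i. weak_pd \<Omega> i f (G i)" "!!i. Lp p \<Omega> (G i)" "!!i. Lp_norm p \<Omega> (G i) \<le> N"
   and xy: "x \<in> \<Omega>" "y \<in> \<Omega>"
  have N: "N \<ge> 0" using f(4)[of undefined] Lp_norm_nonneg[of p \<Omega> "G undefined"] by linarith
  have a: "adm f N" unfolding adm_def using f N by blast
  have "\<bar>f x - f y\<bar> \<le> 2 * ((CK + E k h0) * N)" using all[OF xy(1) a] all[OF xy(2) a] by linarith
  also have "\<dots> \<le> (2 * \<bar>CK + E k h0\<bar> + 1) * N"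
  proof -
   have "(CK + E k h0) * N \<le> \<bar>CK + E k h0\<bar> * N" using N by (intro mult_right_mono) auto
   then show ?thesis using N by (simp add: algebra_simps)
  qed
  finally show "\<bar>f x - f y\<bar> \<le> (2 * \<bar>CK + E k h0\<bar> + 1) * N" .
 qed (simp add: add_nonneg_pos)
qed

end

section \<open>Velocity gradient and conservation of mass\<close>

lemma Lp_imp_integrable_norm:
 fixes f :: "real^3 \<Rightarrow> 'b::euclidean_space"
 assumes q: "q \<ge> 1" and f: "Lp q \<Omega> f" and Om: "\<Omega> \<in> lmeasurable"
 shows "integrable (lebesgue_on \<Omega>) (\<lambda>x. norm (f x))"
  and "(\<integral>x. norm (f x) \<partial>lebesgue_on \<Omega>) \<le> measure lebesgue \<Omega> + Lp_norm q \<Omega> f powr q"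
proof -
 have OL: "\<Omega> \<in> sets lebesgue" using Om by blast
 have c: "integrable (lebesgue_on \<Omega>) (\<lambda>x. 1 :: real)"
  using Om OL by (simp add: integrable_restrict_space lmeasurable_iff_integrable)
 have b: "integrable (lebesgue_on \<Omega>) (\<lambda>x. 1 + norm (f x) powr q)" using c f by (simp add: Lp_def)
 have le: "norm (f x) \<le> 1 + norm (f x) powr q" for x using le_powr_split[of "norm (f x)" 1 q] q by simp
 show i: "integrable (lebesgue_on \<Omega>) (\<lambda>x. norm (f x))"
  by (rule Bochner_Integration.integrable_bound[OF b])
   (use f in \<open>auto simp: Lp_def le intro!: AE_I2\<close>)
 have "(\<integral>x. norm (f x) \<partial>lebesgue_on \<Omega>) \<le> (\<integral>x. 1 + norm (f x) powr q \<partial>lebesgue_on \<Omega>)"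
  by (rule integral_mono[OF i b le])
 also have "\<dots> = measure lebesgue \<Omega> + Lp_norm q \<Omega> f powr q"
  using c f q OL by (simp add: Lp_def Lp_norm_powr measure_restrict_space)
 finally show "(\<integral>x. norm (f x) \<partial>lebesgue_on \<Omega>) \<le> measure lebesgue \<Omega> + Lp_norm q \<Omega> f powr q" .
qed

lemma AE_continuous_le:
 fixes \<phi> :: "real \<Rightarrow> real"
 assumes ab: "a < b" and ae: "AE t in lebesgue_on {a..b}. \<phi> t \<le> L" and c: "continuous_on {a..b} \<phi>" and t: "t \<in> {a..b}"
 shows "\<phi> t \<le> L"
proof (rule ccontr)
 assume "\<not> \<phi> t \<le> L"
 then have "\<phi> t - L > 0" by simp
 with c t obtain d where d: "d > 0" "!!t'. t' \<in> {a..b} ==> dist t' t < d ==> dist (\<phi> t') (\<phi> t) < \<phi> t - L"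
  unfolding continuous_on_iff by blast
 have N: "negligible {s. \<not> (s \<in> {a..b} \<longrightarrow> \<phi> s \<le> L)}"
  using ae AE_lebesgue_on[of "{a..b}" "\<lambda>t. \<phi> t \<le> L"] AE_lebesgue_negligible[of "\<lambda>s. s \<in> {a..b} \<longrightarrow> \<phi> s \<le> L"] by simp
 let ?I = "{max a (t - d)<..<min b (t + d)}"
 have "?I \<subseteq> {s. \<not> (s \<in> {a..b} \<longrightarrow> \<phi> s \<le> L)}"
 proof
  fix s assume s: "s \<in> ?I"
  then have "dist (\<phi> s) (\<phi> t) < \<phi> t - L" by (intro d(2)) (auto simp: dist_real_def)
  then show "s \<in> {s. \<not> (s \<in> {a..b} \<longrightarrow> \<phi> s \<le> L)}" using s by (auto simp: dist_real_def)
 qed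
 then have "negligible ?I" using N negligible_subset by blast
 moreover have "?I \<noteq> {}" using ab t d(1) by (auto simp: greaterThanLessThan_empty_iff)
 moreover have "open ?I" by simp
 ultimately show False using open_not_negligible by blast
qed

context defining_function
begin

lemma lmeas: "\<Omega> \<in> lmeasurable"
 using O bd by (simp add: lmeasurable_open bounded_set_imp_lmeasurable)

text \<open>The regularity class bounds the Sobolev norms for almost every time only; the derivatives are continuous in
  time, which extends the pointwise bound to every time.\<close>

lemma velocity_gradient_bounded:
 assumes q: "q > 3" and u: "Ck_space 2 \<Omega> u"
  and w: "!!i t. t \<ge> 0 ==> weak_pd \<Omega> i (u t) (Du i t)" and Li: "!!i. Linf_loc 2 q \<Omega> (Du i)"
  and t: "0 < t1" "t1 < t2"
 obtains L where "!!i t x. t \<in> {t1..t2} ==> x \<in> \<Omega> ==> norm (pd i (u t) x :: real^3) \<le> L"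
proof -
 have u2: "Ck_space (Suc (Suc 0)) \<Omega> u" using u by (simp add: numeral_2_eq_2)
 obtain C h0 where C: "C > 0" "h0 > 0" and
  sup: "!!(f :: real^3 \<Rightarrow> real^3) G N h x. continuous_on \<Omega> f ==> (!!i. weak_pd \<Omega> i f (G i)) ==>
   (!!i. Lp q \<Omega> (G i)) ==> (!!i. Lp_norm q \<Omega> (G i) \<le> N) ==> integrable (lebesgue_on \<Omega>) (\<lambda>x. norm (f x)) ==>
   0 < h ==> h \<le> h0 ==> x \<in> \<Omega> ==>
   norm (f x) \<le> C * ((1 / h) ^ 3 * (\<integral>x. norm (f x) \<partial>lebesgue_on \<Omega>) + h powr (1 - 3 / q) * N)"
 proof (rule sup_interpolation[OF q])
  fix C h0 :: real
  assume "C > 0" "h0 > 0"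
   "!!(f :: real^3 \<Rightarrow> real^3) G N h x. continuous_on \<Omega> f ==> (!!i. weak_pd \<Omega> i f (G i)) ==>
   (!!i. Lp q \<Omega> (G i)) ==> (!!i. Lp_norm q \<Omega> (G i) \<le> N) ==> integrable (lebesgue_on \<Omega>) (\<lambda>x. norm (f x)) ==>
   0 < h ==> h \<le> h0 ==> x \<in> \<Omega> ==>
   norm (f x) \<le> C * ((1 / h) ^ 3 * (\<integral>x. norm (f x) \<partial>lebesgue_on \<Omega>) + h powr (1 - 3 / q) * N)"
  then show thesis by (rule that)
 qed
 have "\<exists>L. \<forall>t\<in>{t1..t2}. \<forall>x\<in>\<Omega>. norm (pd i (u t) x) \<le> L" for i
 proof -
  obtain B where B: "AE t in lebesgue_on {t1..t2}. Wkp_norm 2 q \<Omega> (Du i t) \<le> B"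
   using Li[of i] t by (auto simp: Linf_loc_def)
  have "AE t in lebesgue_on {0<..}. Wkp 2 q \<Omega> (Du i t)"
   using Li[of i] unfolding Linf_loc_def strongly_measurable_def by (auto elim!: eventually_mono)
  then have "AE t in lebesgue_on {t1..t2}. Wkp 2 q \<Omega> (Du i t)"
   unfolding AE_lebesgue_on[OF lebesgue_closedin[of "{t1..t2}"]]
   by (auto simp: AE_lebesgue_on elim!: eventually_mono intro: less_le_trans[OF t(1)])
  define L where "L = C * ((1 / h0) ^ 3 * (measure lebesgue \<Omega> + \<bar>B\<bar> powr q) + h0 powr (1 - 3 / q) * \<bar>B\<bar>)"
  have good: "\<forall>x\<in>\<Omega>. norm (pd i (u t) x) \<le> L"
   if W: "Wkp 2 q \<Omega> (Du i t)" "Wkp_norm 2 q \<Omega> (Du i t) \<le> B" and t0: "t > 0" for t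
  proof
   fix x assume x: "x \<in> \<Omega>"
   have C2: "Ck_on (Suc (Suc 0)) \<Omega> (u t)" by (rule Ck_space_imp_Ck_on[OF u2 t0])
   have C1: "Ck_on 1 \<Omega> (u t)" using Ck_on_Suc_D[OF C2] by simp
   let ?f = "pd i (u t)"
   have ae: "AE x in lebesgue_on \<Omega>. Du i t x = ?f x"
    by (rule weak_pd_unique[OF O w weak_pd_classical[OF O C1]]) (use t0 in auto)
   have LpD: "Lp q \<Omega> (Du i t)" using Wkp_imp_Lp[OF W(1)] .
   have Lpf: "Lp q \<Omega> ?f" "Lp_norm q \<Omega> ?f \<le> B"
    using Lp_cong_AE[OF O LpD ae] Wkp_norm_ge[of q \<Omega> "Du i t" 2] W(2) by auto
   have "\<forall>j. \<exists>g. weak_pd \<Omega> j (Du i t) g \<and> Wkp 1 q \<Omega> g" using W(1) by (simp add: numeral_2_eq_2)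
   then obtain g where g: "!!j. weak_pd \<Omega> j (Du i t) (g j)" "!!j. Wkp 1 q \<Omega> (g j)" by metis
   have wg: "weak_pd \<Omega> j ?f (g j)" for j by (rule weak_pd_cong_AE[OF O g(1) ae])
   have Lg: "Lp q \<Omega> (g j)" for j by (rule Wkp_imp_Lp[OF g(2)])
   have Ng: "Lp_norm q \<Omega> (g j) \<le> \<bar>B\<bar>" for j
   proof -
    have "AE x in lebesgue_on \<Omega>. g j x = wpd \<Omega> j (Du i t) x"
     by (rule weak_pd_unique[OF O g(1) wpd_weak_pd[OF g(1)]]) simp
    then have "Lp_norm q \<Omega> (g j) = Lp_norm q \<Omega> (wpd \<Omega> j (Du i t))" by (rule Lp_cong_AE(2)[OF O Lg])
    also have "\<dots> \<le> Wkp_norm 1 q \<Omega> (wpd \<Omega> j (Du i t))" by (rule Wkp_norm_ge)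
    also have "\<dots> \<le> Wkp_norm 2 q \<Omega> (Du i t)" using Wkp_norm_Suc_ge[of 1 q \<Omega> j] by (simp add: numeral_2_eq_2)
    finally show ?thesis using W(2) by linarith
   qed
   have cf: "continuous_on \<Omega> ?f" by (rule Ck_on_continuous[OF Ck_on_pd[OF C2]])
   note I = Lp_imp_integrable_norm[OF _ Lpf(1) lmeas]
   have "norm (?f x) \<le> C * ((1 / h0) ^ 3 * (\<integral>x. norm (?f x) \<partial>lebesgue_on \<Omega>) + h0 powr (1 - 3 / q) * \<bar>B\<bar>)"
    using q by (intro sup[OF cf wg Lg Ng I(1) C(2) order_refl x]) auto
   also have "\<dots> \<le> L"
   proof -
    have "(\<integral>x. norm (?f x) \<partial>lebesgue_on \<Omega>) \<le> measure lebesgue \<Omega> + Lp_norm q \<Omega> ?f powr q" using I(2) q by simp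
    also have "\<dots> \<le> measure lebesgue \<Omega> + \<bar>B\<bar> powr q"
     using Lpf(2) Lp_norm_nonneg[of q \<Omega> ?f] q by (intro add_left_mono powr_mono2) auto
    finally show ?thesis unfolding L_def using C by (intro mult_left_mono add_right_mono) auto
   qed
   finally show "norm (?f x) \<le> L" .
  qed
  have ae: "AE t in lebesgue_on {t1..t2}. \<forall>x\<in>\<Omega>. norm (pd i (u t) x) \<le> L"
  proof -
   have "AE t in lebesgue_on {t1..t2}. t \<in> {t1..t2}" by (rule AE_I2) simp
   then show ?thesis using B \<open>AE t in lebesgue_on {t1..t2}. Wkp 2 q \<Omega> (Du i t)\<close>
    by eventually_elim (use good t in auto)
  qed
  have "norm (pd i (u t) x) \<le> L" if tt: "t \<in> {t1..t2}" and x: "x \<in> \<Omega>" for t x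
  proof (rule AE_continuous_le[OF t(2) _ _ tt])
   show "AE t in lebesgue_on {t1..t2}. norm (pd i (u t) x) \<le> L" using ae by eventually_elim (use x in blast)
   have "continuous_on ({0<..} \<times> \<Omega>) (\<lambda>(t, x). pd i (u t) x)"
    by (rule Ck_space_continuous[OF Ck_space_Suc_D(2)[OF u2]])
   then have "continuous_on {t1..t2} (\<lambda>t. (\<lambda>(t, x). pd i (u t) x) (t, x))"
    by (rule continuous_on_compose2) (use t x in \<open>auto intro!: continuous_intros\<close>)
   then show "continuous_on {t1..t2} (\<lambda>t. norm (pd i (u t) x))" by (intro continuous_on_norm) simp
  qed
  then show ?thesis by blast
 qed
 then obtain L where L: "!!i t x. t \<in> {t1..t2} ==> x \<in> \<Omega> ==> norm (pd i (u t) x) \<le> L i" by metis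
 have "norm (pd i (u t) x) \<le> (\<Sum>i\<in>UNIV. \<bar>L i\<bar>)" if "t \<in> {t1..t2}" "x \<in> \<Omega>" for i t x
  using L[OF that, of i] member_le_sum[of i UNIV "\<lambda>i. \<bar>L i\<bar>"] by simp
 then show ?thesis using that by blast
qed

end

lemma slice_continuous:
 assumes "continuous_on ({0..} \<times> S) (\<lambda>(t, x). f t x)" "t \<ge> 0"
 shows "continuous_on S (f t)"
proof -
 have "continuous_on S (\<lambda>x. (\<lambda>(t, x). f t x) (t, x))"
  by (rule continuous_on_compose2[OF assms(1)]) (use assms(2) in \<open>auto intro!: continuous_intros\<close>)
 then show ?thesis by simp
qed

lemma continuous_bounded_slices:
 fixes f :: "real \<Rightarrow> real^3 \<Rightarrow> 'b::real_normed_vector"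
 assumes "continuous_on ({0..} \<times> S) (\<lambda>(t, x). f t x)" "compact S"
 obtains B where "!!t x. 0 \<le> t ==> t \<le> T ==> x \<in> S ==> norm (f t x) \<le> B"
proof -
 have "compact ((\<lambda>(t, x). f t x) ` ({0..T} \<times> S))"
  by (intro compact_continuous_image compact_Times assms continuous_on_subset[OF assms(1)]) auto
 then obtain B where "!!y. y \<in> (\<lambda>(t, x). f t x) ` ({0..T} \<times> S) ==> norm y \<le> B"
  using compact_imp_bounded bounded_iff by metis
 then show ?thesis using that[of B] by force
qed

lemma continuous_on_zero_extend:
 fixes f :: "real \<times> (real^3) \<Rightarrow> 'b::real_normed_vector"
 assumes "open \<Omega>" "closed K" "K \<subseteq> \<Omega>" and f: "continuous_on (T \<times> \<Omega>) f" and z: "!!t x. t \<in> T ==> x \<in> \<Omega> - K ==> f (t, x) = 0"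
 shows "continuous_on (T \<times> UNIV) (\<lambda>p. if snd p \<in> \<Omega> then f p else 0)"
proof -
 have U: "T \<times> UNIV = T \<times> \<Omega> \<union> T \<times> (- K)" using assms(3) by auto
 have o: "openin (top_of_set (T \<times> UNIV)) (T \<times> A)" if "open A" for A :: "(real^3) set"
  unfolding openin_open using open_Times[OF open_UNIV that] by (intro exI[of _ "UNIV \<times> A"]) auto
 have "continuous_on (T \<times> \<Omega> \<union> T \<times> (- K)) (\<lambda>p. if snd p \<in> \<Omega> then f p else 0)"
 proof (rule continuous_on_Un_local_open)
  show "openin (top_of_set (T \<times> \<Omega> \<union> T \<times> - K)) (T \<times> \<Omega>)" "openin (top_of_set (T \<times> \<Omega> \<union> T \<times> - K)) (T \<times> - K)"
   using o[OF assms(1)] o[OF open_Compl[OF assms(2)]] by (simp_all add: U[symmetric])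
  show "continuous_on (T \<times> \<Omega>) (\<lambda>p. if snd p \<in> \<Omega> then f p else 0)"
   using f by (rule continuous_on_eq) auto
  show "continuous_on (T \<times> - K) (\<lambda>p. if snd p \<in> \<Omega> then f p else 0)"
   by (rule continuous_on_eq[OF continuous_on_const[of _ 0]]) (use z in auto)
 qed
 then show ?thesis by (simp add: U)
qed

lemma divergence_density_flux:
 assumes "r differentiable (at x)" "v differentiable (at x)"
 shows "divergence (\<lambda>y. r y *\<^sub>R v y) x = v x \<bullet> grad r x + r x * (\<Sum>i\<in>UNIV. pd i v x $ i)"
  and "(\<Sum>i\<in>UNIV. pd i (\<lambda>y. r y * v y $ i) x) = divergence (\<lambda>y. r y *\<^sub>R v y) x"
proof -
 have vi: "(\<lambda>y. v y $ i) differentiable (at x)" for i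
  using bounded_linear.has_derivative[OF bounded_linear_vec_nth has_derivative_pd[OF assms(2)]] by (rule differentiableI)
 show "divergence (\<lambda>y. r y *\<^sub>R v y) x = v x \<bullet> grad r x + r x * (\<Sum>i\<in>UNIV. pd i v x $ i)"
  by (simp add: divergence_def div_of_def pd_scaleR[OF assms] inner_grad sum.distrib sum_distrib_left mult.commute)
 show "(\<Sum>i\<in>UNIV. pd i (\<lambda>y. r y * v y $ i) x) = divergence (\<lambda>y. r y *\<^sub>R v y) x"
  by (simp add: divergence_def div_of_def pd_scaleR[OF assms] pd_mult[OF assms(1) vi] pd_nth[OF assms(2)])
qed

lemma flat_1_weighted_bound:
 assumes "s > 0" shows "(s + 1) * flat (Suc 0) s \<le> 4" "s \<ge> 1 ==> (s + 1) * flat (Suc 0) s \<le> 2 / s"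
proof -
 have f: "flat (Suc 0) s = exp (- (1 / s)) * (1 / s) ^ 2" using assms by (simp add: flat_1 power_divide)
 have e: "(1 / s) ^ 2 \<le> 2 * exp (1 / s)"
 proof -
  have "0 \<le> 1 / s" using assms by simp
  then show ?thesis using exp_lower_Taylor_quadratic[of "1 / s"] by linarith
 qed
 have "exp (- (1 / s)) * (1 / s) ^ 2 \<le> exp (- (1 / s)) * (2 * exp (1 / s))" using e by (intro mult_left_mono) auto
 then have 2: "flat (Suc 0) s \<le> 2" unfolding f by (simp add: exp_minus field_simps)
 have 3: "flat (Suc 0) s \<le> (1 / s) ^ 2" unfolding f using assms by (intro mult_left_le_one_le) auto
 show large: "(s + 1) * flat (Suc 0) s \<le> 2 / s" if "s \<ge> 1"
 proof -
  have "(s + 1) * flat (Suc 0) s \<le> (2 * s) * (1 / s) ^ 2" using 3 that by (intro mult_mono) (auto simp: flat_1)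
  also have "\<dots> = 2 / s" using assms by (simp add: power2_eq_square)
  finally show ?thesis .
 qed
 show "(s + 1) * flat (Suc 0) s \<le> 4"
 proof (cases "s \<ge> 1")
  case True
  then have "2 / s \<le> 2" by (simp add: divide_simps)
  then show ?thesis using large[OF True] by linarith
 next
  case False
  then have "(s + 1) * flat (Suc 0) s \<le> 2 * 2" using 2 assms by (intro mult_mono) (auto simp: flat_1)
  then show ?thesis by simp
 qed
qed

context defining_function
begin

text \<open>It vanishes on the collar \<open>g \<le> 1 / k\<close> of the boundary and tends to one on the domain as \<open>k\<close> grows.\<close>

definition collar_cutoff :: "nat \<Rightarrow> real^3 \<Rightarrow> real" where
 "collar_cutoff k x = flat 0 (real k * g x - 1)"

definition collar_core :: "nat \<Rightarrow> (real^3) set" where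
 "collar_core k = {x \<in> closure \<Omega>. 1 \<le> real k * g x}"

lemma collar_core: "compact (collar_core k)" "collar_core k \<subseteq> \<Omega>"
proof -
 have "collar_core k = closure \<Omega> \<inter> {x. 1 \<le> real k * g x}" by (auto simp: collar_core_def)
 then show "compact (collar_core k)"
  by (auto intro!: compact_Int_closed compacts closed_Collect_le continuous_intros gcont)
 show "collar_core k \<subseteq> \<Omega>"
 proof
  fix x assume x: "x \<in> collar_core k"
  show "x \<in> \<Omega>"
  proof (rule ccontr)
   assume "x \<notin> \<Omega>"
   then have "x \<in> frontier \<Omega>" using x O by (auto simp: collar_core_def frontier_def interior_open)
   then show False using x gfr by (auto simp: collar_core_def)
  qed
 qed
qed

lemma collar_cutoff_zero: "x \<in> \<Omega> - collar_core k ==> collar_cutoff k x = 0"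
 using closure_subset[of \<Omega>] by (auto simp: collar_cutoff_def collar_core_def flat_0)

lemma Ck_on_collar_cutoff: "Ck_on 1 \<Omega> (collar_cutoff k)"
proof -
 have "Ck_on 1 \<Omega> g" using Ck_on_le[OF Ck_on_subset[OF subset_UNIV gC], of 1] by simp
 then show ?thesis unfolding collar_cutoff_def [abs_def]
  by (intro Ck_on_flat Ck_on_diff Ck_on_mult Ck_on_const O)
qed

lemma pd_collar_cutoff: "pd i (collar_cutoff k) x = flat (Suc 0) (real k * g x - 1) * (real k * pd i g x)"
proof -
 have d: "(\<lambda>x. real k * g x - 1) differentiable (at x)" by (intro differentiable_diff differentiable_mult gd) auto
 have "pd i (\<lambda>x. real k * g x - 1) x = real k * pd i g x"
  using gd by (subst pd_diff) (auto simp: pd_cmul)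
 then show ?thesis unfolding collar_cutoff_def [abs_def]
  using pd_compose(1)[OF flat_deriv d] by simp
qed

text \<open>The flux of mass through the collar tends to zero although the cut-off becomes steep: its gradient
  grows like \<open>1 / g\<close> on the collar, and the normal velocity vanishes like \<open>g\<close>.\<close>

lemma mass_conserved_positive_times:
 assumes rc: "continuous_on ({0..} \<times> closure \<Omega>) (\<lambda>(t, x). \<rho> t x)"
  and r1: "C1_time \<Omega> \<rho>" "Ck_space 1 \<Omega> \<rho>" and u2: "Ck_space 2 \<Omega> u"
  and eq: "!!t x. t > 0 ==> x \<in> \<Omega> ==> dt \<rho> t x + divergence (\<lambda>y. \<rho> t y *\<^sub>R u t y) x = 0"
  and R: "!!t x. t \<ge> 0 ==> x \<in> \<Omega> ==> 0 \<le> \<rho> t x \<and> \<rho> t x \<le> R"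
  and t: "0 < t1" "t1 < t2"
  and flux: "!!t x. t \<in> {t1..t2} ==> x \<in> \<Omega> ==> \<bar>u t x \<bullet> grad g x\<bar> \<le> C * g x"
 shows "(\<integral>x. \<rho> t1 x \<partial>lebesgue_on \<Omega>) = (\<integral>x. \<rho> t2 x \<partial>lebesgue_on \<Omega>)"
proof -
 have OL: "\<Omega> \<in> sets lebesgue" using O by simp
 obtain x0 where x0: "x0 \<in> \<Omega>" using ne by blast
 have C: "C \<ge> 0"
 proof -
  have "0 \<le> C * g x0" using flux[of t1 x0] t x0 by force
  then show ?thesis using gpos[OF x0] by (simp add: zero_le_mult_iff)
 qed
 have Rp: "R \<ge> 0" using R[of 0 x0] x0 by simp
 have c1: "integrable (lebesgue_on \<Omega>) (\<lambda>x. c)" for c :: real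
  using lmeas OL by (simp add: integrable_restrict_space lmeasurable_iff_integrable)
 have ms: "f \<in> borel_measurable (lebesgue_on \<Omega>)" if "continuous_on \<Omega> f" for f :: "real^3 \<Rightarrow> real"
  by (rule continuous_imp_measurable_on_sets_lebesgue[OF that OL])
 have rct: "continuous_on \<Omega> (\<rho> t)" if "t \<ge> 0" for t
  using continuous_on_subset[OF slice_continuous[OF rc that] closure_subset] .
 have ccut: "continuous_on \<Omega> (collar_cutoff k)" for k by (rule Ck_on_continuous[OF Ck_on_collar_cutoff])
 define m where "m = (\<lambda>k t. integral \<Omega> (\<lambda>x. collar_cutoff k x * \<rho> t x))"
 define E where "E = (\<lambda>k x. R * C * (real k * g x * flat (Suc 0) (real k * g x - 1)))"
 have cE: "continuous_on \<Omega> (E k)" for k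
 proof -
  have "continuous_on UNIV (flat (Suc 0))"
   by (rule DERIV_continuous_on) (rule has_field_derivative_at_within[OF flat_deriv])
  then have "continuous_on \<Omega> (\<lambda>x. flat (Suc 0) (real k * g x - 1))"
   by (rule continuous_on_compose2) (auto intro!: continuous_on_diff continuous_on_mult continuous_on_const gcont(1))
  then show ?thesis unfolding E_def by (intro continuous_on_mult continuous_on_const gcont(1))
 qed
 have Eb: "0 \<le> E k x" "E k x \<le> R * C * 4" if "x \<in> \<Omega>" for k x
 proof -
  have "0 \<le> real k * g x * flat (Suc 0) (real k * g x - 1)" using gpos[OF that] by (simp add: flat_1)
  moreover have "real k * g x * flat (Suc 0) (real k * g x - 1) \<le> 4"
   using flat_1_weighted_bound(1)[of "real k * g x - 1"] by (cases "real k * g x - 1 > 0") (auto simp: flat_1)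
  ultimately show "0 \<le> E k x" "E k x \<le> R * C * 4" unfolding E_def using C Rp by (auto intro!: mult_left_mono)
 qed
 have iE: "integrable (lebesgue_on \<Omega>) (E k)" for k
  by (rule Bochner_Integration.integrable_bound[OF c1[of "R * C * 4"] ms[OF cE]])
   (use Eb C Rp in \<open>auto intro!: AE_I2\<close>)
 have E0: "(\<lambda>k. \<integral>x. E k x \<partial>lebesgue_on \<Omega>) \<longlonglongrightarrow> (\<integral>x. 0 \<partial>lebesgue_on \<Omega>)"
 proof (rule integral_dominated_convergence[where w = "\<lambda>x. R * C * 4"])
  show "AE x in lebesgue_on \<Omega>. (\<lambda>k. E k x) \<longlonglongrightarrow> 0"
  proof (rule AE_I2)
   fix x assume "x \<in> space (lebesgue_on \<Omega>)"
   then have x: "x \<in> \<Omega>" by simp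
   have lim: "filterlim (\<lambda>k. real k * g x - 1) at_top sequentially"
   proof -
    have "filterlim (\<lambda>k. g x * real k) at_top sequentially"
     by (rule filterlim_tendsto_pos_mult_at_top[OF tendsto_const gpos[OF x] filterlim_real_sequentially])
    from filterlim_tendsto_add_at_top[OF tendsto_const[of "-1"] this] show ?thesis
     by (simp add: mult.commute)
   qed
   have "((\<lambda>s::real. R * C * (2 / s)) \<longlongrightarrow> R * C * 0) at_top"
    by (intro tendsto_mult tendsto_const tendsto_divide_0[OF tendsto_const]
      filterlim_at_top_imp_at_infinity filterlim_ident)
   then have "((\<lambda>s::real. R * C * (2 / s)) \<longlongrightarrow> 0) at_top" by simp
   then have "(\<lambda>k. R * C * (2 / (real k * g x - 1))) \<longlonglongrightarrow> 0" by (rule filterlim_compose[OF _ lim])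
   then show "(\<lambda>k. E k x) \<longlonglongrightarrow> 0"
   proof (rule Lim_null_comparison[rotated])
    have "eventually (\<lambda>k. real k * g x - 1 \<ge> 1) sequentially"
     using lim unfolding filterlim_at_top by (rule spec)
    then show "eventually (\<lambda>k. norm (E k x) \<le> R * C * (2 / (real k * g x - 1))) sequentially"
    proof eventually_elim
     case (elim k)
     have "E k x \<le> R * C * (2 / (real k * g x - 1))" unfolding E_def
      using flat_1_weighted_bound(2)[of "real k * g x - 1"] elim C Rp by (intro mult_left_mono) auto
     then show ?case using Eb(1)[OF x] by simp
    qed
   qed
  qed
 qed (use c1 ms cE Eb in \<open>auto intro!: AE_I2\<close>)
 have bound: "\<bar>m k t2 - m k t1\<bar> \<le> (\<integral>x. E k x \<partial>lebesgue_on \<Omega>) * (t2 - t1)" for k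
 proof -
  let ?K = "collar_core k"
  obtain c where c: "?K \<subseteq> cbox (-c) c" using bounded_subset_cbox_symmetric[OF compact_imp_bounded[OF collar_core(1)]] by blast
  define f where "f = (\<lambda>t x. if x \<in> \<Omega> then collar_cutoff k x * \<rho> t x else 0)"
  define f' where "f' = (\<lambda>t x. if x \<in> \<Omega> then collar_cutoff k x * dt \<rho> t x else 0)"
  have ms_eq: "m k t = integral (cbox (-c) c) (f t)" for t
  proof -
   have "integral \<Omega> (\<lambda>x. collar_cutoff k x * \<rho> t x) = integral \<Omega> (f t)"
    by (rule Henstock_Kurzweil_Integration.integral_cong) (simp add: f_def)
   also have "\<dots> = integral (cbox (-c) c) (f t)"
    by (rule integral_cpt_support[of ?K]) (use collar_core c collar_cutoff_zero[of _ k] in \<open>auto simp: f_def\<close>)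
   finally show ?thesis by (simp add: m_def)
  qed
  have fc: "continuous_on ({t1..t2} \<times> UNIV) (\<lambda>(t, x). f t x)"
  proof -
   have rc': "continuous_on ({0..} \<times> closure \<Omega>) (\<lambda>p. \<rho> (fst p) (snd p))"
    using rc by (simp add: case_prod_unfold)
   have "continuous_on ({t1..t2} \<times> UNIV) (\<lambda>p. if snd p \<in> \<Omega> then collar_cutoff k (snd p) * \<rho> (fst p) (snd p) else 0)"
    by (rule continuous_on_zero_extend[OF O compact_imp_closed[OF collar_core(1)] collar_core(2)])
     (use t closure_subset[of \<Omega>] collar_cutoff_zero[of _ k] in
      \<open>auto intro!: continuous_on_mult continuous_on_compose2[OF ccut] continuous_intros continuous_on_subset[OF rc']\<close>)
   then show ?thesis by (simp add: f_def case_prod_unfold)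
  qed
  have f'c: "continuous_on ({t1..t2} \<times> UNIV) (\<lambda>(t, x). f' t x)"
  proof -
   have d: "continuous_on ({0<..} \<times> \<Omega>) (\<lambda>p. dt \<rho> (fst p) (snd p))"
    using r1(1) by (simp add: C1_time_def case_prod_unfold)
   have "continuous_on ({t1..t2} \<times> UNIV) (\<lambda>p. if snd p \<in> \<Omega> then collar_cutoff k (snd p) * dt \<rho> (fst p) (snd p) else 0)"
    by (rule continuous_on_zero_extend[OF O compact_imp_closed[OF collar_core(1)] collar_core(2)])
     (use t collar_cutoff_zero[of _ k] in
      \<open>auto intro!: continuous_on_mult continuous_on_compose2[OF ccut] continuous_intros continuous_on_subset[OF d]\<close>)
   then show ?thesis by (simp add: f'_def case_prod_unfold)
  qed
  have D: "((\<lambda>t. m k t) has_vector_derivative integral (cbox (-c) c) (f' t)) (at t within {t1..t2})" if tt: "t \<in> {t1..t2}" for t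
   unfolding ms_eq
  proof (rule leibniz_rule_vector_derivative)
   fix s x assume s: "s \<in> {t1..t2}" "x \<in> cbox (-c) c"
   show "((\<lambda>s. f s x) has_vector_derivative f' s x) (at s within {t1..t2})"
   proof (cases "x \<in> \<Omega>")
    case True
    have "(\<lambda>\<tau>. \<rho> \<tau> x) differentiable (at s)" using r1(1) s t True by (auto simp: C1_time_def)
    then have "((\<lambda>\<tau>. \<rho> \<tau> x) has_vector_derivative dt \<rho> s x) (at s within {t1..t2})"
     unfolding dt_def by (meson vector_derivative_works has_vector_derivative_at_within)
    from has_vector_derivative_mult_right[OF this, of "collar_cutoff k x"]
    show ?thesis using True by (simp add: f_def f'_def)
   qed (simp add: f_def f'_def)
  next
   fix s assume s: "s \<in> {t1..t2}"
   have "continuous_on (cbox (-c) c) (\<lambda>x. (\<lambda>(t, x). f t x) (s, x))"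
    by (rule continuous_on_compose2[OF fc]) (use s in \<open>auto intro!: continuous_intros\<close>)
   then show "f s integrable_on cbox (-c) c" by (simp add: integrable_continuous)
  qed (use f'c tt in \<open>auto intro: continuous_on_subset\<close>)
  have Db: "norm (integral (cbox (-c) c) (f' s)) \<le> (\<integral>x. E k x \<partial>lebesgue_on \<Omega>)" if s: "s \<in> {t1..t2}" for s
  proof -
   have s0: "s > 0" using s t by auto
   have rC: "Ck_on (Suc 0) \<Omega> (\<rho> s)" using Ck_space_imp_Ck_on[OF r1(2) s0] by simp
   have uC: "Ck_on 1 \<Omega> (u s)" using Ck_on_le[OF Ck_space_imp_Ck_on[OF u2 s0], of 1] by simp
   have uC': "Ck_on (Suc 0) \<Omega> (u s)" using uC by simp
   have ruC: "Ck_on 1 \<Omega> (\<lambda>y. \<rho> s y * u s y $ i)" for i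
    using rC by (intro Ck_on_mult Ck_on_nth O uC) simp
   note z = collar_cutoff_zero[of _ k]
   note parts = integral_by_parts[OF O collar_core(1) collar_core(2) order_refl ruC Ck_on_collar_cutoff z]
   have "integral (cbox (-c) c) (f' s) = integral \<Omega> (f' s)"
    by (rule integral_cpt_support[of ?K]) (use collar_core c collar_cutoff_zero[of _ k] in \<open>auto simp: f'_def\<close>)
   also have "\<dots> = integral \<Omega> (\<lambda>x. - (\<Sum>i\<in>UNIV. pd i (\<lambda>y. \<rho> s y * u s y $ i) x * collar_cutoff k x))"
   proof (rule Henstock_Kurzweil_Integration.integral_cong)
    fix x assume x: "x \<in> \<Omega>"
    have "dt \<rho> s x = - (\<Sum>i\<in>UNIV. pd i (\<lambda>y. \<rho> s y * u s y $ i) x)"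
     using eq[OF s0 x] divergence_density_flux(2)[OF Ck_on_differentiable[OF rC x] Ck_on_differentiable[OF uC' x]] by linarith
    then show "f' s x = - (\<Sum>i\<in>UNIV. pd i (\<lambda>y. \<rho> s y * u s y $ i) x * collar_cutoff k x)"
     using x by (simp add: f'_def sum_distrib_left mult.commute)
   qed
   also have "\<dots> = - (\<Sum>i\<in>UNIV. integral \<Omega> (\<lambda>x. pd i (\<lambda>y. \<rho> s y * u s y $ i) x * collar_cutoff k x))"
   proof -
    have "integral \<Omega> (\<lambda>x. \<Sum>i\<in>UNIV. pd i (\<lambda>y. \<rho> s y * u s y $ i) x * collar_cutoff k x) =
     (\<Sum>i\<in>UNIV. integral \<Omega> (\<lambda>x. pd i (\<lambda>y. \<rho> s y * u s y $ i) x * collar_cutoff k x))"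
     by (rule Henstock_Kurzweil_Integration.integral_sum) (simp, rule parts(2))
    then show ?thesis by simp
   qed
   also have "\<dots> = (\<Sum>i\<in>UNIV. integral \<Omega> (\<lambda>x. \<rho> s x * u s x $ i * pd i (collar_cutoff k) x))"
   proof -
    have "integral \<Omega> (\<lambda>x. pd i (\<lambda>y. \<rho> s y * u s y $ i) x * collar_cutoff k x) =
     - integral \<Omega> (\<lambda>x. \<rho> s x * u s x $ i * pd i (collar_cutoff k) x)" for i
     by (rule parts(1))
    then show ?thesis by (simp only: sum_negf minus_minus)
   qed
   also have "\<dots> = integral \<Omega> (\<lambda>x. \<Sum>i\<in>UNIV. \<rho> s x * u s x $ i * pd i (collar_cutoff k) x)"
    by (rule Henstock_Kurzweil_Integration.integral_sum[symmetric]) (auto intro: parts(3))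
   also have "norm \<dots> \<le> integral \<Omega> (E k)"
   proof (rule Henstock_Kurzweil_Integration.integral_norm_bound_integral)
    show "(\<lambda>x. \<Sum>i\<in>UNIV. \<rho> s x * u s x $ i * pd i (collar_cutoff k) x) integrable_on \<Omega>"
     by (intro integrable_sum parts(3)) auto
    show "E k integrable_on \<Omega>" using has_integral_integral_lebesgue_on[OF iE OL] by blast
    fix x assume x: "x \<in> \<Omega>"
    have "(\<Sum>i\<in>UNIV. \<rho> s x * u s x $ i * pd i (collar_cutoff k) x)
     = \<rho> s x * (real k * flat (Suc 0) (real k * g x - 1)) * (u s x \<bullet> grad g x)"
     by (simp add: pd_collar_cutoff inner_grad sum_distrib_left mult_ac)
    also have "norm \<dots> \<le> R * (real k * flat (Suc 0) (real k * g x - 1)) * (C * g x)"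
     unfolding real_norm_def abs_mult using R[of s x] flux[OF s x] s0 x
     by (intro mult_mono) (auto simp: flat_1 Rp)
    finally show "norm (\<Sum>i\<in>UNIV. \<rho> s x * u s x $ i * pd i (collar_cutoff k) x) \<le> E k x"
     by (simp add: E_def mult_ac)
   qed
   also have "\<dots> = (\<integral>x. E k x \<partial>lebesgue_on \<Omega>)" using lebesgue_integral_eq_integral[OF iE OL] by simp
   finally show ?thesis .
  qed
  have "norm (m k t2 - m k t1) \<le> (\<integral>x. E k x \<partial>lebesgue_on \<Omega>) * t2 - (\<integral>x. E k x \<partial>lebesgue_on \<Omega>) * t1"
  proof (rule differentiable_bound_general[OF t(2)])
   show "continuous_on {t1..t2} (m k)"
    using D by (intro continuous_on_vector_derivative) auto
   fix s assume s: "t1 < s" "s < t2"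
   then have "at s within {t1..t2} = at s" by (intro at_within_interior) auto
   then show "(m k has_vector_derivative integral (cbox (-c) c) (f' s)) (at s)" using D[of s] s by simp
   show "norm (integral (cbox (-c) c) (f' s)) \<le> (\<integral>x. E k x \<partial>lebesgue_on \<Omega>)" using Db s by simp
   show "((\<lambda>t. (\<integral>x. E k x \<partial>lebesgue_on \<Omega>) * t) has_vector_derivative (\<integral>x. E k x \<partial>lebesgue_on \<Omega>)) (at s)"
    unfolding has_real_derivative_iff_has_vector_derivative[symmetric] by (auto intro!: derivative_eq_intros)
  qed (intro continuous_intros)
  then show ?thesis by (simp add: right_diff_distrib)
 qed
 have conv: "(\<lambda>k. m k t) \<longlonglongrightarrow> (\<integral>x. \<rho> t x \<partial>lebesgue_on \<Omega>)" if t0: "t > 0" for t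
 proof -
  have cut: "\<bar>collar_cutoff k x\<bar> \<le> 1" for k x using flat_0_bounds[of "real k * g x - 1"] by (simp add: collar_cutoff_def)
  have b: "\<bar>collar_cutoff k x * \<rho> t x\<bar> \<le> R" if "x \<in> \<Omega>" for k x
   using mult_mono[OF cut[of k x], of "\<bar>\<rho> t x\<bar>" R] R[of t x] t0 that by (simp add: abs_mult)
  have mm: "(\<lambda>x. collar_cutoff k x * \<rho> t x) \<in> borel_measurable (lebesgue_on \<Omega>)" for k
   using t0 by (intro ms continuous_on_mult ccut rct) simp
  have i: "integrable (lebesgue_on \<Omega>) (\<lambda>x. collar_cutoff k x * \<rho> t x)" for k
   by (rule Bochner_Integration.integrable_bound[OF c1[of R] mm]) (use b Rp in \<open>auto intro!: AE_I2\<close>)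
  have "(\<lambda>k. \<integral>x. collar_cutoff k x * \<rho> t x \<partial>lebesgue_on \<Omega>) \<longlonglongrightarrow> (\<integral>x. \<rho> t x \<partial>lebesgue_on \<Omega>)"
  proof (rule integral_dominated_convergence[where w = "\<lambda>x. R"])
   show "AE x in lebesgue_on \<Omega>. (\<lambda>k. collar_cutoff k x * \<rho> t x) \<longlonglongrightarrow> \<rho> t x"
   proof (rule AE_I2)
    fix x assume "x \<in> space (lebesgue_on \<Omega>)"
    then have x: "x \<in> \<Omega>" by simp
    have "filterlim (\<lambda>k. g x * real k) at_top sequentially"
     by (rule filterlim_tendsto_pos_mult_at_top[OF tendsto_const gpos[OF x] filterlim_real_sequentially])
    from filterlim_tendsto_add_at_top[OF tendsto_const[of "-1"] this]
    have lim: "filterlim (\<lambda>k. real k * g x - 1) at_top sequentially" by (simp add: mult.commute)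
    have "(\<lambda>k. exp (- (1 / (real k * g x - 1)))) \<longlonglongrightarrow> exp (- 0)"
     by (intro tendsto_exp tendsto_minus tendsto_divide_0[OF tendsto_const] filterlim_at_top_imp_at_infinity lim)
    then have "(\<lambda>k. collar_cutoff k x) \<longlonglongrightarrow> exp (- 0)"
    proof (rule Lim_transform_eventually)
     have "eventually (\<lambda>k. real k * g x - 1 > 0) sequentially"
      using lim unfolding filterlim_at_top_dense by (rule spec)
     then show "eventually (\<lambda>k. exp (- (1 / (real k * g x - 1))) = collar_cutoff k x) sequentially"
      by eventually_elim (simp add: collar_cutoff_def flat_0)
    qed
    from tendsto_mult[OF this tendsto_const[of "\<rho> t x"]]
    show "(\<lambda>k. collar_cutoff k x * \<rho> t x) \<longlonglongrightarrow> \<rho> t x" by simp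
   qed
  qed (use c1 mm b ms rct t0 in \<open>auto intro!: AE_I2\<close>)
  then show ?thesis using lebesgue_integral_eq_integral[OF i OL] by (simp add: m_def)
 qed
 have "(\<lambda>k. (\<integral>x. E k x \<partial>lebesgue_on \<Omega>) * (t2 - t1)) \<longlonglongrightarrow> 0 * (t2 - t1)"
  using E0 by (intro tendsto_mult tendsto_const) simp
 moreover have "(\<lambda>k. \<bar>m k t2 - m k t1\<bar>) \<longlonglongrightarrow> \<bar>(\<integral>x. \<rho> t2 x \<partial>lebesgue_on \<Omega>) - (\<integral>x. \<rho> t1 x \<partial>lebesgue_on \<Omega>)\<bar>"
  using t by (intro tendsto_rabs tendsto_diff conv) auto
 ultimately have "\<bar>(\<integral>x. \<rho> t2 x \<partial>lebesgue_on \<Omega>) - (\<integral>x. \<rho> t1 x \<partial>lebesgue_on \<Omega>)\<bar> \<le> 0 * (t2 - t1)"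
  using LIMSEQ_le[of "\<lambda>k. \<bar>m k t2 - m k t1\<bar>" _ "\<lambda>k. (\<integral>x. E k x \<partial>lebesgue_on \<Omega>) * (t2 - t1)"] bound by blast
 then show ?thesis by simp
qed

text \<open>Extension of the conservation law to the initial time by continuity of the density.\<close>

lemma mass_conserved:
 fixes \<rho> :: "real \<Rightarrow> real^3 \<Rightarrow> real" and t :: real
 assumes rc: "continuous_on ({0..} \<times> closure \<Omega>) (\<lambda>(t, x). \<rho> t x)"
  and R: "!!t x. t \<ge> 0 ==> x \<in> \<Omega> ==> 0 \<le> \<rho> t x \<and> \<rho> t x \<le> R"
  and pos: "!!t1 t2. 0 < t1 ==> t1 < t2 ==> (\<integral>x. \<rho> t1 x \<partial>lebesgue_on \<Omega>) = (\<integral>x. \<rho> t2 x \<partial>lebesgue_on \<Omega>)"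
  and t: "t > 0"
 shows "(\<integral>x. \<rho> t x \<partial>lebesgue_on \<Omega>) = (\<integral>x. \<rho> 0 x \<partial>lebesgue_on \<Omega>)"
proof -
 have OL: "\<Omega> \<in> sets lebesgue" using O by simp
 have ms: "\<rho> s \<in> borel_measurable (lebesgue_on \<Omega>)" if "s \<ge> 0" for s
  by (rule continuous_imp_measurable_on_sets_lebesgue[OF continuous_on_subset[OF slice_continuous[OF rc that] closure_subset] OL])
 have "(\<lambda>n. \<integral>x. \<rho> (t / real (Suc (Suc n))) x \<partial>lebesgue_on \<Omega>) \<longlonglongrightarrow> (\<integral>x. \<rho> 0 x \<partial>lebesgue_on \<Omega>)"
 proof (rule integral_dominated_convergence[where w = "\<lambda>x. R"])
  show "integrable (lebesgue_on \<Omega>) (\<lambda>x. R)"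
   using lmeas OL by (simp add: integrable_restrict_space lmeasurable_iff_integrable)
  show "AE x in lebesgue_on \<Omega>. (\<lambda>n. \<rho> (t / real (Suc (Suc n))) x) \<longlonglongrightarrow> \<rho> 0 x"
  proof (rule AE_I2)
   fix x assume "x \<in> space (lebesgue_on \<Omega>)"
   then have x: "x \<in> closure \<Omega>" using closure_subset by auto
   have "continuous_on {0..} (\<lambda>s. (\<lambda>(t, x). \<rho> t x) (s, x))"
    by (rule continuous_on_compose2[OF rc]) (use x in \<open>auto intro!: continuous_intros\<close>)
   then have c: "continuous_on {0..} (\<lambda>s. \<rho> s x)" by simp
   have "(\<lambda>n. t * (1 / real (Suc (Suc n)))) \<longlonglongrightarrow> t * 0"
    by (intro tendsto_mult tendsto_const LIMSEQ_Suc[OF LIMSEQ_Suc[OF lim_1_over_n]])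
   then have "(\<lambda>n. t / real (Suc (Suc n))) \<longlonglongrightarrow> 0" by simp
   then show "(\<lambda>n. \<rho> (t / real (Suc (Suc n))) x) \<longlonglongrightarrow> \<rho> 0 x"
    by (rule continuous_on_tendsto_compose[OF c]) (use t in auto)
  qed
  show "AE x in lebesgue_on \<Omega>. norm (\<rho> (t / real (Suc (Suc n))) x) \<le> R" for n
   using R t by (auto intro!: AE_I2)
 qed (use ms t in auto)
 moreover have "(\<integral>x. \<rho> (t / real (Suc (Suc n))) x \<partial>lebesgue_on \<Omega>) = (\<integral>x. \<rho> t x \<partial>lebesgue_on \<Omega>)" for n
  by (rule pos) (use t in \<open>auto simp: divide_simps\<close>)
 ultimately show ?thesis by (simp add: LIMSEQ_const_iff)
qed

end

section \<open>Propagation of positive lower bounds backwards in time\<close>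

context defining_function
begin

text \<open>A minimum principle for the transport equation. The function considered decreases strictly along the
  direction of the flow, so its minimum lies at the final time; the term \<open>1 / g\<close> keeps the minimum away
  from the boundary.\<close>

lemma density_lower_bound_backwards:
 fixes \<rho> :: "real \<Rightarrow> real^3 \<Rightarrow> real" and u :: "real \<Rightarrow> real^3 \<Rightarrow> real^3"
 assumes rc: "continuous_on ({0..} \<times> closure \<Omega>) (\<lambda>(t, x). \<rho> t x)"
  and r1: "C1_time \<Omega> \<rho>" "Ck_space 1 \<Omega> \<rho>" and u2: "Ck_space 2 \<Omega> u"
  and eq: "!!t x. t > 0 ==> x \<in> \<Omega> ==> dt \<rho> t x + divergence (\<lambda>y. \<rho> t y *\<^sub>R u t y) x = 0"
  and nonneg: "!!t x. t \<ge> 0 ==> x \<in> \<Omega> ==> 0 \<le> \<rho> t x"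
  and t: "0 < t1" "t1 < T"
  and L: "!!i t x. t \<in> {t1..T} ==> x \<in> \<Omega> ==> norm (pd i (u t) x) \<le> L"
  and flux: "!!t x. t \<in> {t1..T} ==> x \<in> \<Omega> ==> \<bar>u t x \<bullet> grad g x\<bar> \<le> C * g x"
  and \<delta>: "!!x. x \<in> \<Omega> ==> \<delta> \<le> \<rho> T x"
  and x1: "x1 \<in> \<Omega>"
 shows "exp (- (3 * L) * (T - t1)) * \<delta> \<le> \<rho> t1 x1"
proof -
 define K where "K = 3 * L"
 define M where "M = C + 1"
 have gp: "g x1 > 0" by (rule gpos[OF x1])
 have main: "exp (- K * T) * \<delta> \<le> exp (- K * t1) * \<rho> t1 x1 + \<epsilon> * exp (- M * t1) / g x1" if \<epsilon>: "\<epsilon> > 0" for \<epsilon>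
 proof -
  define z where "z = (\<lambda>t x. exp (- K * t) * \<rho> t x + \<epsilon> * exp (- M * t) / g x)"
  have z1: "z t1 x1 > 0"
   unfolding z_def using nonneg[of t1 x1] x1 t \<epsilon> gp by (intro add_nonneg_pos) auto
  \<comment> \<open>Where \<open>g < m\<close>, the term with \<open>1 / g\<close> alone exceeds the value at \<open>(t1, x1)\<close>.\<close>
  define m where "m = \<epsilon> * min (exp (- M * T)) (exp (- M * t1)) / z t1 x1"
  have m: "m > 0" using \<epsilon> z1 by (simp add: m_def)
  define Kc where "Kc = closure \<Omega> \<inter> {x. m \<le> g x}"
  have Kc: "compact Kc" unfolding Kc_def
   by (intro compact_Int_closed compacts closed_Collect_le continuous_on_const gcont(1))
  have KcO: "Kc \<subseteq> \<Omega>"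
  proof
   fix x assume x: "x \<in> Kc"
   show "x \<in> \<Omega>"
   proof (rule ccontr)
    assume "x \<notin> \<Omega>"
    then have "x \<in> frontier \<Omega>" using x O by (auto simp: Kc_def frontier_def interior_open)
    then show False using x gfr m by (auto simp: Kc_def)
   qed
  qed
  have zc: "continuous_on ({t1..T} \<times> Kc) (\<lambda>(t, x). z t x)"
  proof -
   have "continuous_on ({t1..T} \<times> Kc) (\<lambda>p. exp (- K * fst p) * \<rho> (fst p) (snd p) + \<epsilon> * exp (- M * fst p) / g (snd p))"
   proof (intro continuous_on_add continuous_on_mult continuous_on_divide continuous_on_exp continuous_on_const continuous_on_fst continuous_on_id)
    have rc': "continuous_on ({0..} \<times> closure \<Omega>) (\<lambda>p. \<rho> (fst p) (snd p))"
     using rc by (simp add: case_prod_unfold)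
    show "continuous_on ({t1..T} \<times> Kc) (\<lambda>p. \<rho> (fst p) (snd p))"
     by (rule continuous_on_subset[OF rc']) (use t KcO closure_subset[of \<Omega>] in auto)
    show "continuous_on ({t1..T} \<times> Kc) (\<lambda>p. g (snd p))"
     by (rule continuous_on_compose2[OF gcont(1)[of UNIV]]) (auto intro: continuous_on_snd continuous_on_id)
    show "\<forall>p\<in>{t1..T} \<times> Kc. g (snd p) \<noteq> 0" using gpos KcO by force
   qed
   then show ?thesis by (simp add: z_def case_prod_unfold)
  qed
  have out: "z t1 x1 < z t x" if "t \<in> {t1..T}" "x \<in> \<Omega>" "x \<notin> Kc" for t x
  proof -
   have g: "0 < g x" "g x < m" using gpos that closure_subset[of \<Omega>] by (auto simp: Kc_def)
   have e: "min (exp (- M * T)) (exp (- M * t1)) \<le> exp (- M * t)"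
   proof (cases "M \<ge> 0")
    case True
    then have "exp (- M * T) \<le> exp (- M * t)" using that(1) by (simp add: mult_left_mono)
    then show ?thesis by linarith
   next
    case False
    then have "exp (- M * t1) \<le> exp (- M * t)" using that(1) by (simp add: mult_left_mono_neg)
    then show ?thesis by linarith
   qed
   have "z t1 x1 = \<epsilon> * min (exp (- M * T)) (exp (- M * t1)) / m"
    using z1 \<epsilon> by (simp add: m_def min_def)
   also have "\<dots> < \<epsilon> * min (exp (- M * T)) (exp (- M * t1)) / g x"
    using g m \<epsilon> by (intro divide_strict_left_mono) auto
   also have "\<dots> \<le> \<epsilon> * exp (- M * t) / g x"
    using e \<epsilon> g by (intro divide_right_mono mult_left_mono) auto
   also have "\<dots> \<le> z t x" using nonneg[of t x] that t by (simp add: z_def)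
   finally show ?thesis .
  qed
  have x1K: "x1 \<in> Kc" using out[of t1 x1] t x1 by fastforce
  have "compact ({t1..T} \<times> Kc)" by (intro compact_Times Kc) simp
  moreover have "{t1..T} \<times> Kc \<noteq> {}" using t x1K by auto
  ultimately obtain p where p: "p \<in> {t1..T} \<times> Kc" "!!y. y \<in> {t1..T} \<times> Kc ==> (\<lambda>(t, x). z t x) p \<le> (\<lambda>(t, x). z t x) y"
   using continuous_attains_inf[OF _ _ zc] by blast
  obtain ts xs where ps: "p = (ts, xs)" by fastforce
  have ts: "ts \<in> {t1..T}" and xsK: "xs \<in> Kc" using p(1) by (auto simp: ps)
  have xs: "xs \<in> \<Omega>" using xsK KcO by blast
  have minK: "z ts xs \<le> z t x" if "t \<in> {t1..T}" "x \<in> Kc" for t x using p(2)[of "(t, x)"] that by (simp add: ps)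
  have min: "z ts xs \<le> z t x" if "t \<in> {t1..T}" "x \<in> \<Omega>" for t x
   using minK[OF that(1)] minK[of t1 x1] x1K t out[OF that] by (cases "x \<in> Kc") auto
  have "ts = T"
  proof (rule ccontr)
   assume "ts \<noteq> T"
   then have ts': "t1 \<le> ts" "ts < T" "ts > 0" using ts t by auto
   have rC: "Ck_on (Suc 0) \<Omega> (\<rho> ts)" using Ck_space_imp_Ck_on[OF r1(2) ts'(3)] by simp
   have uC: "Ck_on (Suc 0) \<Omega> (u ts)" using Ck_on_le[OF Ck_space_imp_Ck_on[OF u2 ts'(3)], of "Suc 0"] by simp
   note rd = Ck_on_differentiable[OF rC xs] and ud = Ck_on_differentiable[OF uC xs]
   define v where "v = u ts xs"
   define dv where "dv = (\<Sum>i\<in>UNIV. pd i (u ts) xs $ i)"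
   have dr: "((\<lambda>s. \<rho> (ts + s) (xs + s *\<^sub>R v)) has_real_derivative - \<rho> ts xs * dv) (at 0)"
   proof -
    have "dt \<rho> ts xs + (\<Sum>i\<in>UNIV. (v $ i) *\<^sub>R pd i (\<rho> ts) xs) = - \<rho> ts xs * dv"
     using eq[OF ts'(3) xs] divergence_density_flux(1)[OF rd ud] by (simp add: inner_grad v_def dv_def)
    then show ?thesis
     using has_vector_derivative_space_time[OF O r1(1) rd ts'(3) xs, of v]
     by (simp add: has_real_derivative_iff_has_vector_derivative)
   qed
   have dg: "((\<lambda>s. g (xs + s *\<^sub>R v)) has_real_derivative v \<bullet> grad g xs) (at 0)"
    using DERIV_along_line[OF gd(1), where x = xs and s = 0 and v = v] by simp
   have gx: "g xs > 0" by (rule gpos[OF xs])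
   define D where "D = exp (- K * ts) * \<rho> ts xs * (- K - dv) + \<epsilon> * exp (- M * ts) / g xs * (- M - (v \<bullet> grad g xs) / g xs)"
   have "((\<lambda>s. z (ts + s) (xs + s *\<^sub>R v)) has_real_derivative D) (at 0)"
   proof -
    have e: "((\<lambda>s. exp (- k * (ts + s))) has_real_derivative - k * exp (- k * ts)) (at 0)" for k
     by (auto intro!: derivative_eq_intros)
    have "((\<lambda>s. exp (- K * (ts + s)) * \<rho> (ts + s) (xs + s *\<^sub>R v) + \<epsilon> * exp (- M * (ts + s)) / g (xs + s *\<^sub>R v))
      has_real_derivative (- K * exp (- K * ts)) * \<rho> (ts + 0) (xs + 0 *\<^sub>R v) + (- \<rho> ts xs * dv) * exp (- K * (ts + 0))
       + (\<epsilon> * (- M * exp (- M * ts)) * g (xs + 0 *\<^sub>R v) - \<epsilon> * exp (- M * (ts + 0)) * (v \<bullet> grad g xs))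
        / (g (xs + 0 *\<^sub>R v) * g (xs + 0 *\<^sub>R v))) (at 0)"
     by (rule DERIV_add[OF DERIV_mult[OF e dr] DERIV_divide[OF DERIV_cmult[OF e] dg]]) (use gx in simp)
    then show ?thesis
     unfolding z_def D_def by (rule DERIV_cong) (use gx in \<open>simp add: field_simps\<close>)
   qed
   moreover have "D < 0"
   proof -
    have "\<bar>dv\<bar> \<le> (\<Sum>i\<in>(UNIV::3 set). L)" unfolding dv_def
    proof (rule order_trans[OF sum_abs sum_mono])
     fix i show "\<bar>pd i (u ts) xs $ i\<bar> \<le> L"
      using component_le_norm_cart[of "pd i (u ts) xs" i] L[OF ts xs, of i] by linarith
    qed
    then have "- K - dv \<le> 0" by (simp add: K_def)
    then have 1: "exp (- K * ts) * \<rho> ts xs * (- K - dv) \<le> 0"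
     using nonneg[of ts xs] ts' xs by (intro mult_nonneg_nonpos) auto
    have "\<bar>v \<bullet> grad g xs\<bar> \<le> C * g xs" unfolding v_def by (rule flux[OF ts xs])
    then have "- (v \<bullet> grad g xs) \<le> C * g xs" by linarith
    then have "- (v \<bullet> grad g xs) / g xs \<le> C" using pos_divide_le_eq[OF gx] by blast
    then have "- M - (v \<bullet> grad g xs) / g xs < 0" by (simp add: M_def)
    then have 2: "\<epsilon> * exp (- M * ts) / g xs * (- M - (v \<bullet> grad g xs) / g xs) < 0"
     using \<epsilon> gx by (intro mult_pos_neg) auto
    show ?thesis unfolding D_def using 1 2 by linarith
   qed
   ultimately obtain d where d: "d > 0" "!!h. 0 < h ==> h < d ==> z (ts + h) (xs + h *\<^sub>R v) < z ts xs"
    using DERIV_neg_dec_right[of "\<lambda>s. z (ts + s) (xs + s *\<^sub>R v)" D 0] by auto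
   have "((\<lambda>h. xs + h *\<^sub>R v) \<longlongrightarrow> xs + 0 *\<^sub>R v) (at_right 0)" by (intro tendsto_intros)
   then have "eventually (\<lambda>h. xs + h *\<^sub>R v \<in> \<Omega>) (at_right 0)" using O xs by (intro topological_tendstoD) auto
   moreover have "eventually (\<lambda>h. 0 < h \<and> h < min d (T - ts)) (at_right 0)"
    unfolding eventually_at_right_field using d(1) ts' by (intro exI[of _ "min d (T - ts)"]) auto
   ultimately have "eventually (\<lambda>h. False) (at_right (0::real))"
   proof eventually_elim
    case (elim h)
    then have "z (ts + h) (xs + h *\<^sub>R v) < z ts xs" using d(2) by simp
    moreover have "z ts xs \<le> z (ts + h) (xs + h *\<^sub>R v)" using elim ts' by (intro min) auto
    ultimately show False by simp
   qed
   then show False by (simp add: eventually_const)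
  qed
  then have "z t1 x1 \<ge> z T xs" using minK[of t1 x1] x1K t by simp
  also have "z T xs \<ge> exp (- K * T) * \<delta>"
  proof -
   have "exp (- K * T) * \<delta> \<le> exp (- K * T) * \<rho> T xs" using \<delta>[OF xs] by (intro mult_left_mono) auto
   moreover have "0 \<le> \<epsilon> * exp (- M * T) / g xs" using \<epsilon> gpos[OF xs] by simp
   ultimately show ?thesis unfolding z_def by linarith
  qed
  finally show ?thesis by (simp add: z_def)
 qed
 have "exp (- K * T) * \<delta> \<le> exp (- K * t1) * \<rho> t1 x1"
 proof (rule field_le_epsilon)
  fix e :: real assume e: "e > 0"
  define \<epsilon> where "\<epsilon> = e * g x1 / exp (- M * t1)"
  have "\<epsilon> > 0" using e gp by (simp add: \<epsilon>_def)
  from main[OF this] show "exp (- K * T) * \<delta> \<le> exp (- K * t1) * \<rho> t1 x1 + e" using gp by (simp add: \<epsilon>_def)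
 qed
 then have "exp (K * t1) * (exp (- K * T) * \<delta>) \<le> exp (K * t1) * (exp (- K * t1) * \<rho> t1 x1)"
  by (rule mult_left_mono) (rule exp_ge_zero)
 moreover have "exp (K * t1) * (exp (- K * T) * \<delta>) = exp (- (3 * L) * (T - t1)) * \<delta>"
 proof -
  have "K * t1 + - K * T = - (3 * L) * (T - t1)" unfolding K_def by algebra
  then show ?thesis unfolding mult.assoc[symmetric] mult_exp_exp by (rule arg_cong)
 qed
 moreover have "exp (K * t1) * (exp (- K * t1) * \<rho> t1 x1) = \<rho> t1 x1"
 proof -
  have "K * t1 + - K * t1 = 0" by algebra
  then show ?thesis unfolding mult.assoc[symmetric] mult_exp_exp by (simp only: exp_zero mult_1_left)
 qed
 ultimately show ?thesis by (simp only:)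
qed

end

section \<open>Regularised Newtonian kernels\<close>

text \<open>The kernel is compared with a geometric series over dyadic balls.\<close>

lemma riesz_nn_integral:
 fixes x :: "real^3"
 assumes p: "0 < p" "p < 3"
 obtains M :: real where "M \<ge> 0"
  "!!x::real^3. (\<integral>\<^sup>+y. ennreal (norm (x - y) powr (- p)) * indicator (ball x 1) y \<partial>lborel) \<le> ennreal M"
proof -
 define v where "v = unit_ball_vol (real DIM(real^3))"
 have v: "v \<ge> 0" by (simp add: v_def)
 define q where "q = 2 powr (p - 3)"
 have q: "0 \<le> q" "q < 1" using p powr_less_one[of 2 "p - 3"] by (auto simp: q_def)
 have S: "summable (\<lambda>k. 2 powr p * v * q ^ k)" using q by (intro summable_mult summable_geometric) simp
 define M where "M = (\<Sum>k. 2 powr p * v * q ^ k)"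
 have M: "M \<ge> 0" unfolding M_def using v q by (intro suminf_nonneg S) auto
 have "(\<integral>\<^sup>+y. ennreal (norm (x - y) powr (- p)) * indicator (ball x 1) y \<partial>lborel) \<le> ennreal M" for x :: "real^3"
 proof -
  let ?t = "\<lambda>k y. ennreal (2 powr (real (Suc k) * p)) * indicator (ball x ((1/2) ^ k)) y"
  have pt: "ennreal (norm (x - y) powr (- p)) * indicator (ball x 1) y \<le> (\<Sum>k. ?t k y)" for y
  proof (cases "y \<in> ball x 1 \<and> y \<noteq> x")
   case True
   then have r: "0 < norm (x - y)" "norm (x - y) < 1" by (auto simp: dist_norm)
   obtain n0 where n0: "(1/2) ^ n0 < norm (x - y)" using real_arch_pow_inv[OF r(1), of "1/2"] by auto
   define n where "n = (LEAST n. (1/2) ^ n \<le> norm (x - y))"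
   have n: "(1/2) ^ n \<le> norm (x - y)" unfolding n_def by (rule LeastI[of _ n0]) (use n0 in simp)
   have "n \<noteq> 0" using n r by (cases n) auto
   then obtain k where k: "n = Suc k" by (cases n) auto
   have "\<not> (1/2) ^ k \<le> norm (x - y)" using not_less_Least[of k "\<lambda>n. (1/2) ^ n \<le> norm (x - y)"] k by (simp add: n_def)
   then have yk: "y \<in> ball x ((1/2) ^ k)" by (simp add: dist_norm)
   have "norm (x - y) powr (- p) \<le> ((1/2) ^ n) powr (- p)"
    using n p r by (intro powr_mono2') auto
   also have "\<dots> = 2 powr (real n * p)"
   proof -
    have "(1/2 :: real) ^ n = 2 powr (- real n)" by (simp add: powr_minus powr_realpow power_one_over inverse_eq_divide)
    then show ?thesis by (simp add: powr_powr)
   qed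
   finally have "ennreal (norm (x - y) powr (- p)) \<le> ?t k y" using yk k by (simp add: ennreal_leI)
   also have "\<dots> \<le> (\<Sum>k. ?t k y)" 
   proof -
    have "(\<Sum>j\<in>{k}. ?t j y) \<le> (\<Sum>k. ?t k y)" by (rule sum_le_suminf) auto
    then show ?thesis
     by (simp only: sum.insert sum.empty finite.emptyI empty_iff not_False_eq_True add_0_right)
   qed
   finally show ?thesis using True by simp
  qed auto
  have "(\<integral>\<^sup>+y. ennreal (norm (x - y) powr (- p)) * indicator (ball x 1) y \<partial>lborel) \<le> (\<integral>\<^sup>+y. (\<Sum>k. ?t k y) \<partial>lborel)"
   by (rule nn_integral_mono) (rule pt)
  also have "\<dots> = (\<Sum>k. \<integral>\<^sup>+y. ?t k y \<partial>lborel)" by (rule nn_integral_suminf)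
    (intro borel_measurable_times_ennreal borel_measurable_const borel_measurable_indicator, simp)
  also have "\<dots> = (\<Sum>k. ennreal (2 powr p * v * q ^ k))"
  proof (rule suminf_cong)
   fix k
   have "(\<integral>\<^sup>+y. ?t k y \<partial>lborel) = ennreal (2 powr (real (Suc k) * p)) * emeasure lborel (ball x ((1/2) ^ k))"
    by (rule nn_integral_cmult_indicator) simp
   also have "\<dots> = ennreal (2 powr (real (Suc k) * p)) * ennreal (v * ((1/2) ^ k) ^ 3)"
    by (simp add: emeasure_ball v_def)
   also have "\<dots> = ennreal (2 powr (real (Suc k) * p) * (v * ((1/2) ^ k) ^ 3))"
    using v by (simp add: ennreal_mult)
   also have "2 powr (real (Suc k) * p) * (v * ((1/2) ^ k) ^ 3) = 2 powr p * v * q ^ k"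
   proof -
    have "q ^ k = 2 powr (real k * p) * 2 powr (- 3 * real k)"
     by (simp add: q_def powr_power powr_add[symmetric] algebra_simps)
    moreover have "((1/2 :: real) ^ k) ^ 3 = 2 powr (- 3 * real k)"
    proof -
     have "((1/2 :: real) ^ k) ^ 3 = (1/2) ^ (3 * k)" by (simp add: power_mult[symmetric] mult.commute)
     also have "\<dots> = 2 powr (- real (3 * k))" by (simp add: powr_minus powr_realpow power_one_over inverse_eq_divide del: of_nat_mult)
     finally show ?thesis by simp
    qed
    moreover have "2 powr (real (Suc k) * p) = 2 powr p * 2 powr (real k * p)"
     by (simp add: powr_add[symmetric] algebra_simps)
    ultimately show ?thesis by (simp add: mult_ac)
   qed
   finally show "(\<integral>\<^sup>+y. ?t k y \<partial>lborel) = ennreal (2 powr p * v * q ^ k)" .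
  qed
  also have "\<dots> = ennreal M" unfolding M_def using v q by (intro suminf_ennreal2 S) auto
  finally show ?thesis .
 qed
 then show ?thesis using that M by blast
qed

lemma riesz_integral:
 assumes p: "0 < p" "p < 3"
 obtains M where "!!x::real^3. (\<lambda>y. norm (x - y) powr (- p)) integrable_on cbox a b"
  "!!x::real^3. integral (cbox a b) (\<lambda>y. norm (x - y) powr (- p)) \<le> M"
proof -
 obtain M0 :: real where M0: "M0 \<ge> 0"
  "!!x::real^3. (\<integral>\<^sup>+y. ennreal (norm (x - y) powr (- p)) * indicator (ball x 1) y \<partial>lborel) \<le> ennreal M0"
  by (rule riesz_nn_integral[OF p], rule that)
 define M where "M = M0 + measure lborel (cbox a b)"
 have M: "M \<ge> 0" using M0 by (simp add: M_def)
 have "(\<lambda>y. norm (x - y) powr (- p)) integrable_on cbox a b \<and> integral (cbox a b) (\<lambda>y. norm (x - y) powr (- p)) \<le> M" for x :: "real^3"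
 proof -
  let ?f = "\<lambda>y. indicator (cbox a b) y * norm (x - y) powr (- p)"
  have m: "?f \<in> borel_measurable borel" by measurable
  have pt: "ennreal (?f y) \<le> ennreal (norm (x - y) powr (- p)) * indicator (ball x 1) y + indicator (cbox a b) y" for y
  proof (cases "y \<in> ball x 1")
   case False
   then have "1 \<le> norm (x - y)" by (simp add: dist_norm)
   then have "norm (x - y) powr (- p) \<le> 1" using p ge_one_powr_ge_zero[of "norm (x - y)" p]
    by (simp add: powr_minus_divide divide_le_eq_1)
   then show ?thesis using False by (auto simp: indicator_def ennreal_leI simp flip: ennreal_1)
  next
   case True
   then show ?thesis by (auto simp: indicator_def)
  qed
  have "(\<integral>\<^sup>+y. ennreal (?f y) \<partial>lborel) \<le> (\<integral>\<^sup>+y. ennreal (norm (x - y) powr (- p)) * indicator (ball x 1) y + indicator (cbox a b) y \<partial>lborel)"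
   by (rule nn_integral_mono) (rule pt)
  also have "\<dots> = (\<integral>\<^sup>+y. ennreal (norm (x - y) powr (- p)) * indicator (ball x 1) y \<partial>lborel) + emeasure lborel (cbox a b)"
  proof (subst nn_integral_add)
   have "(\<lambda>y. ennreal (norm (x - y) powr (- p))) \<in> borel_measurable lborel" by measurable
   then show "(\<lambda>y. ennreal (norm (x - y) powr (- p)) * indicator (ball x 1) y) \<in> borel_measurable lborel"
    by (intro borel_measurable_times_ennreal borel_measurable_indicator) auto
  qed auto
  also have "\<dots> \<le> ennreal M0 + ennreal (measure lborel (cbox a b))"
   using emeasure_bounded_finite[OF bounded_cbox, of a b]
   by (intro add_mono M0) (simp add: emeasure_eq_ennreal_measure less_top)
  also have "\<dots> = ennreal M" using M0 by (simp add: M_def)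
  finally have le: "(\<integral>\<^sup>+y. ennreal (?f y) \<partial>lborel) \<le> ennreal M" .
  have "(\<integral>\<^sup>+y. ennreal (?f y) \<partial>lborel) \<noteq> top" by (rule neq_top_trans[OF ennreal_neq_top le])
  then obtain r where r: "(\<integral>\<^sup>+y. ennreal (?f y) \<partial>lborel) = ennreal r" "r \<ge> 0"
   by (cases "\<integral>\<^sup>+y. ennreal (?f y) \<partial>lborel") auto
  have "(?f has_integral r) UNIV"
  proof (rule nn_integral_has_integral)
   show "0 \<le> ?f y" for y by simp
  qed (fact m, fact r(1), fact r(2))
  then have "((\<lambda>y. if y \<in> cbox a b then norm (x - y) powr (- p) else 0) has_integral r) UNIV"
   by (rule has_integral_eq[rotated]) (simp add: indicator_def)
  then have I: "((\<lambda>y. norm (x - y) powr (- p)) has_integral r) (cbox a b)"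
   by (simp add: has_integral_restrict_UNIV)
  have "r \<le> M" using le r M by (simp add: ennreal_le_iff)
  then show ?thesis using I by (auto simp: integral_unique)
 qed
 then show ?thesis using that by blast
qed

lemma integral_le_off_finite:
 fixes f g :: "real^3 \<Rightarrow> real"
 assumes f: "f integrable_on S" and g: "g integrable_on S" and F: "finite F"
  and le: "!!y. y \<in> S ==> y \<notin> F ==> f y \<le> g y"
 shows "integral S f \<le> integral S g"
proof -
 let ?f = "\<lambda>y. if y \<in> F then 0 else f y" and ?g = "\<lambda>y. if y \<in> F then 0 else g y"
 have N: "negligible F" using F by (rule negligible_finite)
 have f': "integral S f = integral S ?f" by (rule integral_spike[OF N]) simp
 have g': "integral S g = integral S ?g" by (rule integral_spike[OF N]) simp
 have "integral S ?f \<le> integral S ?g"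
 proof (rule Henstock_Kurzweil_Integration.integral_le)
  show "?f integrable_on S" by (rule integrable_spike[OF f N]) simp
  show "?g integrable_on S" by (rule integrable_spike[OF g N]) simp
 qed (use le in auto)
 then show ?thesis by (simp add: f' g')
qed

lemma DERIV_glue:
 fixes f h :: "real \<Rightarrow> real"
 assumes "(f has_real_derivative D) (at a)" "(h has_real_derivative D) (at a)" "f a = h a"
 shows "((\<lambda>s. if s \<le> a then f s else h s) has_real_derivative D) (at a)"
proof -
 let ?w = "\<lambda>s. if s \<le> a then f s else h s"
 have "((\<lambda>s. (?w s - ?w a) / (s - a)) \<longlongrightarrow> D) (at a)"
 proof (rule filterlim_split_at)
  have "((\<lambda>s. (f s - f a) / (s - a)) \<longlongrightarrow> D) (at_left a)"
   using assms(1) filterlim_at_split[of _ _ a] by (auto simp: has_field_derivative_iff)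
  then show "((\<lambda>s. (?w s - ?w a) / (s - a)) \<longlongrightarrow> D) (at_left a)"
   by (rule tendsto_cong[THEN iffD1, rotated]) (auto simp: eventually_at_filter)
  have "((\<lambda>s. (h s - h a) / (s - a)) \<longlongrightarrow> D) (at_right a)"
   using assms(2) filterlim_at_split[of _ _ a] by (auto simp: has_field_derivative_iff)
  then show "((\<lambda>s. (?w s - ?w a) / (s - a)) \<longlongrightarrow> D) (at_right a)"
   by (rule tendsto_cong[THEN iffD1, rotated]) (auto simp: eventually_at_filter assms(3))
 qed
 then show ?thesis by (simp add: has_field_derivative_iff)
qed

lemma DERIV_glue_all:
 fixes f h :: "real \<Rightarrow> real"
 assumes "!!s. s \<le> a ==> (f has_real_derivative f' s) (at s)" "!!s. s \<ge> a ==> (h has_real_derivative h' s) (at s)"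
  "f a = h a" "f' a = h' a"
 shows "((\<lambda>s. if s \<le> a then f s else h s) has_real_derivative (if s \<le> a then f' s else h' s)) (at s)"
proof (cases s a rule: linorder_cases)
 case less
 have "((\<lambda>s. if s \<le> a then f s else h s) has_real_derivative f' s) (at s)"
  by (rule has_field_derivative_transform_within_open[OF assms(1), of s "{..<a}"]) (use less in auto)
 then show ?thesis using less by simp
next
 case greater
 have "((\<lambda>s. if s \<le> a then f s else h s) has_real_derivative h' s) (at s)"
  by (rule has_field_derivative_transform_within_open[OF assms(2), of s "{a<..}"]) (use greater in auto)
 then show ?thesis using greater by simp
next
 case equal
 then show ?thesis using DERIV_glue[of f "f' a" a h] assms(1)[of a] assms(2)[of a] assms(3,4) by simp
qed

text \<open>The profile of the force is a function of the squared radius, continued below \<open>d\<^sup>2\<close> by the affine function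
  that makes it continuously differentiable.\<close>

definition force :: "real \<Rightarrow> real \<Rightarrow> real" where
 "force d s = (if s \<le> d\<^sup>2 then (5/2 - 3/2 * (s / d\<^sup>2)) / d ^ 3 else s powr (- 3/2))"

definition force' :: "real \<Rightarrow> real \<Rightarrow> real" where
 "force' d s = (if s \<le> d\<^sup>2 then - (3/2) / d ^ 5 else - (3/2) * s powr (- 5/2))"

lemma sq_powr: "d > 0 ==> (d\<^sup>2) powr r = d powr (2 * r)" for d r :: real
 by (simp add: powr_powr flip: powr_numeral)

lemma powr_neg_nat: "d > 0 ==> d powr (- real n) = 1 / d ^ n" for d :: real
 by (simp add: powr_minus powr_realpow inverse_eq_divide)

lemma force_deriv:
 assumes d: "d > 0" shows "(force d has_real_derivative force' d s) (at s)"
 unfolding force_def [abs_def] force'_def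
proof (rule DERIV_glue_all)
 show "((\<lambda>s. (5/2 - 3/2 * (s / d\<^sup>2)) / d ^ 3) has_real_derivative - (3/2) / d ^ 5) (at s)" for s
  using d by (auto intro!: derivative_eq_intros simp: field_simps eval_nat_numeral)
 show "((\<lambda>s. s powr (- 3/2)) has_real_derivative - (3/2) * s powr (- 5/2)) (at s)" if "d\<^sup>2 \<le> s" for s
 proof -
  have "0 < d\<^sup>2" using d by simp
  then have "s > 0" using that by linarith
  from has_real_derivative_powr[OF this, of "- 3/2"] show ?thesis by simp
 qed
 show "(5/2 - 3/2 * (d\<^sup>2 / d\<^sup>2)) / d ^ 3 = (d\<^sup>2) powr (- 3/2)"
  using d powr_neg_nat[OF d, of 3] by (simp add: sq_powr)
 show "- (3/2) / d ^ 5 = - (3/2) * (d\<^sup>2) powr (- 5/2)"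
  using d powr_neg_nat[OF d, of 5] by (simp add: sq_powr)
qed

lemma force_continuous: "d > 0 ==> continuous_on S (force d)"
 by (rule DERIV_continuous_on[where D = "force' d"]) (rule has_field_derivative_at_within[OF force_deriv])

lemma force'_continuous:
 assumes d: "d > 0" shows "continuous_on S (force' d)"
proof -
 have "continuous_on ({..d\<^sup>2} \<union> {d\<^sup>2..}) (\<lambda>s. if s \<le> d\<^sup>2 then - (3/2) / d ^ 5 else - (3/2) * s powr (- 5/2))"
 proof (rule continuous_on_cases)
  show "continuous_on {d\<^sup>2..} (\<lambda>s. - (3/2) * s powr (- 5/2))"
   by (intro continuous_on_mult continuous_on_const continuous_on_powr continuous_on_id) (use d in auto)
  show "\<forall>s. s \<in> {..d\<^sup>2} \<and> \<not> s \<le> d\<^sup>2 \<or> s \<in> {d\<^sup>2..} \<and> s \<le> d\<^sup>2 \<longrightarrow> - (3/2) / d ^ 5 = - (3/2) * s powr (- 5/2)"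
  proof (intro allI impI)
   fix s assume "s \<in> {..d\<^sup>2} \<and> \<not> s \<le> d\<^sup>2 \<or> s \<in> {d\<^sup>2..} \<and> s \<le> d\<^sup>2"
   then have "s = d\<^sup>2" by auto
   then show "- (3/2) / d ^ 5 = - (3/2) * s powr (- 5/2)" using d powr_neg_nat[OF d, of 5] by (simp add: sq_powr)
  qed
 qed auto
 moreover have "{..d\<^sup>2} \<union> {d\<^sup>2..} = UNIV" by auto
 ultimately have "continuous_on UNIV (force' d)" by (simp add: force'_def [abs_def])
 then show ?thesis by (rule continuous_on_subset) simp
qed

lemma kernel_profile_bounds:
 assumes d: "d > 0" and r: "r > 0"
 shows "0 \<le> force d (r\<^sup>2)" "force d (r\<^sup>2) \<le> 5/2 * r powr (- 3)" "\<bar>force' d (r\<^sup>2)\<bar> \<le> 3/2 * r powr (- 5)"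
proof -
 have le: "r \<le> d" if "r\<^sup>2 \<le> d\<^sup>2" by (rule power2_le_imp_le[OF that]) (use d in linarith)
 have inv: "1 / d ^ n \<le> r powr (- real n)" if "r\<^sup>2 \<le> d\<^sup>2" for n
 proof -
  have "r ^ n \<le> d ^ n" using le[OF that] r by (intro power_mono) auto
  then have "1 / d ^ n \<le> 1 / r ^ n" using r by (intro divide_left_mono mult_pos_pos zero_less_power d) auto
  then show ?thesis by (simp only: powr_neg_nat[OF r])
 qed
 have d2: "0 < d\<^sup>2" by (rule zero_less_power[OF d])
 have q: "0 \<le> r\<^sup>2 / d\<^sup>2" by (rule divide_nonneg_nonneg) auto
 have q1: "r\<^sup>2 / d\<^sup>2 \<le> 1" if "r\<^sup>2 \<le> d\<^sup>2" using that d2 pos_divide_le_eq[of "d\<^sup>2" "r\<^sup>2" 1] by linarith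
 have d3: "0 < d ^ 3" by (rule zero_less_power[OF d])
 show "0 \<le> force d (r\<^sup>2)"
 proof (cases "r\<^sup>2 \<le> d\<^sup>2")
  case True
  have "0 \<le> (5/2 - 3/2 * (r\<^sup>2 / d\<^sup>2)) / d ^ 3" by (rule divide_nonneg_pos[OF _ d3]) (use q1[OF True] in linarith)
  then show ?thesis using True by (simp only: force_def if_True)
 next
  case False
  then show ?thesis by (simp only: force_def if_False powr_ge_zero)
 qed
 have rp: "(r\<^sup>2) powr p = r powr (2 * p)" for p by (rule sq_powr[OF r])
 show "force d (r\<^sup>2) \<le> 5/2 * r powr (- 3)"
 proof (cases "r\<^sup>2 \<le> d\<^sup>2")
  case True
  have "(5/2 - 3/2 * (r\<^sup>2 / d\<^sup>2)) / d ^ 3 \<le> 5/2 / d ^ 3" using q d3 by (intro divide_right_mono) auto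
  also have "\<dots> = 5/2 * (1 / d ^ 3)" by simp
  also have "\<dots> \<le> 5/2 * r powr (- real 3)" by (rule mult_left_mono[OF inv[OF True]]) simp
  finally show ?thesis using True by (simp only: force_def if_True of_nat_numeral)
 next
  case False
  have "0 \<le> r powr (- 3)" by simp
  moreover have "force d (r\<^sup>2) = r powr (- 3)" using False rp[of "- 3/2"] by (simp add: force_def)
  ultimately show ?thesis by linarith
 qed
 show "\<bar>force' d (r\<^sup>2)\<bar> \<le> 3/2 * r powr (- 5)"
 proof (cases "r\<^sup>2 \<le> d\<^sup>2")
  case True
  have "\<bar>force' d (r\<^sup>2)\<bar> = 3/2 * (1 / d ^ 5)" using True d by (simp add: force'_def)
  also have "\<dots> \<le> 3/2 * r powr (- real 5)" by (rule mult_left_mono[OF inv[OF True]]) simp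
  finally show ?thesis by (simp only: of_nat_numeral)
 next
  case False
  then show ?thesis using rp[of "- 5/2"] by (simp add: force'_def abs_mult)
 qed
qed

text \<open>The Newtonian force \<open>e / \<bar>e\<bar>\<^sup>3\<close>, regularised in the ball of radius \<open>d\<close>; \<open>kern'\<close> is its matrix of derivatives.\<close>

definition kern :: "real \<Rightarrow> 3 \<Rightarrow> real^3 \<Rightarrow> real" where
 "kern d i e = e $ i * force d (e \<bullet> e)"

definition kern' :: "real \<Rightarrow> 3 \<Rightarrow> 3 \<Rightarrow> real^3 \<Rightarrow> real" where
 "kern' d i j e = (if i = j then force d (e \<bullet> e) else 0) + 2 * e $ i * e $ j * force' d (e \<bullet> e)"

definition mollifier :: "real^3 \<Rightarrow> real" where
 "mollifier z = 15/2 * max 0 (1 - z \<bullet> z)"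

lemma kern'_commute: "kern' d i j e = kern' d j i e"
 by (simp add: kern'_def)

lemma kern_derivative:
 assumes d: "d > 0"
 shows "((\<lambda>y. kern d i (x - y)) has_derivative (\<lambda>h. - (\<Sum>j\<in>UNIV. h $ j * kern' d i j (x - y)))) (at y)"
proof -
 define e where "e = x - y"
 have q: "((\<lambda>y. (x - y) \<bullet> (x - y)) has_derivative (\<lambda>h. - 2 * (h \<bullet> e))) (at y)"
  unfolding e_def by (auto intro!: derivative_eq_intros simp: inner_commute algebra_simps)
 have f: "((\<lambda>y. force d ((x - y) \<bullet> (x - y))) has_derivative (\<lambda>h. - 2 * (h \<bullet> e) * force' d (e \<bullet> e))) (at y)"
  using DERIV_compose_FDERIV[OF force_deriv[OF d] q] by (simp add: e_def)
 have "((\<lambda>y. x - y) has_derivative (\<lambda>h. - h)) (at y)" by (auto intro!: derivative_eq_intros)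
 from bounded_linear.has_derivative[OF bounded_linear_vec_nth this, of i]
 have c: "((\<lambda>y. (x - y) $ i) has_derivative (\<lambda>h. - (h $ i))) (at y)" by simp
 have s: "(\<Sum>j\<in>UNIV. h $ j * kern' d i j e) = h $ i * force d (e \<bullet> e) + 2 * e $ i * force' d (e \<bullet> e) * (h \<bullet> e)" for h
 proof -
  have "(\<Sum>j\<in>UNIV. h $ j * (if i = j then force d (e \<bullet> e) else 0)) = h $ i * force d (e \<bullet> e)"
   by (simp add: if_distrib[where f = "\<lambda>x. _ * x"] cong: if_cong)
  moreover have "(\<Sum>j\<in>UNIV. h $ j * (2 * e $ i * e $ j * c)) = 2 * e $ i * c * (h \<bullet> e)" for c
   by (simp add: inner_vec_def sum_distrib_left mult_ac)
  ultimately show ?thesis by (simp add: kern'_def distrib_left sum.distrib)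
 qed
 have "(\<lambda>h. (x - y) $ i * (- 2 * (h \<bullet> e) * force' d (e \<bullet> e)) + - (h $ i) * force d ((x - y) \<bullet> (x - y)))
  = (\<lambda>h. - (\<Sum>j\<in>UNIV. h $ j * kern' d i j (x - y)))"
  using s by (simp add: e_def[symmetric] algebra_simps fun_eq_iff)
 then show ?thesis using has_derivative_mult[OF c f] by (simp only: kern_def)
qed

lemma pd_kern: "d > 0 ==> pd j (\<lambda>y. kern d i (x - y)) y = - kern' d i j (x - y)"
 by (subst pd_eqI[OF kern_derivative]) (simp_all add: axis_def if_distrib[where f = "\<lambda>x. x * _"] cong: if_cong)

lemma kern'_continuous:
 assumes d: "d > 0" shows "continuous_on S (kern' d i j)"
proof -
 have "continuous_on S (\<lambda>e. force d (e \<bullet> e))" "continuous_on S (\<lambda>e. force' d (e \<bullet> e))"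
  by (rule continuous_on_compose2[OF force_continuous[OF d, of UNIV]] continuous_on_compose2[OF force'_continuous[OF d, of UNIV]];
    auto intro!: continuous_intros)+
 then show ?thesis unfolding kern'_def [abs_def]
  by (cases "i = j") (auto intro!: continuous_intros)
qed

lemma kern_continuous:
 assumes d: "d > 0" shows "continuous_on S (kern d i)"
proof -
 have "continuous_on S (\<lambda>e. force d (e \<bullet> e))"
  by (rule continuous_on_compose2[OF force_continuous[OF d, of UNIV]]) (auto intro!: continuous_intros)
 then show ?thesis unfolding kern_def [abs_def] by (auto intro!: continuous_intros)
qed

lemma Ck_on_kern:
 assumes d: "d > 0" shows "Ck_on (Suc 0) S (\<lambda>y. kern d i (x - y))"
proof (rule Ck_on_SucI)
 show "(\<lambda>y. kern d i (x - y)) differentiable (at y)" for y using kern_derivative[OF d] by (rule differentiableI)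
 have "continuous_on S (\<lambda>y. - kern' d i j (x - y))" for j
  by (intro continuous_on_minus continuous_on_compose2[OF kern'_continuous[OF d, of UNIV]])
   (auto intro!: continuous_intros)
 moreover have "pd j (\<lambda>y. kern d i (x - y)) = (\<lambda>y. - kern' d i j (x - y))" for j using pd_kern[OF d] by blast
 ultimately show "Ck_on 0 S (pd j (\<lambda>y. kern d i (x - y)))" for j by simp
qed

lemma kern_bounds:
 assumes d: "d > 0" and e: "e \<noteq> 0"
 shows "\<bar>kern d i e\<bar> \<le> 5/2 * norm e powr (- 2)" "\<bar>kern' d i j e\<bar> \<le> 11/2 * norm e powr (- 3)"
proof -
 define r where "r = norm e"
 have r: "r > 0" using e by (simp add: r_def)
 have ee: "e \<bullet> e = r\<^sup>2" by (simp add: r_def power2_norm_eq_inner)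
 have ei: "\<bar>e $ i\<bar> \<le> r" "\<bar>e $ j\<bar> \<le> r" unfolding r_def by (rule component_le_norm_cart)+
 note B = kernel_profile_bounds[OF d r]
 have p: "r * r powr (- 3) = r powr (- 2)" "r * (r * r powr (- 5)) = r powr (- 3)"
  using r by (simp_all add: powr_mult_base)
 have "\<bar>kern d i e\<bar> = \<bar>e $ i\<bar> * force d (r\<^sup>2)" using B(1) by (simp add: kern_def ee abs_mult)
 also have "\<dots> \<le> r * (5/2 * r powr (- 3))" using B ei r by (intro mult_mono) auto
 finally show "\<bar>kern d i e\<bar> \<le> 5/2 * norm e powr (- 2)" using p by (simp add: r_def[symmetric])
 have "\<bar>2 * e $ i * e $ j * force' d (e \<bullet> e)\<bar> = 2 * (\<bar>e $ i\<bar> * (\<bar>e $ j\<bar> * \<bar>force' d (r\<^sup>2)\<bar>))" by (simp add: ee abs_mult)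
 also have "\<dots> \<le> 2 * (r * (r * (3/2 * r powr (- 5))))" using B ei r by (intro mult_left_mono mult_mono) auto
 also have "\<dots> = 3 * r powr (- 3)" using p by simp
 finally have two: "\<bar>2 * e $ i * e $ j * force' d (e \<bullet> e)\<bar> \<le> 3 * r powr (- 3)" .
 show "\<bar>kern' d i j e\<bar> \<le> 11/2 * norm e powr (- 3)"
 proof (cases "i = j")
  case True
  have "\<bar>kern' d i j e\<bar> \<le> \<bar>force d (e \<bullet> e)\<bar> + \<bar>2 * e $ i * e $ j * force' d (e \<bullet> e)\<bar>"
   unfolding kern'_def if_P[OF True] by (rule abs_triangle_ineq)
  moreover have "\<bar>force d (e \<bullet> e)\<bar> \<le> 5/2 * r powr (- 3)" using B(1,2) unfolding ee by linarith
  ultimately show ?thesis using two unfolding r_def[symmetric] by linarith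
 next
  case False
  have "0 \<le> r powr (- 3)" by simp
  then show ?thesis using two unfolding kern'_def r_def[symmetric] if_not_P[OF False] by linarith
 qed
qed

text \<open>The divergence of the force field is the mollifier at scale \<open>d\<close>: outside the ball of radius \<open>d\<close> the field is
  the Newtonian one, \<open>e / \<bar>e\<bar>\<^sup>3\<close>, which is divergence free.\<close>

lemma kern'_trace:
 assumes d: "d > 0"
 shows "(\<Sum>i\<in>UNIV. kern' d i i (x - y)) = (1 / d) ^ 3 * mollifier ((1 / d) *\<^sub>R (y - x))"
proof -
 define s where "s = (x - y) \<bullet> (x - y)"
 have yx: "(y - x) \<bullet> (y - x) = s" by (simp add: s_def inner_commute algebra_simps)
 have ee: "(\<Sum>i\<in>UNIV. e $ i * e $ i) = e \<bullet> e" for e :: "real^3" by (simp add: inner_vec_def)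
 have lin: "(\<Sum>i\<in>UNIV. f + 2 * e $ i * e $ i * c) = 3 * f + 2 * (\<Sum>i\<in>UNIV. e $ i * e $ i) * c" for f c and e :: "real^3"
  by (simp add: sum.distrib sum_distrib_left sum_distrib_right mult.assoc)
 have "(\<Sum>i\<in>UNIV. kern' d i i (x - y)) = 3 * force d s + 2 * s * force' d s"
  unfolding kern'_def s_def if_P[OF refl] lin ee ..
 also have "\<dots> = 15/2 * max 0 (1 - s / d\<^sup>2) / d ^ 3"
 proof (cases "s \<le> d\<^sup>2")
  case True
  have "max 0 (1 - s / d\<^sup>2) = 1 - s / d\<^sup>2" using True d by (simp add: max_def divide_le_eq)
  moreover have "3 * ((5/2 - 3/2 * (s / d\<^sup>2)) / d ^ 3) + 2 * s * (- (3/2) / d ^ 5) = 15/2 * (1 - s / d\<^sup>2) / d ^ 3"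
   using d by (simp add: field_simps eval_nat_numeral)
  ultimately show ?thesis using True by (simp add: force_def force'_def)
 next
  case False
  then have "s > 0" using d zero_less_power2[of d] by linarith
  then have "s powr (- 3/2) = s * s powr (- 5/2)" by (simp add: powr_mult_base)
  moreover have "max 0 (1 - s / d\<^sup>2) = 0" using False d by (simp add: max_def divide_less_eq not_le)
  ultimately show ?thesis using False by (simp add: force_def force'_def)
 qed
 also have "\<dots> = (1 / d) ^ 3 * mollifier ((1 / d) *\<^sub>R (y - x))"
 proof -
  have "((1 / d) *\<^sub>R (y - x)) \<bullet> ((1 / d) *\<^sub>R (y - x)) = (1 / d) * ((1 / d) * s)" by (simp only: inner_scaleR_left inner_scaleR_right yx)
  also have "\<dots> = s / d\<^sup>2" by (simp add: power2_eq_square)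
  finally have 1: "((1 / d) *\<^sub>R (y - x)) \<bullet> ((1 / d) *\<^sub>R (y - x)) = s / d\<^sup>2" .
  have 2: "(1 / d) ^ 3 = 1 / d ^ 3" by (rule power_one_over)
  show ?thesis unfolding mollifier_def 1 2 by simp
 qed
 finally show ?thesis .
qed

lemma mollifier_nonneg: "0 \<le> mollifier z" by (simp add: mollifier_def)

lemma mollifier_continuous: "continuous_on S mollifier"
 unfolding mollifier_def [abs_def] by (intro continuous_intros)

lemma mollifier_support:
 assumes "w \<notin> cbox (- vec 1) (vec 1)" shows "mollifier w = 0"
proof -
 obtain i where "\<not> (- 1 \<le> w $ i \<and> w $ i \<le> 1)" using assms by (auto simp: mem_box_cart)
 then have i: "\<bar>w $ i\<bar> > 1" by linarith
 have "\<bar>w $ i\<bar> \<le> norm w" by (rule component_le_norm_cart)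
 then have "1 < norm w" using i by linarith
 then have "1\<^sup>2 < (norm w)\<^sup>2" by (intro power_strict_mono) auto
 then show ?thesis by (simp add: mollifier_def power2_norm_eq_inner)
qed

lemma mollifier_mass_pos: "integral (cbox (- vec 1) (vec 1)) mollifier > 0"
proof -
 let ?Q = "cbox (- vec 1) (vec 1) :: (real^3) set"
 have i: "mollifier integrable_on ?Q" by (rule integrable_continuous[OF mollifier_continuous])
 have "integral ?Q mollifier \<ge> 0" by (rule Henstock_Kurzweil_Integration.integral_nonneg[OF i]) (rule mollifier_nonneg)
 moreover have "integral ?Q mollifier \<noteq> 0"
 proof
  assume z: "integral ?Q mollifier = 0"
  have "mollifier 0 = 0"
  proof (rule has_integral_0_cbox_imp_0[OF mollifier_continuous mollifier_nonneg])
   show "(mollifier has_integral 0) ?Q" using integrable_integral[OF i] by (simp only: z)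
   show "box (- vec 1) (vec 1) \<noteq> ({} :: (real^3) set)" by (auto simp: mem_box_cart intro!: exI[of _ 0] simp flip: ex_in_conv)
  qed (auto simp: mem_box_cart)
  then show False by (simp add: mollifier_def)
 qed
 ultimately show ?thesis by linarith
qed

section \<open>Interior Hoelder continuity\<close>

text \<open>The quantities estimated are averages over cubes of side \<open>2 * s\<close>. An \<open>L\<^sup>2\<close> bound controls them by
  \<open>s powr (- 3 / 2)\<close>; an \<open>L\<^sup>2\<close> bound of the gradient improves this to \<open>s powr (- 1 / 2)\<close> by integration of the
  derivative in \<open>s\<close>. Applied to the gradient of \<open>f\<close>, the improved bound is that of Hoelder exponent \<open>1 / 2\<close>.\<close>

lemma cube_mean_L2:
 fixes h :: "real^3 \<Rightarrow> real"
 assumes OL: "\<Omega> \<in> sets lebesgue" and hc: "continuous_on \<Omega> h" and L: "Lp 2 \<Omega> h" "Lp_norm 2 \<Omega> h \<le> N" and N: "N > 0"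
  and s: "s > 0" and sub: "!!w. w \<in> cbox (- vec 1) (vec 1) ==> x + s *\<^sub>R w \<in> \<Omega>"
 shows "integral (cbox (- vec 1) (vec 1)) (\<lambda>w. \<bar>h (x + s *\<^sub>R w)\<bar>) \<le> 9/2 * N * s powr (- 3/2)"
proof -
 let ?Q = "cbox (- vec 1) (vec 1) :: (real^3) set"
 define B where "B = cbox (s *\<^sub>R (- vec 1) + x) (s *\<^sub>R vec 1 + x)"
 have "0 \<in> ?Q" by (simp add: mem_box_cart)
 then have Qne: "?Q \<noteq> {}" by blast
 have Bim: "B = (\<lambda>w. s *\<^sub>R w + x) ` ?Q" using s Qne by (simp add: B_def image_affinity_cbox)
 have BO: "B \<subseteq> \<Omega>" using sub by (auto simp: Bim add.commute)
 have hs: "continuous_on ?Q (\<lambda>w. h (x + s *\<^sub>R w))"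
  by (rule continuous_on_compose2[OF hc]) (auto intro!: continuous_intros sub)
 \<comment> \<open>\<open>\<theta>\<close> balances the two terms of Young's inequality.\<close>
 define \<theta> where "\<theta> = N * s powr (- 3/2)"
 have \<theta>: "\<theta> > 0" using N s by (simp add: \<theta>_def)
 have p2: "norm y powr 2 = (norm y)\<^sup>2" for y :: real by (cases "y = 0") auto
 have I: "integrable (lebesgue_on \<Omega>) (\<lambda>y. (h y)\<^sup>2)" using L(1) by (simp add: Lp_def p2 del: real_norm_def) simp
 have "integral \<Omega> (\<lambda>y. (h y)\<^sup>2) = (\<integral>y. (h y)\<^sup>2 \<partial>lebesgue_on \<Omega>)"
  by (rule lebesgue_integral_eq_integral[OF I OL, symmetric])
 also have "\<dots> = Lp_norm 2 \<Omega> h powr 2" using Lp_norm_powr[of 2 \<Omega> h] by (simp add: p2 del: real_norm_def) simp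
 also have "\<dots> \<le> N powr 2" using L(2) by (intro powr_mono2) (auto simp: Lp_norm_nonneg)
 also have "\<dots> = N\<^sup>2" using N by simp
 finally have le: "integral \<Omega> (\<lambda>y. (h y)\<^sup>2) \<le> N\<^sup>2" .
 have hB: "(\<lambda>y. (h y)\<^sup>2) integrable_on B" unfolding B_def
  by (intro integrable_continuous continuous_on_power continuous_on_subset[OF hc] BO[unfolded B_def])
 have hO: "(\<lambda>y. (h y)\<^sup>2) integrable_on \<Omega>" using I OL integrable_on_lebesgue_on by blast
 have "integral B (\<lambda>y. (h y)\<^sup>2) \<le> integral \<Omega> (\<lambda>y. (h y)\<^sup>2)" by (rule integral_subset_le[OF BO hB hO]) simp
 then have leB: "integral B (\<lambda>y. (h y)\<^sup>2) \<le> N\<^sup>2" using le by linarith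
 have "((\<lambda>w. (h (s *\<^sub>R w + x))\<^sup>2) has_integral (1 / \<bar>s\<bar> ^ DIM(real^3)) *\<^sub>R integral B (\<lambda>y. (h y)\<^sup>2))
   ((\<lambda>y. (1 / s) *\<^sub>R y + - ((1 / s) *\<^sub>R x)) ` B)"
  unfolding B_def by (rule has_integral_affinity[OF integrable_integral[OF hB[unfolded B_def]]]) (use s in simp)
 moreover have "(\<lambda>y. (1 / s) *\<^sub>R y + - ((1 / s) *\<^sub>R x)) ` B = ?Q"
  using s by (simp add: Bim image_image scaleR_add_right)
 ultimately have A: "((\<lambda>w. (h (x + s *\<^sub>R w))\<^sup>2) has_integral (1 / s ^ 3) * integral B (\<lambda>y. (h y)\<^sup>2)) ?Q"
  using s by (simp add: add.commute eval_nat_numeral)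
 have "integral ?Q (\<lambda>w. \<bar>h (x + s *\<^sub>R w)\<bar>) \<le> integral ?Q (\<lambda>w. \<theta> / 2 + (1 / (2 * \<theta>)) * (h (x + s *\<^sub>R w))\<^sup>2)"
 proof (rule Henstock_Kurzweil_Integration.integral_le)
  show "(\<lambda>w. \<bar>h (x + s *\<^sub>R w)\<bar>) integrable_on ?Q" by (intro integrable_continuous continuous_on_rabs hs)
  show "(\<lambda>w. \<theta> / 2 + (1 / (2 * \<theta>)) * (h (x + s *\<^sub>R w))\<^sup>2) integrable_on ?Q"
   by (intro integrable_continuous continuous_on_add continuous_on_mult continuous_on_const continuous_on_power hs)
  fix w
  have "0 \<le> (\<theta> - \<bar>h (x + s *\<^sub>R w)\<bar>)\<^sup>2" by simp
  then have "2 * \<theta> * \<bar>h (x + s *\<^sub>R w)\<bar> \<le> \<theta>\<^sup>2 + (h (x + s *\<^sub>R w))\<^sup>2" by (simp add: power2_diff)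
  then show "\<bar>h (x + s *\<^sub>R w)\<bar> \<le> \<theta> / 2 + (1 / (2 * \<theta>)) * (h (x + s *\<^sub>R w))\<^sup>2"
   using \<theta> by (simp add: field_simps power2_eq_square)
 qed
 also have "\<dots> = 8 * (\<theta> / 2) + (1 / (2 * \<theta>)) * ((1 / s ^ 3) * integral B (\<lambda>y. (h y)\<^sup>2))"
 proof (rule integral_unique, rule has_integral_add)
  have "((\<lambda>w. \<theta> / 2) has_integral measure lborel ?Q *\<^sub>R (\<theta> / 2)) ?Q" by (rule has_integral_const)
  moreover have "measure lborel ?Q = 8" using Qne by (simp add: content_cbox_cart)
  ultimately show "((\<lambda>w. \<theta> / 2) has_integral 8 * (\<theta> / 2)) ?Q" by simp
  show "((\<lambda>w. 1 / (2 * \<theta>) * (h (x + s *\<^sub>R w))\<^sup>2) has_integral 1 / (2 * \<theta>) * (1 / s ^ 3 * integral B (\<lambda>y. (h y)\<^sup>2))) ?Q"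
   by (rule has_integral_mult_right[OF A])
 qed
 also have "\<dots> \<le> 8 * (\<theta> / 2) + (1 / (2 * \<theta>)) * ((1 / s ^ 3) * N\<^sup>2)"
  using \<theta> s leB by (intro add_left_mono mult_left_mono) auto
 also have "(1 / s ^ 3) * N\<^sup>2 = \<theta>\<^sup>2"
 proof -
  have "(s powr (- 3/2))\<^sup>2 = s powr (- 3)" by (simp add: power2_eq_square powr_add[symmetric])
  also have "\<dots> = 1 / s ^ 3" using s powr_realpow[of s 3] by (simp add: powr_minus inverse_eq_divide)
  finally show ?thesis by (simp add: \<theta>_def power_mult_distrib)
 qed
 also have "8 * (\<theta> / 2) + (1 / (2 * \<theta>)) * \<theta>\<^sup>2 = 9/2 * \<theta>" using \<theta> by (simp add: power2_eq_square)
 finally show ?thesis by (simp add: \<theta>_def)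
qed

lemma weighted_mean_derivative:
 fixes f :: "real^3 \<Rightarrow> real"
 assumes O: "open \<Omega>" and f: "Ck_on (Suc 0) \<Omega> f" and \<gamma>: "continuous_on (cbox a b) \<gamma>"
  and sub: "!!w \<tau>. w \<in> cbox a b ==> \<tau> \<in> {l..r} ==> (A + p *\<^sub>R w) + \<tau> *\<^sub>R (v + q *\<^sub>R w) \<in> \<Omega>"
  and \<tau>: "l < \<tau>" "\<tau> < r"
 shows "((\<lambda>\<tau>. integral (cbox a b) (\<lambda>w. \<gamma> w * f ((A + p *\<^sub>R w) + \<tau> *\<^sub>R (v + q *\<^sub>R w)))) has_real_derivative
  (\<Sum>j\<in>UNIV. integral (cbox a b) (\<lambda>w. (\<gamma> w * (v + q *\<^sub>R w) $ j) * pd j f ((A + p *\<^sub>R w) + \<tau> *\<^sub>R (v + q *\<^sub>R w))))) (at \<tau>)"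
proof -
 let ?y = "\<lambda>\<tau> w. (A + p *\<^sub>R w) + \<tau> *\<^sub>R (v + q *\<^sub>R w)"
 let ?D = "\<lambda>\<tau> w. \<Sum>j\<in>UNIV. (\<gamma> w * (v + q *\<^sub>R w) $ j) * pd j f (?y \<tau> w)"
 have yc: "continuous_on ({l..r} \<times> cbox a b) (\<lambda>z. ?y (fst z) (snd z))" by (intro continuous_intros)
 have \<gamma>c: "continuous_on ({l..r} \<times> cbox a b) (\<lambda>z. \<gamma> (snd z))"
  by (rule continuous_on_compose2[OF \<gamma>]) (auto intro!: continuous_intros)
 have pc: "continuous_on ({l..r} \<times> cbox a b) (\<lambda>z. pd j f (?y (fst z) (snd z)))" for j
  by (rule continuous_on_compose2[OF Ck_on_continuous[OF Ck_on_pd[OF f]] yc]) (use sub in auto)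
 have ys: "continuous_on (cbox a b) (?y \<tau>')" for \<tau>' by (intro continuous_intros)
 have "((\<lambda>\<tau>. integral (cbox a b) (\<lambda>w. \<gamma> w * f (?y \<tau> w))) has_vector_derivative integral (cbox a b) (?D \<tau>)) (at \<tau> within {l..r})"
 proof (rule leibniz_rule_vector_derivative)
  fix \<tau>' w assume w: "\<tau>' \<in> {l..r}" "w \<in> cbox a b"
  have "((\<lambda>\<tau>. f (?y \<tau> w)) has_vector_derivative (\<Sum>j\<in>UNIV. ((v + q *\<^sub>R w) $ j) *\<^sub>R pd j f (?y \<tau>' w))) (at \<tau>')"
   by (rule has_vector_derivative_along_line[OF Ck_on_differentiable[OF f]]) (use sub w in auto)
  then have "((\<lambda>\<tau>. \<gamma> w * f (?y \<tau> w)) has_vector_derivative \<gamma> w * (\<Sum>j\<in>UNIV. ((v + q *\<^sub>R w) $ j) *\<^sub>R pd j f (?y \<tau>' w))) (at \<tau>')"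
   by (rule has_vector_derivative_mult_right)
  moreover have "\<gamma> w * (\<Sum>j\<in>UNIV. ((v + q *\<^sub>R w) $ j) *\<^sub>R pd j f (?y \<tau>' w)) = ?D \<tau>' w"
   by (simp add: sum_distrib_left mult.assoc)
  ultimately show "((\<lambda>\<tau>. \<gamma> w * f (?y \<tau> w)) has_vector_derivative ?D \<tau>' w) (at \<tau>' within {l..r})"
   by (simp add: has_vector_derivative_at_within)
 next
  fix \<tau>' assume t: "\<tau>' \<in> {l..r}"
  show "(\<lambda>w. \<gamma> w * f (?y \<tau>' w)) integrable_on cbox a b"
   by (intro integrable_continuous continuous_on_mult \<gamma> continuous_on_compose2[OF Ck_on_continuous[OF f] ys]) (use sub t in auto)
 next
  have "continuous_on ({l..r} \<times> cbox a b) (\<lambda>z. ?D (fst z) (snd z))"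
   by (intro continuous_on_sum continuous_on_mult \<gamma>c pc) (intro continuous_intros)
  then show "continuous_on ({l..r} \<times> cbox a b) (\<lambda>(\<tau>, w). ?D \<tau> w)" by (simp add: case_prod_unfold)
 qed (use \<tau> in auto)
 moreover have "integral (cbox a b) (?D \<tau>) = (\<Sum>j\<in>UNIV. integral (cbox a b) (\<lambda>w. (\<gamma> w * (v + q *\<^sub>R w) $ j) * pd j f (?y \<tau> w)))"
  by (rule Henstock_Kurzweil_Integration.integral_sum, simp, intro integrable_continuous continuous_on_mult \<gamma>
    continuous_on_compose2[OF Ck_on_continuous[OF Ck_on_pd[OF f]] ys])
   (use sub \<tau> in \<open>auto intro!: continuous_intros\<close>)
 ultimately show ?thesis
  using \<tau> by (simp add: has_real_derivative_iff_has_vector_derivative at_within_Icc_at)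
qed

locale interior_cubes =
 fixes \<Omega> B :: "(real^3) set" and s0 :: real
 assumes O: "open \<Omega>" and B: "convex B" and s0: "0 < s0" "s0 \<le> 1"
  and sub: "!!x w s. x \<in> B ==> w \<in> cbox (- vec 1) (vec 1) ==> 0 \<le> s ==> s \<le> s0 ==> x + s *\<^sub>R w \<in> \<Omega>"
begin

abbreviation Q :: "(real^3) set" where "Q \<equiv> cbox (- vec 1) (vec 1)"

lemma weighted_integral_bound:
 fixes h :: "real^3 \<Rightarrow> real"
 assumes hc: "continuous_on \<Omega> h" and L: "Lp 2 \<Omega> h" "Lp_norm 2 \<Omega> h \<le> N" and N: "N > 0"
  and \<gamma>: "continuous_on Q \<gamma>" "!!w. w \<in> Q ==> \<bar>\<gamma> w\<bar> \<le> 1" and x: "x \<in> B" and s: "0 < s" "s \<le> s0"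
 shows "\<bar>integral Q (\<lambda>w. \<gamma> w * h (x + s *\<^sub>R w))\<bar> \<le> 9/2 * N * s powr (- 3/2)"
proof -
 have hs: "continuous_on Q (\<lambda>w. h (x + s *\<^sub>R w))"
  by (rule continuous_on_compose2[OF hc]) (use sub x s in \<open>auto intro!: continuous_intros\<close>)
 have "norm (integral Q (\<lambda>w. \<gamma> w * h (x + s *\<^sub>R w))) \<le> integral Q (\<lambda>w. \<bar>h (x + s *\<^sub>R w)\<bar>)"
 proof (rule Henstock_Kurzweil_Integration.integral_norm_bound_integral)
  show "(\<lambda>w. \<gamma> w * h (x + s *\<^sub>R w)) integrable_on Q" by (intro integrable_continuous continuous_on_mult \<gamma> hs)
  show "(\<lambda>w. \<bar>h (x + s *\<^sub>R w)\<bar>) integrable_on Q" by (intro integrable_continuous continuous_on_rabs hs)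
  show "norm (\<gamma> w * h (x + s *\<^sub>R w)) \<le> \<bar>h (x + s *\<^sub>R w)\<bar>" if "w \<in> Q" for w
   using \<gamma>(2)[OF that] by (simp add: abs_mult mult_left_le_one_le)
 qed
 also have "\<dots> \<le> 9/2 * N * s powr (- 3/2)"
  by (rule cube_mean_L2[OF _ hc L N s(1)]) (use O sub x s in auto)
 finally show ?thesis by simp
qed

lemma weighted_mean_growth:
 fixes h :: "real^3 \<Rightarrow> real"
 assumes h: "Ck_on (Suc 0) \<Omega> h" and L: "Lp 2 \<Omega> h" "Lp_norm 2 \<Omega> h \<le> N"
  and L1: "!!j. Lp 2 \<Omega> (pd j h)" "!!j. Lp_norm 2 \<Omega> (pd j h) \<le> N" and N: "N > 0"
  and \<gamma>: "continuous_on Q \<gamma>" "!!w. w \<in> Q ==> \<bar>\<gamma> w\<bar> \<le> 1" and x: "x \<in> B" and s: "0 < s" "s \<le> s0"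
 shows "\<bar>integral Q (\<lambda>w. \<gamma> w * h (x + s *\<^sub>R w))\<bar> \<le> (9/2 / s0 + 27) * N * s powr (- 1/2)"
proof -
 have upper: "integral Q (\<lambda>w. \<gamma> w * h (x + s *\<^sub>R w)) \<le> (9/2 / s0 + 27) * N * s powr (- 1/2)"
  if \<gamma>: "continuous_on Q \<gamma>" "!!w. w \<in> Q ==> \<bar>\<gamma> w\<bar> \<le> 1" for \<gamma>
 proof -
  define P where "P = (\<lambda>s. integral Q (\<lambda>w. \<gamma> w * h (x + s *\<^sub>R w)))"
  have wj: "\<bar>\<gamma> w * w $ j\<bar> \<le> 1" if "w \<in> Q" for w j
  proof -
   have "\<bar>w $ j\<bar> \<le> 1" using that by (auto simp: mem_box_cart abs_le_iff)
   then show ?thesis using \<gamma>(2)[OF that] by (simp add: abs_mult mult_le_one)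
  qed
  have P': "\<exists>D. (P has_real_derivative D) (at r) \<and> - (27/2 * N * r powr (- 3/2)) \<le> D" if r: "0 < r" "r < s0" for r
  proof -
   let ?D = "\<Sum>j\<in>UNIV. integral Q (\<lambda>w. (\<gamma> w * w $ j) * pd j h (x + r *\<^sub>R w))"
   have "(P has_real_derivative ?D) (at r)"
    using weighted_mean_derivative[OF O h \<gamma>(1), of 0 s0 x 0 0 1 r] sub x r by (simp add: P_def)
   moreover have "\<bar>?D\<bar> \<le> (\<Sum>j\<in>(UNIV::3 set). 9/2 * N * r powr (- 3/2))"
   proof (rule order_trans[OF sum_abs sum_mono])
    fix j show "\<bar>integral Q (\<lambda>w. (\<gamma> w * w $ j) * pd j h (x + r *\<^sub>R w))\<bar> \<le> 9/2 * N * r powr (- 3/2)"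
     by (intro weighted_integral_bound L1 N Ck_on_continuous[OF Ck_on_pd[OF h]] continuous_on_mult \<gamma>(1) wj x
      continuous_on_component continuous_on_id) (use r in auto)
   qed
   then have "- (27/2 * N * r powr (- 3/2)) \<le> ?D" by simp
   ultimately show ?thesis by blast
  qed
  have hx: "continuous_on ({s..s0} \<times> Q) (\<lambda>z. h (x + fst z *\<^sub>R snd z))"
   by (rule continuous_on_compose2[OF Ck_on_continuous[OF h]]) (use sub x s in \<open>auto intro!: continuous_intros\<close>)
  have \<gamma>x: "continuous_on ({s..s0} \<times> Q) (\<lambda>z. \<gamma> (snd z))"
   by (rule continuous_on_compose2[OF \<gamma>(1)]) (auto intro!: continuous_intros)
  have "continuous_on ({s..s0} \<times> Q) (\<lambda>(r, w). \<gamma> w * h (x + r *\<^sub>R w))"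
   using continuous_on_mult[OF \<gamma>x hx] by (simp add: case_prod_unfold)
  then have Pc: "continuous_on {s..s0} P" unfolding P_def by (rule integral_continuous_on_param)
  have "P s - 27 * N * s powr (- 1/2) \<le> P s0 - 27 * N * s0 powr (- 1/2)"
  proof (rule DERIV_nonneg_imp_increasing_open[OF s(2)])
   fix r assume r: "s < r" "r < s0"
   then have r0: "r > 0" using s by linarith
   obtain D where D: "(P has_real_derivative D) (at r)" "- (27/2 * N * r powr (- 3/2)) \<le> D" using P'[OF r0 r(2)] by blast
   have "((\<lambda>r. r powr (- 1/2)) has_real_derivative (- 1/2 * r powr (- 3/2))) (at r)"
    using has_real_derivative_powr[OF r0, of "- 1/2"] by simp
   from DERIV_diff[OF D(1) DERIV_cmult[OF this, of "27 * N"]]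
   have "((\<lambda>r. P r - 27 * N * r powr (- 1/2)) has_real_derivative (D - 27 * N * (- 1/2 * r powr (- 3/2)))) (at r)" .
   moreover have "D - 27 * N * (- 1/2 * r powr (- 3/2)) \<ge> 0" using D(2) by simp
   ultimately show "\<exists>y. ((\<lambda>r. P r - 27 * N * r powr (- 1/2)) has_real_derivative y) (at r) \<and> 0 \<le> y" by blast
  next
   show "continuous_on {s..s0} (\<lambda>r. P r - 27 * N * r powr (- 1/2))"
    by (intro continuous_on_diff Pc continuous_on_mult continuous_on_const continuous_on_powr continuous_on_id) (use s in auto)
  qed
  moreover have "P s0 \<le> 9/2 / s0 * N * s powr (- 1/2)"
  proof -
   have "P s0 \<le> 9/2 * N * s0 powr (- 3/2)"
    using weighted_integral_bound[OF Ck_on_continuous[OF h] L N \<gamma> x s0(1) order_refl] by (simp add: P_def abs_le_iff)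
   also have "s0 powr (- 3/2) = s0 powr (- 1) * s0 powr (- 1/2)"
   proof -
    have "- 3/2 = - 1 + (- 1/2 :: real)" by simp
    then show ?thesis by (metis powr_add)
   qed
   also have "\<dots> \<le> s0 powr (- 1) * s powr (- 1/2)" using s s0 by (intro mult_left_mono powr_mono2') auto
   also have "s0 powr (- 1) = 1 / s0" using s0 by (simp add: powr_minus inverse_eq_divide)
   finally show ?thesis using N by (simp add: mult_left_mono)
  qed
  moreover have "0 \<le> 27 * N * s0 powr (- 1/2)" using N by simp
  ultimately show ?thesis by (simp add: P_def algebra_simps)
 qed
 have "integral Q (\<lambda>w. - \<gamma> w * h (x + s *\<^sub>R w)) \<le> (9/2 / s0 + 27) * N * s powr (- 1/2)"
  by (rule upper) (use \<gamma> in \<open>auto intro!: continuous_intros\<close>)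
 then show ?thesis using upper[OF \<gamma>] by (simp add: abs_le_iff)
qed

lemma hoelder_half:
 fixes f :: "real^3 \<Rightarrow> real"
 assumes f: "Ck_on (Suc (Suc 0)) \<Omega> f" and L: "!!i. Lp 2 \<Omega> (pd i f)" "!!i. Lp_norm 2 \<Omega> (pd i f) \<le> N"
  and L1: "!!i j. Lp 2 \<Omega> (pd j (pd i f))" "!!i j. Lp_norm 2 \<Omega> (pd j (pd i f)) \<le> N" and N: "N > 0"
  and x: "x \<in> B" "z \<in> B" and xz: "norm (x - z) \<le> s0"
 shows "\<bar>f x - f z\<bar> \<le> 2 * ((9/2 / s0 + 27) * N) * norm (x - z) powr (1/2)"
proof (cases "x = z")
 case False
 define C where "C = (9/2 / s0 + 27) * N"
 have C: "C > 0" using s0 N by (simp add: C_def add_pos_pos)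
 define s where "s = norm (x - z)"
 have s: "0 < s" "s \<le> s0" using False xz by (auto simp: s_def)
 have f1: "Ck_on (Suc 0) \<Omega> f" using Ck_on_Suc_D[OF f] .
 note G = weighted_mean_growth[OF Ck_on_pd[OF f] L(1) L(2) L1(1) L1(2) N, folded C_def]
 define m where "m = (\<lambda>x s. integral Q (\<lambda>w. 1 * f (x + s *\<^sub>R w)))"
 have "0 \<in> Q" by (simp add: mem_box_cart)
 then have Qne: "Q \<noteq> {}" by blast
 have m0: "m x 0 = 8 * f x" for x using Qne by (simp add: m_def content_cbox_cart)
 have ms: "\<bar>m x s - m x 0\<bar> \<le> 6 * C * s powr (1/2)" if x: "x \<in> B" for x
 proof -
  have d: "\<exists>D. (m x has_real_derivative D) (at r) \<and> \<bar>D\<bar> \<le> 3 * C * r powr (- 1/2)" if r: "0 < r" "r < s" for r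
  proof -
   let ?D = "\<Sum>j\<in>UNIV. integral Q (\<lambda>w. w $ j * pd j f (x + r *\<^sub>R w))"
   have "(m x has_real_derivative ?D) (at r)"
    using weighted_mean_derivative[OF O f1 continuous_on_const, of "- vec 1" "vec 1" 0 s x 0 0 1 r 1] sub x r s by (simp add: m_def)
   moreover have "\<bar>?D\<bar> \<le> (\<Sum>j\<in>(UNIV::3 set). C * r powr (- 1/2))"
   proof (rule order_trans[OF sum_abs sum_mono])
    fix j
    have "\<bar>w $ j\<bar> \<le> 1" if "w \<in> Q" for w using that by (auto simp: mem_box_cart abs_le_iff)
    then show "\<bar>integral Q (\<lambda>w. w $ j * pd j f (x + r *\<^sub>R w))\<bar> \<le> C * r powr (- 1/2)"
     using r s x by (intro G) (auto intro!: continuous_intros)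
   qed
   ultimately show ?thesis by fastforce
  qed
  have "continuous_on ({0..s} \<times> Q) (\<lambda>z. 1 * f (x + fst z *\<^sub>R snd z))"
   by (intro continuous_on_mult continuous_on_const continuous_on_compose2[OF Ck_on_continuous[OF f]])
    (use sub x s in \<open>auto intro!: continuous_intros\<close>)
  then have "continuous_on ({0..s} \<times> Q) (\<lambda>(r, w). 1 * f (x + r *\<^sub>R w))" by (simp add: case_prod_unfold)
  then have mc: "continuous_on {0..s} (m x)" unfolding m_def by (rule integral_continuous_on_param)
  have pc: "continuous_on {0..s} (\<lambda>r. 6 * C * r powr (1/2))"
   by (intro continuous_on_mult continuous_on_const continuous_on_powr' continuous_on_id) auto
  have pd: "((\<lambda>r. 6 * C * r powr (1/2)) has_real_derivative 3 * C * r powr (- 1/2)) (at r)" if "r > 0" for r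
   using DERIV_cmult[OF has_real_derivative_powr[OF that, of "1/2"], of "6 * C"] by (simp add: mult.assoc)
  have "m x s - 6 * C * s powr (1/2) \<le> m x 0 - 6 * C * 0 powr (1/2)"
  proof (rule DERIV_nonpos_imp_decreasing_open[where f = "\<lambda>r. m x r - 6 * C * r powr (1/2)" and a = 0 and b = s])
   fix r assume r: "0 < r" "r < s"
   then obtain D where D: "(m x has_real_derivative D) (at r)" "\<bar>D\<bar> \<le> 3 * C * r powr (- 1/2)" using d by blast
   show "\<exists>y. ((\<lambda>r. m x r - 6 * C * r powr (1/2)) has_real_derivative y) (at r) \<and> y \<le> 0"
    by (rule exI, rule conjI, rule DERIV_diff[OF D(1) pd[OF r(1)]]) (use D(2) in linarith)
  qed (use s in \<open>auto intro: continuous_on_diff[OF mc pc]\<close>)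
  moreover have "m x 0 + 6 * C * 0 powr (1/2) \<le> m x s + 6 * C * s powr (1/2)"
  proof (rule DERIV_nonneg_imp_increasing_open[where f = "\<lambda>r. m x r + 6 * C * r powr (1/2)" and a = 0 and b = s])
   fix r assume r: "0 < r" "r < s"
   then obtain D where D: "(m x has_real_derivative D) (at r)" "\<bar>D\<bar> \<le> 3 * C * r powr (- 1/2)" using d by blast
   show "\<exists>y. ((\<lambda>r. m x r + 6 * C * r powr (1/2)) has_real_derivative y) (at r) \<and> 0 \<le> y"
    by (rule exI, rule conjI, rule DERIV_add[OF D(1) pd[OF r(1)]]) (use D(2) in linarith)
  qed (use s in \<open>auto intro: continuous_on_add[OF mc pc]\<close>)
  ultimately show ?thesis by (simp add: abs_le_iff)
 qed
 have "\<bar>m z s - m x s\<bar> \<le> 3 * C * s powr (1/2)"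
 proof -
  define k where "k = (\<lambda>\<tau>. integral Q (\<lambda>w. 1 * f ((x + s *\<^sub>R w) + \<tau> *\<^sub>R ((z - x) + 0 *\<^sub>R w))))"
  have pt: "x + \<tau> *\<^sub>R (z - x) \<in> B" if "\<tau> \<in> {0..1}" for \<tau>
   using convexD_alt[OF B x(1) x(2), of \<tau>] that by (simp add: algebra_simps)
  have sub': "(x + s *\<^sub>R w) + \<tau> *\<^sub>R ((z - x) + 0 *\<^sub>R w) \<in> \<Omega>" if "w \<in> Q" "\<tau> \<in> {0..1}" for w \<tau>
   using sub[OF pt[OF that(2)] that(1), of s] s by (simp add: algebra_simps)
  have d: "\<exists>D. (k has_real_derivative D) (at \<tau>) \<and> \<bar>D\<bar> \<le> 3 * C * s powr (1/2)" if t: "0 < \<tau>" "\<tau> < 1" for \<tau>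
  proof -
   let ?I = "\<lambda>j. integral Q (\<lambda>w. 1 * pd j f ((x + \<tau> *\<^sub>R (z - x)) + s *\<^sub>R w))"
   let ?D = "\<Sum>j\<in>UNIV. integral Q (\<lambda>w. (1 * ((z - x) + 0 *\<^sub>R w) $ j) * pd j f ((x + s *\<^sub>R w) + \<tau> *\<^sub>R ((z - x) + 0 *\<^sub>R w)))"
   have "(k has_real_derivative ?D) (at \<tau>)"
    unfolding k_def by (rule weighted_mean_derivative[OF O f1 continuous_on_const sub' t])
   moreover have "\<bar>?D\<bar> \<le> (\<Sum>j\<in>(UNIV::3 set). C * s powr (1/2))"
   proof (rule order_trans[OF sum_abs sum_mono])
    fix j
    have "integral Q (\<lambda>w. (1 * ((z - x) + 0 *\<^sub>R w) $ j) * pd j f ((x + s *\<^sub>R w) + \<tau> *\<^sub>R ((z - x) + 0 *\<^sub>R w)))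
     = (z - x) $ j * ?I j"
     by (simp add: algebra_simps flip: integral_mult_right)
    moreover have "\<bar>(z - x) $ j\<bar> \<le> s" using component_le_norm_cart[of "z - x" j] by (simp add: s_def norm_minus_commute)
    moreover have "\<bar>?I j\<bar> \<le> C * s powr (- 1/2)"
     using pt[of \<tau>] t s by (intro G) auto
    ultimately have "\<bar>integral Q (\<lambda>w. (1 * ((z - x) + 0 *\<^sub>R w) $ j) * pd j f ((x + s *\<^sub>R w) + \<tau> *\<^sub>R ((z - x) + 0 *\<^sub>R w)))\<bar>
      \<le> s * (C * s powr (- 1/2))" using s by (simp only: abs_mult) (intro mult_mono, auto)
    also have "\<dots> = C * s powr (1/2)" using s powr_mult_base[of s "- 1/2"] by (simp add: mult_ac)
    finally show "\<bar>integral Q (\<lambda>w. (1 * ((z - x) + 0 *\<^sub>R w) $ j) * pd j f ((x + s *\<^sub>R w) + \<tau> *\<^sub>R ((z - x) + 0 *\<^sub>R w)))\<bar>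
      \<le> C * s powr (1/2)" .
   qed
   ultimately show ?thesis by fastforce
  qed
  have "continuous_on ({0..1} \<times> Q) (\<lambda>p. 1 * f ((x + s *\<^sub>R snd p) + fst p *\<^sub>R ((z - x) + 0 *\<^sub>R snd p)))"
   by (intro continuous_on_mult continuous_on_const continuous_on_compose2[OF Ck_on_continuous[OF f]])
    (use sub' in \<open>auto intro!: continuous_intros\<close>)
  then have "continuous_on ({0..1} \<times> Q) (\<lambda>(\<tau>, w). 1 * f ((x + s *\<^sub>R w) + \<tau> *\<^sub>R ((z - x) + 0 *\<^sub>R w)))"
   by (simp add: case_prod_unfold)
  then have kc: "continuous_on {0..1} k" unfolding k_def by (rule integral_continuous_on_param)
  define c where "c = 3 * C * s powr (1/2)"
  have lc: "continuous_on {0..1} (\<lambda>\<tau>. c * \<tau>)" by (intro continuous_intros)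
  have ld: "((\<lambda>\<tau>. c * \<tau>) has_real_derivative c) (at \<tau>)" for \<tau> by (auto intro!: derivative_eq_intros)
  have "k 1 - c * 1 \<le> k 0 - c * 0"
  proof (rule DERIV_nonpos_imp_decreasing_open[where f = "\<lambda>r. k r - c * r" and a = 0 and b = 1])
   fix r :: real assume r: "0 < r" "r < 1"
   then obtain D where D: "(k has_real_derivative D) (at r)" "\<bar>D\<bar> \<le> c" using d c_def by blast
   show "\<exists>y. ((\<lambda>r. k r - c * r) has_real_derivative y) (at r) \<and> y \<le> 0"
    by (rule exI, rule conjI, rule DERIV_diff[OF D(1) ld]) (use D(2) in linarith)
  qed (auto intro: continuous_on_diff[OF kc lc])
  moreover have "k 0 + c * 0 \<le> k 1 + c * 1"
  proof (rule DERIV_nonneg_imp_increasing_open[where f = "\<lambda>r. k r + c * r" and a = 0 and b = 1])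
   fix r :: real assume r: "0 < r" "r < 1"
   then obtain D where D: "(k has_real_derivative D) (at r)" "\<bar>D\<bar> \<le> c" using d c_def by blast
   show "\<exists>y. ((\<lambda>r. k r + c * r) has_real_derivative y) (at r) \<and> 0 \<le> y"
    by (rule exI, rule conjI, rule DERIV_add[OF D(1) ld]) (use D(2) in linarith)
  qed (auto intro: continuous_on_add[OF kc lc])
  moreover have "k 1 = m z s" "k 0 = m x s" by (simp_all add: k_def m_def algebra_simps)
  ultimately show ?thesis by (simp add: c_def abs_le_iff)
 qed
 then have "\<bar>8 * f x - 8 * f z\<bar> \<le> 15 * C * s powr (1/2)" using ms[OF x(1)] ms[OF x(2)] m0[of x] m0[of z] by linarith
 moreover have "0 \<le> C * s powr (1/2)" using C by simp
 ultimately have "\<bar>f x - f z\<bar> \<le> 2 * C * s powr (1/2)" by linarith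
 then show ?thesis by (simp add: C_def s_def)
qed simp

end

section \<open>The momentum equation in divergence form\<close>

locale mhd_flow =
 fixes \<mu> lam \<nu> \<gamma> a T :: real and \<Omega> :: "(real^3) set"
  and \<rho> :: "real \<Rightarrow> real^3 \<Rightarrow> real" and u H :: "real \<Rightarrow> real^3 \<Rightarrow> real^3"
 assumes O: "open \<Omega>" and rt: "C1_time \<Omega> \<rho>" and rx: "Ck_space 1 \<Omega> \<rho>"
  and ut: "C1_time \<Omega> u" and ux: "Ck_space 2 \<Omega> u" and Hx: "Ck_space 2 \<Omega> H"
  and eqs: "MHD_equations \<mu> lam \<nu> \<gamma> a \<Omega> \<rho> u H"
  and pos: "!!t x. 0 < t ==> t \<le> T ==> x \<in> \<Omega> ==> 0 < \<rho> t x"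
begin

lemma rC: "t > 0 ==> Ck_on (Suc 0) \<Omega> (\<rho> t)"
 using Ck_space_imp_Ck_on[OF rx] by simp

lemma uC: "t > 0 ==> Ck_on (Suc (Suc 0)) \<Omega> (u t)" and HC: "t > 0 ==> Ck_on (Suc (Suc 0)) \<Omega> (H t)"
 using Ck_space_imp_Ck_on[OF ux] Ck_space_imp_Ck_on[OF Hx] by (simp_all add: numeral_2_eq_2)

definition dtm :: "3 \<Rightarrow> real \<Rightarrow> real^3 \<Rightarrow> real" where
 "dtm i t x = dt \<rho> t x * u t x $ i + \<rho> t x * dt u t x $ i"

text \<open>The constant field \<open>h\<close> does not change the derivatives of the stress. It will be the value of the magnetic
  field at the singularity of the kernel, so that the magnetic part of the stress vanishes there.\<close>

definition stress :: "3 \<Rightarrow> 3 \<Rightarrow> real \<Rightarrow> real^3 \<Rightarrow> real^3 \<Rightarrow> real" where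
 "stress i j t h y = \<rho> t y * u t y $ j * u t y $ i - (H t y $ j * H t y $ i - h $ j * h $ i)
   - \<mu> * (pd j (u t) y $ i - pd i (u t) y $ j)"

text \<open>Up to sign this is the effective viscous flux. It is the only place where the divergence of the velocity
  enters the momentum equation.\<close>

definition eff_pressure :: "real \<Rightarrow> real^3 \<Rightarrow> real" where
 "eff_pressure t y = pressure a \<gamma> (\<rho> t y) + (\<Sum>k\<in>UNIV. H t y $ k * H t y $ k) / 2
   - (2 * \<mu> + lam) * (\<Sum>k\<in>UNIV. pd k (u t) y $ k)"

lemma time_derivatives:
 assumes "t > 0" "x \<in> \<Omega>"
 shows "((\<lambda>\<tau>. \<rho> \<tau> x) has_real_derivative dt \<rho> t x) (at t)" "((\<lambda>\<tau>. u \<tau> x) has_vector_derivative dt u t x) (at t)"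
 using rt ut assms
 by (auto simp: C1_time_def dt_def has_real_derivative_iff_has_vector_derivative vector_derivative_works)

lemma dtm_derivative:
 assumes "t > 0" "x \<in> \<Omega>"
 shows "((\<lambda>\<tau>. \<rho> \<tau> x * u \<tau> x $ i) has_real_derivative dtm i t x) (at t)"
  and "dt (\<lambda>\<tau> y. \<rho> \<tau> y *\<^sub>R u \<tau> y) t x $ i = dtm i t x"
proof -
 note D = time_derivatives[OF assms]
 have "((\<lambda>\<tau>. u \<tau> x $ i) has_real_derivative dt u t x $ i) (at t)"
  using bounded_linear.has_vector_derivative[OF bounded_linear_vec_nth D(2)]
  by (simp add: has_real_derivative_iff_has_vector_derivative)
 from DERIV_mult[OF D(1) this]
 show "((\<lambda>\<tau>. \<rho> \<tau> x * u \<tau> x $ i) has_real_derivative dtm i t x) (at t)"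
  by (rule DERIV_cong) (simp add: dtm_def algebra_simps)
 have "((\<lambda>\<tau>. \<rho> \<tau> x *\<^sub>R u \<tau> x) has_vector_derivative (\<rho> t x *\<^sub>R dt u t x + dt \<rho> t x *\<^sub>R u t x)) (at t)"
  by (rule has_vector_derivative_scaleR[OF D])
 then have "dt (\<lambda>\<tau> y. \<rho> \<tau> y *\<^sub>R u \<tau> y) t x = \<rho> t x *\<^sub>R dt u t x + dt \<rho> t x *\<^sub>R u t x"
  unfolding dt_def by (rule vector_derivative_at)
 then show "dt (\<lambda>\<tau> y. \<rho> \<tau> y *\<^sub>R u \<tau> y) t x $ i = dtm i t x" by (simp add: dtm_def)
qed

lemma spacetime_continuous:
 "continuous_on ({0<..} \<times> \<Omega>) (\<lambda>z. \<rho> (fst z) (snd z))" "continuous_on ({0<..} \<times> \<Omega>) (\<lambda>z. u (fst z) (snd z))"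
 "continuous_on ({0<..} \<times> \<Omega>) (\<lambda>z. dtm i (fst z) (snd z))"
proof -
 show r: "continuous_on ({0<..} \<times> \<Omega>) (\<lambda>z. \<rho> (fst z) (snd z))"
  using Ck_space_continuous[OF rx] by (simp add: case_prod_unfold)
 show u: "continuous_on ({0<..} \<times> \<Omega>) (\<lambda>z. u (fst z) (snd z))"
  using Ck_space_continuous[OF ux] by (simp add: case_prod_unfold)
 have "continuous_on ({0<..} \<times> \<Omega>) (\<lambda>z. dt \<rho> (fst z) (snd z))" "continuous_on ({0<..} \<times> \<Omega>) (\<lambda>z. dt u (fst z) (snd z))"
  using rt ut by (simp_all add: C1_time_def case_prod_unfold)
 then show "continuous_on ({0<..} \<times> \<Omega>) (\<lambda>z. dtm i (fst z) (snd z))"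
  unfolding dtm_def by (intro continuous_on_add continuous_on_mult continuous_on_component r u)
qed

lemma pressure_C1:
 assumes t: "0 < t" "t \<le> T"
 shows "Ck_on (Suc 0) \<Omega> (\<lambda>y. pressure a \<gamma> (\<rho> t y))"
proof (rule Ck_on_SucI)
 have D: "((\<lambda>s. pressure a \<gamma> s) has_real_derivative a * (\<gamma> * \<rho> t x powr (\<gamma> - 1))) (at (\<rho> t x))" if "x \<in> \<Omega>" for x
  unfolding pressure_def by (rule DERIV_cmult[OF has_real_derivative_powr[OF pos[OF t that]]])
 note d = Ck_on_differentiable[OF rC[OF t(1)]]
 show "(\<lambda>y. pressure a \<gamma> (\<rho> t y)) differentiable (at x)" if "x \<in> \<Omega>" for x by (rule pd_compose(2)[OF D d]) (use that in auto)
 fix i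
 have "continuous_on \<Omega> (\<lambda>x. a * (\<gamma> * \<rho> t x powr (\<gamma> - 1)) * pd i (\<rho> t) x)"
 proof (intro continuous_on_mult continuous_on_const continuous_on_powr)
  show "continuous_on \<Omega> (\<rho> t)" by (rule Ck_on_continuous[OF rC[OF t(1)]])
  show "continuous_on \<Omega> (pd i (\<rho> t))" by (rule Ck_on_continuous[OF Ck_on_pd[OF rC[OF t(1)]]])
  show "\<forall>x\<in>\<Omega>. \<rho> t x \<noteq> 0" using pos[OF t] by fastforce
 qed
 then have "continuous_on \<Omega> (pd i (\<lambda>y. pressure a \<gamma> (\<rho> t y)))"
  by (rule continuous_on_eq) (rule pd_compose(1)[OF D d, symmetric], auto)
 then show "Ck_on 0 \<Omega> (pd i (\<lambda>y. pressure a \<gamma> (\<rho> t y)))" by simp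
qed

lemma stress_C1:
 assumes t: "0 < t" shows "Ck_on (Suc 0) \<Omega> (stress i j t h)"
proof -
 note 1 = rC[OF t] Ck_on_Suc_D[OF uC[OF t]] Ck_on_Suc_D[OF HC[OF t]] Ck_on_pd[OF uC[OF t]]
 show ?thesis unfolding stress_def [abs_def]
  by (intro Ck_on_diff Ck_on_mult Ck_on_nth Ck_on_const O 1)
qed

lemma eff_pressure_C1:
 assumes t: "0 < t" "t \<le> T" shows "Ck_on (Suc 0) \<Omega> (eff_pressure t)"
proof -
 note 1 = Ck_on_Suc_D[OF HC[OF t(1)]] Ck_on_pd[OF uC[OF t(1)]] pressure_C1[OF t]
 show ?thesis unfolding eff_pressure_def [abs_def] divide_inverse
  by (intro Ck_on_diff Ck_on_add Ck_on_mult Ck_on_nth Ck_on_sum Ck_on_const O 1)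
qed

text \<open>Since \<open>div H = 0\<close>, the Lorentz force is a divergence; the viscous force splits into the divergence of an
  antisymmetric matrix and a gradient, by the symmetry of second derivatives.\<close>

lemma momentum_divergence_form:
 assumes t: "0 < t" "t \<le> T" and x: "x \<in> \<Omega>"
 shows "dtm i t x = - (\<Sum>j\<in>UNIV. pd j (stress i j t h) x) - pd i (eff_pressure t) x"
proof -
 note t0 = t(1)
 have rd: "\<rho> t differentiable (at x)" by (rule Ck_on_differentiable[OF rC[OF t0] x])
 have ud: "u t differentiable (at x)" by (rule Ck_on_differentiable[OF uC[OF t0] x])
 have Hd: "H t differentiable (at x)" by (rule Ck_on_differentiable[OF HC[OF t0] x])
 have upd: "pd j (u t) differentiable (at x)" for j by (rule Ck_on_differentiable[OF Ck_on_pd[OF uC[OF t0]] x])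
 have Pd: "(\<lambda>y. pressure a \<gamma> (\<rho> t y)) differentiable (at x)" by (rule Ck_on_differentiable[OF pressure_C1[OF t] x])
 have comp: "(\<lambda>y. v y $ j) differentiable (at x)" if "v differentiable (at x)" for v :: "real^3 \<Rightarrow> real^3" and j
  using bounded_linear.has_derivative[OF bounded_linear_vec_nth has_derivative_pd[OF that]] by (rule differentiableI)
 note uc = comp[OF ud] and Hc = comp[OF Hd] and upc = comp[OF upd]
 have HH: "(\<lambda>y. H t y $ j * H t y $ k) differentiable (at x)" for j k by (intro differentiable_mult Hc)
 have ruu: "(\<lambda>y. \<rho> t y * u t y $ j * u t y $ i) differentiable (at x)" for j by (intro differentiable_mult rd uc)
 have cd: "(\<lambda>y. c) differentiable (at x)" for c :: real by (rule differentiable_const)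
 define R where "R j = pd j (\<lambda>y. \<rho> t y * u t y $ j * u t y $ i) x" for j
 have pT: "pd j (stress i j t h) x = R j - (pd j (H t) x $ j * H t x $ i + H t x $ j * pd j (H t) x $ i)
   - \<mu> * (pd j (pd j (u t)) x $ i - pd j (pd i (u t)) x $ j)" for j
 proof -
  have 1: "(\<lambda>y. H t y $ j * H t y $ i - h $ j * h $ i) differentiable (at x)"
   "(\<lambda>y. pd j (u t) y $ i - pd i (u t) y $ j) differentiable (at x)"
   by (intro differentiable_diff HH cd upc)+
  have 2: "(\<lambda>y. \<mu> * (pd j (u t) y $ i - pd i (u t) y $ j)) differentiable (at x)" by (intro differentiable_mult cd 1)
  have 3: "(\<lambda>y. \<rho> t y * u t y $ j * u t y $ i - (H t y $ j * H t y $ i - h $ j * h $ i)) differentiable (at x)"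
   by (intro differentiable_diff ruu 1)
  show ?thesis unfolding stress_def [abs_def] R_def
   by (simp add: pd_diff[OF 3 2] pd_diff[OF ruu 1(1)] pd_diff[OF HH cd] pd_mult[OF Hc Hc] pd_nth[OF Hd] pd_cmul[OF 1(2)]
     pd_diff[OF upc upc] pd_nth[OF upd])
 qed
 have pP: "pd i (eff_pressure t) x = pd i (\<lambda>y. pressure a \<gamma> (\<rho> t y)) x + (\<Sum>k\<in>UNIV. pd i (H t) x $ k * H t x $ k)
   - (2 * \<mu> + lam) * (\<Sum>k\<in>UNIV. pd i (pd k (u t)) x $ k)"
 proof -
  have 1: "(\<lambda>y. \<Sum>k\<in>UNIV. H t y $ k * H t y $ k) differentiable (at x)" "(\<lambda>y. \<Sum>k\<in>UNIV. pd k (u t) y $ k) differentiable (at x)"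
   by (intro differentiable_sum HH upc ballI, simp)+
  have 2: "(\<lambda>y. (1/2) * (\<Sum>k\<in>UNIV. H t y $ k * H t y $ k)) differentiable (at x)"
   "(\<lambda>y. (2 * \<mu> + lam) * (\<Sum>k\<in>UNIV. pd k (u t) y $ k)) differentiable (at x)" by (intro differentiable_mult cd 1)+
  have 3: "(\<lambda>y. pressure a \<gamma> (\<rho> t y) + (1/2) * (\<Sum>k\<in>UNIV. H t y $ k * H t y $ k)) differentiable (at x)"
   by (intro differentiable_add Pd 2)
  have e: "eff_pressure t = (\<lambda>y. pressure a \<gamma> (\<rho> t y) + (1/2) * (\<Sum>k\<in>UNIV. H t y $ k * H t y $ k)
   - (2 * \<mu> + lam) * (\<Sum>k\<in>UNIV. pd k (u t) y $ k))" by (simp add: eff_pressure_def fun_eq_iff)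
  have h: "pd i (\<lambda>y. \<Sum>k\<in>UNIV. H t y $ k * H t y $ k) x = 2 * (\<Sum>k\<in>UNIV. pd i (H t) x $ k * H t x $ k)"
   by (simp add: pd_sum[OF HH] pd_mult[OF Hc Hc] pd_nth[OF Hd] sum_distrib_left mult_ac)
  have k: "pd i (\<lambda>y. \<Sum>k\<in>UNIV. pd k (u t) y $ k) x = (\<Sum>k\<in>UNIV. pd i (pd k (u t)) x $ k)"
   by (simp add: pd_sum[OF upc] pd_nth[OF upd])
  show ?thesis unfolding e pd_diff[OF 3 2(2)] pd_add[OF Pd 2(1)] pd_cmul[OF 1(1)] pd_cmul[OF 1(2)] h k by simp
 qed
 have E: "dt (\<lambda>\<tau> y. \<rho> \<tau> y *\<^sub>R u \<tau> y) t x $ i + (\<Sum>j\<in>UNIV. pd j (\<lambda>y. (\<rho> t y * u t y $ j) *\<^sub>R u t y) x) $ i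
   + grad (\<lambda>y. pressure a \<gamma> (\<rho> t y)) x $ i
  = \<mu> * laplacian (u t) x $ i + (\<mu> + lam) * grad (divergence (u t)) x $ i + cross3 (curl (H t) x) (H t x) $ i"
 proof -
  have "dt (\<lambda>\<tau> y. \<rho> \<tau> y *\<^sub>R u \<tau> y) t x + (\<Sum>j\<in>UNIV. pd j (\<lambda>y. (\<rho> t y * u t y $ j) *\<^sub>R u t y) x)
   + grad (\<lambda>y. pressure a \<gamma> (\<rho> t y)) x
  = \<mu> *\<^sub>R laplacian (u t) x + (\<mu> + lam) *\<^sub>R grad (divergence (u t)) x + cross3 (curl (H t) x) (H t x)"
   using eqs t0 x by (simp add: MHD_equations_def)
  from arg_cong[OF this, of "\<lambda>w. w $ i"] show ?thesis by (simp only: vector_add_component vector_scaleR_component real_scaleR_def)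
 qed
 have e1: "(\<Sum>j\<in>UNIV. pd j (\<lambda>y. (\<rho> t y * u t y $ j) *\<^sub>R u t y) x) $ i = (\<Sum>j\<in>UNIV. R j)"
 proof -
  have "(\<lambda>y. (\<rho> t y * u t y $ j) *\<^sub>R u t y) differentiable (at x)" for j by (intro differentiable_scaleR differentiable_mult rd uc ud)
  from pd_nth[OF this] show ?thesis by (simp add: R_def flip: pd_nth)
 qed
 have e2: "laplacian (u t) x $ i = (\<Sum>j\<in>UNIV. pd j (pd j (u t)) x $ i)" by (simp add: laplacian_def)
 have e3: "grad (divergence (u t)) x $ i = (\<Sum>k\<in>UNIV. pd i (pd k (u t)) x $ k)"
 proof -
  have "divergence (u t) = (\<lambda>y. \<Sum>k\<in>UNIV. pd k (u t) y $ k)" by (simp add: divergence_def div_of_def fun_eq_iff)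
  then show ?thesis by (simp add: grad_nth pd_sum[OF upc] pd_nth[OF upd])
 qed
 have e4: "cross3 (curl (H t) x) (H t x) $ i = (\<Sum>j\<in>UNIV. H t x $ j * pd j (H t) x $ i) - (\<Sum>j\<in>UNIV. pd i (H t) x $ j * H t x $ j)"
  using exhaust_3[of i] by (auto simp: cross3_def curl_def curl_of_def sum_3 algebra_simps)
 have e5: "(\<Sum>j\<in>UNIV. pd j (H t) x $ j * H t x $ i) = 0"
 proof -
  have "(\<Sum>j\<in>UNIV. pd j (H t) x $ j) = 0" using eqs t0 x by (simp add: MHD_equations_def divergence_def div_of_def)
  then show ?thesis by (simp flip: sum_distrib_right)
 qed
 have e6: "pd j (pd i (u t)) x $ j = pd i (pd j (u t)) x $ j" for j
  using pd_commute[OF O x, of "u t" j i] uC[OF t0] by (simp add: numeral_2_eq_2)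
 have e3': "pd i (divergence (u t)) x = (\<Sum>k\<in>UNIV. pd i (pd k (u t)) x $ k)" using e3 by (simp only: grad_nth)
 have sT: "(\<Sum>j\<in>UNIV. pd j (stress i j t h) x) = (\<Sum>j\<in>UNIV. R j)
   - ((\<Sum>j\<in>UNIV. pd j (H t) x $ j * H t x $ i) + (\<Sum>j\<in>UNIV. H t x $ j * pd j (H t) x $ i))
   - \<mu> * ((\<Sum>j\<in>UNIV. pd j (pd j (u t)) x $ i) - (\<Sum>j\<in>UNIV. pd i (pd j (u t)) x $ j))"
  by (simp only: pT e6 sum.distrib sum_subtractf sum_distrib_left[symmetric])
 have E': "dtm i t x + (\<Sum>j\<in>UNIV. R j) + pd i (\<lambda>y. pressure a \<gamma> (\<rho> t y)) x
  = \<mu> * (\<Sum>j\<in>UNIV. pd j (pd j (u t)) x $ i) + (\<mu> + lam) * (\<Sum>k\<in>UNIV. pd i (pd k (u t)) x $ k)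
   + ((\<Sum>j\<in>UNIV. H t x $ j * pd j (H t) x $ i) - (\<Sum>j\<in>UNIV. pd i (H t) x $ j * H t x $ j))"
  using E by (simp only: grad_nth dtm_derivative(2)[OF t0 x] e1 e2 e3' e4)
 show ?thesis unfolding sT pP e5 using E' by (simp only: ring_distribs)
qed

end

section \<open>The potential of the momentum\<close>

locale mhd_flow_cutoff = mhd_flow +
 fixes cut :: "real^3 \<Rightarrow> real" and A B :: "real^3"
 assumes cutC: "Ck_on (Suc 0) UNIV cut" and cut0: "!!y. y \<notin> cbox A B ==> cut y = 0" and S\<Omega>: "cbox A B \<subseteq> \<Omega>"
begin

abbreviation "S \<equiv> cbox A B"

text \<open>Up to a constant factor, the inverse Laplacian of the divergence of the localised momentum.\<close>

definition momentum_potential :: "real \<Rightarrow> real \<Rightarrow> real^3 \<Rightarrow> real" where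
 "momentum_potential d t x = (\<Sum>i\<in>UNIV. integral S (\<lambda>y. (cut y * (\<rho> t y * u t y $ i)) * kern d i (x - y)))"

text \<open>The integrand of the derivative of the potential at \<open>(t, x)\<close> in the direction \<open>(1, v)\<close>, after the spatial
  derivatives in the momentum equation have been moved to the kernel.\<close>

definition flux_density :: "real \<Rightarrow> real \<Rightarrow> real^3 \<Rightarrow> real^3 \<Rightarrow> real^3 \<Rightarrow> 3 \<Rightarrow> real^3 \<Rightarrow> real" where
 "flux_density d t x v h i y =
   (\<Sum>j\<in>UNIV. stress i j t h y * (pd j cut y * kern d i (x - y) - cut y * kern' d i j (x - y)))
   + eff_pressure t y * (pd i cut y * kern d i (x - y) - cut y * kern' d i i (x - y))
   + (cut y * (\<rho> t y * u t y $ i)) * (\<Sum>j\<in>UNIV. v $ j * kern' d i j (x - y))"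

lemma kern_shift_derivative:
 assumes d: "d > 0"
 shows "((\<lambda>s. kern d i (x + s *\<^sub>R v - y)) has_real_derivative (\<Sum>j\<in>UNIV. v $ j * kern' d i j (x + s *\<^sub>R v - y))) (at s)"
proof -
 have "((\<lambda>s. kern d i (x - (y + s *\<^sub>R (- v)))) has_vector_derivative
   (\<Sum>j\<in>UNIV. ((- v) $ j) *\<^sub>R pd j (\<lambda>y. kern d i (x - y)) (y + s *\<^sub>R (- v)))) (at s)"
  by (rule has_vector_derivative_along_line) (rule differentiableI[OF kern_derivative[OF d]])
 then show ?thesis
  by (simp add: pd_kern[OF d] has_real_derivative_iff_has_vector_derivative algebra_simps)
qed

lemma potential_derivative_parts:
 assumes d: "d > 0" and t: "0 < t" "t \<le> T"
 shows "((\<lambda>y. cut y * dtm i t y * kern d i (x - y)) has_integral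
  integral S (\<lambda>y. (\<Sum>j\<in>UNIV. stress i j t h y * (pd j cut y * kern d i (x - y) - cut y * kern' d i j (x - y)))
   + eff_pressure t y * (pd i cut y * kern d i (x - y) - cut y * kern' d i i (x - y)))) S"
proof -
 let ?h = "\<lambda>y. cut y * kern d i (x - y)"
 have hC: "Ck_on (Suc 0) \<Omega> ?h"
  by (rule Ck_on_mult[OF O Ck_on_subset[OF subset_UNIV cutC] Ck_on_kern[OF d]])
 have ph: "pd j ?h y = pd j cut y * kern d i (x - y) - cut y * kern' d i j (x - y)" for j y
 proof -
  have "cut differentiable (at y)" by (rule Ck_on_differentiable[OF cutC]) simp
  moreover have "(\<lambda>y. kern d i (x - y)) differentiable (at y)" by (rule differentiableI[OF kern_derivative[OF d]])
  ultimately show ?thesis by (simp add: pd_mult pd_kern[OF d])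
 qed
 have ibp: "((\<lambda>y. pd j f y * ?h y) has_integral - integral S (\<lambda>y. f y * pd j ?h y)) S"
   "(\<lambda>y. f y * pd j ?h y) integrable_on S" if f: "Ck_on (Suc 0) \<Omega> f" for f j
 proof -
  have C: "Ck_on 1 \<Omega> f" "Ck_on 1 \<Omega> ?h" using f hC by simp_all
  have z: "?h y = 0" if "y \<in> \<Omega> - S" for y using cut0[of y] that by simp
  have P: "integral S (\<lambda>y. pd j f y * ?h y) = - integral S (\<lambda>y. f y * pd j ?h y)"
   "(\<lambda>y. pd j f y * ?h y) integrable_on S" "(\<lambda>y. f y * pd j ?h y) integrable_on S"
   by (rule integral_by_parts[OF O compact_cbox order_refl S\<Omega> C], erule z)+
  show "((\<lambda>y. pd j f y * ?h y) has_integral - integral S (\<lambda>y. f y * pd j ?h y)) S"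
   using integrable_integral[OF P(2)] unfolding P(1) .
  show "(\<lambda>y. f y * pd j ?h y) integrable_on S" by (rule P(3))
 qed
 note 1 = ibp[OF stress_C1[OF t(1)]] and 2 = ibp[OF eff_pressure_C1[OF t]]
 have "((\<lambda>y. - (\<Sum>j\<in>UNIV. pd j (stress i j t h) y * ?h y) - pd i (eff_pressure t) y * ?h y) has_integral
   - (\<Sum>j\<in>UNIV. - integral S (\<lambda>y. stress i j t h y * pd j ?h y)) - - integral S (\<lambda>y. eff_pressure t y * pd i ?h y)) S"
  by (intro has_integral_diff has_integral_neg has_integral_sum 1 2) simp
 moreover have "- (\<Sum>j\<in>UNIV. - integral S (\<lambda>y. stress i j t h y * pd j ?h y)) - - integral S (\<lambda>y. eff_pressure t y * pd i ?h y)
   = integral S (\<lambda>y. (\<Sum>j\<in>UNIV. stress i j t h y * pd j ?h y) + eff_pressure t y * pd i ?h y)"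
  using 1(2) 2(2)
  by (simp add: Henstock_Kurzweil_Integration.integral_add integrable_sum Henstock_Kurzweil_Integration.integral_sum sum_negf)
 ultimately have "((\<lambda>y. - (\<Sum>j\<in>UNIV. pd j (stress i j t h) y * ?h y) - pd i (eff_pressure t) y * ?h y) has_integral
   integral S (\<lambda>y. (\<Sum>j\<in>UNIV. stress i j t h y * pd j ?h y) + eff_pressure t y * pd i ?h y)) S" by (simp only:)
 then have "((\<lambda>y. cut y * dtm i t y * kern d i (x - y)) has_integral
   integral S (\<lambda>y. (\<Sum>j\<in>UNIV. stress i j t h y * pd j ?h y) + eff_pressure t y * pd i ?h y)) S"
 proof (rule has_integral_eq[rotated])
  fix y assume "y \<in> S"
  then have "y \<in> \<Omega>" using S\<Omega> by blast
  note M = momentum_divergence_form[OF t this, of i h]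
  have alg: "- (p * (c * k)) - q * (c * k) = c * (- p - q) * k" for p q c k :: real by (simp add: algebra_simps)
  have "(\<Sum>j\<in>UNIV. pd j (stress i j t h) y * ?h y) = (\<Sum>j\<in>UNIV. pd j (stress i j t h) y) * ?h y"
   by (rule sum_distrib_right[symmetric])
  then show "- (\<Sum>j\<in>UNIV. pd j (stress i j t h) y * ?h y) - pd i (eff_pressure t) y * ?h y = cut y * dtm i t y * kern d i (x - y)"
   unfolding M by (simp only: alg)
 qed
 then show ?thesis by (simp only: ph)
qed

lemma momentum_potential_derivative:
 assumes d: "d > 0" and t: "0 < t" "t \<le> T"
 shows "((\<lambda>s. momentum_potential d (t + s) (x + s *\<^sub>R v)) has_real_derivative
  (\<Sum>i\<in>UNIV. integral S (flux_density d t x v h i))) (at 0)"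
  and "flux_density d t x v h i integrable_on S"
proof -
 have cutc: "continuous_on UNIV cut" by (rule Ck_on_continuous[OF cutC])
 let ?U = "{- (t/2)..t/2}"
 have main: "((\<lambda>s. integral S (\<lambda>y. (cut y * (\<rho> (t + s) y * u (t + s) y $ i)) * kern d i (x + s *\<^sub>R v - y)))
   has_real_derivative integral S (flux_density d t x v h i)) (at 0) \<and> flux_density d t x v h i integrable_on S" for i
 proof -
  let ?f = "\<lambda>s y. (cut y * (\<rho> (t + s) y * u (t + s) y $ i)) * kern d i (x + s *\<^sub>R v - y)"
  let ?D = "\<lambda>s y. cut y * dtm i (t + s) y * kern d i (x + s *\<^sub>R v - y)
    + (cut y * (\<rho> (t + s) y * u (t + s) y $ i)) * (\<Sum>j\<in>UNIV. v $ j * kern' d i j (x + s *\<^sub>R v - y))"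
  have sh: "continuous_on (?U \<times> S) (\<lambda>z. (t + fst z, snd z))" by (intro continuous_intros)
  have shs: "(\<lambda>z. (t + fst z, snd z)) ` (?U \<times> S) \<subseteq> {0<..} \<times> \<Omega>" using S\<Omega> t by auto
  have e: "continuous_on (?U \<times> S) (\<lambda>z. x + fst z *\<^sub>R v - snd z)" by (intro continuous_intros)
  have c1: "continuous_on (?U \<times> S) (\<lambda>z. kern d i (x + fst z *\<^sub>R v - snd z))"
   by (rule continuous_on_compose2[OF kern_continuous[OF d, of UNIV] e]) simp
  have c2: "continuous_on (?U \<times> S) (\<lambda>z. kern' d i j (x + fst z *\<^sub>R v - snd z))" for j
   by (rule continuous_on_compose2[OF kern'_continuous[OF d, of UNIV] e]) simp
  have c3: "continuous_on (?U \<times> S) (\<lambda>z. cut (snd z))"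
   by (rule continuous_on_compose2[OF cutc]) (auto intro!: continuous_intros)
  have c4: "continuous_on (?U \<times> S) (\<lambda>z. \<rho> (t + fst z) (snd z))"
   using continuous_on_compose2[OF spacetime_continuous(1) sh shs] by simp
  have c5: "continuous_on (?U \<times> S) (\<lambda>z. u (t + fst z) (snd z))"
   using continuous_on_compose2[OF spacetime_continuous(2) sh shs] by simp
  have c6: "continuous_on (?U \<times> S) (\<lambda>z. dtm i (t + fst z) (snd z))"
   using continuous_on_compose2[OF spacetime_continuous(3) sh shs] by simp
  have slice: "continuous_on S (\<lambda>y. F (s, y))" if "continuous_on (?U \<times> S) F" "s \<in> ?U" for F :: "real \<times> (real^3) \<Rightarrow> real" and s
   by (rule continuous_on_compose2[OF that(1)]) (use that(2) in \<open>auto intro!: continuous_intros\<close>)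
  have fc: "continuous_on (?U \<times> S) (\<lambda>z. ?f (fst z) (snd z))"
   by (intro continuous_on_mult continuous_on_component c1 c3 c4 c5)
  have Dc2: "continuous_on (?U \<times> S) (\<lambda>z. (cut (snd z) * (\<rho> (t + fst z) (snd z) * u (t + fst z) (snd z) $ i))
    * (\<Sum>j\<in>UNIV. v $ j * kern' d i j (x + fst z *\<^sub>R v - snd z)))"
   by (intro continuous_on_mult continuous_on_component continuous_on_sum continuous_on_const c2 c3 c4 c5)
  have Dc: "continuous_on (?U \<times> S) (\<lambda>z. ?D (fst z) (snd z))"
   by (intro continuous_on_add Dc2 continuous_on_mult c1 c3 c6)
  have "((\<lambda>s. integral S (?f s)) has_vector_derivative integral S (?D 0)) (at 0 within ?U)"
  proof (rule leibniz_rule_vector_derivative)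
   fix s y assume s: "s \<in> ?U" "y \<in> S"
   have ts: "t + s > 0" "y \<in> \<Omega>" using s t S\<Omega> by auto
   have "((\<lambda>s. \<rho> (t + s) y * u (t + s) y $ i) has_real_derivative dtm i (t + s) y * 1) (at s)"
    by (rule DERIV_chain2[where f = "\<lambda>\<tau>. \<rho> \<tau> y * u \<tau> y $ i" and g = "\<lambda>s. t + s", OF dtm_derivative(1)[OF ts]])
     (auto intro!: derivative_eq_intros)
   from DERIV_mult[OF DERIV_cmult[OF this, of "cut y"] kern_shift_derivative[OF d, of i x v y s]]
   have "((\<lambda>s. ?f s y) has_real_derivative ?D s y) (at s)" by (rule DERIV_cong) (simp add: algebra_simps)
   then show "((\<lambda>s. ?f s y) has_vector_derivative ?D s y) (at s within ?U)"
    by (simp add: has_real_derivative_iff_has_vector_derivative has_vector_derivative_at_within)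
  next
   fix s assume "s \<in> ?U"
   from slice[OF fc this] show "?f s integrable_on S" by (intro integrable_continuous) simp
  next
   show "continuous_on (?U \<times> S) (\<lambda>(s, y). ?D s y)" using Dc by (simp add: case_prod_unfold)
  qed (use t in auto)
  then have der: "((\<lambda>s. integral S (?f s)) has_real_derivative integral S (?D 0)) (at 0)"
   using t by (simp add: has_real_derivative_iff_has_vector_derivative at_within_Icc_at)
  let ?G1 = "\<lambda>y. (\<Sum>j\<in>UNIV. stress i j t h y * (pd j cut y * kern d i (x - y) - cut y * kern' d i j (x - y)))
    + eff_pressure t y * (pd i cut y * kern d i (x - y) - cut y * kern' d i i (x - y))"
  let ?G2 = "\<lambda>y. (cut y * (\<rho> t y * u t y $ i)) * (\<Sum>j\<in>UNIV. v $ j * kern' d i j (x - y))"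
  have i2: "?G2 integrable_on S" using slice[OF Dc2, of 0] t by (intro integrable_continuous) simp
  have i1: "?G1 integrable_on S"
  proof (rule integrable_continuous)
   have k: "continuous_on S (\<lambda>y. kern d i (x - y))" "continuous_on S (\<lambda>y. kern' d i j (x - y))" for j
    using slice[OF c1, of 0] slice[OF c2, of 0] t by simp_all
   have p: "continuous_on S (pd j cut)" "continuous_on S cut" for j
    using continuous_on_subset[OF Ck_on_continuous[OF Ck_on_pd[OF cutC]]] continuous_on_subset[OF cutc] by auto
   have q: "continuous_on S (stress i j t h)" "continuous_on S (eff_pressure t)" for j
    using continuous_on_subset[OF Ck_on_continuous[OF stress_C1[OF t(1)]] S\<Omega>]
     continuous_on_subset[OF Ck_on_continuous[OF eff_pressure_C1[OF t]] S\<Omega>] by auto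
   show "continuous_on S ?G1" by (intro continuous_on_add continuous_on_sum continuous_on_mult continuous_on_diff k p q)
  qed
  have "integral S (?D 0) = integral S ?G1 + integral S ?G2"
  proof (rule integral_unique)
   have "(?D 0 has_integral integral S ?G1 + integral S ?G2) S"
    using has_integral_add[OF potential_derivative_parts[OF d t, of i x h] integrable_integral[OF i2]] by simp
   then show "(?D 0 has_integral integral S ?G1 + integral S ?G2) S" .
  qed
  also have "\<dots> = integral S (flux_density d t x v h i)"
   unfolding flux_density_def [abs_def] by (rule Henstock_Kurzweil_Integration.integral_add[OF i1 i2, symmetric])
  finally show ?thesis
   using der integrable_add[OF i1 i2] unfolding flux_density_def [abs_def] by simp
 qed
 show "((\<lambda>s. momentum_potential d (t + s) (x + s *\<^sub>R v)) has_real_derivative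
  (\<Sum>i\<in>UNIV. integral S (flux_density d t x v h i))) (at 0)"
  unfolding momentum_potential_def by (rule DERIV_sum) (use main in blast)
 show "flux_density d t x v h i integrable_on S" using main by blast
qed

end

context mhd_flow_cutoff
begin

text \<open>For \<open>v = u t x\<close> the convective part becomes the difference of the velocities at \<open>x\<close> and \<open>y\<close>. The
  antisymmetric viscous part drops out against the symmetric matrix \<open>kern'\<close>.\<close>

lemma sum_flux_density:
 shows "(\<Sum>i\<in>UNIV. flux_density d t x v h i y) =
  (\<Sum>i\<in>UNIV. (\<Sum>j\<in>UNIV. stress i j t h y * (pd j cut y * kern d i (x - y))) + eff_pressure t y * (pd i cut y * kern d i (x - y)))
  + cut y * (\<Sum>i\<in>UNIV. \<Sum>j\<in>UNIV. kern' d i j (x - y) *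
    (\<rho> t y * u t y $ i * (v $ j - u t y $ j) + (H t y $ j * H t y $ i - h $ j * h $ i)))
  - cut y * (\<Sum>i\<in>UNIV. kern' d i i (x - y)) * (pressure a \<gamma> (\<rho> t y) + (\<Sum>k\<in>UNIV. H t y $ k * H t y $ k) / 2)
  + (2 * \<mu> + lam) * (cut y * (\<Sum>i\<in>UNIV. kern' d i i (x - y)) * (\<Sum>k\<in>UNIV. pd k (u t) y $ k))"
proof -
 define k' where "k' i j = kern' d i j (x - y)" for i j
 define k where "k i = kern d i (x - y)" for i
 have sym: "k' 2 1 = k' 1 2" "k' 3 1 = k' 1 3" "k' 3 2 = k' 2 3" unfolding k'_def by (rule kern'_commute)+
 have b: "(\<Sum>i\<in>UNIV. \<Sum>j\<in>UNIV. k' i j * (\<rho> t y * u t y $ i * v $ j - stress i j t h y)) =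
  (\<Sum>i\<in>UNIV. \<Sum>j\<in>UNIV. k' i j * (\<rho> t y * u t y $ i * (v $ j - u t y $ j) + (H t y $ j * H t y $ i - h $ j * h $ i)))"
  by (simp add: sum_3 stress_def sym algebra_simps)
 have c: "(\<Sum>i\<in>UNIV. flux_density d t x v h i y) =
  (\<Sum>i\<in>UNIV. (\<Sum>j\<in>UNIV. stress i j t h y * (pd j cut y * k i)) + eff_pressure t y * (pd i cut y * k i))
  + cut y * (\<Sum>i\<in>UNIV. \<Sum>j\<in>UNIV. k' i j * (\<rho> t y * u t y $ i * v $ j - stress i j t h y))
  - cut y * (\<Sum>i\<in>UNIV. k' i i) * eff_pressure t y"
  by (simp add: sum_3 flux_density_def k_def k'_def algebra_simps)
 show ?thesis
  unfolding c b unfolding k_def k'_def eff_pressure_def by (simp add: algebra_simps)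
qed

text \<open>The terms with derivatives of the cutoff see the kernel only away from its singularity, and the others are
  differences of values at \<open>x\<close> and \<open>y\<close>, whose Hoelder continuity makes the singularity integrable. The pressure
  enters with a favourable sign, so that the divergence of the velocity is the only term left to estimate.\<close>

lemma flux_estimate:
 assumes par: "\<mu> > 0" "a > 0" "\<gamma> > 1" and r: "r > 0" and nn: "Rm \<ge> 0" "V \<ge> 0" "K \<ge> 0" "G \<ge> 0"
  and cutb: "!!y. 0 \<le> cut y" "!!y. cut y \<le> 1" and G: "!!j y. \<bar>pd j cut y\<bar> \<le> G"
  and G0: "!!j y. norm (y - x0) < r ==> pd j cut y = 0"
 obtains C where "!!t x d. 0 < d ==> 0 < t ==> t \<le> T ==> norm (x - x0) \<le> r / 2 ==> norm (u t x) \<le> V ==> norm (H t x) \<le> V ==>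
   (!!y. y \<in> S ==> \<rho> t y \<le> Rm) ==> (!!y. y \<in> S ==> norm (u t y) \<le> V) ==> (!!y. y \<in> S ==> norm (H t y) \<le> V) ==>
   (!!i y. y \<in> S ==> \<bar>u t x $ i - u t y $ i\<bar> \<le> K * norm (x - y) powr (1/2)) ==>
   (!!i y. y \<in> S ==> \<bar>H t x $ i - H t y $ i\<bar> \<le> K * norm (x - y) powr (1/2)) ==>
   (!!i j. integral S (\<lambda>y. \<bar>pd j (u t) y $ i\<bar>) \<le> N) ==>
   (\<Sum>i\<in>UNIV. integral S (flux_density d t x (u t x) (H t x) i))
    \<le> C + (2 * \<mu> + lam) * integral S (\<lambda>y. cut y * (\<Sum>i\<in>UNIV. kern' d i i (x - y)) * (\<Sum>k\<in>UNIV. pd k (u t) y $ k))"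
proof -
 let ?\<kappa> = "2 * \<mu> + lam"
 obtain M where M: "!!x::real^3. (\<lambda>y. norm (x - y) powr (- (5/2))) integrable_on S"
  "!!x::real^3. integral S (\<lambda>y. norm (x - y) powr (- (5/2))) \<le> M"
  by (rule riesz_integral[of "5/2" A B]) (simp, simp, rule that)
 define G' where "G' = G * (5/2 * (r/2) powr (- 2))"
 have G': "G' \<ge> 0" using nn by (simp add: G'_def)
 define B0 where "B0 = Rm * V * V + 2 * (V * V)"
 define B1 where "B1 = a * Rm powr \<gamma> + V * V / 2"
 have B: "B0 \<ge> 0" "B1 \<ge> 0" using nn par by (simp_all add: B0_def B1_def)
 define A1 where "A1 = 9 * (B0 * G') + 3 * (B1 * G')"
 define A2 where "A2 = (9 * (2 * \<mu>) + 3 * \<bar>?\<kappa>\<bar>) * G'"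
 define A3 where "A3 = 9 * (11/2 * ((Rm * V + 2 * V) * K))"
 have A: "A2 \<ge> 0" "A3 \<ge> 0" using nn par G' by (auto simp: A2_def A3_def)
 define C where "C = A1 * measure lborel S + A2 * (9 * N) + A3 * M"
 have "(\<Sum>i\<in>UNIV. integral S (flux_density d t x (u t x) (H t x) i))
    \<le> C + ?\<kappa> * integral S (\<lambda>y. cut y * (\<Sum>i\<in>UNIV. kern' d i i (x - y)) * (\<Sum>k\<in>UNIV. pd k (u t) y $ k))"
  if d: "0 < d" and t: "0 < t" "t \<le> T" and x: "norm (x - x0) \<le> r / 2" and bx: "norm (u t x) \<le> V" "norm (H t x) \<le> V"
   and yb: "!!y. y \<in> S ==> \<rho> t y \<le> Rm" "!!y. y \<in> S ==> norm (u t y) \<le> V" "!!y. y \<in> S ==> norm (H t y) \<le> V"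
   and ho: "!!i y. y \<in> S ==> \<bar>u t x $ i - u t y $ i\<bar> \<le> K * norm (x - y) powr (1/2)"
    "!!i y. y \<in> S ==> \<bar>H t x $ i - H t y $ i\<bar> \<le> K * norm (x - y) powr (1/2)"
   and N: "!!i j. integral S (\<lambda>y. \<bar>pd j (u t) y $ i\<bar>) \<le> N"
  for t x d
 proof -
  let ?e = "\<lambda>y. cut y * (\<Sum>i\<in>UNIV. kern' d i i (x - y)) * (\<Sum>k\<in>UNIV. pd k (u t) y $ k)"
  define DD where "DD y = (\<Sum>j\<in>UNIV. \<Sum>i\<in>UNIV. \<bar>pd j (u t) y $ i\<bar>)" for y
  have uc: "continuous_on S (pd j (u t))" for j
   using continuous_on_subset[OF Ck_on_continuous[OF Ck_on_pd[OF uC[OF t(1)]]] S\<Omega>] .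
  have DDj: "(\<Sum>i\<in>UNIV. \<bar>pd j (u t) y $ i\<bar>) \<le> DD y" for j y
   unfolding DD_def by (rule member_le_sum) (auto intro: sum_nonneg)
  have DDij: "\<bar>pd j (u t) y $ i\<bar> \<le> DD y" for i j y
   using member_le_sum[of i UNIV "\<lambda>i. \<bar>pd j (u t) y $ i\<bar>"] DDj[of j y] by simp
  have divD: "\<bar>\<Sum>k\<in>UNIV. pd k (u t) y $ k\<bar> \<le> DD y" for y
  proof (rule order_trans[OF sum_abs])
   show "(\<Sum>k\<in>UNIV. \<bar>pd k (u t) y $ k\<bar>) \<le> DD y" unfolding DD_def
    by (rule sum_mono) (rule member_le_sum, auto)
  qed
  have ei: "?e integrable_on S"
  proof (rule integrable_continuous)
   have "continuous_on S (\<lambda>y. kern' d i i (x - y))" for i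
    by (rule continuous_on_compose2[OF kern'_continuous[OF d, of UNIV]]) (auto intro!: continuous_intros)
   moreover have "continuous_on S cut" using Ck_on_continuous[OF cutC] continuous_on_subset by blast
   ultimately show "continuous_on S ?e" by (intro continuous_on_mult continuous_on_sum continuous_on_component uc)
  qed
  have DI: "(\<lambda>y. \<bar>pd j (u t) y $ i\<bar>) integrable_on S" for i j
   by (intro integrable_continuous continuous_on_rabs continuous_on_component uc)
  have DDI: "DD integrable_on S" unfolding DD_def [abs_def] by (intro integrable_sum DI) auto
  have DDN: "integral S DD \<le> 9 * N"
  proof -
   have "integral S DD = (\<Sum>j\<in>UNIV. \<Sum>i\<in>UNIV. integral S (\<lambda>y. \<bar>pd j (u t) y $ i\<bar>))"
    unfolding DD_def [abs_def] by (simp add: Henstock_Kurzweil_Integration.integral_sum DI integrable_sum)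
   also have "\<dots> \<le> (\<Sum>j\<in>(UNIV::3 set). \<Sum>i\<in>(UNIV::3 set). N)" by (intro sum_mono N)
   finally show ?thesis by simp
  qed
  note FI = momentum_potential_derivative(2)[OF d t, where x = x and v = "u t x" and h = "H t x"]
  have FS: "(\<lambda>y. \<Sum>i\<in>UNIV. flux_density d t x (u t x) (H t x) i y) integrable_on S" by (intro integrable_sum FI) auto
  have pt: "(\<Sum>i\<in>UNIV. flux_density d t x (u t x) (H t x) i y) - ?\<kappa> * ?e y
    \<le> A1 + A2 * DD y + A3 * norm (x - y) powr (- (5/2))" if y: "y \<in> S" "y \<notin> {x}" for y
  proof -
   have yO: "y \<in> \<Omega>" using y S\<Omega> by blast
   have xy: "x - y \<noteq> 0" "norm (x - y) > 0" using y by auto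
   have rp: "0 \<le> \<rho> t y" "\<rho> t y \<le> Rm" using pos[OF t yO] yb(1)[OF y(1)] by auto
   have ub: "\<bar>u t y $ i\<bar> \<le> V" for i using component_le_norm_cart[of "u t y" i] yb(2)[OF y(1)] by linarith
   have Hb: "\<bar>H t y $ i\<bar> \<le> V" for i using component_le_norm_cart[of "H t y" i] yb(3)[OF y(1)] by linarith
   have hb: "\<bar>H t x $ i\<bar> \<le> V" for i using component_le_norm_cart[of "H t x" i] bx(2) by linarith
   have P: "0 \<le> pressure a \<gamma> (\<rho> t y)" "pressure a \<gamma> (\<rho> t y) \<le> a * Rm powr \<gamma>"
    unfolding pressure_def using par rp by (auto intro!: mult_left_mono powr_mono2)
   have HH: "0 \<le> (\<Sum>k\<in>UNIV. H t y $ k * H t y $ k)" "(\<Sum>k\<in>UNIV. H t y $ k * H t y $ k) \<le> V * V"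
   proof -
    show "0 \<le> (\<Sum>k\<in>UNIV. H t y $ k * H t y $ k)" by (intro sum_nonneg) simp
    have "(\<Sum>k\<in>UNIV. H t y $ k * H t y $ k) = norm (H t y) * norm (H t y)"
     using dot_square_norm[of "H t y"] by (simp add: inner_vec_def power2_eq_square)
    also have "\<dots> \<le> V * V" using yb(3)[OF y(1)] nn by (intro mult_mono) auto
    finally show "(\<Sum>k\<in>UNIV. H t y $ k * H t y $ k) \<le> V * V" .
   qed
   have Xk: "\<bar>pd j cut y * kern d i (x - y)\<bar> \<le> G'" for i j
   proof (cases "norm (y - x0) < r")
    case True
    then show ?thesis using G0[OF True] G' by simp
   next
    case False
    have "norm (y - x0) \<le> norm (x - y) + norm (x - x0)"
     using norm_triangle_ineq4[of "x - x0" "x - y"] by (simp add: algebra_simps)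
    then have "r / 2 \<le> norm (x - y)" using False x by linarith
    then have "norm (x - y) powr (- 2) \<le> (r/2) powr (- 2)" using r by (intro powr_mono2') auto
    then have "\<bar>kern d i (x - y)\<bar> \<le> 5/2 * (r/2) powr (- 2)" using kern_bounds(1)[OF d xy(1), of i] by linarith
    then show ?thesis unfolding G'_def abs_mult using G nn by (intro mult_mono) auto
   qed
   have st: "\<bar>stress i j t (H t x) y\<bar> \<le> B0 + 2 * \<mu> * DD y" for i j
   proof -
    have 1: "\<bar>\<rho> t y * u t y $ j * u t y $ i\<bar> \<le> Rm * V * V"
     unfolding abs_mult using rp ub nn by (intro mult_mono) auto
    have 2: "\<bar>H t y $ j * H t y $ i\<bar> \<le> V * V" "\<bar>H t x $ j * H t x $ i\<bar> \<le> V * V"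
     unfolding abs_mult using Hb hb nn by (intro mult_mono; simp)+
    have "\<bar>pd j (u t) y $ i - pd i (u t) y $ j\<bar> \<le> 2 * DD y" using DDij[of j y i] DDij[of i y j] by linarith
    then have "\<mu> * \<bar>pd j (u t) y $ i - pd i (u t) y $ j\<bar> \<le> \<mu> * (2 * DD y)" using par by (intro mult_left_mono) auto
    then have 3: "\<bar>\<mu> * (pd j (u t) y $ i - pd i (u t) y $ j)\<bar> \<le> 2 * \<mu> * DD y" using par by (simp add: abs_mult)
    show ?thesis unfolding stress_def B0_def using 1 2 3 by linarith
   qed
   have ep: "\<bar>eff_pressure t y\<bar> \<le> B1 + \<bar>?\<kappa>\<bar> * DD y"
   proof -
    have "\<bar>?\<kappa> * (\<Sum>k\<in>UNIV. pd k (u t) y $ k)\<bar> \<le> \<bar>?\<kappa>\<bar> * DD y" unfolding abs_mult by (intro mult_left_mono divD) auto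
    then show ?thesis unfolding eff_pressure_def B1_def using P HH by linarith
   qed
   have DD0: "0 \<le> DD y" using DDij[of undefined y undefined] by linarith
   have I: "(\<Sum>i\<in>UNIV. (\<Sum>j\<in>UNIV. stress i j t (H t x) y * (pd j cut y * kern d i (x - y))) + eff_pressure t y * (pd i cut y * kern d i (x - y)))
     \<le> A1 + A2 * DD y"
   proof -
    have m: "p * q \<le> p' * G'" if "\<bar>p\<bar> \<le> p'" "\<bar>q\<bar> \<le> G'" for p q p'
    proof -
     have "p * q \<le> \<bar>p\<bar> * \<bar>q\<bar>" by (simp flip: abs_mult)
     also have "\<dots> \<le> p' * G'" using that by (intro mult_mono) auto
     finally show ?thesis .
    qed
    have "(\<Sum>i\<in>UNIV. (\<Sum>j\<in>UNIV. stress i j t (H t x) y * (pd j cut y * kern d i (x - y))) + eff_pressure t y * (pd i cut y * kern d i (x - y)))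
     \<le> (\<Sum>i\<in>(UNIV::3 set). (\<Sum>j\<in>(UNIV::3 set). (B0 + 2 * \<mu> * DD y) * G') + (B1 + \<bar>?\<kappa>\<bar> * DD y) * G')"
     by (intro sum_mono add_mono m st ep Xk)
    also have "\<dots> = A1 + A2 * DD y" by (simp add: A1_def A2_def algebra_simps)
    finally show ?thesis .
   qed
   have br: "\<bar>kern' d i j (x - y) * (\<rho> t y * u t y $ i * (u t x $ j - u t y $ j) + (H t y $ j * H t y $ i - H t x $ j * H t x $ i))\<bar>
     \<le> 11/2 * ((Rm * V + 2 * V) * K) * norm (x - y) powr (- (5/2))" for i j
   proof -
    let ?q = "K * norm (x - y) powr (1/2)"
    have q: "?q \<ge> 0" using nn by simp
    have 1: "\<bar>\<rho> t y * u t y $ i * (u t x $ j - u t y $ j)\<bar> \<le> Rm * V * ?q"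
     unfolding abs_mult using rp ub nn ho(1)[OF y(1)] by (intro mult_mono) auto
    have 2: "\<bar>H t y $ j * (H t x $ i - H t y $ i)\<bar> \<le> V * ?q" "\<bar>(H t x $ j - H t y $ j) * H t x $ i\<bar> \<le> ?q * V"
     unfolding abs_mult using Hb hb nn ho(2)[OF y(1)] q by (intro mult_mono; simp)+
    have 3: "H t y $ j * H t y $ i - H t x $ j * H t x $ i
      = - (H t y $ j * (H t x $ i - H t y $ i)) - (H t x $ j - H t y $ j) * H t x $ i" by (simp add: algebra_simps)
    have "\<bar>\<rho> t y * u t y $ i * (u t x $ j - u t y $ j) + (H t y $ j * H t y $ i - H t x $ j * H t x $ i)\<bar>
      \<le> Rm * V * ?q + (V * ?q + ?q * V)" unfolding 3 using 1 2 by linarith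
    also have "\<dots> = (Rm * V + 2 * V) * K * norm (x - y) powr (1/2)" by (simp add: algebra_simps)
    finally have b: "\<bar>\<rho> t y * u t y $ i * (u t x $ j - u t y $ j) + (H t y $ j * H t y $ i - H t x $ j * H t x $ i)\<bar>
      \<le> (Rm * V + 2 * V) * K * norm (x - y) powr (1/2)" .
    have "\<bar>kern' d i j (x - y)\<bar> * \<bar>\<rho> t y * u t y $ i * (u t x $ j - u t y $ j) + (H t y $ j * H t y $ i - H t x $ j * H t x $ i)\<bar>
      \<le> (11/2 * norm (x - y) powr (- 3)) * ((Rm * V + 2 * V) * K * norm (x - y) powr (1/2))"
     by (intro mult_mono kern_bounds(2)[OF d xy(1)] b) auto
    also have "\<dots> = 11/2 * ((Rm * V + 2 * V) * K) * (norm (x - y) powr (- 3) * norm (x - y) powr (1/2))" by (simp only: mult_ac)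
    also have "norm (x - y) powr (- 3) * norm (x - y) powr (1/2) = norm (x - y) powr (- (5/2))"
     by (simp add: powr_add[symmetric])
    finally show ?thesis by (simp only: abs_mult)
   qed
   let ?S2 = "\<Sum>i\<in>UNIV. \<Sum>j\<in>UNIV. kern' d i j (x - y) * (\<rho> t y * u t y $ i * (u t x $ j - u t y $ j) + (H t y $ j * H t y $ i - H t x $ j * H t x $ i))"
   have II: "cut y * ?S2 \<le> A3 * norm (x - y) powr (- (5/2))"
   proof -
    have "\<bar>?S2\<bar> \<le> (\<Sum>i\<in>(UNIV::3 set). \<Sum>j\<in>(UNIV::3 set). 11/2 * ((Rm * V + 2 * V) * K) * norm (x - y) powr (- (5/2)))"
     by (rule order_trans[OF sum_abs sum_mono], rule order_trans[OF sum_abs sum_mono], rule br)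
    then have s: "\<bar>?S2\<bar> \<le> A3 * norm (x - y) powr (- (5/2))" by (simp add: A3_def)
    have "cut y * ?S2 \<le> \<bar>cut y * ?S2\<bar>" by simp
    also have "\<dots> \<le> 1 * \<bar>?S2\<bar>" unfolding abs_mult using cutb[of y] by (intro mult_right_mono) auto
    finally show ?thesis using s by linarith
   qed
   have "0 \<le> (\<Sum>i\<in>UNIV. kern' d i i (x - y))" unfolding kern'_trace[OF d] using d by (simp add: mollifier_nonneg)
   then have III: "0 \<le> cut y * (\<Sum>i\<in>UNIV. kern' d i i (x - y)) * (pressure a \<gamma> (\<rho> t y) + (\<Sum>k\<in>UNIV. H t y $ k * H t y $ k) / 2)"
    using cutb(1)[of y] P HH by (intro mult_nonneg_nonneg) auto
   show ?thesis unfolding sum_flux_density using I II III by linarith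
  qed
  have "integral S (\<lambda>y. (\<Sum>i\<in>UNIV. flux_density d t x (u t x) (H t x) i y) - ?\<kappa> * ?e y)
    \<le> integral S (\<lambda>y. A1 + A2 * DD y + A3 * norm (x - y) powr (- (5/2)))"
  proof (rule integral_le_off_finite[where F = "{x}"])
   show "(\<lambda>y. (\<Sum>i\<in>UNIV. flux_density d t x (u t x) (H t x) i y) - ?\<kappa> * ?e y) integrable_on S"
    by (intro integrable_diff FS integrable_on_mult_right ei)
   show "(\<lambda>y. A1 + A2 * DD y + A3 * norm (x - y) powr (- (5/2))) integrable_on S"
    by (intro integrable_add integrable_on_mult_right DDI M integrable_on_const) simp
  qed (use pt in auto)
  also have "\<dots> = A1 * measure lborel S + A2 * integral S DD + A3 * integral S (\<lambda>y. norm (x - y) powr (- (5/2)))"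
  proof (rule integral_unique, intro has_integral_add has_integral_mult_right integrable_integral DDI M)
   show "((\<lambda>y. A1) has_integral A1 * measure lborel S) S" using has_integral_const[of A1 A B] by (simp add: mult.commute)
  qed
  also have "\<dots> \<le> C" unfolding C_def using DDN M(2)[of x] A by (intro add_mono[OF add_mono[OF order_refl mult_left_mono] mult_left_mono]) auto
  finally have le: "integral S (\<lambda>y. (\<Sum>i\<in>UNIV. flux_density d t x (u t x) (H t x) i y) - ?\<kappa> * ?e y) \<le> C" .
  have "integral S (\<lambda>y. (\<Sum>i\<in>UNIV. flux_density d t x (u t x) (H t x) i y) - ?\<kappa> * ?e y)
   = (\<Sum>i\<in>UNIV. integral S (flux_density d t x (u t x) (H t x) i)) - ?\<kappa> * integral S ?e"
   by (rule integral_unique, intro has_integral_diff has_integral_sum has_integral_mult_right integrable_integral FI ei) simp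
  then show ?thesis using le by linarith
 qed
 then show ?thesis using that by blast
qed

text \<open>At small scales the mollified divergence is close to the mass of the mollifier times the divergence.\<close>

lemma mollified_le:
 assumes d: "d > 0" and sub: "!!w. w \<in> cbox (- vec 1) (vec 1) ==> x + d *\<^sub>R w \<in> S"
  and one: "!!w. w \<in> cbox (- vec 1) (vec 1) ==> cut (x + d *\<^sub>R w) = 1"
  and f: "continuous_on S f" and le: "!!w. w \<in> cbox (- vec 1) (vec 1) ==> f (x + d *\<^sub>R w) \<le> m"
 shows "integral S (\<lambda>y. cut y * (\<Sum>i\<in>UNIV. kern' d i i (x - y)) * f y) \<le> integral (cbox (- vec 1) (vec 1)) mollifier * m"
proof -
 let ?Q = "cbox (- vec 1) (vec 1) :: (real^3) set"
 have cutc: "continuous_on S cut" using Ck_on_continuous[OF cutC] continuous_on_subset by blast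
 have im: "(\<lambda>w. x + d *\<^sub>R w) ` ?Q \<subseteq> S" using sub by auto
 have fc: "continuous_on ((\<lambda>w. x + d *\<^sub>R w) ` ?Q) (\<lambda>y. cut y * f y)"
  by (rule continuous_on_subset[OF continuous_on_mult[OF cutc f] im])
 have "((\<lambda>y. ((1 / d) ^ 3 * mollifier ((1 / d) *\<^sub>R (y - x))) *\<^sub>R (cut y * f y)) has_integral
   integral ?Q (\<lambda>w. mollifier w *\<^sub>R (cut (x + d *\<^sub>R w) * f (x + d *\<^sub>R w)))) S"
  by (rule has_integral_scaled_weight[OF mollifier_continuous mollifier_support d fc im])
 then have "((\<lambda>y. cut y * (\<Sum>i\<in>UNIV. kern' d i i (x - y)) * f y) has_integral
   integral ?Q (\<lambda>w. mollifier w * (cut (x + d *\<^sub>R w) * f (x + d *\<^sub>R w)))) S"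
  unfolding kern'_trace[OF d] by (simp add: mult_ac)
 then have "integral S (\<lambda>y. cut y * (\<Sum>i\<in>UNIV. kern' d i i (x - y)) * f y)
   = integral ?Q (\<lambda>w. mollifier w * (cut (x + d *\<^sub>R w) * f (x + d *\<^sub>R w)))" by (rule integral_unique)
 also have "\<dots> \<le> integral ?Q (\<lambda>w. mollifier w * m)"
 proof (rule Henstock_Kurzweil_Integration.integral_le)
  have c: "continuous_on ?Q (\<lambda>w. cut (x + d *\<^sub>R w) * f (x + d *\<^sub>R w))"
   by (rule continuous_on_compose2[OF fc]) (auto intro!: continuous_intros)
  show "(\<lambda>w. mollifier w * (cut (x + d *\<^sub>R w) * f (x + d *\<^sub>R w))) integrable_on ?Q"
   by (rule integrable_continuous[OF continuous_on_mult[OF mollifier_continuous c]])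
  show "(\<lambda>w. mollifier w * m) integrable_on ?Q"
   by (intro integrable_continuous continuous_on_mult mollifier_continuous continuous_on_const)
  show "mollifier w * (cut (x + d *\<^sub>R w) * f (x + d *\<^sub>R w)) \<le> mollifier w * m" if "w \<in> ?Q" for w
   using one[OF that] le[OF that] by (simp add: mult_left_mono mollifier_nonneg)
 qed
 also have "\<dots> = integral ?Q mollifier * m" by simp
 finally show ?thesis .
qed

lemma momentum_potential_bound:
 assumes nn: "Rm \<ge> 0" "V \<ge> 0" and cutb: "!!y. 0 \<le> cut y" "!!y. cut y \<le> 1"
 obtains M where "!!d t x. d > 0 ==> t > 0 ==> t \<le> T ==> (!!y. y \<in> S ==> \<rho> t y \<le> Rm) ==> (!!y. y \<in> S ==> norm (u t y) \<le> V) ==>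
  \<bar>momentum_potential d t x\<bar> \<le> M"
proof -
 obtain M where M: "!!x::real^3. (\<lambda>y. norm (x - y) powr (- 2)) integrable_on S"
  "!!x::real^3. integral S (\<lambda>y. norm (x - y) powr (- 2)) \<le> M"
  by (rule riesz_integral[of 2 A B]) (simp, simp, rule that)
 have "\<bar>momentum_potential d t x\<bar> \<le> 3 * (5/2 * (Rm * V) * M)"
  if d: "d > 0" and t: "t > 0" "t \<le> T" and b: "!!y. y \<in> S ==> \<rho> t y \<le> Rm" "!!y. y \<in> S ==> norm (u t y) \<le> V" for d t x
 proof -
  have bound: "\<bar>integral S (\<lambda>y. (cut y * (\<rho> t y * u t y $ i)) * kern d i (x - y))\<bar> \<le> 5/2 * (Rm * V) * M" for i
  proof -
   let ?f = "\<lambda>y. (cut y * (\<rho> t y * u t y $ i)) * kern d i (x - y)"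
   let ?g = "\<lambda>y. 5/2 * (Rm * V) * norm (x - y) powr (- 2)"
   have fi: "?f integrable_on S"
   proof (intro integrable_continuous continuous_on_mult continuous_on_component)
    show "continuous_on S cut" using Ck_on_continuous[OF cutC] continuous_on_subset by blast
    show "continuous_on S (\<rho> t)" using continuous_on_subset[OF Ck_on_continuous[OF rC[OF t(1)]] S\<Omega>] .
    show "continuous_on S (u t)" using continuous_on_subset[OF Ck_on_continuous[OF uC[OF t(1)]] S\<Omega>] .
    show "continuous_on S (\<lambda>y. kern d i (x - y))"
     by (rule continuous_on_compose2[OF kern_continuous[OF d, of UNIV]]) (auto intro!: continuous_intros)
   qed
   have gi: "?g integrable_on S" by (intro integrable_on_mult_right M)
   have le: "\<bar>?f y\<bar> \<le> ?g y" if y: "y \<in> S" "y \<notin> {x}" for y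
   proof -
    have rp: "0 \<le> \<rho> t y" "\<rho> t y \<le> Rm" using pos[OF t, of y] S\<Omega> b(1)[OF y(1)] y by auto
    have ub: "\<bar>u t y $ i\<bar> \<le> V" using component_le_norm_cart[of "u t y" i] b(2)[OF y(1)] by linarith
    have "\<bar>\<rho> t y * u t y $ i\<bar> \<le> Rm * V" unfolding abs_mult using rp ub nn by (intro mult_mono) auto
    then have 1: "\<bar>cut y * (\<rho> t y * u t y $ i)\<bar> \<le> 1 * (Rm * V)"
     unfolding abs_mult[of "cut y"] using cutb[of y] by (intro mult_mono) auto
    have 2: "\<bar>kern d i (x - y)\<bar> \<le> 5/2 * norm (x - y) powr (- 2)" using kern_bounds(1)[OF d, of "x - y" i] y by auto
    have "\<bar>?f y\<bar> \<le> (1 * (Rm * V)) * (5/2 * norm (x - y) powr (- 2))"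
     unfolding abs_mult[of _ "kern d i (x - y)"] using nn by (intro mult_mono 1 2) auto
    then show ?thesis by (simp only: mult_ac mult_1_left)
   qed
   have "integral S ?f \<le> integral S ?g" by (rule integral_le_off_finite[OF fi gi, of "{x}"]) (use le in fastforce)+
   moreover have "integral S (\<lambda>y. - ?f y) \<le> integral S ?g"
    by (rule integral_le_off_finite[OF integrable_neg[OF fi] gi, of "{x}"]) (use le in fastforce)+
   moreover have "integral S ?g \<le> 5/2 * (Rm * V) * M" using M(2)[of x] nn by (simp add: mult_left_mono)
   ultimately show ?thesis by (simp only: abs_le_iff Henstock_Kurzweil_Integration.integral_neg) linarith
  qed
  have "\<bar>momentum_potential d t x\<bar> \<le> (\<Sum>i\<in>(UNIV::3 set). 5/2 * (Rm * V) * M)"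
   unfolding momentum_potential_def by (rule order_trans[OF sum_abs sum_mono]) (rule bound)
  then show ?thesis by simp
 qed
 then show ?thesis using that by blast
qed

lemma momentum_potential_continuous:
 assumes d: "d > 0" and E: "E \<subseteq> {0<..} \<times> UNIV"
 shows "continuous_on E (\<lambda>(t, x). momentum_potential d t x)"
proof -
 have "continuous_on E (\<lambda>p. integral S (\<lambda>y. (cut y * (\<rho> (fst p) y * u (fst p) y $ i)) * kern d i (snd p - y)))" for i
 proof (rule integral_continuous_on_param)
  have s: "continuous_on (E \<times> S) (\<lambda>z. (fst (fst z), snd z))" by (intro continuous_intros)
  have ss: "(\<lambda>z. (fst (fst z), snd z)) ` (E \<times> S) \<subseteq> {0<..} \<times> \<Omega>" using E S\<Omega> by auto
  have 1: "continuous_on (E \<times> S) (\<lambda>z. \<rho> (fst (fst z)) (snd z))" using continuous_on_compose2[OF spacetime_continuous(1) s ss] by simp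
  have 2: "continuous_on (E \<times> S) (\<lambda>z. u (fst (fst z)) (snd z))" using continuous_on_compose2[OF spacetime_continuous(2) s ss] by simp
  have 3: "continuous_on (E \<times> S) (\<lambda>z. kern d i (snd (fst z) - snd z))"
   by (rule continuous_on_compose2[OF kern_continuous[OF d, of UNIV]]) (auto intro!: continuous_intros)
  have 4: "continuous_on (E \<times> S) (\<lambda>z. cut (snd z))"
   by (rule continuous_on_compose2[OF Ck_on_continuous[OF cutC]]) (auto intro!: continuous_intros)
  have "continuous_on (E \<times> S) (\<lambda>z. (cut (snd z) * (\<rho> (fst (fst z)) (snd z) * u (fst (fst z)) (snd z) $ i)) * kern d i (snd (fst z) - snd z))"
   by (intro continuous_on_mult continuous_on_component 1 2 3 4)
  then show "continuous_on (E \<times> S) (\<lambda>(p, y). (cut y * (\<rho> (fst p) y * u (fst p) y $ i)) * kern d i (snd p - y))"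
   by (simp add: case_prod_unfold)
 qed
 then have "continuous_on E (\<lambda>p. momentum_potential d (fst p) (snd p))"
  unfolding momentum_potential_def by (intro continuous_on_sum)
 then show ?thesis by (simp add: case_prod_unfold)
qed

end

section \<open>The density near the initial time\<close>

lemma Lp_component:
 fixes w :: "real^3 \<Rightarrow> real^3"
 assumes w: "Lp p \<Omega> w" and p: "p > 0"
 shows "Lp p \<Omega> (\<lambda>x. w x $ k)" "Lp_norm p \<Omega> (\<lambda>x. w x $ k) \<le> Lp_norm p \<Omega> w"
proof -
 have "(\<lambda>x. w x \<bullet> axis k 1) \<in> borel_measurable (lebesgue_on \<Omega>)"
  using w by (intro borel_measurable_inner borel_measurable_const) (simp add: Lp_def)
 then have m: "(\<lambda>x. w x $ k) \<in> borel_measurable (lebesgue_on \<Omega>)" by (simp add: inner_axis)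
 have le: "norm (w x $ k) powr p \<le> norm (w x) powr p" for x
  using component_le_norm_cart[of "w x" k] p by (intro powr_mono2) auto
 have I: "integrable (lebesgue_on \<Omega>) (\<lambda>x. norm (w x) powr p)" using w by (simp add: Lp_def)
 have J: "integrable (lebesgue_on \<Omega>) (\<lambda>x. norm (w x $ k) powr p)"
  by (rule Bochner_Integration.integrable_bound[OF I]) (use m le in auto)
 show "Lp p \<Omega> (\<lambda>x. w x $ k)" using m J by (simp add: Lp_def)
 show "Lp_norm p \<Omega> (\<lambda>x. w x $ k) \<le> Lp_norm p \<Omega> w"
  unfolding Lp_norm_def using p by (intro powr_mono2 integral_mono I J le) auto
qed

text \<open>Distant points are handled by the bound on \<open>w\<close> itself.\<close>

lemma (in interior_cubes) hoelder_components:
 fixes w :: "real^3 \<Rightarrow> real^3"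
 assumes w: "Ck_on (Suc (Suc 0)) \<Omega> w" and L: "!!i. Lp 2 \<Omega> (pd i w)" "!!i. Lp_norm 2 \<Omega> (pd i w) \<le> N"
  and L1: "!!i j. Lp 2 \<Omega> (pd j (pd i w))" "!!i j. Lp_norm 2 \<Omega> (pd j (pd i w)) \<le> N" and N: "N > 0"
  and V: "!!y. y \<in> B ==> norm (w y) \<le> V" and V0: "V \<ge> 0" and x: "x \<in> B" "z \<in> B"
 shows "\<bar>w x $ k - w z $ k\<bar> \<le> (2 * ((9/2 / s0 + 27) * N) + 2 * V / s0 powr (1/2)) * norm (x - z) powr (1/2)"
proof -
 let ?K = "2 * ((9/2 / s0 + 27) * N)" and ?q = "norm (x - z) powr (1/2)"
 have K: "?K \<ge> 0" using s0 N by (intro mult_nonneg_nonneg add_nonneg_nonneg) auto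
 have pdk: "pd i (\<lambda>y. w y $ k) y = pd i w y $ k" if "y \<in> \<Omega>" for i y
  by (rule pd_nth[OF Ck_on_differentiable[OF w that]])
 have pdk2: "pd j (pd i (\<lambda>y. w y $ k)) y = pd j (pd i w) y $ k" if y: "y \<in> \<Omega>" for i j y
 proof -
  have "pd j (pd i (\<lambda>y. w y $ k)) y = pd j (\<lambda>y. pd i w y $ k) y" by (rule pd_cong[OF O y]) (rule pdk)
  also have "\<dots> = pd j (pd i w) y $ k" by (rule pd_nth[OF Ck_on_differentiable[OF Ck_on_pd[OF w] y]])
  finally show ?thesis .
 qed
 have ae: "AE y in lebesgue_on \<Omega>. f y = f' y" if "!!y. y \<in> \<Omega> ==> f y = f' y" for f f' :: "real^3 \<Rightarrow> real"
  by (rule AE_I2) (use that in simp)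
 note C1 = Lp_component[OF L(1), where k = k] and C2 = Lp_component[OF L1(1), where k = k]
 have a1: "AE y in lebesgue_on \<Omega>. pd i w y $ k = pd i (\<lambda>y. w y $ k) y" for i by (rule ae) (simp add: pdk)
 have a2: "AE y in lebesgue_on \<Omega>. pd j (pd i w) y $ k = pd j (pd i (\<lambda>y. w y $ k)) y" for i j by (rule ae) (simp add: pdk2)
 have b1: "Lp 2 \<Omega> (pd i (\<lambda>y. w y $ k))" "Lp_norm 2 \<Omega> (pd i (\<lambda>y. w y $ k)) \<le> N" for i
  using Lp_cong_AE[OF O C1(1) a1, of i] C1(2)[of i] L(2)[of i] by auto
 have b2: "Lp 2 \<Omega> (pd j (pd i (\<lambda>y. w y $ k)))" "Lp_norm 2 \<Omega> (pd j (pd i (\<lambda>y. w y $ k))) \<le> N" for i j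
  using Lp_cong_AE[OF O C2(1) a2, of j i] C2(2)[of j i] L1(2)[of j i] by auto
 show ?thesis
 proof (cases "norm (x - z) \<le> s0")
  case True
  have "\<bar>w x $ k - w z $ k\<bar> \<le> ?K * ?q"
   by (rule hoelder_half[OF Ck_on_nth[OF O w] b1 b2 N x True])
  moreover have "0 \<le> 2 * V / s0 powr (1/2) * ?q" using V0 by simp
  ultimately show ?thesis by (simp only: distrib_right)
 next
  case False
  have "\<bar>w x $ k - w z $ k\<bar> \<le> 2 * V"
   using component_le_norm_cart[of "w x" k] component_le_norm_cart[of "w z" k] V[OF x(1)] V[OF x(2)] by linarith
  also have "\<dots> = 2 * V / s0 powr (1/2) * s0 powr (1/2)" using s0 by simp
  also have "\<dots> \<le> 2 * V / s0 powr (1/2) * ?q" using False s0 V0 by (intro mult_left_mono powr_mono2) auto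
  finally show ?thesis using mult_nonneg_nonneg[OF K, of ?q] by (simp only: distrib_right) simp
 qed
qed

text \<open>The regularity class gives continuity in time up to \<open>t = 0\<close> with values in \<open>H\<^sup>1\<close> for the first
  derivatives, and the classical derivatives represent the weak ones for positive times.\<close>

lemma derivative_bounds_near_0:
 fixes c :: "real \<Rightarrow> real^3 \<Rightarrow> real^3"
 assumes O: "open \<Omega>" and cC: "!!t. t > 0 ==> Ck_on (Suc (Suc 0)) \<Omega> (c t)"
  and g: "!!i. \<exists>g. C_time (Suc 0) 2 \<Omega> g \<and> (\<forall>t>0. AE x in lebesgue_on \<Omega>. g t x = pd i (c t) x)"
 obtains N \<tau> where "N > 0" "\<tau> > 0"
  "!!t i. 0 < t ==> t \<le> \<tau> ==> Lp 2 \<Omega> (pd i (c t))" "!!t i. 0 < t ==> t \<le> \<tau> ==> Lp_norm 2 \<Omega> (pd i (c t)) \<le> N"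
  "!!t i j. 0 < t ==> t \<le> \<tau> ==> Lp 2 \<Omega> (pd j (pd i (c t)))"
  "!!t i j. 0 < t ==> t \<le> \<tau> ==> Lp_norm 2 \<Omega> (pd j (pd i (c t))) \<le> N"
proof -
 have cC1: "Ck_on 1 \<Omega> (pd i (c t))" if "t > 0" for i t using Ck_on_pd[OF cC[OF that], of i] by simp
 have "\<exists>M d. d > 0 \<and> (\<forall>t. 0 < t \<and> t \<le> d \<longrightarrow> Lp 2 \<Omega> (pd i (c t)) \<and> Lp_norm 2 \<Omega> (pd i (c t)) \<le> M)" for i
 proof -
  obtain g where g: "C_time (Suc 0) 2 \<Omega> g" "!!t. t > 0 ==> AE x in lebesgue_on \<Omega>. g t x = pd i (c t) x" using g[of i] by blast
  obtain M d where M: "d > 0" "!!t. 0 \<le> t ==> t \<le> d ==> Lp 2 \<Omega> (g t) \<and> Lp_norm 2 \<Omega> (g t) \<le> M"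
   using C_time_bounded_near_0[OF O _ g(1)] by auto
  have "Lp 2 \<Omega> (pd i (c t)) \<and> Lp_norm 2 \<Omega> (pd i (c t)) \<le> M" if "0 < t" "t \<le> d" for t
   using Lp_cong_AE[OF O _ g(2)[OF that(1)], of 2] M(2)[of t] that by auto
  then show ?thesis using M(1) by blast
 qed
 then obtain M1 d1 where 1: "!!i. d1 i > (0::real)"
  "!!i t. 0 < t ==> t \<le> d1 i ==> Lp 2 \<Omega> (pd i (c t)) \<and> Lp_norm 2 \<Omega> (pd i (c t)) \<le> M1 i" by metis
 have "\<exists>M d. d > 0 \<and> (\<forall>t. 0 < t \<and> t \<le> d \<longrightarrow> Lp 2 \<Omega> (pd j (pd i (c t))) \<and> Lp_norm 2 \<Omega> (pd j (pd i (c t))) \<le> M)" for i j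
 proof -
  obtain g where g: "C_time (Suc 0) 2 \<Omega> g" "!!t. t > 0 ==> AE x in lebesgue_on \<Omega>. g t x = pd i (c t) x" using g[of i] by blast
  have "(1::real) \<le> 2" by simp
  from C_time_classical_bound(1)[OF O this g(1) cC1 g(2)] show ?thesis .
 qed
 then have "\<exists>M d. d > 0 \<and> (\<forall>t. 0 < t \<and> t \<le> d \<longrightarrow> Lp 2 \<Omega> (pd (snd p) (pd (fst p) (c t))) \<and>
   Lp_norm 2 \<Omega> (pd (snd p) (pd (fst p) (c t))) \<le> M)" for p :: "3 \<times> 3" .
 then obtain M2 d2 where 2: "!!p. d2 p > (0::real)"
  "!!p t. 0 < t ==> t \<le> d2 p ==> Lp 2 \<Omega> (pd (snd p) (pd (fst p) (c t))) \<and> Lp_norm 2 \<Omega> (pd (snd p) (pd (fst p) (c t))) \<le> M2 p"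
  by metis
 define N where "N = 1 + (\<Sum>i\<in>UNIV. \<bar>M1 i\<bar>) + (\<Sum>p\<in>UNIV. \<bar>M2 p\<bar>)"
 define \<tau> where "\<tau> = Min (range d1 \<union> range d2)"
 have s: "0 \<le> (\<Sum>i\<in>UNIV. \<bar>M1 i\<bar>)" "0 \<le> (\<Sum>p\<in>UNIV. \<bar>M2 p\<bar>)" by (simp_all add: sum_nonneg)
 have N: "N > 0" "M1 i \<le> N" "M2 (i, j) \<le> N" for i j
  using s member_le_sum[of i UNIV "\<lambda>i. \<bar>M1 i\<bar>"] member_le_sum[of "(i, j)" UNIV "\<lambda>p. \<bar>M2 p\<bar>"]
  by (auto simp: N_def)
 have \<tau>: "\<tau> > 0" unfolding \<tau>_def using 1(1) 2(1) by (subst Min_gr_iff) auto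
 have \<tau>1: "\<tau> \<le> d1 i" for i unfolding \<tau>_def by (rule Min_le) auto
 have \<tau>2: "\<tau> \<le> d2 p" for p unfolding \<tau>_def by (rule Min_le) auto
 show ?thesis
 proof (rule that[OF N(1) \<tau>])
  fix t i j assume t: "0 < t" "t \<le> \<tau>"
  have "t \<le> d1 i" "t \<le> d2 (i, j)" using t \<tau>1[of i] \<tau>2[of "(i, j)"] by auto
  then show "Lp 2 \<Omega> (pd i (c t))" "Lp_norm 2 \<Omega> (pd i (c t)) \<le> N" "Lp 2 \<Omega> (pd j (pd i (c t)))"
   "Lp_norm 2 \<Omega> (pd j (pd i (c t))) \<le> N"
   using 1(2)[OF t(1), of i] 2(2)[OF t(1), of "(i, j)"] N(2)[of i] N(3)[of i j] by auto
 qed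
qed

lemma plateau_gradient_bounded:
 assumes r: "r > 0"
 obtains G where "G \<ge> 0" "!!j y. \<bar>pd j (plateau x0 r) y\<bar> \<le> G" "!!j y. norm (y - x0) < r ==> pd j (plateau x0 r) y = 0"
proof -
 let ?K = "cbox (x0 - vec (2 * r)) (x0 + vec (2 * r))"
 have C: "Ck_on (Suc 0) UNIV (plateau x0 r)" by (rule Ck_on_plateau)
 have "\<exists>G. \<forall>y. \<bar>pd j (plateau x0 r) y\<bar> \<le> G" for j
 proof -
  have "continuous_on ?K (pd j (plateau x0 r))"
   using Ck_on_continuous[OF Ck_on_pd[OF C]] continuous_on_subset by blast
  then have "bounded (pd j (plateau x0 r) ` ?K)" by (intro compact_imp_bounded compact_continuous_image compact_cbox)
  then obtain G where G: "!!y. y \<in> ?K ==> \<bar>pd j (plateau x0 r) y\<bar> \<le> G" by (auto simp: bounded_iff)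
  have "\<bar>pd j (plateau x0 r) y\<bar> \<le> \<bar>G\<bar>" for y
  proof (cases "y \<in> ?K")
   case True
   then show ?thesis using G[OF True] by linarith
  next
   case False
   have "pd j (plateau x0 r) y = pd j (\<lambda>y. 0) y"
    by (rule pd_cong[of "- ?K"]) (use False plateau_eq_0[OF r] in \<open>auto simp: open_Compl closed_cbox\<close>)
   then show ?thesis by simp
  qed
  then show ?thesis by blast
 qed
 then obtain G where G: "!!j y. \<bar>pd j (plateau x0 r) y\<bar> \<le> G j" by metis
 have "\<bar>pd j (plateau x0 r) y\<bar> \<le> (\<Sum>j\<in>UNIV. \<bar>G j\<bar>)" for j y
  using G[of j y] member_le_sum[of j UNIV "\<lambda>j. \<bar>G j\<bar>"] by simp
 moreover have "pd j (plateau x0 r) y = 0" if "norm (y - x0) < r" for j y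
 proof -
  have "pd j (plateau x0 r) y = pd j (\<lambda>y. 1) y"
  proof (rule pd_cong[of "ball x0 r"])
   show "y \<in> ball x0 r" using that by (simp add: dist_norm norm_minus_commute)
   fix z assume "z \<in> ball x0 r"
   then have n: "norm (z - x0) < r" by (simp add: dist_norm norm_minus_commute)
   have "z \<in> cbox (x0 - vec r) (x0 + vec r)"
   proof (simp add: mem_box_cart, intro allI)
    fix i show "x0 $ i - r \<le> z $ i \<and> z $ i \<le> x0 $ i + r"
     using component_le_norm_cart[of "z - x0" i] n by (simp add: abs_le_iff)
   qed
   then show "plateau x0 r z = 1" by (rule plateau_eq_1[OF r])
  qed simp
  then show ?thesis by simp
 qed
 moreover have "0 \<le> (\<Sum>j\<in>UNIV. \<bar>G j\<bar>)" by (simp add: sum_nonneg)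
 ultimately show ?thesis using that by blast
qed

context mhd_flow_cutoff
begin

text \<open>A minimum principle on a truncated cone, whose cross sections grow at least as fast as the flow. The weight built
  from the momentum potential turns the transport equation \<open>D\<^sub>t \<rho> = - \<rho> div u\<close>, in which \<open>div u\<close> is not
  bounded as \<open>t \<rightarrow> 0\<close>, into a differential inequality with bounded coefficients.\<close>

lemma density_cone_minimum:
 assumes \<kappa>: "2 * \<mu> + lam > 0" and d: "d > 0" and \<tau>: "0 < \<tau>" "\<tau> < ts" "ts \<le> T" and c: "c > 0"
  and W: "!!t y. \<tau> \<le> t ==> t \<le> ts ==> norm (y - x0) \<le> r ==> norm (u t y) \<le> W" and r: "W * ts \<le> r" "W \<ge> 0"
  and r\<Omega>: "cball x0 r \<subseteq> \<Omega>"
  and eq: "!!t x. t > 0 ==> x \<in> \<Omega> ==> dt \<rho> t x + divergence (\<lambda>y. \<rho> t y *\<^sub>R u t y) x = 0"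
  and fl: "!!t x. \<tau> \<le> t ==> t \<le> ts ==> norm (x - x0) \<le> r ==>
   (\<Sum>i\<in>UNIV. integral S (flux_density d t x (u t x) (H t x) i)) \<le> C + (2 * \<mu> + lam) * (c * ((\<Sum>k\<in>UNIV. pd k (u t) x $ k) + 1))"
  and \<Psi>: "!!t x. \<tau> \<le> t ==> t \<le> ts ==> \<bar>momentum_potential d t x\<bar> \<le> M"
  and low: "!!x. x \<in> \<Omega> ==> \<delta> \<le> \<rho> ts x" and \<delta>: "\<delta> > 0"
 shows "\<delta> * exp (- 2 * (M / (c * (2 * \<mu> + lam))) - 2 * \<bar>C / (c * (2 * \<mu> + lam)) + 2\<bar> * ts) \<le> \<rho> \<tau> x0"
proof -
 define k where "k = c * (2 * \<mu> + lam)"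
 have k: "k > 0" using c \<kappa> by (simp add: k_def)
 define A where "A = C / k + 2"
 define z where "z t x = \<rho> t x * exp (momentum_potential d t x / k - A * t)" for t x
 define E where "E = {p. \<tau> \<le> fst p \<and> fst p \<le> ts \<and> norm (snd p - x0) \<le> W * (fst p - \<tau>)}"
 have Er: "norm (x - x0) \<le> r" if "(t, x) \<in> E" for t x
 proof -
  have "W * (t - \<tau>) \<le> W * ts" using that \<tau> r by (intro mult_left_mono) (auto simp: E_def)
  then show ?thesis using that r by (auto simp: E_def)
 qed
 have E\<Omega>: "x \<in> \<Omega>" if "(t, x) \<in> E" for t x using Er[OF that] r\<Omega> by (auto simp: dist_norm norm_minus_commute)
 have "closed E" unfolding E_def
  by (intro closed_Collect_conj closed_Collect_le continuous_intros)
 moreover have "E \<subseteq> {\<tau>..ts} \<times> cball x0 r" using Er by (auto simp: E_def dist_norm norm_minus_commute)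
 ultimately have Ec: "compact E"
  using compact_Int_closed[OF compact_Times[OF compact_Icc compact_cball], of E \<tau> ts x0 r] by (simp add: Int_absorb1)
 have x0E: "(\<tau>, x0) \<in> E" using \<tau> by (simp add: E_def)
 have E0: "E \<subseteq> {0<..} \<times> UNIV" "E \<subseteq> {0<..} \<times> \<Omega>" using \<tau> E\<Omega> by (auto simp: E_def)
 have zc: "continuous_on E (\<lambda>p. z (fst p) (snd p))"
 proof -
  have "continuous_on E (\<lambda>p. momentum_potential d (fst p) (snd p))"
   using momentum_potential_continuous[OF d E0(1)] by (simp add: case_prod_unfold)
  moreover have "continuous_on E (\<lambda>p. \<rho> (fst p) (snd p))" by (rule continuous_on_subset[OF spacetime_continuous(1) E0(2)])
  ultimately show ?thesis unfolding z_def divide_inverse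
   by (intro continuous_on_mult continuous_on_exp continuous_on_diff continuous_on_const continuous_on_fst continuous_on_id)
 qed
 obtain p where p: "p \<in> E" "!!q. q \<in> E ==> z (fst p) (snd p) \<le> z (fst q) (snd q)"
  using continuous_attains_inf[OF Ec _ zc] x0E by blast
 obtain t1 x1 where px: "p = (t1, x1)" by fastforce
 have min: "z t1 x1 \<le> z t x" if "(t, x) \<in> E" for t x using p(2)[OF that] by (simp add: px)
 have t1: "\<tau> \<le> t1" "t1 \<le> ts" "t1 > 0" "t1 \<le> T" and x1: "x1 \<in> \<Omega>" "norm (x1 - x0) \<le> r" and x1W: "norm (x1 - x0) \<le> W * (t1 - \<tau>)"
  using p(1) E\<Omega>[of t1 x1] Er[of t1 x1] \<tau> by (auto simp: px E_def)
 have "t1 = ts"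
 proof (rule ccontr)
  assume "t1 \<noteq> ts"
  then have lt: "t1 < ts" using t1 by simp
  note rd = Ck_on_differentiable[OF rC[OF t1(3)] x1(1)] and ud = Ck_on_differentiable[OF uC[OF t1(3)] x1(1)]
  define v where "v = u t1 x1"
  define dv where "dv = (\<Sum>i\<in>UNIV. pd i (u t1) x1 $ i)"
  define DP where "DP = (\<Sum>i\<in>UNIV. integral S (flux_density d t1 x1 v (H t1 x1) i))"
  have dr: "((\<lambda>s. \<rho> (t1 + s) (x1 + s *\<^sub>R v)) has_real_derivative - \<rho> t1 x1 * dv) (at 0)"
  proof -
   have "dt \<rho> t1 x1 + (\<Sum>i\<in>UNIV. (v $ i) *\<^sub>R pd i (\<rho> t1) x1) = - \<rho> t1 x1 * dv"
    using eq[OF t1(3) x1(1)] divergence_density_flux(1)[OF rd ud] by (simp add: inner_grad v_def dv_def)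
   then show ?thesis
    using has_vector_derivative_space_time[OF O rt rd t1(3) x1(1), of v]
    by (simp add: has_real_derivative_iff_has_vector_derivative)
  qed
  have dP: "((\<lambda>s. momentum_potential d (t1 + s) (x1 + s *\<^sub>R v)) has_real_derivative DP) (at 0)"
   unfolding DP_def by (rule momentum_potential_derivative(1)[OF d t1(3,4)])
  have dA: "((\<lambda>s. A * (t1 + s)) has_real_derivative A) (at 0)" by (auto intro!: derivative_eq_intros)
  define e where "e = exp (momentum_potential d t1 x1 / k - A * t1)"
  have de: "((\<lambda>s. exp (momentum_potential d (t1 + s) (x1 + s *\<^sub>R v) / k - A * (t1 + s))) has_real_derivative e * (DP / k - A)) (at 0)"
   using DERIV_chain2[OF DERIV_exp DERIV_diff[OF DERIV_cdivide[OF dP] dA]] by (simp add: e_def)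
  have dz: "((\<lambda>s. z (t1 + s) (x1 + s *\<^sub>R v)) has_real_derivative \<rho> t1 x1 * e * (- dv + (DP / k - A))) (at 0)"
   unfolding z_def using DERIV_mult[OF dr de] by (rule DERIV_cong) (simp add: e_def algebra_simps)
  have "DP \<le> C + k * (dv + 1)"
   using fl[OF t1(1,2) x1(2)] by (simp add: DP_def v_def dv_def k_def algebra_simps)
  then have "DP / k \<le> C / k + (dv + 1)" using k by (simp add: field_simps)
  then have "- dv + (DP / k - A) < 0" by (simp add: A_def)
  moreover have "\<rho> t1 x1 * e > 0" using pos[OF t1(3,4) x1(1)] by (simp add: e_def)
  ultimately have "\<rho> t1 x1 * e * (- dv + (DP / k - A)) < 0" by (intro mult_pos_neg)
  from DERIV_neg_dec_right[OF dz this] obtain h0 where h0: "h0 > 0"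
   "!!h. 0 < h ==> h < h0 ==> z (t1 + h) (x1 + h *\<^sub>R v) < z t1 x1" by auto
  define h where "h = min (h0 / 2) (ts - t1)"
  have h: "0 < h" "h < h0" "t1 + h \<le> ts" using h0(1) lt by (auto simp: h_def)
  have "norm (x1 + h *\<^sub>R v - x0) \<le> norm (x1 - x0) + h * norm v"
   using norm_triangle_ineq[of "x1 - x0" "h *\<^sub>R v"] h by (simp add: algebra_simps)
  also have "\<dots> \<le> W * (t1 - \<tau>) + h * W" using x1W W[OF t1(1,2) x1(2)] h by (intro add_mono mult_left_mono) (auto simp: v_def)
  finally have "(t1 + h, x1 + h *\<^sub>R v) \<in> E" using h t1 by (simp add: E_def algebra_simps)
  then show False using min h0(2)[OF h(1,2)] by fastforce
 qed
 have z0: "z ts x1 \<le> z \<tau> x0" using min[OF x0E] \<open>t1 = ts\<close> by simp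
 let ?a = "M / k + \<bar>A\<bar> * ts"
 have ex: "\<bar>momentum_potential d t x / k - A * t\<bar> \<le> ?a" if "\<tau> \<le> t" "t \<le> ts" for t x
 proof -
  have "\<bar>momentum_potential d t x / k\<bar> \<le> M / k" using \<Psi>[OF that] k by (simp add: divide_right_mono)
  moreover have "\<bar>A * t\<bar> \<le> \<bar>A\<bar> * ts" unfolding abs_mult using that \<tau> by (intro mult_left_mono) auto
  ultimately show ?thesis by linarith
 qed
 have "\<delta> * exp (- ?a) \<le> \<rho> ts x1 * exp (momentum_potential d ts x1 / k - A * ts)"
  using low[OF x1(1)] \<delta> ex[of ts x1] \<tau> by (intro mult_mono) (auto simp: abs_le_iff)
 also have "\<dots> \<le> \<rho> \<tau> x0 * exp (momentum_potential d \<tau> x0 / k - A * \<tau>)" using z0 by (simp add: z_def)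
 also have "\<dots> \<le> \<rho> \<tau> x0 * exp ?a"
  using ex[of \<tau> x0] \<tau> pos[of \<tau> x0] E\<Omega>[OF x0E] by (intro mult_left_mono) (auto simp: abs_le_iff)
 finally have "\<delta> * exp (- ?a) * exp (- ?a) \<le> \<rho> \<tau> x0 * exp ?a * exp (- ?a)" by (rule mult_right_mono) simp
 then have "\<delta> * exp (- ?a - ?a) \<le> \<rho> \<tau> x0" by (simp add: mult.assoc mult_exp_exp)
 moreover have "- ?a - ?a = - 2 * (M / k) - 2 * \<bar>A\<bar> * ts" by simp
 ultimately show ?thesis by (simp only: k_def A_def)
qed

end

section \<open>Vacuum persists\<close>

context defining_function
begin

lemma flow_bounds:
 fixes u :: "real \<Rightarrow> real^3 \<Rightarrow> real^3"
 assumes q: "q > 3" and uc: "continuous_on ({0..} \<times> closure \<Omega>) (\<lambda>(t, x). u t x)" and ux: "Ck_space 2 \<Omega> u"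
  and w: "!!i t. t \<ge> 0 ==> weak_pd \<Omega> i (u t) (Du i t)" and Li: "!!i. Linf_loc 2 q \<Omega> (Du i)"
  and bdry: "!!t y. t > 0 ==> y \<in> frontier \<Omega> ==> u t y \<bullet> grad g y = 0" and t: "0 < t1" "t1 < t2"
 obtains L C where "!!i t x. t \<in> {t1..t2} ==> x \<in> \<Omega> ==> norm (pd i (u t) x) \<le> L"
  "!!t x. t \<in> {t1..t2} ==> x \<in> \<Omega> ==> \<bar>u t x \<bullet> grad g x\<bar> \<le> C * g x"
proof -
 obtain L where L: "!!i t x. t \<in> {t1..t2} ==> x \<in> \<Omega> ==> norm (pd i (u t) x) \<le> L"
  by (rule velocity_gradient_bounded[OF q ux w Li t]) (assumption, blast)
 obtain V where V: "!!t x. 0 \<le> t ==> t \<le> t2 ==> x \<in> closure \<Omega> ==> norm (u t x) \<le> V"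
  by (rule continuous_bounded_slices[OF uc compacts(1), of t2]) blast
 have "\<exists>C. \<forall>t\<in>{t1..t2}. \<forall>x\<in>\<Omega>. \<bar>u t x \<bullet> grad g x\<bar> \<le> C * g x"
 proof (rule normal_flux_bound[of V L], goal_cases)
  case (1 C)
  show ?case
  proof (intro exI[of _ C] ballI)
   fix t x assume tx: "t \<in> {t1..t2}" "x \<in> \<Omega>"
   then have t0: "t > 0" "t \<ge> 0" "t \<le> t2" using t by auto
   have c: "continuous_on (closure \<Omega>) (u t)" by (rule slice_continuous[OF uc t0(2)])
   have v: "norm (u t y) \<le> V" if "y \<in> \<Omega>" for y using V[OF t0(2,3)] that closure_subset by blast
   have d: "u t differentiable (at y)" if "y \<in> \<Omega>" for y
    using Ck_on_differentiable[OF _ that] Ck_space_imp_Ck_on[OF ux t0(1)] by (simp add: numeral_2_eq_2)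
   show "\<bar>u t x \<bullet> grad g x\<bar> \<le> C * g x" by (rule 1(2)[OF c v d L[OF tx(1)] bdry[OF t0(1)] tx(2)])
  qed
 qed
 then show ?thesis using L that by blast
qed

text \<open>A positive lower bound at time \<open>T\<close> is carried back to any positive time by the bounds on the velocity
  gradient. On a short initial interval, where these bounds degenerate, the minimum principle on cones gives a lower bound
  at \<open>(\<tau>, x0)\<close> that does not depend on \<open>\<tau>\<close>, and \<open>\<tau>\<close> tends to zero.\<close>

lemma initial_density_positive:
 assumes par: "\<mu> > 0" "a > 0" "\<gamma> > 1" and \<kappa>: "2 * \<mu> + lam > 0" and q: "q > 3"
  and sol: "classical_MHD_solution \<mu> lam \<nu> \<gamma> a \<Omega> \<rho>0 u0 H0 \<rho> u H"
  and reg: "solution_regularity \<gamma> a \<rho>bar \<Omega> q \<rho> u H"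
  and R: "!!t x. t \<ge> 0 ==> x \<in> \<Omega> ==> 0 \<le> \<rho> t x \<and> \<rho> t x \<le> R"
  and bdry: "!!t y. t > 0 ==> y \<in> frontier \<Omega> ==> u t y \<bullet> grad g y = 0"
  and T: "T > 0" and \<delta>: "\<delta> > 0" "!!x. x \<in> \<Omega> ==> \<delta> \<le> \<rho> T x" and x0: "x0 \<in> \<Omega>"
 shows "\<rho> 0 x0 > 0"
proof -
 have rc: "continuous_on ({0..} \<times> closure \<Omega>) (\<lambda>(t, x). \<rho> t x)"
  and uc: "continuous_on ({0..} \<times> closure \<Omega>) (\<lambda>(t, x). u t x)"
  and Hc: "continuous_on ({0..} \<times> closure \<Omega>) (\<lambda>(t, x). H t x)"
  and rt: "C1_time \<Omega> \<rho>" and rx: "Ck_space 1 \<Omega> \<rho>" and ut: "C1_time \<Omega> u" and ux: "Ck_space 2 \<Omega> u"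
  and Hx: "Ck_space 2 \<Omega> H" and eqs: "MHD_equations \<mu> lam \<nu> \<gamma> a \<Omega> \<rho> u H"
  using sol unfolding classical_MHD_solution_def by blast+
 have eq1: "dt \<rho> t x + divergence (\<lambda>y. \<rho> t y *\<^sub>R u t y) x = 0" if "t > 0" "x \<in> \<Omega>" for t x
  using eqs that unfolding MHD_equations_def by blast
 obtain Du where w: "!!i t. t \<ge> 0 ==> weak_pd \<Omega> i (u t) (Du i t)" and Dc: "!!i. C_time 1 2 \<Omega> (Du i)"
  and Dq: "!!i. Linf_loc 2 q \<Omega> (Du i)" using reg unfolding solution_regularity_def by blast
 have HC2: "C_time 2 2 \<Omega> H" using reg unfolding solution_regularity_def by blast
 have nonneg: "0 \<le> \<rho> t x" if "t \<ge> 0" "x \<in> \<Omega>" for t x using R[OF that] by blast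
 have low: "\<exists>\<beta>>0. \<forall>x\<in>\<Omega>. \<beta> \<le> \<rho> t1 x" if t1: "0 < t1" "t1 < T" for t1
 proof (rule flow_bounds[OF q uc ux w Dq bdry t1], assumption, assumption, assumption, goal_cases)
  case (1 L C)
  show ?case
  proof (intro exI[of _ "exp (- (3 * L) * (T - t1)) * \<delta>"] conjI ballI)
   fix x assume x: "x \<in> \<Omega>"
   show "exp (- (3 * L) * (T - t1)) * \<delta> \<le> \<rho> t1 x"
    by (rule density_lower_bound_backwards[OF rc rt rx ux eq1 nonneg t1 1(1) 1(2) \<delta>(2) x])
  qed (use \<delta>(1) in simp)
 qed
 have pos: "0 < \<rho> t x" if "0 < t" "t \<le> T" "x \<in> \<Omega>" for t x
 proof (cases "t = T")
  case True
  then show ?thesis using \<delta>(1) \<delta>(2)[OF that(3)] by simp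
 next
  case False
  then have "t < T" using that by simp
  then show ?thesis using low[OF that(1)] that(3) by (auto intro: less_le_trans)
 qed
 interpret F: mhd_flow \<mu> lam \<nu> \<gamma> a T \<Omega> \<rho> u H
  by unfold_locales (fact O rt rx ut ux Hx eqs | (rule pos; assumption))+
 obtain e where e: "e > 0" "ball x0 e \<subseteq> \<Omega>" using O x0 open_contains_ball by blast
 define r where "r = e / 13"
 have r: "r > 0" using e by (simp add: r_def)
 have box4: "y \<in> \<Omega>" if y: "!!i. \<bar>y $ i - x0 $ i\<bar> \<le> 4 * r" for y
 proof -
  have "norm (y - x0) \<le> (\<Sum>i\<in>UNIV. \<bar>(y - x0) $ i\<bar>)" by (rule norm_le_l1_cart)
  also have "\<dots> \<le> (\<Sum>i\<in>(UNIV::3 set). 4 * r)" using y by (intro sum_mono) simp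
  also have "\<dots> < e" using e by (simp add: r_def)
  finally show ?thesis using e(2) by (auto simp: dist_norm norm_minus_commute)
 qed
 let ?A = "x0 - vec (2 * r)" and ?B = "x0 + vec (2 * r)"
 let ?S = "cbox ?A ?B" and ?Q = "cbox (- vec 1) (vec 1) :: (real^3) set"
 have Si: "y \<in> ?S \<longleftrightarrow> (\<forall>i. \<bar>y $ i - x0 $ i\<bar> \<le> 2 * r)" for y by (auto simp: mem_box_cart abs_le_iff algebra_simps)
 have Qi: "\<bar>w $ i\<bar> \<le> 1" if "w \<in> ?Q" for w i using that by (auto simp: mem_box_cart abs_le_iff dest!: spec[of _ i])
 have S\<Omega>: "?S \<subseteq> \<Omega>"
 proof
  fix y assume "y \<in> ?S"
  then have b: "\<bar>y $ i - x0 $ i\<bar> \<le> 2 * r" for i using Si by blast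
  have "\<bar>y $ i - x0 $ i\<bar> \<le> 4 * r" for i using b[of i] r by linarith
  then show "y \<in> \<Omega>" by (rule box4)
 qed
 interpret FC: mhd_flow_cutoff \<mu> lam \<nu> \<gamma> a T \<Omega> \<rho> u H "plateau x0 r" ?A ?B
  by unfold_locales (fact Ck_on_plateau, rule plateau_eq_0[OF r], assumption, fact S\<Omega>)
 interpret IC: interior_cubes \<Omega> ?S "min r 1"
 proof
  show "x + s *\<^sub>R w \<in> \<Omega>" if x: "x \<in> ?S" and w: "w \<in> ?Q" and s: "0 \<le> s" "s \<le> min r 1" for x w s
  proof (rule box4)
   fix i
   have "s * \<bar>w $ i\<bar> \<le> r * 1" using s Qi[OF w, of i] by (intro mult_mono) auto
   then have "\<bar>s * w $ i\<bar> \<le> r" using s by (simp add: abs_mult)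
   moreover have "\<bar>x $ i - x0 $ i\<bar> \<le> 2 * r" using x Si by blast
   ultimately show "\<bar>(x + s *\<^sub>R w) $ i - x0 $ i\<bar> \<le> 4 * r" using r by simp
  qed
 qed (use O r in \<open>auto simp: convex_box\<close>)
 obtain G where G: "G \<ge> 0" "!!j y. \<bar>pd j (plateau x0 r) y\<bar> \<le> G" "!!j y. norm (y - x0) < r ==> pd j (plateau x0 r) y = 0"
  by (rule plateau_gradient_bounded[OF r, of x0]) blast
 obtain V1 where V1: "!!t x. 0 \<le> t ==> t \<le> T ==> x \<in> closure \<Omega> ==> norm (u t x) \<le> V1"
  by (rule continuous_bounded_slices[OF uc compacts(1), of T]) blast
 obtain V2 where V2: "!!t x. 0 \<le> t ==> t \<le> T ==> x \<in> closure \<Omega> ==> norm (H t x) \<le> V2"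
  by (rule continuous_bounded_slices[OF Hc compacts(1), of T]) blast
 define V where "V = max \<bar>V1\<bar> \<bar>V2\<bar>"
 have V: "V \<ge> 0" by (simp add: V_def)
 have uV: "norm (u t x) \<le> V" and HV: "norm (H t x) \<le> V" if "0 < t" "t \<le> T" "x \<in> \<Omega>" for t x
  using V1[of t x] V2[of t x] that closure_subset[of \<Omega>] by (auto simp: V_def)
 have gu: "\<exists>h. C_time (Suc 0) 2 \<Omega> h \<and> (\<forall>t>0. AE x in lebesgue_on \<Omega>. h t x = pd i (u t) x)" for i
 proof (intro exI[of _ "Du i"] conjI allI impI)
  show "C_time (Suc 0) 2 \<Omega> (Du i)" using Dc[of i] by simp
  fix t :: real assume t: "t > 0"
  have "Ck_on 1 \<Omega> (u t)" using Ck_on_Suc_D[OF F.uC[OF t]] by simp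
  from weak_pd_classical[OF O this, of i] have c: "weak_pd \<Omega> i (u t) (pd i (u t))" .
  have "t \<ge> 0" using t by simp
  from weak_pd_unique[OF O w[OF this] c] show "AE x in lebesgue_on \<Omega>. Du i t x = pd i (u t) x" by simp
 qed
 have gH: "\<exists>h. C_time (Suc 0) 2 \<Omega> h \<and> (\<forall>t>0. AE x in lebesgue_on \<Omega>. h t x = pd i (H t) x)" for i
 proof (rule C_time_classical_bound(2)[OF O])
  show "C_time (Suc (Suc 0)) 2 \<Omega> H" using HC2 by (simp add: numeral_2_eq_2)
  show "Ck_on 1 \<Omega> (H t)" if "t > 0" for t using Ck_on_Suc_D[OF F.HC[OF that]] by simp
 qed auto
 obtain Nu \<tau>u where Nu: "Nu > 0" "\<tau>u > 0"
  "!!t i. 0 < t ==> t \<le> \<tau>u ==> Lp 2 \<Omega> (pd i (u t))" "!!t i. 0 < t ==> t \<le> \<tau>u ==> Lp_norm 2 \<Omega> (pd i (u t)) \<le> Nu"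
  "!!t i j. 0 < t ==> t \<le> \<tau>u ==> Lp 2 \<Omega> (pd j (pd i (u t)))"
  "!!t i j. 0 < t ==> t \<le> \<tau>u ==> Lp_norm 2 \<Omega> (pd j (pd i (u t))) \<le> Nu"
  by (rule derivative_bounds_near_0[OF O F.uC gu], assumption) (rule that, assumption+)
 obtain NH \<tau>H where NH: "NH > 0" "\<tau>H > 0"
  "!!t i. 0 < t ==> t \<le> \<tau>H ==> Lp 2 \<Omega> (pd i (H t))" "!!t i. 0 < t ==> t \<le> \<tau>H ==> Lp_norm 2 \<Omega> (pd i (H t)) \<le> NH"
  "!!t i j. 0 < t ==> t \<le> \<tau>H ==> Lp 2 \<Omega> (pd j (pd i (H t)))"
  "!!t i j. 0 < t ==> t \<le> \<tau>H ==> Lp_norm 2 \<Omega> (pd j (pd i (H t))) \<le> NH"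
  by (rule derivative_bounds_near_0[OF O F.HC gH], assumption) (rule that, assumption+)
 define tm where "tm = min (min \<tau>u \<tau>H) T"
 have tm: "tm > 0" "tm \<le> \<tau>u" "tm \<le> \<tau>H" "tm \<le> T" using Nu(2) NH(2) T by (auto simp: tm_def)
 let ?hc = "\<lambda>N. 2 * ((9/2 / min r 1 + 27) * N) + 2 * V / min r 1 powr (1/2)"
 define K where "K = max (?hc Nu) (?hc NH)"
 have K: "K \<ge> 0" using Nu(1) V r by (auto simp: K_def le_max_iff_disj intro!: disjI1 add_nonneg_nonneg)
 have hu: "\<bar>u t x $ i - u t y $ i\<bar> \<le> K * norm (x - y) powr (1/2)"
  if t: "0 < t" "t \<le> tm" and xy: "x \<in> ?S" "y \<in> ?S" for t x y i
 proof -
  have t': "t \<le> \<tau>u" "t \<le> T" using t tm by auto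
  have v: "norm (u t y) \<le> V" if "y \<in> ?S" for y using uV[OF t(1) t'(2)] S\<Omega> that by blast
  have "\<bar>u t x $ i - u t y $ i\<bar> \<le> ?hc Nu * norm (x - y) powr (1/2)"
   by (rule IC.hoelder_components[OF F.uC[OF t(1)] Nu(3)[OF t(1) t'(1)] Nu(4)[OF t(1) t'(1)] Nu(5)[OF t(1) t'(1)]
     Nu(6)[OF t(1) t'(1)] Nu(1) v V xy])
  also have "\<dots> \<le> K * norm (x - y) powr (1/2)" unfolding K_def by (rule mult_right_mono[OF max.cobounded1]) simp
  finally show ?thesis .
 qed
 have hH: "\<bar>H t x $ i - H t y $ i\<bar> \<le> K * norm (x - y) powr (1/2)"
  if t: "0 < t" "t \<le> tm" and xy: "x \<in> ?S" "y \<in> ?S" for t x y i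
 proof -
  have t': "t \<le> \<tau>H" "t \<le> T" using t tm by auto
  have v: "norm (H t y) \<le> V" if "y \<in> ?S" for y using HV[OF t(1) t'(2)] S\<Omega> that by blast
  have "\<bar>H t x $ i - H t y $ i\<bar> \<le> ?hc NH * norm (x - y) powr (1/2)"
   by (rule IC.hoelder_components[OF F.HC[OF t(1)] NH(3)[OF t(1) t'(1)] NH(4)[OF t(1) t'(1)] NH(5)[OF t(1) t'(1)]
     NH(6)[OF t(1) t'(1)] NH(1) v V xy])
  also have "\<dots> \<le> K * norm (x - y) powr (1/2)" unfolding K_def by (rule mult_right_mono[OF max.cobounded2]) simp
  finally show ?thesis .
 qed
 define N1 where "N1 = measure lebesgue \<Omega> + Nu powr 2"
 have N1: "integral ?S (\<lambda>y. \<bar>pd j (u t) y $ i\<bar>) \<le> N1" if t: "0 < t" "t \<le> tm" for t i j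
 proof -
  have t': "t \<le> \<tau>u" using t tm by auto
  have OL: "\<Omega> \<in> sets lebesgue" using O by simp
  have "(1::real) \<le> 2" by simp
  note I = Lp_imp_integrable_norm[OF this Nu(3)[OF t(1) t'] lmeas, of j]
  have c: "continuous_on ?S (pd j (u t))"
   by (rule continuous_on_subset[OF Ck_on_continuous[OF Ck_on_pd[OF F.uC[OF t(1)]]] S\<Omega>])
  have "integral ?S (\<lambda>y. \<bar>pd j (u t) y $ i\<bar>) \<le> integral ?S (\<lambda>y. norm (pd j (u t) y))"
  proof (rule Henstock_Kurzweil_Integration.integral_le)
   show "(\<lambda>y. \<bar>pd j (u t) y $ i\<bar>) integrable_on ?S"
    by (intro integrable_continuous continuous_on_rabs continuous_on_component c)
   show "(\<lambda>y. norm (pd j (u t) y)) integrable_on ?S" by (intro integrable_continuous continuous_on_norm c)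
  qed (rule component_le_norm_cart)
  also have "\<dots> \<le> integral \<Omega> (\<lambda>y. norm (pd j (u t) y))"
  proof (rule integral_subset_le[OF S\<Omega>])
   show "(\<lambda>y. norm (pd j (u t) y)) integrable_on ?S" by (intro integrable_continuous continuous_on_norm c)
   show "(\<lambda>y. norm (pd j (u t) y)) integrable_on \<Omega>" using I(1) OL integrable_on_lebesgue_on by blast
  qed simp
  also have "\<dots> = (\<integral>y. norm (pd j (u t) y) \<partial>lebesgue_on \<Omega>)" by (rule lebesgue_integral_eq_integral[OF I(1) OL, symmetric])
  also have "\<dots> \<le> measure lebesgue \<Omega> + Lp_norm 2 \<Omega> (pd j (u t)) powr 2" by (rule I(2))
  also have "\<dots> \<le> N1" unfolding N1_def
   using Nu(4)[OF t(1) t', of j] by (intro add_left_mono powr_mono2) (auto simp: Lp_norm_nonneg)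
  finally show ?thesis .
 qed
 have Rm: "\<rho> t y \<le> \<bar>R\<bar>" if "0 < t" "y \<in> ?S" for t y using R[of t y] S\<Omega> that by force
 have uS: "norm (u t y) \<le> V" and HS: "norm (H t y) \<le> V" if "0 < t" "t \<le> tm" "y \<in> ?S" for t y
  using uV[of t y] HV[of t y] that tm S\<Omega> by auto
 have ballS: "x \<in> ?S" if "norm (x - x0) \<le> r / 2" for x
 proof -
  have "\<bar>x $ i - x0 $ i\<bar> \<le> 2 * r" for i using component_le_norm_cart[of "x - x0" i] that r by simp
  then show ?thesis using Si by blast
 qed
 let ?\<kappa> = "2 * \<mu> + lam"
 let ?div = "\<lambda>t y. \<Sum>k\<in>UNIV. pd k (u t) y $ k"
 have "\<exists>C. \<forall>t x (d::real). 0 < d \<and> 0 < t \<and> t \<le> tm \<and> norm (x - x0) \<le> r / 2 \<longrightarrow>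
  (\<Sum>i\<in>UNIV. integral ?S (FC.flux_density d t x (u t x) (H t x) i))
   \<le> C + ?\<kappa> * integral ?S (\<lambda>y. plateau x0 r y * (\<Sum>i\<in>UNIV. kern' d i i (x - y)) * ?div t y)"
 proof (rule FC.flux_estimate[OF par r abs_ge_zero[of R] V K G(1) plateau_bounds(1) plateau_bounds(2) G(2) G(3), where N = N1],
   assumption, goal_cases)
  case (1 C)
  show ?case
  proof (intro exI[of _ C] allI impI, elim conjE)
   fix t x and d :: real assume d: "0 < d" and t: "0 < t" "t \<le> tm" and x: "norm (x - x0) \<le> r / 2"
   have tT: "t \<le> T" using t tm by auto
   note xS = ballS[OF x]
   show "(\<Sum>i\<in>UNIV. integral ?S (FC.flux_density d t x (u t x) (H t x) i))
   \<le> C + ?\<kappa> * integral ?S (\<lambda>y. plateau x0 r y * (\<Sum>i\<in>UNIV. kern' d i i (x - y)) * ?div t y)"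
    by (rule 1[OF d t(1) tT x uS[OF t xS] HS[OF t xS] Rm[OF t(1)] uS[OF t] HS[OF t] hu[OF t xS] hH[OF t xS] N1[OF t]])
  qed
 qed
 then obtain C where C: "!!t x (d::real). 0 < d ==> 0 < t ==> t \<le> tm ==> norm (x - x0) \<le> r / 2 ==>
  (\<Sum>i\<in>UNIV. integral ?S (FC.flux_density d t x (u t x) (H t x) i))
   \<le> C + ?\<kappa> * integral ?S (\<lambda>y. plateau x0 r y * (\<Sum>i\<in>UNIV. kern' d i i (x - y)) * ?div t y)" by blast
 have "\<exists>M. \<forall>t x (d::real). 0 < d \<and> 0 < t \<and> t \<le> tm \<longrightarrow> \<bar>FC.momentum_potential d t x\<bar> \<le> M"
 proof (rule FC.momentum_potential_bound[OF abs_ge_zero[of R] V plateau_bounds(1) plateau_bounds(2)], goal_cases)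
  case (1 M)
  show ?case
  proof (intro exI[of _ M] allI impI, elim conjE)
   fix t x and d :: real assume d: "0 < d" and t: "0 < t" "t \<le> tm"
   have tT: "t \<le> T" using t tm by auto
   show "\<bar>FC.momentum_potential d t x\<bar> \<le> M" by (rule 1[OF d t(1) tT Rm[OF t(1)] uS[OF t]])
  qed
 qed
 then obtain M where M: "!!t x (d::real). 0 < d ==> 0 < t ==> t \<le> tm ==> \<bar>FC.momentum_potential d t x\<bar> \<le> M" by blast
 define c where "c = integral ?Q mollifier"
 have c: "c > 0" unfolding c_def by (rule mollifier_mass_pos)
 define W where "W = V + 1"
 have W: "W > 0" using V by (simp add: W_def)
 define ts where "ts = min (min tm (T / 2)) (r / 2 / W)"
 have ts: "ts > 0" "ts \<le> tm" "ts < T" "ts \<le> r / 2 / W" using tm T r W by (auto simp: ts_def)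
 have Wts: "W * ts \<le> r / 2" using mult_left_mono[OF ts(4), of W] W by simp
 obtain \<beta> where \<beta>: "\<beta> > 0" "!!x. x \<in> \<Omega> ==> \<beta> \<le> \<rho> ts x" using low[OF ts(1,3)] by blast
 define b where "b = \<beta> * exp (- 2 * (M / (c * ?\<kappa>)) - 2 * \<bar>C / (c * ?\<kappa>) + 2\<bar> * ts)"
 have b: "b > 0" using \<beta>(1) by (simp add: b_def)
 have main: "b \<le> \<rho> \<tau> x0" if \<tau>: "0 < \<tau>" "\<tau> < ts" for \<tau>
 proof -
  let ?K1 = "cbox (x0 - vec r) (x0 + vec r)"
  have K1i: "y \<in> ?K1 \<longleftrightarrow> (\<forall>i. \<bar>y $ i - x0 $ i\<bar> \<le> r)" for y by (auto simp: mem_box_cart abs_le_iff algebra_simps)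
  have K1S: "?K1 \<subseteq> ?S"
  proof
   fix y assume "y \<in> ?K1"
   then have b: "\<bar>y $ i - x0 $ i\<bar> \<le> r" for i using K1i by blast
   have "\<bar>y $ i - x0 $ i\<bar> \<le> 2 * r" for i using b[of i] r by linarith
   then show "y \<in> ?S" using Si by blast
  qed
  have "continuous_on ({0<..} \<times> \<Omega>) (\<lambda>p. pd k (u (fst p)) (snd p))" for k
   using Ck_space_continuous[OF Ck_space_Suc_D(2)[of 1 \<Omega> u k]] ux by (simp add: case_prod_unfold numeral_2_eq_2)
  then have "continuous_on ({0<..} \<times> \<Omega>) (\<lambda>p. ?div (fst p) (snd p))" by (intro continuous_on_sum continuous_on_component)
  then have "continuous_on ({\<tau>..ts} \<times> ?K1) (\<lambda>p. ?div (fst p) (snd p))"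
   by (rule continuous_on_subset) (use K1S S\<Omega> \<tau> in auto)
  then have "uniformly_continuous_on ({\<tau>..ts} \<times> ?K1) (\<lambda>p. ?div (fst p) (snd p))"
   by (rule compact_uniformly_continuous) (intro compact_Times compact_Icc compact_cbox)
  then obtain e1 where e1: "e1 > 0" "!!p p'. p \<in> {\<tau>..ts} \<times> ?K1 ==> p' \<in> {\<tau>..ts} \<times> ?K1 ==> dist p' p < e1 ==>
    dist (?div (fst p') (snd p')) (?div (fst p) (snd p)) < 1"
   unfolding uniformly_continuous_on_def using zero_less_one by blast
  \<comment> \<open>The scale of the kernel depends on \<open>\<tau>\<close>, but the bounds \<open>C\<close> and \<open>M\<close> hold for all scales.\<close>
  define d where "d = min (r / 2) (e1 / 4)"
  have d: "d > 0" "d \<le> r / 2" "d \<le> e1 / 4" using e1(1) r by (auto simp: d_def)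
  have fl: "(\<Sum>i\<in>UNIV. integral ?S (FC.flux_density d t x (u t x) (H t x) i)) \<le> C + ?\<kappa> * (c * (?div t x + 1))"
   if t: "\<tau> \<le> t" "t \<le> ts" and x: "norm (x - x0) \<le> r / 2" for t x
  proof -
   have t0: "0 < t" "t \<le> tm" using t \<tau> ts by auto
   have xi: "\<bar>x $ i - x0 $ i\<bar> \<le> r / 2" for i using component_le_norm_cart[of "x - x0" i] x by simp
   have wi: "\<bar>(x + d *\<^sub>R w) $ i - x0 $ i\<bar> \<le> r" if "w \<in> ?Q" for w i
   proof -
    have "d * \<bar>w $ i\<bar> \<le> r / 2 * 1" using d Qi[OF that, of i] r by (intro mult_mono) auto
    then have "\<bar>d * w $ i\<bar> \<le> r / 2" using d by (simp add: abs_mult)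
    then show ?thesis using xi[of i] unfolding vector_add_component vector_scaleR_component real_scaleR_def by linarith
   qed
   have wK: "x + d *\<^sub>R w \<in> ?K1" if "w \<in> ?Q" for w using wi[OF that] K1i by blast
   have xK: "x \<in> ?K1" unfolding K1i using xi r by (auto intro: order_trans[of _ "r / 2"])
   have le: "?div t (x + d *\<^sub>R w) \<le> ?div t x + 1" if wQ: "w \<in> ?Q" for w
   proof -
    have "norm w \<le> (\<Sum>i\<in>UNIV. \<bar>w $ i\<bar>)" by (rule norm_le_l1_cart)
    also have "\<dots> \<le> (\<Sum>i\<in>(UNIV::3 set). 1)" by (intro sum_mono Qi wQ)
    finally have "d * norm w \<le> e1 / 4 * 3" using d by (intro mult_mono) auto
    then have "dist (t, x + d *\<^sub>R w) (t, x) < e1" using d e1(1) by (simp add: dist_Pair_Pair dist_norm)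
    then have "dist (?div t (x + d *\<^sub>R w)) (?div t x) < 1"
     using e1(2)[of "(t, x)" "(t, x + d *\<^sub>R w)"] xK wK[OF wQ] t by simp
    then show ?thesis by (simp add: dist_real_def abs_less_iff)
   qed
   have f: "continuous_on ?S (?div t)"
    by (intro continuous_on_sum continuous_on_component continuous_on_subset[OF Ck_on_continuous[OF Ck_on_pd[OF F.uC[OF t0(1)]]] S\<Omega>])
   have one: "plateau x0 r (x + d *\<^sub>R w) = 1" if "w \<in> ?Q" for w by (rule plateau_eq_1[OF r wK[OF that]])
   have sub: "x + d *\<^sub>R w \<in> ?S" if "w \<in> ?Q" for w using wK[OF that] K1S by blast
   have "integral ?S (\<lambda>y. plateau x0 r y * (\<Sum>i\<in>UNIV. kern' d i i (x - y)) * ?div t y) \<le> c * (?div t x + 1)"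
    unfolding c_def by (rule FC.mollified_le[OF d(1) sub one f le])
   then have "?\<kappa> * integral ?S (\<lambda>y. plateau x0 r y * (\<Sum>i\<in>UNIV. kern' d i i (x - y)) * ?div t y) \<le> ?\<kappa> * (c * (?div t x + 1))"
    using \<kappa> by (intro mult_left_mono) auto
   then show ?thesis using C[OF d(1) t0 x] by linarith
  qed
  have Wb: "norm (u t y) \<le> W" if "\<tau> \<le> t" "t \<le> ts" "norm (y - x0) \<le> r / 2" for t y
   using uS[of t y] ballS[OF that(3)] that \<tau> ts by (simp add: W_def)
  have cb: "cball x0 (r / 2) \<subseteq> \<Omega>"
   using ballS S\<Omega> by (auto simp: dist_norm norm_minus_commute)
  have \<Psi>: "\<bar>FC.momentum_potential d t x\<bar> \<le> M" if "\<tau> \<le> t" "t \<le> ts" for t x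
   using M[OF d(1), of t x] that \<tau> ts by simp
  have tsT: "ts \<le> T" using ts by simp
  have W0: "W \<ge> 0" using W by simp
  show ?thesis unfolding b_def
   by (rule FC.density_cone_minimum[OF \<kappa> d(1) \<tau> tsT c Wb Wts W0 cb eq1 fl \<Psi> \<beta>(2) \<beta>(1)])
 qed
 have "continuous_on {0..} (\<lambda>t. (\<lambda>(t, x). \<rho> t x) (t, x0))"
  by (rule continuous_on_compose2[OF rc]) (use x0 closure_subset in \<open>auto intro!: continuous_intros\<close>)
 then have "((\<lambda>t. \<rho> t x0) \<longlongrightarrow> \<rho> 0 x0) (at 0 within {0..})" by (simp add: continuous_on)
 then have "((\<lambda>t. \<rho> t x0) \<longlongrightarrow> \<rho> 0 x0) (at_right 0)" by (rule tendsto_within_subset) auto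
 moreover have "eventually (\<lambda>t. b \<le> \<rho> t x0) (at_right 0)"
  unfolding eventually_at_right_field using main ts(1) by blast
 ultimately have "b \<le> \<rho> 0 x0" by (rule tendsto_lowerbound) simp
 then show ?thesis using b by linarith
qed

end

section \<open>Growth of the density gradient\<close>

context defining_function
begin

lemma bounded_continuous_Lp:
 fixes f :: "real^3 \<Rightarrow> 'b::euclidean_space"
 assumes f: "continuous_on \<Omega> f" and B: "!!x. x \<in> \<Omega> ==> norm (f x) \<le> B" and p: "p > 0"
 shows "Lp p \<Omega> f"
proof -
 have OL: "\<Omega> \<in> sets lebesgue" using O by simp
 have m: "f \<in> borel_measurable (lebesgue_on \<Omega>)" by (rule continuous_imp_measurable_on_sets_lebesgue[OF f OL])
 have c: "integrable (lebesgue_on \<Omega>) (\<lambda>x. \<bar>B\<bar> powr p)"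
  using lmeas OL by (simp add: integrable_restrict_space lmeasurable_iff_integrable)
 have le: "norm (f x) powr p \<le> \<bar>B\<bar> powr p" if "x \<in> \<Omega>" for x
  using B[OF that] p by (intro powr_mono2) auto
 have "integrable (lebesgue_on \<Omega>) (\<lambda>x. norm (f x) powr p)"
  by (rule Bochner_Integration.integrable_bound[OF c]) (use m le in \<open>auto intro!: AE_I2\<close>)
 then show ?thesis using m by (simp add: Lp_def)
qed

text \<open>The weak second derivatives are in \<open>L\<^sup>q\<close> with \<open>q > 3\<close>, so the gradient is bounded and all its norms are
  finite.\<close>

lemma gradient_Lp:
 fixes \<rho> :: "real^3 \<Rightarrow> real"
 assumes q: "q > 3" and p: "p > 0" and C: "Ck_on (Suc 0) \<Omega> \<rho>" and W: "Wkp 2 q \<Omega> (\<lambda>x. \<rho> x - c)"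
 defines "f \<equiv> \<lambda>x. \<rho> x - c"
 shows "weak_pd \<Omega> i f (pd i f)" "Lp p \<Omega> (pd i f)" "Lp_norm p \<Omega> (pd i f) \<le> Lp_norm p \<Omega> (grad \<rho>)"
proof -
 have fC: "Ck_on (Suc 0) \<Omega> f" unfolding f_def by (rule Ck_on_diff[OF O C Ck_on_const])
 have wf: "weak_pd \<Omega> i f (pd i f)" for i by (rule weak_pd_classical[OF O]) (use fC in simp)
 show "weak_pd \<Omega> i f (pd i f)" by (rule wf)
 have cf: "continuous_on \<Omega> (pd i f)" for i by (rule Ck_on_continuous[OF Ck_on_pd[OF fC]])
 have W': "Wkp (Suc (Suc 0)) q \<Omega> f" using W by (simp add: f_def numeral_2_eq_2)
 have bounded: "\<exists>B. \<forall>x\<in>\<Omega>. norm (pd i f x) \<le> B" for i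
 proof -
  obtain h where h: "weak_pd \<Omega> i f h" "Wkp (Suc 0) q \<Omega> h"
   using W' unfolding Wkp.simps(2)[of "Suc 0"] by blast
  have ae: "AE x in lebesgue_on \<Omega>. h x = pd i f x" by (rule weak_pd_unique[OF O h(1) wf]) simp
  have "\<forall>j. \<exists>k. weak_pd \<Omega> j h k \<and> Lp q \<Omega> k" using h(2) by auto
  then obtain k where k: "!!j. weak_pd \<Omega> j h (k j)" "!!j. Lp q \<Omega> (k j)" by metis
  have wk: "weak_pd \<Omega> j (pd i f) (k j)" for j by (rule weak_pd_cong_AE[OF O k(1) ae])
  define N where "N = (\<Sum>j\<in>UNIV. Lp_norm q \<Omega> (k j))"
  have N: "Lp_norm q \<Omega> (k j) \<le> N" for j unfolding N_def by (rule member_le_sum) (auto simp: Lp_norm_nonneg)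
  have "Lp q \<Omega> (pd i f)" by (rule Lp_cong_AE(1)[OF O Wkp_imp_Lp[OF h(2)] ae])
  moreover have "1 \<le> q" using q by simp
  ultimately have I: "integrable (lebesgue_on \<Omega>) (\<lambda>x. norm (pd i f x))" by (rule Lp_imp_integrable_norm(1)[OF _ _ lmeas, rotated])
  show ?thesis
  proof (rule sup_interpolation[OF q, where 'b = real], goal_cases)
   case (1 C h0)
   show ?case
    by (rule exI, rule ballI, rule 1(3)[OF cf wk k(2) N I 1(2) order_refl])
  qed
 qed
 then obtain B where B: "!!i x. x \<in> \<Omega> ==> norm (pd i f x) \<le> B i" by metis
 show Lf: "Lp p \<Omega> (pd i f)" by (rule bounded_continuous_Lp[OF cf B p])
 have gf: "grad \<rho> x $ i = pd i f x" if "x \<in> \<Omega>" for x i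
  unfolding grad_nth f_def using pd_diff[OF Ck_on_differentiable[OF C that] differentiable_const, of i c] by simp
 have gb: "norm (grad \<rho> x) \<le> (\<Sum>i\<in>UNIV. B i)" if "x \<in> \<Omega>" for x
 proof -
  have "norm (grad \<rho> x) \<le> (\<Sum>i\<in>UNIV. \<bar>grad \<rho> x $ i\<bar>)" by (rule norm_le_l1_cart)
  also have "\<dots> \<le> (\<Sum>i\<in>UNIV. B i)" using B[OF that] gf[OF that] by (intro sum_mono) simp
  finally show ?thesis .
 qed
 have gc: "continuous_on \<Omega> (grad \<rho>)"
  unfolding grad_def grad_of_def [abs_def] by (intro continuous_on_vec_lambda Ck_on_continuous[OF Ck_on_pd[OF C]])
 have Lg: "Lp p \<Omega> (grad \<rho>)" by (rule bounded_continuous_Lp[OF gc gb p])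
 show "Lp_norm p \<Omega> (pd i f) \<le> Lp_norm p \<Omega> (grad \<rho>)"
  unfolding Lp_norm_def
 proof (rule powr_mono2)
  show "(\<integral>x. norm (pd i f x) powr p \<partial>lebesgue_on \<Omega>) \<le> (\<integral>x. norm (grad \<rho> x) powr p \<partial>lebesgue_on \<Omega>)"
  proof (rule integral_mono)
   fix x assume "x \<in> space (lebesgue_on \<Omega>)"
   then have "x \<in> \<Omega>" by simp
   then have "norm (pd i f x) \<le> norm (grad \<rho> x)" using component_le_norm_cart[of "grad \<rho> x" i] gf by simp
   then show "norm (pd i f x) powr p \<le> norm (grad \<rho> x) powr p" using p by (intro powr_mono2) auto
  qed (use Lf Lg in \<open>auto simp: Lp_def\<close>)
 qed (use p in auto)
qed

end

text \<open>At every time the density takes values below \<open>\<rho>bar / 4\<close>, since it is not bounded below by a positive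
  constant, and values above \<open>3/4 * \<rho>bar\<close>, since its mean is \<open>\<rho>bar\<close>.\<close>

lemma (in defining_function) density_spread:
 assumes par: "\<mu> > 0" "a > 0" "\<gamma> > 1" and \<kappa>: "2 * \<mu> + lam > 0" and q: "q > 3" and \<rho>bar: "\<rho>bar > 0"
  and sol: "classical_MHD_solution \<mu> lam \<nu> \<gamma> a \<Omega> \<rho>0 u0 H0 \<rho> u H"
  and reg: "solution_regularity \<gamma> a \<rho>bar \<Omega> q \<rho> u H"
  and R: "!!t x. t \<ge> 0 ==> x \<in> \<Omega> ==> 0 \<le> \<rho> t x \<and> \<rho> t x \<le> R"
  and bdry: "!!t y. t > 0 ==> y \<in> frontier \<Omega> ==> u t y \<bullet> grad g y = 0"
  and mean: "mean_value \<Omega> \<rho>0 = \<rho>bar" and vac: "x0 \<in> \<Omega>" "\<rho>0 x0 = 0" and t: "t > 0"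
 obtains x y where "x \<in> \<Omega>" "y \<in> \<Omega>" "\<rho> t x < \<rho>bar / 4" "3/4 * \<rho>bar \<le> \<rho> t y"
proof -
 have rc: "continuous_on ({0..} \<times> closure \<Omega>) (\<lambda>(t, x). \<rho> t x)"
  and uc: "continuous_on ({0..} \<times> closure \<Omega>) (\<lambda>(t, x). u t x)"
  and rt: "C1_time \<Omega> \<rho>" and rx: "Ck_space 1 \<Omega> \<rho>" and ux: "Ck_space 2 \<Omega> u"
  and eqs: "MHD_equations \<mu> lam \<nu> \<gamma> a \<Omega> \<rho> u H" and init: "!!x. x \<in> \<Omega> ==> \<rho> 0 x = \<rho>0 x"
  using sol unfolding classical_MHD_solution_def by blast+
 have eq1: "dt \<rho> t x + divergence (\<lambda>y. \<rho> t y *\<^sub>R u t y) x = 0" if "t > 0" "x \<in> \<Omega>" for t x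
  using eqs that unfolding MHD_equations_def by blast
 obtain Du where w: "!!i t. t \<ge> 0 ==> weak_pd \<Omega> i (u t) (Du i t)" and Dq: "!!i. Linf_loc 2 q \<Omega> (Du i)"
  using reg unfolding solution_regularity_def by blast
 have "\<exists>x\<in>\<Omega>. \<rho> t x < \<rho>bar / 4"
 proof (rule ccontr)
  assume "\<not> (\<exists>x\<in>\<Omega>. \<rho> t x < \<rho>bar / 4)"
  then have low: "\<rho>bar / 4 \<le> \<rho> t x" if "x \<in> \<Omega>" for x using that by (meson not_le)
  have "\<rho>bar / 4 > 0" using \<rho>bar by simp
  from initial_density_positive[OF par \<kappa> q sol reg R bdry t this low vac(1)]
  show False using init[OF vac(1)] vac(2) by simp
 qed
 then obtain x where x: "x \<in> \<Omega>" "\<rho> t x < \<rho>bar / 4" by blast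
 have pm: "(\<integral>x. \<rho> t1 x \<partial>lebesgue_on \<Omega>) = (\<integral>x. \<rho> t2 x \<partial>lebesgue_on \<Omega>)" if tt: "0 < t1" "t1 < t2" for t1 t2
 proof (rule flow_bounds[OF q uc ux w Dq bdry tt], assumption, assumption, assumption, goal_cases)
  case (1 L C)
  show ?case by (rule mass_conserved_positive_times[OF rc rt rx ux eq1 R tt 1(2)])
 qed
 have "(\<integral>x. \<rho> t x \<partial>lebesgue_on \<Omega>) = (\<integral>x. \<rho> 0 x \<partial>lebesgue_on \<Omega>)" by (rule mass_conserved[OF rc R pm t])
 also have "\<dots> = (\<integral>x. \<rho>0 x \<partial>lebesgue_on \<Omega>)" by (rule Bochner_Integration.integral_cong) (auto simp: init)
 also have "\<dots> = \<rho>bar * measure lebesgue \<Omega>" 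
 proof -
  have "measure lebesgue \<Omega> \<noteq> 0"
  proof
   assume "measure lebesgue \<Omega> = 0"
   then show False using mean \<rho>bar by (simp add: mean_value_def)
  qed
  then show ?thesis using mean by (simp add: mean_value_def divide_eq_eq)
 qed
 finally have mass: "(\<integral>x. \<rho> t x \<partial>lebesgue_on \<Omega>) = \<rho>bar * measure lebesgue \<Omega>" .
 have mpos: "measure lebesgue \<Omega> > 0"
 proof (rule ccontr)
  assume "\<not> measure lebesgue \<Omega> > 0"
  then have "measure lebesgue \<Omega> = 0" using measure_nonneg[of lebesgue \<Omega>] by linarith
  then show False using mean \<rho>bar by (simp add: mean_value_def)
 qed
 have "\<exists>y\<in>\<Omega>. 3/4 * \<rho>bar \<le> \<rho> t y"
 proof (rule ccontr)
  assume "\<not> (\<exists>y\<in>\<Omega>. 3/4 * \<rho>bar \<le> \<rho> t y)"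
  then have up: "\<rho> t y \<le> 3/4 * \<rho>bar" if "y \<in> \<Omega>" for y using that by (meson linear)
  have OL: "\<Omega> \<in> sets lebesgue" using O by simp
  have t0: "t \<ge> 0" using t by simp
  have c: "integrable (lebesgue_on \<Omega>) (\<lambda>x. k)" for k :: real
   using lmeas OL by (simp add: integrable_restrict_space lmeasurable_iff_integrable)
  have m: "\<rho> t \<in> borel_measurable (lebesgue_on \<Omega>)"
   by (rule continuous_imp_measurable_on_sets_lebesgue[OF continuous_on_subset[OF slice_continuous[OF rc t0] closure_subset] OL])
  have i: "integrable (lebesgue_on \<Omega>) (\<rho> t)"
   by (rule Bochner_Integration.integrable_bound[OF c[of R] m]) (use R[OF t0] in \<open>force intro!: AE_I2\<close>)
  have "(\<integral>x. \<rho> t x \<partial>lebesgue_on \<Omega>) \<le> (\<integral>x. 3/4 * \<rho>bar \<partial>lebesgue_on \<Omega>)"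
   by (rule integral_mono[OF i c]) (use up in simp)
  also have "\<dots> = 3/4 * \<rho>bar * measure lebesgue \<Omega>" using OL by (simp add: measure_restrict_space)
  finally have "\<rho>bar * measure lebesgue \<Omega> \<le> 3/4 * \<rho>bar * measure lebesgue \<Omega>" using mass by simp
  then show False using \<rho>bar mpos by simp
 qed
 then show ?thesis using x that by blast
qed

theorem theorem1p2:
 fixes \<mu> lam \<nu> \<gamma> a \<rho>bar \<rho>hat s M1 M2 \<epsilon> r1 :: real
  and \<Omega> :: "(real^3) set"
 assumes "\<mu> > 0" and "2 * \<mu> + 3 * lam \<ge> 0" and "\<nu> > 0" and "a > 0" and "\<gamma> > 1"
  and "admissible_domain \<Omega>"
  and "M1 > 0" and "M2 > 0" and "1/2 < s" and "s \<le> 1"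
  and "\<rho>bar > 0" and "\<rho>hat \<ge> \<rho>bar + 1"
  and "smallness_constant \<mu> lam \<nu> \<gamma> a \<rho>bar \<rho>hat s \<Omega> M1 M2 \<epsilon>"
  and "r1 > 3"
 shows "\<exists>C1>0. \<exists>C2>0. \<forall>q \<rho>0 u0 H0 \<rho> u H.
  3 < q \<and> q < 6 \<and>
  admissible_data \<mu> lam \<gamma> a \<rho>bar \<rho>hat s \<Omega> M1 M2 q \<rho>0 u0 H0 \<and>
  initial_energy a \<gamma> \<rho>bar \<Omega> \<rho>0 u0 H0 \<le> \<epsilon> \<and>
  global_solution \<mu> lam \<nu> \<gamma> a \<rho>bar \<rho>hat \<Omega> q \<rho>0 u0 H0 \<rho> u H \<and>
  (\<exists>x0\<in>\<Omega>. \<rho>0 x0 = 0) \<longrightarrow>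
  (\<forall>t>0. Lp_norm r1 \<Omega> (grad (\<rho> t)) \<ge> C1 * exp (C2 * t))"
proof (rule global_defining_function[OF assms(6)], goal_cases)
 case (1 g)
 have dom: "open \<Omega>" "connected \<Omega>" "\<Omega> \<noteq> {}" "bounded \<Omega>" using assms(6) by (auto simp: admissible_domain_def)
 interpret defining_function \<Omega> g
  by unfold_locales (use 1 dom in auto)
 have \<kappa>: "2 * \<mu> + lam > 0" using assms(1,2) by linarith
 have \<rho>bar: "\<rho>bar > 0" by fact
 obtain C0 \<eta> where C0: "C0 > 0" "\<eta> > 0" and decay: "\<And>q \<rho>0 u0 H0 \<rho> u H t. 3 < q \<Longrightarrow> q < 6 \<Longrightarrow>
   admissible_data \<mu> lam \<gamma> a \<rho>bar \<rho>hat s \<Omega> M1 M2 q \<rho>0 u0 H0 \<Longrightarrow> initial_energy a \<gamma> \<rho>bar \<Omega> \<rho>0 u0 H0 \<le> \<epsilon> \<Longrightarrow>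
   global_solution \<mu> lam \<nu> \<gamma> a \<rho>bar \<rho>hat \<Omega> q \<rho>0 u0 H0 \<rho> u H \<Longrightarrow> t > 0 \<Longrightarrow>
   Lp_norm 1 \<Omega> (\<lambda>x. \<rho> t x - \<rho>bar) \<le> C0 * exp (- \<eta> * t)"
 proof -
  have "\<exists>C>0. \<exists>\<eta>>0. \<forall>q \<rho>0 u0 H0 \<rho> u H. 3 < q \<and> q < 6 \<and>
      admissible_data \<mu> lam \<gamma> a \<rho>bar \<rho>hat s \<Omega> M1 M2 q \<rho>0 u0 H0 \<and>
      initial_energy a \<gamma> \<rho>bar \<Omega> \<rho>0 u0 H0 \<le> \<epsilon> \<and>
      global_solution \<mu> lam \<nu> \<gamma> a \<rho>bar \<rho>hat \<Omega> q \<rho>0 u0 H0 \<rho> u H \<longrightarrow>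
      (\<forall>t>0. Lp_norm 1 \<Omega> (\<lambda>x. \<rho> t x - \<rho>bar) \<le> C * exp (- \<eta> * t)) \<and>
      (\<forall>t\<ge>1. decay_quantity \<rho>bar \<Omega> 1 1 \<rho> u H t \<le> C * exp (- \<eta> * t))"
   using assms(13)[unfolded smallness_constant_def, THEN conjunct2, THEN conjunct2, rule_format, of 1 1] by simp
  then show ?thesis using that by blast
 qed
 define \<theta> where "\<theta> = 1 - 3 / r1"
 have \<theta>: "\<theta> > 0" using assms(14) by (simp add: \<theta>_def)
 have r1: "r1 > 0" using assms(14) by simp
 obtain Ci h0 where Ci: "Ci > 0" "h0 > 0" and interp: "\<And>(f :: real^3 \<Rightarrow> real) G N h x. continuous_on \<Omega> f \<Longrightarrow>
   (\<And>i. weak_pd \<Omega> i f (G i)) \<Longrightarrow> (\<And>i. Lp r1 \<Omega> (G i)) \<Longrightarrow> (\<And>i. Lp_norm r1 \<Omega> (G i) \<le> N) \<Longrightarrow>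
   integrable (lebesgue_on \<Omega>) (\<lambda>x. norm (f x)) \<Longrightarrow> 0 < h \<Longrightarrow> h \<le> h0 \<Longrightarrow> x \<in> \<Omega> \<Longrightarrow>
   norm (f x) \<le> Ci * ((1 / h) ^ 3 * (\<integral>x. norm (f x) \<partial>lebesgue_on \<Omega>) + h powr \<theta> * N)"
 proof (rule sup_interpolation[OF assms(14), where 'b = real])
  fix C h :: real
  assume "C > 0" "h > 0" "\<And>(f :: real^3 \<Rightarrow> real) G N s x. continuous_on \<Omega> f \<Longrightarrow>
   (\<And>i. weak_pd \<Omega> i f (G i)) \<Longrightarrow> (\<And>i. Lp r1 \<Omega> (G i)) \<Longrightarrow> (\<And>i. Lp_norm r1 \<Omega> (G i) \<le> N) \<Longrightarrow>
   integrable (lebesgue_on \<Omega>) (\<lambda>x. norm (f x)) \<Longrightarrow> 0 < s \<Longrightarrow> s \<le> h \<Longrightarrow> x \<in> \<Omega> \<Longrightarrow>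
   norm (f x) \<le> C * ((1 / s) ^ 3 * (\<integral>x. norm (f x) \<partial>lebesgue_on \<Omega>) + s powr (1 - 3 / r1) * N)"
  then show thesis unfolding \<theta>_def[symmetric] by (rule that)
 qed
 obtain Co where Co: "Co > 0" and osc: "\<And>(f :: real^3 \<Rightarrow> real) G N x y. continuous_on \<Omega> f \<Longrightarrow>
   (\<And>i. weak_pd \<Omega> i f (G i)) \<Longrightarrow> (\<And>i. Lp r1 \<Omega> (G i)) \<Longrightarrow> (\<And>i. Lp_norm r1 \<Omega> (G i) \<le> N) \<Longrightarrow>
   x \<in> \<Omega> \<Longrightarrow> y \<in> \<Omega> \<Longrightarrow> \<bar>f x - f y\<bar> \<le> Co * N"
  by (rule oscillation_bound[OF assms(14) dom(2)]) blast
 define A where "A = Ci * C0 / h0 ^ 3"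
 have A: "A > 0" using Ci C0 by (simp add: A_def)
 \<comment> \<open>After time \<open>t0\<close> the \<open>L\<^sup>1\<close> term of the interpolation inequality is at most \<open>\<rho>bar / 4\<close>.\<close>
 define t0 where "t0 = 8 * A / (\<eta> * \<rho>bar)"
 define C2 where "C2 = \<eta> * \<theta> / 6"
 have C2: "C2 > 0" using C0 \<theta> by (simp add: C2_def)
 define K1 where "K1 = \<rho>bar / (2 * (Ci * h0 powr \<theta>))"
 define K2 where "K2 = \<rho>bar / (2 * Co) * exp (- (C2 * t0))"
 have K: "K1 > 0" "K2 > 0" using \<rho>bar Ci Co by (simp_all add: K1_def K2_def)
 have bound: "min K1 K2 * exp (C2 * t) \<le> Lp_norm r1 \<Omega> (grad (\<rho> t))"
  if q: "3 < q" "q < 6" and data: "admissible_data \<mu> lam \<gamma> a \<rho>bar \<rho>hat s \<Omega> M1 M2 q \<rho>0 u0 H0"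
   and en: "initial_energy a \<gamma> \<rho>bar \<Omega> \<rho>0 u0 H0 \<le> \<epsilon>"
   and gs: "global_solution \<mu> lam \<nu> \<gamma> a \<rho>bar \<rho>hat \<Omega> q \<rho>0 u0 H0 \<rho> u H"
   and vac: "x0 \<in> \<Omega>" "\<rho>0 x0 = 0" and t: "t > 0" for q \<rho>0 u0 H0 \<rho> u H x0 t
 proof -
  have sol: "classical_MHD_solution \<mu> lam \<nu> \<gamma> a \<Omega> \<rho>0 u0 H0 \<rho> u H" and reg: "solution_regularity \<gamma> a \<rho>bar \<Omega> q \<rho> u H"
   and R: "\<And>t x. t \<ge> 0 \<Longrightarrow> x \<in> \<Omega> \<Longrightarrow> 0 \<le> \<rho> t x \<and> \<rho> t x \<le> 2 * \<rho>hat"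
   using gs unfolding global_solution_def by blast+
  have mean: "mean_value \<Omega> \<rho>0 = \<rho>bar" using data unfolding admissible_data_def by blast
  have bdry: "u t y \<bullet> grad g y = 0" if "t > 0" "y \<in> frontier \<Omega>" for t y
  proof -
   have "slip_boundary \<Omega> (u t)" using sol that(1) unfolding classical_MHD_solution_def by blast
   then have "\<And>n. outward_unit_normal \<Omega> y n \<Longrightarrow> u t y \<bullet> n = 0" unfolding slip_boundary_def by blast
   then show ?thesis using 1 that(2) by blast
  qed
  obtain x y where xy: "x \<in> \<Omega>" "y \<in> \<Omega>" "\<rho> t x < \<rho>bar / 4" "3/4 * \<rho>bar \<le> \<rho> t y"
   by (rule density_spread[OF assms(1,4,5) \<kappa> q(1) \<rho>bar sol reg R bdry mean vac t]) blast
  let ?f = "\<lambda>x. \<rho> t x - \<rho>bar"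
  define N where "N = Lp_norm r1 \<Omega> (grad (\<rho> t))"
  have rC: "Ck_on (Suc 0) \<Omega> (\<rho> t)"
   using sol t Ck_space_imp_Ck_on[of 1 \<Omega> \<rho> t] unfolding classical_MHD_solution_def by simp
  have Ct: "C_time 2 q \<Omega> (\<lambda>t x. \<rho> t x - \<rho>bar)" using reg unfolding solution_regularity_def by blast
  then have W: "Wkp 2 q \<Omega> ?f" using t unfolding C_time_def by simp
  note G = gradient_Lp[OF q(1) r1 rC W, folded N_def]
  have fc: "continuous_on \<Omega> ?f" by (intro continuous_on_diff continuous_on_const Ck_on_continuous[OF rC])
  have "1 \<le> q" using q by simp
  from Lp_imp_integrable_norm(1)[OF this Wkp_imp_Lp[OF W] lmeas]
  have fi: "integrable (lebesgue_on \<Omega>) (\<lambda>x. norm (?f x))" .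
  have fL: "(\<integral>x. norm (?f x) \<partial>lebesgue_on \<Omega>) \<le> C0 * exp (- \<eta> * t)"
  proof -
   have "0 \<le> (\<integral>x. norm (?f x) \<partial>lebesgue_on \<Omega>)" by (rule integral_nonneg_AE) simp
   then have "Lp_norm 1 \<Omega> ?f = (\<integral>x. norm (?f x) \<partial>lebesgue_on \<Omega>)" by (simp add: Lp_norm_def)
   then show ?thesis using decay[OF q data en gs t] by simp
  qed
  have N0: "N \<ge> 0" by (simp add: N_def Lp_norm_nonneg)
  show ?thesis
  proof (cases "t < t0")
   case True
   have "\<rho>bar / 2 \<le> \<bar>?f y - ?f x\<bar>" using xy by linarith
   also have "\<dots> \<le> Co * N" by (rule osc[OF fc G xy(2,1)])
   finally have 1: "\<rho>bar / (2 * Co) \<le> N" using Co by (simp add: field_simps)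
   have "min K1 K2 * exp (C2 * t) \<le> K2 * exp (C2 * t)" by (intro mult_right_mono) auto
   also have "\<dots> = \<rho>bar / (2 * Co) * exp (C2 * t - C2 * t0)" by (simp add: K2_def mult.assoc mult_exp_exp)
   also have "\<dots> \<le> \<rho>bar / (2 * Co) * 1"
    using True C2 \<rho>bar Co by (intro mult_left_mono) auto
   finally show ?thesis using 1 by (simp add: N_def)
  next
   case False
   \<comment> \<open>The rate \<open>\<eta> / 6\<close> makes \<open>1 / h ^ 3\<close> grow at half the rate at which the \<open>L\<^sup>1\<close> norm decays.\<close>
   define h where "h = h0 * exp (- (\<eta> / 6) * t)"
   have h: "0 < h" "h \<le> h0" using Ci C0 t by (auto simp: h_def mult_left_le)
   have h3: "(1 / h) ^ 3 = exp (\<eta> / 2 * t) / h0 ^ 3"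
   proof -
    have "h ^ 3 = h0 ^ 3 * exp (- (\<eta> / 2) * t)" by (simp add: h_def power_mult_distrib flip: exp_of_nat_mult)
    then have "(1 / h) ^ 3 = 1 / (h0 ^ 3 * exp (- (\<eta> / 2 * t)))" by (simp add: power_one_over)
    also have "\<dots> = exp (\<eta> / 2 * t) / h0 ^ 3" using Ci(2) by (simp add: exp_minus field_simps)
    finally show ?thesis .
   qed
   have h\<theta>: "h powr \<theta> = h0 powr \<theta> * exp (- (C2 * t))"
    using Ci by (simp add: h_def powr_mult exp_powr_real C2_def mult_ac)
   have "3/4 * \<rho>bar \<le> norm (?f x)" unfolding real_norm_def using xy(3) by linarith
   also have "\<dots> \<le> Ci * ((1 / h) ^ 3 * (\<integral>x. norm (?f x) \<partial>lebesgue_on \<Omega>) + h powr \<theta> * N)"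
    by (rule interp[OF fc G fi h xy(1)])
   also have "\<dots> \<le> Ci * ((1 / h) ^ 3 * (C0 * exp (- \<eta> * t)) + h powr \<theta> * N)"
    using Ci h fL by (intro mult_left_mono add_right_mono) auto
   also have "\<dots> = A * exp (- (\<eta> / 2 * t)) + Ci * h0 powr \<theta> * exp (- (C2 * t)) * N"
   proof -
    have "exp (\<eta> / 2 * t) * exp (- \<eta> * t) = exp (- (\<eta> / 2 * t))" by (simp add: mult_exp_exp field_simps)
    then show ?thesis unfolding h3 h\<theta> A_def by (simp add: distrib_left mult_ac)
   qed
   finally have main: "3/4 * \<rho>bar \<le> A * exp (- (\<eta> / 2 * t)) + Ci * h0 powr \<theta> * exp (- (C2 * t)) * N" .
   have "A * exp (- (\<eta> / 2 * t)) \<le> \<rho>bar / 4"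
   proof -
    have "4 * A / \<rho>bar = \<eta> / 2 * t0" using C0 \<rho>bar by (simp add: t0_def)
    also have "\<dots> \<le> \<eta> / 2 * t" using False C0 by (intro mult_left_mono) auto
    also have "\<dots> \<le> exp (\<eta> / 2 * t)" using exp_ge_add_one_self[of "\<eta> / 2 * t"] by linarith
    finally have "4 * A \<le> \<rho>bar * exp (\<eta> / 2 * t)" using \<rho>bar by (simp add: divide_le_eq mult.commute)
    then show ?thesis by (simp add: exp_minus field_simps)
   qed
   then have "\<rho>bar / 2 \<le> Ci * h0 powr \<theta> * exp (- (C2 * t)) * N" using main by linarith
   then have "\<rho>bar / 2 * exp (C2 * t) \<le> Ci * h0 powr \<theta> * exp (- (C2 * t)) * N * exp (C2 * t)" by (rule mult_right_mono) simp
   also have "\<dots> = Ci * h0 powr \<theta> * N" by (simp add: exp_minus)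
   finally have "K1 * exp (C2 * t) \<le> N" using Ci unfolding K1_def by (simp add: field_simps)
   moreover have "min K1 K2 * exp (C2 * t) \<le> K1 * exp (C2 * t)" by (intro mult_right_mono) auto
   ultimately show ?thesis unfolding N_def by linarith
  qed
 qed
 have "min K1 K2 > 0" using K by simp
 then show ?case using C2 bound by (intro exI[of _ "min K1 K2"] conjI exI[of _ C2]) blast+
qed

end
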